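(* Let $T\colon X\to X$ be a continuous (not necessarily invertible) transformation that is a factor of a transitive subshift of finite type, with $X$ infinite, and let $V$ be a smooth vector bundle over $X$. For every integer $r\geq 0$, there is an open and dense subset $\mathcal{O}\subset LC^r_{V,T}$ of linear cocycles of class $C^r$ that have simple Lyapunov spectrum at some $T$-periodic point; that is, for every $\mathcal{A}\in\mathcal{O}$ there is a $T$-periodic point $x\in X$ such that the eigenvalues (counted with multiplicity) of the first return linear map of $\mathcal{A}$ on the fiber $V_x$ have pairwise distinct moduli.
   Context: Subshifts. Given $n\ge 1$ and a matrix $\mathtt{A}=(a_{ij})_{1\le i,j\le n}$ with entries in $\{0,1\}$ such that each line contains at least one $1$, let $\Omega_{\mathtt{A}}$ be the set of $\omega=(\omega_i)_{i\in\mathbb{Z}}\in\{1,\dots,n\}^{\mathbb{Z}}$ with $a_{\omega_i\omega_{i+1}}=1$ for all $i$. The subshift of finite type (SFT) is the restriction to $\Omega_{\mathtt A}$ of the shift $\sigma\colon(\omega_i)_i\mapsto(\omega_{i+1})_i$. It is transitive if some point has dense positive orbit. $T\colon X\to X$ is a factor of $S\colon Y\to Y$ if there is a continuous surjection $\pi\colon Y\to X$ with $\pi\circ S=T\circ\pi$. Bundles and cocycles. $X$ is a compact subset of a smooth manifold $M$. A smooth vector bundle $V$ over $X$ is the restriction to $X$ of a smooth vector bundle $\widetilde V$ (of finite constant rank $d$) over an open set $Y\subset M$ containing $X$. $V_x$ is the fiber over $x$. A linear cocycle on $V$ over $T$ is a continuous map $\mathcal{A}\colon V\to V$ fibering over $T$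 whose restriction to each $V_x$ is a linear isomorphism $A(x)\colon V_x\to V_{Tx}$. If $x$ has period $p$, the first return linear map at $x$ is $\mathcal{A}^p|_{V_x}\colon V_x\to V_x$. $C^r$-topology. $LC^r_{V,\mathrm{Id}_X}$ is the set of $C^r$ cocycles over $\mathrm{Id}_X$, i.e. sections of $\bigsqcup_{x\in X}GL(V_x)$ that are restrictions to $X$ of $C^r$ sections over a neighborhood of $X$; a neighborhood basis of $R$ consists of those $R'$ such that $R'-R$ extends to a $C^r$ section of $\mathrm{End}(\widetilde V)$ of small $C^r$-norm on a fixed compact neighborhood of $X$. For general $T$, $LC^r_{V,T}$ is the set of linear cocycles over $T$ with the topology in which a neighborhood basis of $\mathcal{A}$ is given by the sets $\{\mathcal{A}\circ\mathcal{R}:\mathcal{R}\in\mathcal{N}\}$, $\mathcal{N}$ a neighborhood of $\mathrm{Id}_V$ in $LC^r_{V,\mathrm{Id}_X}$. (If $V=X\times\mathbb{R}^d$ is trivial, on the $C^r$ maps $A\colon X\to GL(d,\mathbb{R})$ this is the usual $C^r$-topology; for $r=0$ it is the topology of uniform convergence.) *)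

theory Defs
  imports
    "HOL-Analysis.Analysis"
    "HOL-Computational_Algebra.Polynomial"
begin

section \<open>Subshifts of finite type and factors\<close>

text \<open>
  The alphabet is \<open>{1..n}\<close>. The type \<^typ>\<open>int \<Rightarrow> nat\<close> carries the product topology
  of the discrete topology on \<^typ>\<open>nat\<close>.
\<close>

definition transition_matrix :: "nat \<Rightarrow> (nat \<Rightarrow> nat \<Rightarrow> nat) \<Rightarrow> bool" where
  "transition_matrix n a \<longleftrightarrow> 1 \<le> n \<and>
     (\<forall>i\<in>{1..n}. \<forall>j\<in>{1..n}. a i j \<in> {0, 1}) \<and>
     (\<forall>i\<in>{1..n}. \<exists>j\<in>{1..n}. a i j = 1)"

definition sft :: "nat \<Rightarrow> (nat \<Rightarrow> nat \<Rightarrow> nat) \<Rightarrow> (int \<Rightarrow> nat) set" where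
  "sft n a = {\<omega>. (\<forall>i. \<omega> i \<in> {1..n}) \<and> (\<forall>i. a (\<omega> i) (\<omega> (i + 1)) = 1)}"

definition shift :: "(int \<Rightarrow> nat) \<Rightarrow> int \<Rightarrow> nat" where
  "shift \<omega> = (\<lambda>i. \<omega> (i + 1))"

definition transitive_on :: "'a::topological_space set \<Rightarrow> ('a \<Rightarrow> 'a) \<Rightarrow> bool" where
  "transitive_on Z S \<longleftrightarrow> (\<exists>z\<in>Z. Z \<subseteq> closure (range (\<lambda>k. (S ^^ k) z)))"

definition is_factor_of ::
  "'a::topological_space set \<Rightarrow> ('a \<Rightarrow> 'a) \<Rightarrow> 'b::topological_space set \<Rightarrow> ('b \<Rightarrow> 'b) \<Rightarrow> bool" where
  "is_factor_of X T Z S \<longleftrightarrow>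
     (\<exists>q. continuous_on Z q \<and> q ` Z = X \<and> (\<forall>z\<in>Z. q (S z) = T (q z)))"

definition has_period :: "('a \<Rightarrow> 'a) \<Rightarrow> 'a \<Rightarrow> nat \<Rightarrow> bool" where
  "has_period T x p \<longleftrightarrow> 0 < p \<and> (T ^^ p) x = x \<and> (\<forall>q. 0 < q \<and> q < p \<longrightarrow> (T ^^ q) x \<noteq> x)"


section \<open>\<open>C\<^sup>r\<close> maps\<close>

text \<open>The sets \<open>S\<close> to which the following predicate is applied are open.\<close>

fun Cr_on :: "nat \<Rightarrow> 'e::euclidean_space set \<Rightarrow> ('e \<Rightarrow> 'g::real_normed_vector) \<Rightarrow> bool" where
  "Cr_on 0 S f \<longleftrightarrow> continuous_on S f"
| "Cr_on (Suc r) S f \<longleftrightarrow> (\<forall>y\<in>S. f differentiable (at y)) \<and>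
     (\<forall>b\<in>Basis. Cr_on r S (\<lambda>y. frechet_derivative f (at y) b))"

fun partial_derivs :: "'e::euclidean_space list \<Rightarrow> ('e \<Rightarrow> 'g::real_normed_vector) \<Rightarrow> 'e \<Rightarrow> 'g" where
  "partial_derivs [] f = f"
| "partial_derivs (b # bs) f = partial_derivs bs (\<lambda>y. frechet_derivative f (at y) b)"

type_synonym ('m, 'e) chart = "'m set \<times> ('m \<Rightarrow> 'e)"

text \<open>An atlas making the whole type \<open>'m\<close> a smooth manifold modelled on \<open>'e\<close>.\<close>

definition smooth_atlas ::
  "('m::{t2_space, second_countable_topology}, 'e::euclidean_space) chart set \<Rightarrow> bool" where
  "smooth_atlas \<Phi> \<longleftrightarrow>
     (\<Union>(U, \<phi>)\<in>\<Phi>. U) = UNIV \<and>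
     (\<forall>(U, \<phi>)\<in>\<Phi>. open U \<and> open (\<phi> ` U) \<and> homeomorphism U (\<phi> ` U) \<phi> (inv_into U \<phi>)) \<and>
     (\<forall>(U, \<phi>)\<in>\<Phi>. \<forall>(U', \<phi>')\<in>\<Phi>. \<forall>r. Cr_on r (\<phi> ` (U \<inter> U')) (\<phi>' \<circ> inv_into U \<phi>))"

definition Cr_on_manifold ::
  "('m::{t2_space, second_countable_topology}, 'e::euclidean_space) chart set \<Rightarrow> nat \<Rightarrow>
   'm set \<Rightarrow> ('m \<Rightarrow> 'g::real_normed_vector) \<Rightarrow> bool" where
  "Cr_on_manifold \<Phi> r W f \<longleftrightarrow>
     (\<forall>(U, \<phi>)\<in>\<Phi>. Cr_on r (\<phi> ` (U \<inter> W)) (f \<circ> inv_into U \<phi>))"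


section \<open>Vector bundles\<close>

text \<open>
  The total space is the whole type \<open>'v\<close>. A local trivialization over \<open>U\<close> is a pair
  \<open>(U, \<psi>)\<close>, where \<open>\<psi>\<close> is the component in the model fiber \<open>\<real>\<^sup>d\<close>, so that the trivializing map
  is \<open>v \<mapsto> (proj v, \<psi> v)\<close>.
\<close>

record ('m, 'v, 'd) vbundle =
  proj :: "'v \<Rightarrow> 'm"
  fadd :: "'v \<Rightarrow> 'v \<Rightarrow> 'v"
  fscale :: "real \<Rightarrow> 'v \<Rightarrow> 'v"
  trivs :: "('m set \<times> ('v \<Rightarrow> real ^ 'd)) set"

definition fiber :: "('m, 'v, 'd::finite) vbundle \<Rightarrow> 'm \<Rightarrow> 'v set" where
  "fiber E x = {v. proj E v = x}"

definition bundle_over :: "('m, 'v, 'd::finite) vbundle \<Rightarrow> 'm set \<Rightarrow> 'v set" where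
  "bundle_over E W = proj E -` W"

definition fiber_linear :: "('m, 'v, 'd::finite) vbundle \<Rightarrow> 'm \<Rightarrow> 'm \<Rightarrow> ('v \<Rightarrow> 'v) \<Rightarrow> bool" where
  "fiber_linear E x y L \<longleftrightarrow>
     (\<forall>v\<in>fiber E x. L v \<in> fiber E y) \<and>
     (\<forall>v\<in>fiber E x. \<forall>w\<in>fiber E x. L (fadd E v w) = fadd E (L v) (L w)) \<and>
     (\<forall>c. \<forall>v\<in>fiber E x. L (fscale E c v) = fscale E c (L v))"

definition fiber_iso :: "('m, 'v, 'd::finite) vbundle \<Rightarrow> 'm \<Rightarrow> 'm \<Rightarrow> ('v \<Rightarrow> 'v) \<Rightarrow> bool" where
  "fiber_iso E x y L \<longleftrightarrow> fiber_linear E x y L \<and> bij_betw L (fiber E x) (fiber E y)"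

text \<open>Inverse of the fiber isomorphism given by a trivialization \<open>\<psi>\<close> at \<open>x\<close>.\<close>

definition triv_inv :: "('m, 'v, 'd::finite) vbundle \<Rightarrow> ('v \<Rightarrow> real ^ 'd) \<Rightarrow> 'm \<Rightarrow> real ^ 'd \<Rightarrow> 'v" where
  "triv_inv E \<psi> x = inv_into (fiber E x) \<psi>"

definition triv_matrix ::
  "('m, 'v, 'd::finite) vbundle \<Rightarrow> ('v \<Rightarrow> real ^ 'd) \<Rightarrow> 'm \<Rightarrow> ('v \<Rightarrow> 'v) \<Rightarrow> real ^ 'd ^ 'd" where
  "triv_matrix E \<psi> x L = matrix (\<lambda>w. \<psi> (L (triv_inv E \<psi> x w)))"

text \<open>
  The vector space axioms on the fibers need not be listed: the trivializations identify the
  operations on each fiber with those of \<open>\<real>\<^sup>d\<close>.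
\<close>

definition smooth_vector_bundle ::
  "('m::{t2_space, second_countable_topology}, 'e::euclidean_space) chart set \<Rightarrow> 'm set \<Rightarrow>
   ('m, 'v::topological_space, 'd::finite) vbundle \<Rightarrow> bool" where
  "smooth_vector_bundle \<Phi> Y E \<longleftrightarrow>
     open Y \<and> continuous_on UNIV (proj E) \<and> range (proj E) = Y \<and>
     (\<forall>x\<in>Y. \<forall>v\<in>fiber E x. \<forall>w\<in>fiber E x. fadd E v w \<in> fiber E x) \<and>
     (\<forall>x\<in>Y. \<forall>v\<in>fiber E x. \<forall>c. fscale E c v \<in> fiber E x) \<and>
     (\<Union>(U, \<psi>)\<in>trivs E. U) = Y \<and>
     (\<forall>(U, \<psi>)\<in>trivs E. open U \<and>
        (\<exists>g. homeomorphism (bundle_over E U) (U \<times> UNIV) (\<lambda>v. (proj E v, \<psi> v)) g) \<and>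
        (\<forall>x\<in>U. \<forall>v\<in>fiber E x. \<forall>w\<in>fiber E x. \<psi> (fadd E v w) = \<psi> v + \<psi> w) \<and>
        (\<forall>x\<in>U. \<forall>v\<in>fiber E x. \<forall>c. \<psi> (fscale E c v) = c *\<^sub>R \<psi> v)) \<and>
     (\<forall>(U, \<psi>)\<in>trivs E. \<forall>(U', \<psi>')\<in>trivs E. \<forall>r.
        Cr_on_manifold \<Phi> r (U \<inter> U') (\<lambda>x. matrix (\<lambda>w. \<psi>' (triv_inv E \<psi> x w))))"

text \<open>\<open>C\<^sup>r\<close> sections over \<open>W\<close> of the bundle of endomorphisms, as fiber preserving maps of \<open>E\<close>.\<close>

definition Cr_End_section ::
  "('m::{t2_space, second_countable_topology}, 'e::euclidean_space) chart set \<Rightarrow>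
   ('m, 'v::topological_space, 'd::finite) vbundle \<Rightarrow> nat \<Rightarrow> 'm set \<Rightarrow> ('v \<Rightarrow> 'v) \<Rightarrow> bool" where
  "Cr_End_section \<Phi> E r W S \<longleftrightarrow>
     (\<forall>x\<in>W. fiber_linear E x x S) \<and>
     (\<forall>(U, \<psi>)\<in>trivs E. Cr_on_manifold \<Phi> r (U \<inter> W) (\<lambda>x. triv_matrix E \<psi> x S))"

text \<open>
  The \<open>C\<^sup>r\<close>-norm over a compact set \<open>K\<close> is computed in a finite family of charts of the manifold
  and trivializations of the bundle, on compact pieces covering \<open>K\<close>. Different choices of the
  family give equivalent norms.
\<close>

definition norm_cover ::
  "('m::{t2_space, second_countable_topology}, 'e::euclidean_space) chart set \<Rightarrow>
   ('m, 'v::topological_space, 'd::finite) vbundle \<Rightarrow> 'm set \<Rightarrow>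
   (('m, 'e) chart \<times> ('m set \<times> ('v \<Rightarrow> real ^ 'd)) \<times> 'm set) set \<Rightarrow> bool" where
  "norm_cover \<Phi> E K D \<longleftrightarrow> finite D \<and>
     (\<forall>((U, \<phi>), (W, \<psi>), C)\<in>D. (U, \<phi>) \<in> \<Phi> \<and> (W, \<psi>) \<in> trivs E \<and> compact C \<and> C \<subseteq> U \<inter> W) \<and>
     (\<Union>(_, _, C)\<in>D. C) = K"

definition Cr_norm ::
  "('m, 'v, 'd::finite) vbundle \<Rightarrow>
   (('m, 'e::euclidean_space) chart \<times> ('m set \<times> ('v \<Rightarrow> real ^ 'd)) \<times> 'm set) set \<Rightarrow>
   nat \<Rightarrow> ('v \<Rightarrow> 'v) \<Rightarrow> real" where
  "Cr_norm E D r S = Sup {norm (partial_derivs bs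
       ((\<lambda>x. triv_matrix E \<psi> x S) \<circ> inv_into U \<phi>) (\<phi> x)) | bs U \<phi> W \<psi> C x.
     ((U, \<phi>), (W, \<psi>), C) \<in> D \<and> x \<in> C \<and> set bs \<subseteq> Basis \<and> length bs \<le> r}"


section \<open>Linear cocycles and the \<open>C\<^sup>r\<close>-topology\<close>

text \<open>
  The bundle \<open>V\<close> over \<open>X\<close> is \<^term>\<open>bundle_over E X\<close>. Maps defined on \<open>V\<close> are extended by
  \<^term>\<open>undefined\<close> so that they are determined by their values on \<open>V\<close>.
\<close>

definition linear_cocycles ::
  "('m, 'v::topological_space, 'd::finite) vbundle \<Rightarrow> 'm set \<Rightarrow> ('m \<Rightarrow> 'm) \<Rightarrow> ('v \<Rightarrow> 'v) set" where
  "linear_cocycles E X T = {A \<in> extensional (bundle_over E X).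
     continuous_on (bundle_over E X) A \<and> (\<forall>x\<in>X. fiber_iso E x (T x) A)}"

definition LC_Id ::
  "('m::{t2_space, second_countable_topology}, 'e::euclidean_space) chart set \<Rightarrow>
   ('m, 'v::topological_space, 'd::finite) vbundle \<Rightarrow> 'm set \<Rightarrow> nat \<Rightarrow> ('v \<Rightarrow> 'v) set" where
  "LC_Id \<Phi> E X r = {restrict S (bundle_over E X) | S.
     \<exists>W. open W \<and> X \<subseteq> W \<and> W \<subseteq> range (proj E) \<and>
       Cr_End_section \<Phi> E r W S \<and> (\<forall>x\<in>W. fiber_iso E x x S)}"

definition LC_Id_ball ::
  "('m::{t2_space, second_countable_topology}, 'e::euclidean_space) chart set \<Rightarrow>
   ('m, 'v::topological_space, 'd::finite) vbundle \<Rightarrow> 'm set \<Rightarrow>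
   (('m, 'e) chart \<times> ('m set \<times> ('v \<Rightarrow> real ^ 'd)) \<times> 'm set) set \<Rightarrow>
   nat \<Rightarrow> ('v \<Rightarrow> 'v) \<Rightarrow> real \<Rightarrow> ('v \<Rightarrow> 'v) set" where
  "LC_Id_ball \<Phi> E X D r R \<epsilon> = {R' \<in> LC_Id \<Phi> E X r.
     \<exists>S. Cr_End_section \<Phi> E r (range (proj E)) S \<and>
       (\<forall>v\<in>bundle_over E X. S v = fadd E (R' v) (fscale E (-1) (R v))) \<and>
       Cr_norm E D r S < \<epsilon>}"

definition LC_Id_topology ::
  "('m::{t2_space, second_countable_topology}, 'e::euclidean_space) chart set \<Rightarrow>
   ('m, 'v::topological_space, 'd::finite) vbundle \<Rightarrow> 'm set \<Rightarrow>
   (('m, 'e) chart \<times> ('m set \<times> ('v \<Rightarrow> real ^ 'd)) \<times> 'm set) set \<Rightarrow>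
   nat \<Rightarrow> ('v \<Rightarrow> 'v) topology" where
  "LC_Id_topology \<Phi> E X D r = topology (\<lambda>N. N \<subseteq> LC_Id \<Phi> E X r \<and>
     (\<forall>R\<in>N. \<exists>\<epsilon>>0. LC_Id_ball \<Phi> E X D r R \<epsilon> \<subseteq> N))"

definition LC_topology ::
  "('m::{t2_space, second_countable_topology}, 'e::euclidean_space) chart set \<Rightarrow>
   ('m, 'v::topological_space, 'd::finite) vbundle \<Rightarrow> 'm set \<Rightarrow> ('m \<Rightarrow> 'm) \<Rightarrow>
   (('m, 'e) chart \<times> ('m set \<times> ('v \<Rightarrow> real ^ 'd)) \<times> 'm set) set \<Rightarrow>
   nat \<Rightarrow> ('v \<Rightarrow> 'v) topology" where
  "LC_topology \<Phi> E X T D r = topology (\<lambda>G. G \<subseteq> linear_cocycles E X T \<and>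
     (\<forall>A\<in>G. \<exists>N. openin (LC_Id_topology \<Phi> E X D r) N \<and> restrict id (bundle_over E X) \<in> N \<and>
        (\<lambda>R. compose (bundle_over E X) A R) ` N \<subseteq> G))"


section \<open>Simple Lyapunov spectrum\<close>

definition complex_charpoly :: "real ^ 'd ^ 'd \<Rightarrow> complex poly" where
  "complex_charpoly M =
     det (\<chi> i j. (if i = j then [:0, 1:] else 0) - [:complex_of_real (M $ i $ j):])"

definition eigenvalues :: "real ^ 'd ^ 'd \<Rightarrow> complex multiset" where
  "eigenvalues M = proots (complex_charpoly M)"

definition distinct_moduli :: "complex multiset \<Rightarrow> bool" where
  "distinct_moduli E \<longleftrightarrow> (\<forall>t. count (image_mset cmod E) t \<le> 1)"

text \<open>
  The eigenvalues of an endomorphism of the fiber at \<open>x\<close> are those of its matrix in the basis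
  given by a trivialization at \<open>x\<close>; they do not depend on the trivialization.
\<close>

definition simple_spectrum_at ::
  "('m, 'v, 'd::finite) vbundle \<Rightarrow> 'm \<Rightarrow> ('v \<Rightarrow> 'v) \<Rightarrow> bool" where
  "simple_spectrum_at E x L \<longleftrightarrow>
     (\<exists>(U, \<psi>)\<in>trivs E. x \<in> U \<and> distinct_moduli (eigenvalues (triv_matrix E \<psi> x L)))"

definition simple_at_periodic_point ::
  "('m, 'v, 'd::finite) vbundle \<Rightarrow> 'm set \<Rightarrow> ('m \<Rightarrow> 'm) \<Rightarrow> ('v \<Rightarrow> 'v) \<Rightarrow> bool" where
  "simple_at_periodic_point E X T A \<longleftrightarrow>
     (\<exists>x\<in>X. \<exists>p. has_period T x p \<and> simple_spectrum_at E x (A ^^ p))"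

section \<open>The topologies are well defined\<close>

lemma openin_LC_Id_topology:
  "openin (LC_Id_topology \<Phi> E X D r) N \<longleftrightarrow> N \<subseteq> LC_Id \<Phi> E X r \<and>
     (\<forall>R\<in>N. \<exists>\<epsilon>>0. LC_Id_ball \<Phi> E X D r R \<epsilon> \<subseteq> N)"
proof -
  let ?P = "\<lambda>N. N \<subseteq> LC_Id \<Phi> E X r \<and> (\<forall>R\<in>N. \<exists>\<epsilon>>0. LC_Id_ball \<Phi> E X D r R \<epsilon> \<subseteq> N)"
  have "istopology ?P"
    unfolding istopology_def
  proof (intro conjI allI impI)
    fix S T assume S: "?P S" and T: "?P T"
    show "S \<inter> T \<subseteq> LC_Id \<Phi> E X r" using S by blast
    show "\<forall>R\<in>S \<inter> T. \<exists>\<epsilon>>0. LC_Id_ball \<Phi> E X D r R \<epsilon> \<subseteq> S \<inter> T"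
    proof
      fix R assume "R \<in> S \<inter> T"
      then obtain d e where "d > 0" "LC_Id_ball \<Phi> E X D r R d \<subseteq> S"
        and "e > 0" "LC_Id_ball \<Phi> E X D r R e \<subseteq> T"
        using S T by (meson IntE)
      moreover have "LC_Id_ball \<Phi> E X D r R (min d e) \<subseteq> LC_Id_ball \<Phi> E X D r R d"
        and "LC_Id_ball \<Phi> E X D r R (min d e) \<subseteq> LC_Id_ball \<Phi> E X D r R e"
        by (auto simp: LC_Id_ball_def)
      ultimately have "min d e > 0 \<and> LC_Id_ball \<Phi> E X D r R (min d e) \<subseteq> S \<inter> T" by auto
      then show "\<exists>\<epsilon>>0. LC_Id_ball \<Phi> E X D r R \<epsilon> \<subseteq> S \<inter> T" by blast
    qed
  next
    fix \<K> assume K: "\<forall>S\<in>\<K>. ?P S"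
    show "\<Union>\<K> \<subseteq> LC_Id \<Phi> E X r" using K by blast
    show "\<forall>R\<in>\<Union>\<K>. \<exists>\<epsilon>>0. LC_Id_ball \<Phi> E X D r R \<epsilon> \<subseteq> \<Union>\<K>"
      using K by (meson UnionE Union_upper order_trans)
  qed
  then show ?thesis by (simp add: LC_Id_topology_def topology_inverse')
qed

lemma topspace_LC_Id_topology: "topspace (LC_Id_topology \<Phi> E X D r) = LC_Id \<Phi> E X r"
proof
  show "topspace (LC_Id_topology \<Phi> E X D r) \<subseteq> LC_Id \<Phi> E X r"
    by (metis openin_LC_Id_topology openin_topspace)
  have "openin (LC_Id_topology \<Phi> E X D r) (LC_Id \<Phi> E X r)"
    unfolding openin_LC_Id_topology by (auto simp: LC_Id_ball_def intro: exI[of _ 1])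
  then show "LC_Id \<Phi> E X r \<subseteq> topspace (LC_Id_topology \<Phi> E X D r)"
    by (rule openin_subset)
qed

lemma openin_LC_topology:
  "openin (LC_topology \<Phi> E X T D r) G \<longleftrightarrow> G \<subseteq> linear_cocycles E X T \<and>
     (\<forall>A\<in>G. \<exists>N. openin (LC_Id_topology \<Phi> E X D r) N \<and> restrict id (bundle_over E X) \<in> N \<and>
        (\<lambda>R. compose (bundle_over E X) A R) ` N \<subseteq> G)"
proof -
  let ?Q = "\<lambda>G A N. openin (LC_Id_topology \<Phi> E X D r) N \<and> restrict id (bundle_over E X) \<in> N \<and>
        (\<lambda>R. compose (bundle_over E X) A R) ` N \<subseteq> G"
  let ?P = "\<lambda>G. G \<subseteq> linear_cocycles E X T \<and> (\<forall>A\<in>G. \<exists>N. ?Q G A N)"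
  have "istopology ?P"
    unfolding istopology_def
  proof (intro conjI allI impI)
    fix S U assume S: "?P S" and U: "?P U"
    show "S \<inter> U \<subseteq> linear_cocycles E X T" using S by blast
    show "\<forall>A\<in>S \<inter> U. \<exists>N. ?Q (S \<inter> U) A N"
    proof
      fix A assume "A \<in> S \<inter> U"
      then obtain N N' where N: "?Q S A N" and N': "?Q U A N'" using S U by (meson IntE)
      have "?Q (S \<inter> U) A (N \<inter> N')" using N N' openin_Int by blast
      then show "\<exists>N. ?Q (S \<inter> U) A N" by blast
    qed
  next
    fix \<K> assume K: "\<forall>S\<in>\<K>. ?P S"
    show "\<Union>\<K> \<subseteq> linear_cocycles E X T" using K by blast
    show "\<forall>A\<in>\<Union>\<K>. \<exists>N. ?Q (\<Union>\<K>) A N"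
      using K by (meson UnionE Union_upper order_trans)
  qed
  then show ?thesis by (simp add: LC_topology_def topology_inverse')
qed

lemma smooth_atlas_cover: "smooth_atlas \<Phi> \<Longrightarrow> (\<Union>c\<in>\<Phi>. fst c) = UNIV"
  by (simp add: smooth_atlas_def case_prod_beta')

lemma smooth_atlas_open: "smooth_atlas \<Phi> \<Longrightarrow> c \<in> \<Phi> \<Longrightarrow> open (fst c)"
  by (simp add: smooth_atlas_def case_prod_beta')

lemma trivs_cover: "smooth_vector_bundle \<Phi> Y E \<Longrightarrow> (\<Union>c\<in>trivs E. fst c) = Y"
  by (simp add: smooth_vector_bundle_def case_prod_beta')

lemma trivs_open: "smooth_vector_bundle \<Phi> Y E \<Longrightarrow> c \<in> trivs E \<Longrightarrow> open (fst c)"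
  by (simp add: smooth_vector_bundle_def case_prod_beta')

lemma smooth_atlas_chart:
  assumes "smooth_atlas \<Phi>" "(U, \<phi>) \<in> \<Phi>"
  shows "open U" "open (\<phi> ` U)" "homeomorphism U (\<phi> ` U) \<phi> (inv_into U \<phi>)"
  using assms by (simp_all add: smooth_atlas_def Ball_def)

lemma smooth_vector_bundle_base:
  assumes "smooth_vector_bundle \<Phi> Y E"
  shows "open Y" "continuous_on UNIV (proj E)" "range (proj E) = Y"
  using assms by (simp_all add: smooth_vector_bundle_def)

lemma smooth_vector_bundle_ops:
  assumes "smooth_vector_bundle \<Phi> Y E" "x \<in> Y" "v \<in> fiber E x"
  shows "w \<in> fiber E x \<Longrightarrow> fadd E v w \<in> fiber E x" "fscale E c v \<in> fiber E x"
  using assms by (simp_all add: smooth_vector_bundle_def)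

lemma smooth_vector_bundle_triv:
  assumes "smooth_vector_bundle \<Phi> Y E" "(U, \<psi>) \<in> trivs E"
  shows "open U" "\<exists>g. homeomorphism (bundle_over E U) (U \<times> UNIV) (\<lambda>v. (proj E v, \<psi> v)) g"
    and "x \<in> U \<Longrightarrow> v \<in> fiber E x \<Longrightarrow> w \<in> fiber E x \<Longrightarrow> \<psi> (fadd E v w) = \<psi> v + \<psi> w"
    and "x \<in> U \<Longrightarrow> v \<in> fiber E x \<Longrightarrow> \<psi> (fscale E c v) = c *\<^sub>R \<psi> v"
  using assms by (simp_all add: smooth_vector_bundle_def Ball_def)

lemma triv_bij:
  assumes "smooth_vector_bundle \<Phi> Y E" "(U, \<psi>) \<in> trivs E" "x \<in> U"
  shows "bij_betw \<psi> (fiber E x) UNIV"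
proof -
  obtain g where "homeomorphism (bundle_over E U) (U \<times> UNIV) (\<lambda>v. (proj E v, \<psi> v)) g"
    using smooth_vector_bundle_triv(2)[OF assms(1,2)] by blast
  then have g1: "\<And>v. v \<in> bundle_over E U \<Longrightarrow> g (proj E v, \<psi> v) = v"
    and g2: "\<And>y. y \<in> U \<times> UNIV \<Longrightarrow> (\<lambda>v. (proj E v, \<psi> v)) (g y) = y"
    by (auto simp: homeomorphism_def)
  show ?thesis
  proof (rule bij_betw_byWitness[where f' = "\<lambda>w. g (x, w)"])
    show "\<forall>a\<in>fiber E x. g (x, \<psi> a) = a"
      using g1 assms(3) by (auto simp: fiber_def bundle_over_def)
    show "\<forall>a'\<in>UNIV. \<psi> (g (x, a')) = a'"
      using g2 assms(3) by auto
    show "(\<lambda>w. g (x, w)) ` UNIV \<subseteq> fiber E x"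
      using g2 assms(3) by (auto simp: fiber_def)
  qed simp
qed

lemma triv_inv_simps:
  assumes "smooth_vector_bundle \<Phi> Y E" "(U, \<psi>) \<in> trivs E" "x \<in> U"
  shows "triv_inv E \<psi> x w \<in> fiber E x" "\<psi> (triv_inv E \<psi> x w) = w"
    and "v \<in> fiber E x \<Longrightarrow> triv_inv E \<psi> x (\<psi> v) = v"
  using triv_bij[OF assms] unfolding triv_inv_def bij_betw_def
  by (auto intro: inv_into_into f_inv_into_f)

lemma triv_matrix_works:
  assumes E: "smooth_vector_bundle \<Phi> Y E" and U: "(U, \<psi>) \<in> trivs E" and x: "x \<in> U"
    and L: "fiber_linear E x x L" and v: "v \<in> fiber E x"
  shows "triv_matrix E \<psi> x L *v \<psi> v = \<psi> (L v)"
proof -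
  note ti = triv_inv_simps[OF E U x]
  note add = smooth_vector_bundle_triv(3)[OF E U x] and sc = smooth_vector_bundle_triv(4)[OF E U x]
  have "x \<in> Y" using trivs_cover[OF E] U x by fastforce
  note addm = smooth_vector_bundle_ops(1)[OF E this] and scm = smooth_vector_bundle_ops(2)[OF E this]
  have inv_add: "triv_inv E \<psi> x (a + b) = fadd E (triv_inv E \<psi> x a) (triv_inv E \<psi> x b)" for a b
    by (metis ti add addm)
  have inv_sc: "triv_inv E \<psi> x (c *\<^sub>R a) = fscale E c (triv_inv E \<psi> x a)" for c a
    by (metis ti sc scm)
  have Lm: "L v \<in> fiber E x" if "v \<in> fiber E x" for v
    using L that by (auto simp: fiber_linear_def)
  have "linear (\<lambda>w. \<psi> (L (triv_inv E \<psi> x w)))"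
  proof (rule linearI)
    fix a b
    show "\<psi> (L (triv_inv E \<psi> x (a + b))) = \<psi> (L (triv_inv E \<psi> x a)) + \<psi> (L (triv_inv E \<psi> x b))"
      using L ti(1) by (simp add: inv_add fiber_linear_def add)
  next
    fix c a
    show "\<psi> (L (triv_inv E \<psi> x (c *\<^sub>R a))) = c *\<^sub>R \<psi> (L (triv_inv E \<psi> x a))"
      using L ti(1) sc[OF Lm] by (simp add: inv_sc fiber_linear_def)
  qed
  then have "triv_matrix E \<psi> x L *v \<psi> v = \<psi> (L (triv_inv E \<psi> x (\<psi> v)))"
    unfolding triv_matrix_def by (intro matrix_works) (simp add: linear_matrix_vector_mul_eq)
  then show ?thesis using ti(3)[OF v] by simp
qed

lemma Cr_on_imp_continuous: "Cr_on r S f \<Longrightarrow> continuous_on S f"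
  by (cases r) (auto intro!: differentiable_imp_continuous_on
      simp: differentiable_on_def differentiable_at_withinI)

lemma Cr_on_manifold_imp_continuous:
  assumes \<Phi>: "smooth_atlas \<Phi>" and W: "open W" and f: "Cr_on_manifold \<Phi> r W f"
  shows "continuous_on W f"
proof -
  have "continuous_on (U \<inter> W) f" if U: "(U, \<phi>) \<in> \<Phi>" for U \<phi>
  proof -
    have h: "homeomorphism U (\<phi> ` U) \<phi> (inv_into U \<phi>)"
      using smooth_atlas_chart[OF \<Phi> U] by blast
    have "continuous_on (\<phi> ` (U \<inter> W)) (f \<circ> inv_into U \<phi>)"
      using f U Cr_on_imp_continuous unfolding Cr_on_manifold_def by fast
    moreover have "continuous_on (U \<inter> W) \<phi>"
      using h homeomorphism_cont1 continuous_on_subset by blast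
    ultimately have "continuous_on (U \<inter> W) ((f \<circ> inv_into U \<phi>) \<circ> \<phi>)"
      using continuous_on_compose by blast
    then show ?thesis
      using homeomorphism_apply1[OF h] by (auto elim!: continuous_on_eq)
  qed
  moreover have "open (fst c \<inter> W)" if "c \<in> \<Phi>" for c
    using smooth_atlas_open[OF \<Phi> that] W by blast
  ultimately have "continuous_on (\<Union>c\<in>\<Phi>. fst c \<inter> W) f"
    by (intro continuous_on_open_UN) auto
  moreover have "(\<Union>c\<in>\<Phi>. fst c \<inter> W) = W"
    using smooth_atlas_cover[OF \<Phi>] by blast
  ultimately show ?thesis by simp
qed

lemma Cr_End_section_continuous:
  assumes \<Phi>: "smooth_atlas \<Phi>" and E: "smooth_vector_bundle \<Phi> Y E"
    and W: "open W" "W \<subseteq> Y" and S: "Cr_End_section \<Phi> E r W S"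
  shows "continuous_on (bundle_over E W) S"
proof -
  have pc: "continuous_on B (proj E)" for B
    using smooth_vector_bundle_base(2)[OF E] continuous_on_subset by blast
  have op: "open (bundle_over E B)" if "open B" for B
    unfolding bundle_over_def using that pc open_vimage by blast
  have "continuous_on (bundle_over E (U \<inter> W)) S" if U: "(U, \<psi>) \<in> trivs E" for U \<psi>
  proof -
    obtain g where h: "homeomorphism (bundle_over E U) (U \<times> UNIV) (\<lambda>v. (proj E v, \<psi> v)) g"
      using smooth_vector_bundle_triv(2)[OF E U] by blast
    have oU: "open U" by (rule smooth_vector_bundle_triv(1)[OF E U])
    let ?M = "\<lambda>x. triv_matrix E \<psi> x S"
    have "continuous_on (U \<inter> W) ?M"
      using S U oU W by (intro Cr_on_manifold_imp_continuous[OF \<Phi>, of _ r])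
        (auto simp: Cr_End_section_def)
    then have cM: "continuous_on (bundle_over E (U \<inter> W)) (\<lambda>v. ?M (proj E v))"
      by (rule continuous_on_compose2[OF _ pc]) (auto simp: bundle_over_def)
    have "continuous_on (bundle_over E U) (\<lambda>v. snd (proj E v, \<psi> v))"
      using homeomorphism_cont1[OF h] continuous_on_snd by blast
    then have c\<psi>: "continuous_on (bundle_over E (U \<inter> W)) \<psi>"
      by (auto elim: continuous_on_subset simp: bundle_over_def)
    have "continuous_on (bundle_over E (U \<inter> W)) (\<lambda>v. ?M (proj E v) *v \<psi> v)"
      unfolding matrix_vector_mult_def
      by (intro continuous_intros continuous_on_vec_lambda cM c\<psi>)
    then have "continuous_on (bundle_over E (U \<inter> W)) (\<lambda>v. g (proj E v, ?M (proj E v) *v \<psi> v))"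
      by (intro continuous_on_compose2[OF homeomorphism_cont2[OF h]] continuous_on_Pair pc)
        (auto simp: bundle_over_def)
    moreover have "g (proj E v, ?M (proj E v) *v \<psi> v) = S v" if v: "v \<in> bundle_over E (U \<inter> W)" for v
    proof -
      have x: "proj E v \<in> U" "proj E v \<in> W" and vf: "v \<in> fiber E (proj E v)"
        using v by (auto simp: bundle_over_def fiber_def)
      have L: "fiber_linear E (proj E v) (proj E v) S"
        using S x by (auto simp: Cr_End_section_def)
      then have p: "proj E (S v) = proj E v"
        using vf by (auto simp: fiber_linear_def fiber_def)
      have "?M (proj E v) *v \<psi> v = \<psi> (S v)"
        by (rule triv_matrix_works[OF E U x(1) L vf])
      then show ?thesis
        using homeomorphism_apply1[OF h, of "S v"] x p by (simp add: bundle_over_def)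
    qed
    ultimately show ?thesis by (rule continuous_on_eq)
  qed
  moreover have "open (bundle_over E (fst c \<inter> W))" if "c \<in> trivs E" for c
    using trivs_open[OF E that] W op by blast
  ultimately have "continuous_on (\<Union>c\<in>trivs E. bundle_over E (fst c \<inter> W)) S"
    by (intro continuous_on_open_UN) auto
  moreover have "(\<Union>c\<in>trivs E. bundle_over E (fst c \<inter> W)) = bundle_over E W"
    using trivs_cover[OF E] W unfolding bundle_over_def by blast
  ultimately show ?thesis by simp
qed

lemma Cr_on_const: "Cr_on r S (\<lambda>_. c)"
proof (induction r arbitrary: c)
  case (Suc r)
  then show ?case by (simp add: frechet_derivative_const)
qed simp

lemma Cr_on_cong:
  assumes "open S" "Cr_on r S f" "\<And>y. y \<in> S \<Longrightarrow> f y = g y"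
  shows "Cr_on r S g"
  using assms(2,3)
proof (induction r arbitrary: f g)
  case 0
  then show ?case using continuous_on_cong by fastforce
next
  case (Suc r)
  have d: "(g has_derivative f') (at y)" if "y \<in> S" "(f has_derivative f') (at y)" for y f'
    using has_derivative_transform_within_open[OF that(2) assms(1) that(1)] Suc.prems by blast
  have 1: "g differentiable (at y)" if "y \<in> S" for y
  proof -
    obtain f' where "(f has_derivative f') (at y)"
      using Suc.prems(1) \<open>y \<in> S\<close> unfolding Cr_on.simps differentiable_def by blast
    then show ?thesis using d[OF \<open>y \<in> S\<close>] unfolding differentiable_def by blast
  qed
  have "frechet_derivative f (at y) = frechet_derivative g (at y)" if "y \<in> S" for y
    using d[OF that] Suc.prems(1) that
    by (metis Cr_on.simps(2) frechet_derivative_at frechet_derivative_works)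
  then have fg: "frechet_derivative f (at y) b = frechet_derivative g (at y) b" if "y \<in> S" for y b
    using that by simp
  have "Cr_on r S (\<lambda>y. frechet_derivative g (at y) b)" if "b \<in> Basis" for b
  proof (rule Suc.IH)
    show "Cr_on r S (\<lambda>y. frechet_derivative f (at y) b)" using Suc.prems(1) that by simp
  qed (rule fg)
  with 1 show ?case unfolding Cr_on.simps by blast
qed

lemma id_in_LC_Id:
  assumes \<Phi>: "smooth_atlas \<Phi>" and E: "smooth_vector_bundle \<Phi> Y E" and X: "X \<subseteq> Y"
  shows "restrict id (bundle_over E X) \<in> LC_Id \<Phi> E X r"
proof -
  have Y: "open Y" "range (proj E) = Y" using smooth_vector_bundle_base[OF E] by auto
  have "Cr_on_manifold \<Phi> r (U \<inter> Y) (\<lambda>x. triv_matrix E \<psi> x id)" if U: "(U, \<psi>) \<in> trivs E" for U \<psi>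
    unfolding Cr_on_manifold_def
  proof safe
    fix O' \<phi> assume O': "(O', \<phi>) \<in> \<Phi>"
    have h: "homeomorphism O' (\<phi> ` O') \<phi> (inv_into O' \<phi>)" and oO: "open O'" "open (\<phi> ` O')"
      using smooth_atlas_chart[OF \<Phi> O'] by blast+
    have "open U" by (rule smooth_vector_bundle_triv(1)[OF E U])
    then have "openin (top_of_set O') (O' \<inter> (U \<inter> Y))"
      using Y by (intro openin_open_Int) auto
    then have "openin (top_of_set (\<phi> ` O')) (\<phi> ` (O' \<inter> (U \<inter> Y)))"
      by (rule homeomorphism_imp_open_map[OF h])
    then have op: "open (\<phi> ` (O' \<inter> (U \<inter> Y)))"
      using oO openin_open_trans by blast
    have "triv_matrix E \<psi> x id = mat 1" if "x \<in> U" for x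
      unfolding triv_matrix_def using triv_inv_simps(2)[OF E U that]
      by (simp add: matrix_id_mat_1 flip: id_def)
    then have "((\<lambda>x. triv_matrix E \<psi> x id) \<circ> inv_into O' \<phi>) y = mat 1"
      if "y \<in> \<phi> ` (O' \<inter> (U \<inter> Y))" for y
      using that homeomorphism_apply1[OF h] by auto
    then show "Cr_on r (\<phi> ` (O' \<inter> (U \<inter> Y))) ((\<lambda>x. triv_matrix E \<psi> x id) \<circ> inv_into O' \<phi>)"
      using Cr_on_cong[OF op Cr_on_const[where c = "mat 1"]] by metis
  qed
  then have "Cr_End_section \<Phi> E r Y id"
    by (auto simp: Cr_End_section_def fiber_linear_def)
  moreover have "\<forall>x\<in>Y. fiber_iso E x x id"
    by (auto simp: fiber_iso_def fiber_linear_def)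
  ultimately show ?thesis
    unfolding LC_Id_def using X Y by blast
qed

lemma compose_in_linear_cocycles:
  assumes \<Phi>: "smooth_atlas \<Phi>" and E: "smooth_vector_bundle \<Phi> Y E"
    and A: "A \<in> linear_cocycles E X T" and R: "R \<in> LC_Id \<Phi> E X r"
  shows "compose (bundle_over E X) A R \<in> linear_cocycles E X T"
proof -
  let ?V = "bundle_over E X"
  obtain S W where W: "open W" "X \<subseteq> W" "W \<subseteq> range (proj E)" "Cr_End_section \<Phi> E r W S"
    "\<forall>x\<in>W. fiber_iso E x x S" and RS: "R = restrict S ?V"
    using R unfolding LC_Id_def by blast
  have "continuous_on (bundle_over E W) S"
    using Cr_End_section_continuous[OF \<Phi> E W(1) _ W(4)] W(3) smooth_vector_bundle_base[OF E]
    by simp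
  then have cS: "continuous_on ?V S"
    by (rule continuous_on_subset) (use W in \<open>auto simp: bundle_over_def\<close>)
  have iso: "fiber_iso E x x S" if "x \<in> X" for x using W that by blast
  have SV: "S v \<in> ?V" if "v \<in> ?V" for v
    using iso[of "proj E v"] that
    by (auto simp: fiber_iso_def fiber_linear_def fiber_def bundle_over_def)
  have eq: "compose ?V A R v = A (S v)" if "v \<in> ?V" for v
    using that by (simp add: compose_def RS)
  have "continuous_on ?V (\<lambda>v. A (S v))"
    using A SV by (intro continuous_on_compose2[OF _ cS, of ?V]) (auto simp: linear_cocycles_def)
  then have "continuous_on ?V (compose ?V A R)"
    using eq continuous_on_cong by fastforce
  moreover have "fiber_iso E x (T x) (compose ?V A R)" if x: "x \<in> X" for x
  proof -
    have Ax: "fiber_iso E x (T x) A" using A x by (simp add: linear_cocycles_def)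
    have sub: "fiber E x \<subseteq> ?V" using x by (auto simp: fiber_def bundle_over_def)
    have "x \<in> Y" using W x smooth_vector_bundle_base[OF E] by auto
    then have cl: "fadd E v w \<in> fiber E x" "fscale E c v \<in> fiber E x"
      if "v \<in> fiber E x" "w \<in> fiber E x" for v w c
      using smooth_vector_bundle_ops[OF E \<open>x \<in> Y\<close>] that by blast+
    have "bij_betw (A \<circ> S) (fiber E x) (fiber E (T x))"
      using Ax iso[OF x] bij_betw_trans unfolding fiber_iso_def by blast
    then have "bij_betw (compose ?V A R) (fiber E x) (fiber E (T x))"
      using eq sub by (subst bij_betw_cong[of _ _ "A \<circ> S"]) auto
    moreover have "compose ?V A R v = A (S v)" if "v \<in> fiber E x" for v
      using eq sub that by blast
    then have "fiber_linear E x (T x) (compose ?V A R)"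
      using Ax iso[OF x] cl unfolding fiber_iso_def fiber_linear_def by simp
    ultimately show ?thesis by (simp add: fiber_iso_def)
  qed
  ultimately show ?thesis
    by (simp add: linear_cocycles_def compose_extensional)
qed

lemma topspace_LC_topology:
  assumes \<Phi>: "smooth_atlas \<Phi>" and E: "smooth_vector_bundle \<Phi> Y E" and X: "X \<subseteq> Y"
  shows "topspace (LC_topology \<Phi> E X T D r) = linear_cocycles E X T"
proof
  show "topspace (LC_topology \<Phi> E X T D r) \<subseteq> linear_cocycles E X T"
    by (metis openin_LC_topology openin_topspace)
  have "openin (LC_Id_topology \<Phi> E X D r) (LC_Id \<Phi> E X r)"
    by (metis topspace_LC_Id_topology openin_topspace)
  then have "openin (LC_topology \<Phi> E X T D r) (linear_cocycles E X T)"
    unfolding openin_LC_topology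
    using id_in_LC_Id[OF \<Phi> E X] compose_in_linear_cocycles[OF \<Phi> E]
    by (intro conjI ballI exI[of _ "LC_Id \<Phi> E X r"]) auto
  then show "linear_cocycles E X T \<subseteq> topspace (LC_topology \<Phi> E X T D r)"
    by (rule openin_subset)
qed

end

theory Submission
  imports Defs "HOL-Computational_Algebra.Fundamental_Theorem_Algebra"
begin

text \<open>
  Openness: the condition is tested on one return matrix, which depends continuously on the cocycle.

  Density: in a nonempty open set \<open>G\<close>, choose a cocycle and a periodic point (the image of a
  periodic symbol sequence) for which the number \<open>k\<close> of moduli of eigenvalues of the return
  matrix \<open>M\<close> is maximal. Rank one perturbations and maximality force \<open>M\<close> to have \<open>d\<close> distinct
  eigenvalues, two of which have equal modulus only if they are conjugate. If \<open>k < d\<close>, there is a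
  nonreal pair \<open>l\<close>, \<open>cnj l\<close>. Follow periodic orbits that stay near the given one for a long time
  and then make a fixed homoclinic excursion. A perturbation on the excursion puts it in general
  position with respect to all gaps of \<open>M\<close>, so that cone fields produce at least \<open>k\<close> groups of
  moduli for the long periodic orbits as well, by maximality exactly \<open>k\<close>. Rotating slightly in the
  plane of the pair at the original periodic point turns the central direction of the long orbit
  arbitrarily often, so for some parameter a real eigenvalue appears in the group of \<open>l\<close>. Since the
  long orbit also realises the maximum \<open>k\<close>, that group then consists of a single eigenvalue, and
  fewer than \<open>d\<close> eigenvalues remain, a contradiction.
\<close>

section \<open>Characteristic polynomials\<close>

text \<open>\<open>T\<close> need not be invertible, so points of X have no canonical past. The
  excursion is built in the two-sided shift and projected to an orbit \<open>x\<close> indexed by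
  the integers. The projection need not be injective, so it takes an argument that some
  neighbourhood of \<open>x 0\<close> is met exactly once per turn by each long orbit and never by
  the orbit of p; only then does a perturbation there insert a single factor. No invariant splitting
  is constructed along the homoclinic orbit. Cone conditions around sets of coordinates are open and
  compose; subspaces are recovered afterwards from growth rates. Cones come with two apertures, 1/2
  and 2: the central class between two gaps J and K lies outside the wide J-cone and inside the
  narrow K-cone, and with the common aperture 1 these conditions would not bound a vector by its
  central coordinates. The rotation at p also changes the excursion, whose turning might undo that
  of the long stay near p. The limit along the homoclinic orbit shows that the excursion contributes
  a bounded turn, uniformly in the length of the orbit.\<close>

lemma mat_vec: "mat z *v (w :: 'a::comm_ring_1 ^ 'd) = z *s w"
proof -
  have "(\<Sum>j\<in>UNIV. (if i = j then z else 0) * w $ j) = z * w $ i" for i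
    by (simp add: if_distrib[of "\<lambda>x. x * _"] cong: if_cong)
  then show ?thesis by (simp add: vec_eq_iff matrix_vector_mult_def mat_def)
qed

text \<open>Stated for complex matrices, since the rank one updates below go along complex
  eigenvectors even when the perturbed matrix is real.\<close>

definition charp :: "complex ^ 'd ^ 'd \<Rightarrow> complex poly" where
  "charp A = det (\<chi> i j. (if i = j then [:0, 1:] else 0) - [:A $ i $ j:])"

definition cmat :: "real ^ 'd ^ 'd \<Rightarrow> complex ^ 'd ^ 'd" where
  "cmat M = (\<chi> i j. complex_of_real (M $ i $ j))"

lemma complex_charpoly_eq: "complex_charpoly M = charp (cmat M)"
  by (simp add: complex_charpoly_def charp_def cmat_def)

lemma poly_det: "poly (det A) z = det (\<chi> i j. poly (A $ i $ j) z)"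
  by (simp add: det_def poly_sum poly_prod sign_def)

lemma poly_charp: "poly (charp A) z = det (mat z - A)"
proof -
  have "(\<chi> i j. poly ((\<chi> i j. (if i = j then [:0, 1:] else 0) - [:A $ i $ j:]) $ i $ j) z) = mat z - A"
    by (simp add: vec_eq_iff mat_def)
  then show ?thesis unfolding charp_def poly_det by simp
qed

text \<open>In the Leibniz sum the degree of a term is at most the number of fixed points of its
  permutation, so the identity alone reaches the full degree.\<close>

lemma degree_det_aux:
  fixes f :: "'d::finite \<Rightarrow> 'd \<Rightarrow> complex poly"
  assumes 1: "\<And>i. degree (f i i) = 1" and 0: "\<And>i j. i ~= j ==> degree (f i j) = 0"
  shows "degree (\<Sum>p\<in>{p. p permutes UNIV}. of_int (sign p) * (\<Prod>i\<in>UNIV. f i (p i))) = CARD('d)"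
proof -
  define g where "g p = of_int (sign p) * (\<Prod>i\<in>UNIV. f i (p i))" for p
  have fin: "finite {p. p permutes (UNIV :: 'd set)}" by (simp add: finite_permutations)
  have s: "(\<Sum>p\<in>{p. p permutes UNIV}. g p) = g id + (\<Sum>p\<in>{p. p permutes UNIV} - {id}. g p)"
    by (rule sum.remove[OF fin]) (simp add: permutes_id)
  have "f i i ~= 0" for i using 1[of i] by auto
  then have "degree (\<Prod>i\<in>UNIV. f i i) = (\<Sum>i\<in>UNIV. degree (f i i))"
    by (intro degree_prod_eq_sum_degree) blast
  then have d: "degree (g id) = CARD('d)" by (simp add: g_def sign_id 1)
  have "degree (g p) < CARD('d)" if p: "p \<in> {p. p permutes UNIV} - {id}" for p
  proof -
    have "degree (g p) <= degree (\<Prod>i\<in>UNIV. f i (p i))"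
      by (cases "sign p = 1") (simp_all add: sign_def g_def)
    also have "\<dots> <= (\<Sum>i\<in>UNIV. degree (f i (p i)))"
      using degree_prod_sum_le[of "UNIV :: 'd set" "\<lambda>i. f i (p i)"] by (simp add: comp_def)
    also have "\<dots> <= (\<Sum>i\<in>UNIV. if p i = i then 1 else 0)"
      by (rule sum_mono) (metis 0 1 order_refl)
    also have "\<dots> = card {i. p i = i}" by (simp add: sum.If_cases)
    also have "\<dots> < CARD('d)"
    proof (rule psubset_card_mono)
      show "{i. p i = i} \<subset> UNIV" using p by (auto simp: fun_eq_iff)
    qed simp
    finally show ?thesis .
  qed
  then have "degree (\<Sum>p\<in>{p. p permutes UNIV} - {id}. g p) < CARD('d)"
    by (intro degree_sum_less zero_less_card_finite)
  then show ?thesis using d s unfolding g_def[symmetric] by (simp add: degree_add_eq_left)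
qed

lemma degree_charp: "degree (charp (A :: complex ^ 'd ^ 'd)) = CARD('d)"
  unfolding charp_def det_def
  using degree_det_aux[of "\<lambda>i j. (if i = j then [:0, 1:] else 0) - [:A $ i $ j:]"] by simp

text \<open>With row \<open>k\<close> equal to \<open>l\<close>, the multiples of \<open>l\<close>
  in the other rows are removed by row operations; Cramer's rule then leaves
  \<open>l $ k\<close>.\<close>

lemma det_rank_one_aux:
  fixes v l :: "'a::field ^ 'd"
  assumes "finite S" "k \<notin> S"
  shows "det (\<chi> i. if i = k then l else if i \<in> S then axis i 1 + v $ i *s l else axis i 1) = l $ k"
  using assms
proof (induction S)
  case empty
  have "(\<Sum>i\<in>UNIV. l $ i *s row i (mat 1)) = l"
    by (simp add: vec_eq_iff row_def mat_def if_distrib[of "\<lambda>x. _ * x"] cong: if_cong)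
  moreover have "row i (mat 1 :: 'a ^ 'd ^ 'd) = axis i 1" for i
    unfolding vec_eq_iff row_def mat_def axis_def by auto
  ultimately have "(\<chi> i. if i = k then \<Sum>i\<in>UNIV. l $ i *s row i (mat 1) else row i (mat 1))
      = (\<chi> i. if i = k then l else if i \<in> {} then axis i 1 + v $ i *s l else axis i 1)"
    by (simp only: empty_iff if_False)
  then show ?case
    using cramer_lemma_transpose[of k l "mat 1"] by (metis det_I mult_1_right)
next
  case (insert j S)
  define A :: "'a ^ 'd ^ 'd"
    where "A = (\<chi> i. if i = k then l else if i \<in> S then axis i 1 + v $ i *s l else axis i 1)"
  have "k ~= j" "k \<notin> S" using insert.prems by auto
  then have "(\<chi> i. if i = k then l else if i \<in> insert j S then axis i 1 + v $ i *s l else axis i 1)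
      = (\<chi> i. if i = j then row j A + v $ j *s row k A else row i A)"
    using insert.hyps(2) by (simp add: vec_eq_iff row_def A_def)
  also have "det \<dots> = det A" using \<open>k ~= j\<close> by (intro det_row_operation) auto
  finally show ?case using insert.IH[OF \<open>k \<notin> S\<close>] unfolding A_def by (rule trans)
qed

text \<open>Matrix determinant lemma. By multilinearity the perturbed rows are switched on one at a
  time, and each new row contributes \<open>v $ k\<close> times the determinant of the auxiliary
  lemma.\<close>

lemma det_rank_one:
  fixes v l :: "'a::field ^ 'd"
  shows "det (mat 1 + (\<chi> i j. v $ i * l $ j)) = 1 + (\<Sum>i\<in>UNIV. v $ i * l $ i)"
proof -
  have "det (\<chi> i. if i \<in> S then axis i 1 + v $ i *s l else axis i 1) = 1 + (\<Sum>i\<in>S. v $ i * l $ i)"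
    if "finite S" for S
    using that
  proof (induction S)
    case empty
    have "(\<chi> i. axis i 1) = (mat 1 :: 'a ^ 'd ^ 'd)" by (simp add: vec_eq_iff mat_def axis_def)
    then show ?case by simp
  next
    case (insert k S)
    let ?c = "\<lambda>i. if i \<in> S then axis i 1 + v $ i *s l else axis i 1"
    have "(\<chi> i. if i \<in> insert k S then axis i 1 + v $ i *s l else axis i 1)
        = (\<chi> i. if i = k then axis i 1 + v $ k *s l else ?c i)"
      by (simp add: vec_eq_iff)
    also have "det \<dots> = det (\<chi> i. if i = k then axis i 1 else ?c i)
        + v $ k * det (\<chi> i. if i = k then l else ?c i)"
      by (simp only: det_row_add det_row_mul)
    also have "(\<chi> i. if i = k then axis i 1 else ?c i) = (\<chi> i. ?c i)"
      using insert.hyps by (simp add: vec_eq_iff)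
    also have "det (\<chi> i. if i = k then l else ?c i) = l $ k"
      using insert.hyps by (intro det_rank_one_aux) auto
    finally show ?case using insert by (simp add: algebra_simps)
  qed
  from this[of UNIV] have "det (\<chi> i. axis i 1 + v $ i *s l) = 1 + (\<Sum>i\<in>UNIV. v $ i * l $ i)"
    by simp
  moreover have "(\<chi> i. axis i 1 + v $ i *s l) = mat 1 + (\<chi> i j. v $ i * l $ j)"
    by (simp add: vec_eq_iff mat_def axis_def)
  ultimately show ?thesis by simp
qed

text \<open>Brauer's theorem: a rank one update along an eigenvector moves one eigenvalue only.\<close>

lemma charp_rank_one:
  assumes ev: "A *v v = \<mu> *s v" and l: "(\<Sum>i\<in>UNIV. v $ i * l $ i) = 1"
  shows "charp (A + (\<chi> i j. c * v $ i * l $ j)) * [:-\<mu>, 1:] = charp A * [:-(\<mu> + c), 1:]"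
proof -
  let ?R = "(\<chi> i j. v $ i * l $ j) :: complex ^ 'a ^ 'a"
  have "poly (charp (A + (\<chi> i j. c * v $ i * l $ j)) * [:-\<mu>, 1:]) z
      = poly (charp A * [:-(\<mu> + c), 1:]) z" for z
  proof (cases "z = \<mu>")
    case True
    have "(mat \<mu> - A) *v v = 0"
      by (simp add: matrix_vector_mult_diff_rdistrib mat_vec ev)
    moreover have "v ~= 0" using l by auto
    ultimately have "det (mat \<mu> - A) = 0"
      using invertible_det_nz invertible_left_inverse matrix_left_invertible_ker by metis
    with True show ?thesis by (simp add: poly_charp)
  next
    case False
    \<comment> \<open>The vector \<open>v\<close> is an eigenvector, so the resolvent divides it by
      z - \<mu>. With this \<open>?w\<close> the updated matrix factors as \<open>mat z - A\<close>
      times a rank one perturbation of the identity, whose determinant is known.\<close>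
    let ?w = "(\<chi> i. -c / (z - \<mu>) * v $ i) :: complex ^ 'a"
    have AR: "(\<Sum>k\<in>UNIV. A $ i $ k * v $ k) = \<mu> * v $ i" for i
      using ev by (simp add: vec_eq_iff matrix_vector_mult_def)
    have "(mat z - A) ** (\<chi> i j. ?w $ i * l $ j) = - (\<chi> i j. c * v $ i * l $ j)"
    proof -
      have "((mat z - A) ** (\<chi> i j. ?w $ i * l $ j)) $ i $ j = - (c * v $ i * l $ j)" for i j
      proof -
        have "((mat z - A) ** (\<chi> i j. ?w $ i * l $ j)) $ i $ j
            = (-c / (z - \<mu>)) * l $ j * ((\<Sum>k\<in>UNIV. mat z $ i $ k * v $ k) - (\<Sum>k\<in>UNIV. A $ i $ k * v $ k))"
        proof -
          have "((mat z - A) ** (\<chi> i j. ?w $ i * l $ j)) $ i $ j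
              = (\<Sum>k\<in>UNIV. (-c / (z - \<mu>)) * l $ j * (mat z $ i $ k * v $ k - A $ i $ k * v $ k))"
            unfolding matrix_matrix_mult_def by (simp add: algebra_simps diff_divide_distrib)
          then show ?thesis by (simp only: sum_distrib_left[symmetric] sum_subtractf)
        qed
        also have "(\<Sum>k\<in>UNIV. mat z $ i $ k * v $ k) = z * v $ i"
          using mat_vec[of z v] by (simp add: vec_eq_iff matrix_vector_mult_def)
        also have "(-c / (z - \<mu>)) * l $ j * (z * v $ i - (\<Sum>k\<in>UNIV. A $ i $ k * v $ k)) = - (c * v $ i * l $ j)"
          using False unfolding AR by (simp add: field_simps)
        finally show ?thesis .
      qed
      then show ?thesis by (simp add: vec_eq_iff)
    qed
    then have "mat z - (A + (\<chi> i j. c * v $ i * l $ j)) = (mat z - A) ** (mat 1 + (\<chi> i j. ?w $ i * l $ j))"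
      by (simp add: matrix_add_ldistrib)
    then have "det (mat z - (A + (\<chi> i j. c * v $ i * l $ j)))
        = det (mat z - A) * (1 + (\<Sum>i\<in>UNIV. ?w $ i * l $ i))"
      by (simp only: det_mul det_rank_one)
    also have "(\<Sum>i\<in>UNIV. ?w $ i * l $ i) = -c / (z - \<mu>)"
    proof -
      have "(\<Sum>i\<in>UNIV. ?w $ i * l $ i) = (\<Sum>i\<in>UNIV. (-c / (z - \<mu>)) * (v $ i * l $ i))"
        by (simp add: algebra_simps)
      then show ?thesis by (simp only: sum_distrib_left[symmetric] l mult_1_right)
    qed
    finally show ?thesis using False by (simp add: poly_charp field_simps)
  qed
  then show ?thesis by (simp add: poly_eq_poly_eq_iff[symmetric] fun_eq_iff)
qed

section \<open>Spectrum of a real matrix and the number of its moduli\<close>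

definition spec :: "real ^ 'd ^ 'd \<Rightarrow> complex set" where
  "spec M = {z. poly (complex_charpoly M) z = 0}"

lemma charp_nz: "charp A ~= 0"
  using degree_charp[of A] by (metis degree_0 zero_less_card_finite less_irrefl)

lemma finite_spec: "finite (spec M)"
  unfolding spec_def complex_charpoly_eq using poly_roots_finite charp_nz by blast

lemma charp_eigenvector:
  "poly (charp A) z = 0 \<longleftrightarrow> (\<exists>w. w ~= 0 & A *v w = z *s w)"
proof -
  have "(mat z - A) *v w = z *s w - A *v w" for w
    by (simp add: matrix_vector_mult_diff_rdistrib mat_vec)
  then show ?thesis
    unfolding poly_charp using invertible_det_nz[of "mat z - A"] invertible_left_inverse[of "mat z - A"]
      matrix_left_invertible_ker[of "mat z - A"] by force
qed

text \<open>Real and imaginary parts of the eigenvector equation for u + iv. In this form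
  eigenvectors can be handled inside real subspaces and with real norms.\<close>

lemma spec_iff_real:
  "z \<in> spec M \<longleftrightarrow> (\<exists>u v. (u ~= 0 \<or> v ~= 0) \<and>
     M *v u = Re z *\<^sub>R u - Im z *\<^sub>R v & M *v v = Im z *\<^sub>R u + Re z *\<^sub>R v)"
proof
  assume "z \<in> spec M"
  then obtain w where w: "w ~= 0" "cmat M *v w = z *s w"
    unfolding spec_def complex_charpoly_eq using charp_eigenvector by auto
  have e: "(\<Sum>j\<in>UNIV. complex_of_real (M $ i $ j) * w $ j) = z * w $ i" for i
    using w(2) by (simp add: vec_eq_iff matrix_vector_mult_def cmat_def)
  let ?u = "\<chi> i. Re (w $ i)" and ?v = "\<chi> i. Im (w $ i)"
  have "?u ~= 0 \<or> ?v ~= 0" using w(1) by (auto simp: vec_eq_iff complex_eq_iff)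
  moreover have "M *v ?u = Re z *\<^sub>R ?u - Im z *\<^sub>R ?v"
    using arg_cong[OF e, of Re] by (simp add: vec_eq_iff matrix_vector_mult_def)
  moreover have "M *v ?v = Im z *\<^sub>R ?u + Re z *\<^sub>R ?v"
    using arg_cong[OF e, of Im] by (simp add: vec_eq_iff matrix_vector_mult_def)
  ultimately show "\<exists>u v. (u ~= 0 \<or> v ~= 0) \<and>
     M *v u = Re z *\<^sub>R u - Im z *\<^sub>R v & M *v v = Im z *\<^sub>R u + Re z *\<^sub>R v" by blast
next
  assume "\<exists>u v. (u ~= 0 \<or> v ~= 0) \<and>
     M *v u = Re z *\<^sub>R u - Im z *\<^sub>R v & M *v v = Im z *\<^sub>R u + Re z *\<^sub>R v"
  then obtain u v where uv: "u ~= 0 \<or> v ~= 0" "M *v u = Re z *\<^sub>R u - Im z *\<^sub>R v"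
     "M *v v = Im z *\<^sub>R u + Re z *\<^sub>R v" by blast
  let ?w = "\<chi> i. Complex (u $ i) (v $ i)"
  have "?w ~= 0" using uv(1) by (auto simp: vec_eq_iff complex_eq_iff)
  moreover have "cmat M *v ?w = z *s ?w"
    using uv(2,3) by (simp add: vec_eq_iff matrix_vector_mult_def cmat_def complex_eq_iff)
  ultimately show "z \<in> spec M"
    unfolding spec_def complex_charpoly_eq using charp_eigenvector by blast
qed

lemma matrix_vector_mult_minus: "(M :: real ^ 'd ^ 'd) *v (- v) = - (M *v v)"
  using linear_neg[OF matrix_vector_mul_linear[of M]] .

lemma spec_cnj: "z \<in> spec M ==> cnj z \<in> spec M"
proof -
  assume "z \<in> spec M"
  then obtain u v where uv: "u ~= 0 \<or> v ~= 0" "M *v u = Re z *\<^sub>R u - Im z *\<^sub>R v"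
     "M *v v = Im z *\<^sub>R u + Re z *\<^sub>R v" unfolding spec_iff_real by blast
  then show ?thesis unfolding spec_iff_real
    by (intro exI[of _ u] exI[of _ "- v"]) (auto simp: matrix_vector_mult_minus algebra_simps)
qed

definition nmod :: "real ^ 'd ^ 'd \<Rightarrow> nat" where
  "nmod M = card (cmod ` spec M)"

text \<open>What the radial perturbation argument extracts from maximality. Such a matrix has a real
  block form with blocks of size one and two, and different blocks have different moduli.\<close>

definition structured :: "real ^ 'd ^ 'd \<Rightarrow> bool" where
  "structured M \<longleftrightarrow> card (spec M) = CARD('d) \<and>
     (\<forall>z\<in>spec M. \<forall>z'\<in>spec M. cmod z = cmod z' --> z' = z \<or> z' = cnj z)"

lemma card_spec_le: "card (spec (M :: real ^ 'd ^ 'd)) <= CARD('d)"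
  unfolding spec_def complex_charpoly_eq using card_poly_roots_bound[OF charp_nz] degree_charp by metis

lemma card_spec_simple:
  assumes "\<And>z. z \<in> spec M ==> order z (complex_charpoly M) = 1"
  shows "card (spec (M :: real ^ 'd ^ 'd)) = CARD('d)"
proof -
  have nz: "complex_charpoly M ~= 0" by (simp add: complex_charpoly_eq charp_nz)
  have "CARD('d) = size (proots (complex_charpoly M))"
    by (simp add: size_proots_complex complex_charpoly_eq degree_charp)
  also have "\<dots> = (\<Sum>z\<in>spec M. order z (complex_charpoly M))"
    using nz by (simp add: size_multiset_overloaded_eq spec_def)
  also have "\<dots> = card (spec M)" using assms by simp
  finally show ?thesis by simp
qed

lemma nmod_le: "nmod (M :: real ^ 'd ^ 'd) <= CARD('d)"
  unfolding nmod_def using card_spec_le[of M] card_image_le[OF finite_spec, of cmod M] by linarith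

text \<open>Each modulus occurs at least once in the multiset and the multiplicities add up to the
  dimension. The goal of the whole proof thus becomes the largest possible value of
  \<open>nmod\<close>.\<close>

lemma distinct_moduli_iff:
  fixes M :: "real ^ 'd ^ 'd"
  shows "distinct_moduli (eigenvalues M) \<longleftrightarrow> nmod M = CARD('d)"
proof -
  let ?E = "eigenvalues M"
  have nz: "complex_charpoly M ~= 0" by (simp add: complex_charpoly_eq charp_nz)
  have set: "set_mset ?E = spec M" using nz by (simp add: eigenvalues_def spec_def)
  have "size ?E = CARD('d)"
    by (simp add: eigenvalues_def size_proots_complex complex_charpoly_eq degree_charp)
  then have sz: "size (image_mset cmod ?E) = CARD('d)" by simp
  have ims: "set_mset (image_mset cmod ?E) = cmod ` spec M" using set by simp
  have "distinct_moduli ?E \<longleftrightarrow> (\<forall>t\<in>cmod ` spec M. count (image_mset cmod ?E) t = 1)"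
    unfolding distinct_moduli_def
  proof safe
    fix t z assume *: "\<forall>t. count (image_mset cmod ?E) t <= 1" and "z \<in> spec M"
    then have "cmod z \<in># image_mset cmod ?E" using ims by blast
    then show "count (image_mset cmod ?E) (cmod z) = 1"
      using * by (metis count_greater_eq_one_iff le_antisym)
  next
    fix t assume *: "\<forall>t\<in>cmod ` spec M. count (image_mset cmod ?E) t = 1"
    show "count (image_mset cmod ?E) t <= 1"
      using * ims by (metis count_inI le_refl zero_le_one)
  qed
  also have "\<dots> \<longleftrightarrow> nmod M = CARD('d)"
  proof -
    let ?m = "image_mset cmod ?E"
    have s: "CARD('d) = (\<Sum>t\<in>cmod ` spec M. count ?m t)"
      using sz ims by (simp add: size_multiset_overloaded_eq)
    have ge: "1 <= count ?m t" if "t \<in> cmod ` spec M" for t using that ims by (metis count_greater_eq_one_iff)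
    have n: "nmod M = (\<Sum>t\<in>cmod ` spec M. 1)" by (simp add: nmod_def)
    show ?thesis
    proof
      assume "nmod M = CARD('d)"
      then have "(\<Sum>t\<in>cmod ` spec M. count ?m t - 1) = 0"
        using s n ge by (subst sum_subtractf_nat) auto
      then have "\<forall>t\<in>cmod ` spec M. count ?m t - 1 = 0" using finite_spec[of M] by simp
      then show "\<forall>t\<in>cmod ` spec M. count ?m t = 1" using ge by (metis diff_is_0_eq le_antisym)
    next
      assume "\<forall>t\<in>cmod ` spec M. count ?m t = 1"
      then have "(\<Sum>t\<in>cmod ` spec M. count ?m t) = (\<Sum>t\<in>cmod ` spec M. 1)" by (intro sum.cong) auto
      then show "nmod M = CARD('d)" using s n by simp
    qed
  qed
  finally show ?thesis .
qed

text \<open>Moving \<open>Z\<close> off the circle of radius \<rho> must not lose this radius: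
  either another root lies on the circle, or a root in \<open>Z\<close> is multiple and a copy stays
  behind. Hence all old moduli survive and (1 + t) \<rho> joins them.\<close>

lemma moduli_increase:
  fixes p pt :: "complex poly" and t :: real
  assumes eq: "pt * (\<Prod>y\<in>Z. [:-y, 1:]) = p * (\<Prod>y\<in>Z. [:-((1 + of_real t) * y), 1:])"
    and Z: "finite Z" "Z ~= {}" "\<And>y. y \<in> Z ==> poly p y = 0 & cmod y = \<rho>" and \<rho>: "\<rho> > 0" and t: "t > 0"
    and more: "(\<exists>w. w \<notin> Z & poly p w = 0 & cmod w = \<rho>) \<or> (\<exists>y\<in>Z. order y p ~= 1)" and p: "p ~= 0"
  shows "insert ((1 + t) * \<rho>) (cmod ` {z. poly p z = 0}) \<subseteq> cmod ` {z. poly pt z = 0}"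
proof -
  have ev: "poly pt w * (\<Prod>y\<in>Z. w - y) = poly p w * (\<Prod>y\<in>Z. w - (1 + of_real t) * y)" for w
    using arg_cong[OF eq, of "\<lambda>q. poly q w"] by (simp add: poly_prod algebra_simps)
  have 1: "poly pt w = 0" if "poly p w = 0" "w \<notin> Z" for w
    using ev[of w] that Z(1) by auto
  have n1: "cmod ((1 + of_real t) * y) = (1 + t) * \<rho>" if "y \<in> Z" for y
  proof -
    have "cmod (1 + of_real t) = 1 + t" using t by (metis add_pos_pos norm_of_real abs_of_pos of_real_1 of_real_add zero_less_one)
    then show ?thesis using Z(3)[OF that] by (simp add: norm_mult)
  qed
  obtain y0 where y0: "y0 \<in> Z" using Z(2) by blast
  have big: "(1 + t) * \<rho> \<in> cmod ` {z. poly pt z = 0}"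
  proof -
    let ?w = "(1 + of_real t) * y0"
    have "?w ~= y" if "y \<in> Z" for y
      using n1[OF y0] Z(3)[OF that] t \<rho> by auto
    then have "(\<Prod>y\<in>Z. ?w - y) ~= 0" using Z(1) by auto
    moreover have "(\<Prod>y\<in>Z. ?w - (1 + of_real t) * y) = 0"
      using Z(1) y0 by (intro prod_zero) auto
    ultimately have "poly pt ?w = 0" using ev[of ?w] by auto
    then show ?thesis using n1[OF y0] by (metis (mono_tags) imageI mem_Collect_eq)
  qed
  have "\<rho> \<in> cmod ` {z. poly pt z = 0}"
    using more
  proof
    assume "\<exists>w. w \<notin> Z & poly p w = 0 & cmod w = \<rho>"
    then show ?thesis using 1 by blast
  next
    assume "\<exists>y\<in>Z. order y p ~= 1"
    then obtain y where y: "y \<in> Z" "order y p ~= 1" by blast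
    have "order y p ~= 0" using Z(3)[OF y(1)] p by (simp add: order_root)
    then have "2 <= order y p" using y(2) by linarith
    then have "[:-y, 1:] ^ 2 dvd p" using order_divides by blast
    then have "[:-y, 1:] ^ 2 dvd pt * (\<Prod>y\<in>Z. [:-y, 1:])" unfolding eq by simp
    moreover have "(\<Prod>y\<in>Z. [:-y, 1:]) = [:-y, 1:] * (\<Prod>y\<in>Z - {y}. [:-y, 1:])"
      using Z(1) y(1) by (rule prod.remove)
    ultimately have "[:-y, 1:] * [:-y, 1:] dvd [:-y, 1:] * (pt * (\<Prod>y\<in>Z - {y}. [:-y, 1:]))"
      by (simp add: power2_eq_square mult.left_commute)
    then have "[:-y, 1:] dvd pt * (\<Prod>y\<in>Z - {y}. [:-y, 1:])"
      by (metis dvd_mult_cancel_left pCons_eq_0_iff zero_neq_one)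
    then have "poly (pt * (\<Prod>y\<in>Z - {y}. [:-y, 1:])) y = 0"
      by (simp only: poly_eq_0_iff_dvd)
    then have "poly pt y = 0" using Z(1) by (auto simp: poly_prod)
    then show ?thesis using Z(3)[OF y(1)] by blast
  qed
  then have "cmod w \<in> cmod ` {z. poly pt z = 0}" if "poly p w = 0" for w
    using 1[OF that] Z(3) by (cases "w \<in> Z") auto
  with big show ?thesis by blast
qed

lemma matrix_scaleR_mult_right: "M ** (c *\<^sub>R B) = c *\<^sub>R (M ** (B :: real ^ 'b ^ 'c))"
  by (simp add: vec_eq_iff matrix_matrix_mult_def sum_distrib_left algebra_simps)

text \<open>The direction \<open>B\<close> of a perturbation that moves the eigenvalues in \<open>Z\<close> radially.\<close>

lemma radial_perturbation:
  fixes M :: "real ^ 'd ^ 'd"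
  assumes z: "z \<in> spec M"
  shows "\<exists>B. \<forall>t. complex_charpoly (M ** (mat 1 + t *\<^sub>R B)) * (\<Prod>y\<in>{z, cnj z}. [:-y, 1:])
     = complex_charpoly M * (\<Prod>y\<in>{z, cnj z}. [:-((1 + of_real t) * y), 1:])"
proof -
  obtain u v where uv: "u ~= 0 \<or> v ~= 0" "M *v u = Re z *\<^sub>R u - Im z *\<^sub>R v"
     "M *v v = Im z *\<^sub>R u + Re z *\<^sub>R v" using z unfolding spec_iff_real by blast
  show ?thesis
  proof (cases "Im z = 0")
    case True
    then have cz: "cnj z = z" by (simp add: complex_eq_iff)
    obtain w where w: "w ~= 0" "M *v w = Re z *\<^sub>R w" using uv True by auto
    let ?l = "(1 / (w \<bullet> w)) *\<^sub>R w"
    let ?B = "\<chi> i j. w $ i * ?l $ j"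
    let ?cw = "\<chi> i. complex_of_real (w $ i)" and ?cl = "\<chi> i. complex_of_real (?l $ i)"
    have e: "(\<Sum>j\<in>UNIV. M $ i $ j * w $ j) = Re z * w $ i" for i
      using w(2) by (simp add: vec_eq_iff matrix_vector_mult_def)
    have zr: "z = of_real (Re z)" using True by (simp add: complex_eq_iff)
    have ev: "cmat M *v ?cw = z *s ?cw"
      by (subst zr) (simp add: vec_eq_iff matrix_vector_mult_def cmat_def flip: of_real_mult of_real_sum e)
    have "(\<Sum>i\<in>UNIV. w $ i * ?l $ i) = 1"
    proof -
      have "(\<Sum>i\<in>UNIV. w $ i * ?l $ i) = (\<Sum>i\<in>UNIV. w $ i * w $ i) / (w \<bullet> w)"
        by (simp add: sum_divide_distrib)
      also have "\<dots> = 1" using w(1) by (simp add: inner_vec_def[symmetric] inner_vec_def[of w w, simplified, symmetric])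
      finally show ?thesis .
    qed
    then have "(\<Sum>i\<in>UNIV. ?cw $ i * ?cl $ i) = 1"
      by (simp del: of_real_mult of_real_divide of_real_inverse vector_scaleR_component
          add: flip: of_real_mult of_real_sum)
    note ch = charp_rank_one[OF ev this]
    have "complex_charpoly (M ** (mat 1 + t *\<^sub>R ?B)) * (\<Prod>y\<in>{z, cnj z}. [:-y, 1:])
     = complex_charpoly M * (\<Prod>y\<in>{z, cnj z}. [:-((1 + of_real t) * y), 1:])" for t
    proof -
      have "(M ** ?B) $ i $ j = Re z * w $ i * ?l $ j" for i j
        unfolding matrix_matrix_mult_def
        by (simp only: vec_lambda_beta mult.assoc[symmetric] sum_distrib_right[symmetric] e)
      then have "cmat (M ** (mat 1 + t *\<^sub>R ?B)) = cmat M + (\<chi> i j. (of_real t * z) * ?cw $ i * ?cl $ j)"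
        by (subst zr) (simp add: matrix_add_ldistrib matrix_scaleR_mult_right cmat_def vec_eq_iff)
      then show ?thesis using ch[of "of_real t * z"] by (simp add: complex_charpoly_eq cz algebra_simps)
    qed
    then show ?thesis by blast
  next
    case False
    \<comment> \<open>On the span of \<open>u\<close> and \<open>v\<close> the matrix acts like
      multiplication by the nonreal number z, which leaves no real line invariant; so neither vector
      can be a multiple of the other.\<close>
    have nuv: "u ~= c *\<^sub>R v" for c
    proof
      assume u: "u = c *\<^sub>R v"
      have v: "v ~= 0" using uv(1) u by auto
      have "M *v u = c *\<^sub>R (M *v v)" unfolding u by (simp add: matrix_vector_mult_scaleR)
      then have "(Re z * c - Im z) *\<^sub>R v = (c * (Im z * c + Re z)) *\<^sub>R v"
        using uv(2,3) unfolding u by (simp add: algebra_simps)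
      then have "(Im z * (1 + c * c)) *\<^sub>R v = 0" by (simp add: algebra_simps)
      then have "Im z * (1 + c * c) = 0" using v by (simp only: scaleR_eq_0_iff simp_thms)
      moreover have "1 + c * c > 0" by (simp add: add_pos_nonneg)
      ultimately show False using False by simp
    qed
    have nvu: "v ~= c *\<^sub>R u" for c
    proof
      assume v: "v = c *\<^sub>R u"
      show False
      proof (cases "c = 0")
        case True
        then have "v = 0" "u ~= 0" using v uv(1) by auto
        then show False using uv(3) False by simp
      next
        case c: False
        then have "u = (1 / c) *\<^sub>R v" using v by simp
        then show False using nuv by blast
      qed
    qed
    have dual: "\<exists>a. a \<bullet> x = 1 & a \<bullet> y = 0" if "\<And>c. x ~= c *\<^sub>R y" for x y :: "real ^ 'd"
    proof -
      let ?a = "x - ((x \<bullet> y) / (y \<bullet> y)) *\<^sub>R y"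
      have ay: "?a \<bullet> y = 0" by (simp add: inner_diff_left)
      have "?a ~= 0" using that by auto
      moreover have "?a \<bullet> x = ?a \<bullet> ?a"
        using ay by (metis (no_types, lifting) diff_zero inner_diff_right inner_scaleR_right mult_zero_right)
      ultimately have "?a \<bullet> x ~= 0" by simp
      then have "((1 / (?a \<bullet> x)) *\<^sub>R ?a) \<bullet> x = 1 & ((1 / (?a \<bullet> x)) *\<^sub>R ?a) \<bullet> y = 0"
        using ay by simp
      then show ?thesis by blast
    qed
    obtain a where a: "a \<bullet> u = 1" "a \<bullet> v = 0" using dual[of u v] nuv by blast
    obtain b where b: "b \<bullet> v = 1" "b \<bullet> u = 0" using dual[of v u] nvu by blast
    \<comment> \<open>\<open>?B\<close> is the projection onto the plane of \<open>u\<close> and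
      \<open>v\<close> along the common kernel of \<open>a\<close> and \<open>b\<close>. The complex
      functionals \<open>?l\<close> and \<open>?l'\<close> split the update into two rank one
      updates, and \<open>?l\<close> kills \<open>?w'\<close>, so that \<open>?w'\<close> is still
      an eigenvector after the first of them.\<close>
    let ?B = "\<chi> i j. u $ i * a $ j + v $ i * b $ j"
    let ?w = "\<chi> i. Complex (u $ i) (v $ i)" and ?l = "\<chi> i. Complex (a $ i / 2) (- b $ i / 2)"
    let ?w' = "\<chi> i. Complex (u $ i) (- v $ i)" and ?l' = "\<chi> i. Complex (a $ i / 2) (b $ i / 2)"
    have eu: "(\<Sum>j\<in>UNIV. M $ i $ j * u $ j) = Re z * u $ i - Im z * v $ i"
      and ev: "(\<Sum>j\<in>UNIV. M $ i $ j * v $ j) = Im z * u $ i + Re z * v $ i" for i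
      using uv(2,3) by (simp_all add: vec_eq_iff matrix_vector_mult_def)
    have in': "(\<Sum>i\<in>UNIV. u $ i * a $ i) = 1" "(\<Sum>i\<in>UNIV. v $ i * a $ i) = 0"
      "(\<Sum>i\<in>UNIV. v $ i * b $ i) = 1" "(\<Sum>i\<in>UNIV. u $ i * b $ i) = 0"
      using a b by (simp_all add: inner_vec_def mult.commute)
    have w: "cmat M *v ?w = z *s ?w"
      using eu ev by (simp add: vec_eq_iff matrix_vector_mult_def cmat_def complex_eq_iff)
    have w': "cmat M *v ?w' = cnj z *s ?w'"
      using eu ev by (simp add: vec_eq_iff matrix_vector_mult_def cmat_def complex_eq_iff sum_negf)
    have l: "(\<Sum>i\<in>UNIV. ?w $ i * ?l $ i) = 1"
      using in' by (simp add: complex_eq_iff sum.distrib sum_subtractf sum_negf flip: sum_divide_distrib)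
    have l': "(\<Sum>i\<in>UNIV. ?w' $ i * ?l' $ i) = 1"
      using in' by (simp add: complex_eq_iff sum.distrib sum_subtractf sum_negf flip: sum_divide_distrib)
    have lw': "(\<Sum>i\<in>UNIV. ?l $ i * ?w' $ i) = 0"
      using in' by (simp add: complex_eq_iff sum.distrib sum_subtractf sum_negf mult.commute flip: sum_divide_distrib)
    have "complex_charpoly (M ** (mat 1 + t *\<^sub>R ?B)) * (\<Prod>y\<in>{z, cnj z}. [:-y, 1:])
     = complex_charpoly M * (\<Prod>y\<in>{z, cnj z}. [:-((1 + of_real t) * y), 1:])" for t
    proof -
      let ?A1 = "cmat M + (\<chi> i j. (of_real t * z) * ?w $ i * ?l $ j)"
      have c1: "charp ?A1 * [:-z, 1:] = charp (cmat M) * [:-(z + of_real t * z), 1:]"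
        by (rule charp_rank_one[OF w l])
      have "(\<chi> i j. (of_real t * z) * ?w $ i * ?l $ j) *v ?w' = 0"
      proof -
        have "((\<chi> i j. (of_real t * z) * ?w $ i * ?l $ j) *v ?w') $ i
            = (of_real t * z) * ?w $ i * (\<Sum>j\<in>UNIV. ?l $ j * ?w' $ j)" for i
          unfolding matrix_vector_mult_def by (simp only: vec_lambda_beta sum_distrib_left mult.assoc)
        then show ?thesis unfolding lw' by (simp add: vec_eq_iff)
      qed
      then have "?A1 *v ?w' = cnj z *s ?w'" using w' by (simp only: matrix_vector_mult_add_rdistrib add_0_right)
      note c2 = charp_rank_one[OF this l', of "of_real t * cnj z"]
      have MB: "(M ** ?B) $ i $ j = (Re z * u $ i - Im z * v $ i) * a $ j + (Im z * u $ i + Re z * v $ i) * b $ j" for i j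
        by (simp add: matrix_matrix_mult_def distrib_left sum.distrib mult.assoc[symmetric]
            sum_distrib_right[symmetric] eu ev)
      have "cmat (M ** (mat 1 + t *\<^sub>R ?B)) = ?A1 + (\<chi> i j. (of_real t * cnj z) * ?w' $ i * ?l' $ j)"
      proof -
        have cid: "z * Complex x y * Complex (p / 2) (- q / 2) + cnj z * Complex x (- y) * Complex (p / 2) (q / 2)
            = complex_of_real ((Re z * x - Im z * y) * p + (Im z * x + Re z * y) * q)" for x y p q
          by (simp add: complex_eq_iff algebra_simps)
        have "cmat (M ** (mat 1 + t *\<^sub>R ?B)) $ i $ j
            = of_real (M $ i $ j) + of_real t * of_real ((M ** ?B) $ i $ j)" for i j
          by (simp add: matrix_add_ldistrib matrix_scaleR_mult_right cmat_def)
        also have "\<dots> i j = of_real (M $ i $ j) + of_real t *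
            (z * ?w $ i * ?l $ j + cnj z * ?w' $ i * ?l' $ j)" for i j
          unfolding MB vec_lambda_beta cid ..
        finally show ?thesis
          by (simp add: vec_eq_iff cmat_def distrib_left mult.assoc)
      qed
      then have e: "complex_charpoly (M ** (mat 1 + t *\<^sub>R ?B)) * [:- cnj z, 1:]
          = charp ?A1 * [:-(cnj z + of_real t * cnj z), 1:]"
        using c2 by (simp only: complex_charpoly_eq)
      have "complex_charpoly (M ** (mat 1 + t *\<^sub>R ?B)) * ([:-z, 1:] * [:- cnj z, 1:])
          = (complex_charpoly (M ** (mat 1 + t *\<^sub>R ?B)) * [:- cnj z, 1:]) * [:-z, 1:]"
        by (simp only: mult_ac)
      also have "\<dots> = (charp ?A1 * [:-z, 1:]) * [:-(cnj z + of_real t * cnj z), 1:]"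
        unfolding e by (simp only: mult_ac)
      also have "\<dots> = complex_charpoly M * ([:-((1 + of_real t) * z), 1:] * [:-((1 + of_real t) * cnj z), 1:])"
        unfolding c1 complex_charpoly_eq distrib_right mult_1_left by (simp only: mult_ac)
      finally show ?thesis using False by (simp add: complex_eq_iff)
    qed
    then show ?thesis by blast
  qed
qed

text \<open>A surplus root on the circle of an eigenvalue z, or a multiple root, would let a small
  radial push of z and its conjugate create a new modulus while all old ones survive.\<close>

lemma structured_of_max:
  fixes M :: "real ^ 'd ^ 'd"
  assumes nz: "0 \<notin> spec M"
    and max: "\<And>B. \<exists>\<epsilon>>0. \<forall>t. 0 < t & t < \<epsilon> --> nmod (M ** (mat 1 + t *\<^sub>R B)) <= nmod M"
  shows "structured M"
proof -
  have key: "\<not> ((\<exists>w. w \<notin> {z, cnj z} & w \<in> spec M & cmod w = cmod z) \<or>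
      (\<exists>y\<in>{z, cnj z}. order y (complex_charpoly M) ~= 1))" if z: "z \<in> spec M" for z
  proof
    assume more: "(\<exists>w. w \<notin> {z, cnj z} & w \<in> spec M & cmod w = cmod z) \<or>
      (\<exists>y\<in>{z, cnj z}. order y (complex_charpoly M) ~= 1)"
    obtain B where B: "\<And>t. complex_charpoly (M ** (mat 1 + t *\<^sub>R B)) * (\<Prod>y\<in>{z, cnj z}. [:-y, 1:])
     = complex_charpoly M * (\<Prod>y\<in>{z, cnj z}. [:-((1 + of_real t) * y), 1:])"
      using radial_perturbation[OF z] by blast
    obtain \<epsilon> where \<epsilon>: "\<epsilon> > 0" "\<And>t. 0 < t ==> t < \<epsilon> ==> nmod (M ** (mat 1 + t *\<^sub>R B)) <= nmod M"
      using max by metis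
    have cz: "cmod z > 0" using nz z by auto
    \<comment> \<open>The finitely many t for which (1 + t) |z| is already a modulus have to be
      avoided.\<close>
    have "finite ((\<lambda>r. r / cmod z - 1) ` cmod ` spec M)" using finite_spec by blast
    moreover have "infinite {0<..<\<epsilon>}" using \<epsilon>(1) by (simp add: infinite_Ioo)
    ultimately obtain t where t: "t \<in> {0<..<\<epsilon>}" "t \<notin> (\<lambda>r. r / cmod z - 1) ` cmod ` spec M"
      by (meson finite_subset subsetI)
    have "(1 + t) * cmod z \<notin> cmod ` spec M"
    proof
      assume "(1 + t) * cmod z \<in> cmod ` spec M"
      then have "(1 + t) * cmod z / cmod z - 1 \<in> (\<lambda>r. r / cmod z - 1) ` cmod ` spec M"
        by (rule imageI)
      then show False using t(2) cz by simp
    qed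
    then have "card (insert ((1 + t) * cmod z) (cmod ` spec M)) = nmod M + 1"
      using finite_spec[of M] by (simp add: nmod_def)
    moreover have "insert ((1 + t) * cmod z) (cmod ` spec M) \<subseteq> cmod ` spec (M ** (mat 1 + t *\<^sub>R B))"
      unfolding spec_def
      by (rule moduli_increase[OF B])
        (use t more z cz spec_cnj[OF z] in \<open>auto simp: spec_def complex_charpoly_eq charp_nz\<close>)
    ultimately have "nmod M + 1 <= nmod (M ** (mat 1 + t *\<^sub>R B))"
      unfolding nmod_def by (metis card_mono finite_imageI finite_spec)
    then show False using \<epsilon>(2)[of t] t(1) by simp
  qed
  have "card (spec M) = CARD('d)"
    by (rule card_spec_simple) (use key in blast)
  moreover have "z' = z \<or> z' = cnj z" if "z \<in> spec M" "z' \<in> spec M" "cmod z = cmod z'" for z z'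
    using key[OF that(1)] that(2,3) by auto
  ultimately show ?thesis unfolding structured_def by blast
qed

section \<open>Real coordinates adapted to the eigenvalues\<close>

lemma eigenvectors_independent:
  fixes w :: "complex \<Rightarrow> complex ^ 'd"
  assumes "finite S" "\<And>z. z \<in> S ==> w z ~= 0 & A *v w z = z *s w z"
    and "(\<Sum>z\<in>S. c z *s w z) = 0" "z \<in> S"
  shows "c z = 0"
  using assms
proof (induction S arbitrary: c z)
  case (insert y S)
  have sum0: "c y *s w y + (\<Sum>z\<in>S. c z *s w z) = 0" using insert by simp
  have A: "A *v (\<Sum>z\<in>S. c z *s w z) = (\<Sum>z\<in>S. (c z * z) *s w z)"
  proof -
    have "A *v (\<Sum>z\<in>S. c z *s w z) = (\<Sum>z\<in>S. A *v (c z *s w z))"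
      using insert.hyps(1) by (induction S) (auto simp: matrix_vector_right_distrib)
    also have "\<dots> = (\<Sum>z\<in>S. (c z * z) *s w z)"
      using insert.prems(1) by (intro sum.cong) (auto simp: vec.scale vector_scalar_commute[symmetric] vector_smult_assoc)
    finally show ?thesis .
  qed
  have e: "(\<Sum>z\<in>S. c z *s w z) = (- c y) *s w y" using sum0 unfolding vec.scale_minus_left by (metis add_eq_0_iff)
  have "(\<Sum>z\<in>S. (c z * (z - y)) *s w z) = (\<Sum>z\<in>S. (c z * z) *s w z) - y *s (\<Sum>z\<in>S. c z *s w z)"
    by (simp add: vec.scale_sum_right sum_subtractf[symmetric] algebra_simps vector_sub_rdistrib)
  moreover have "(\<Sum>z\<in>S. (c z * z) *s w z) = y *s (\<Sum>z\<in>S. c z *s w z)"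
  proof -
    have wy: "A *v w y = y *s w y" using insert.prems(1) by blast
    show ?thesis unfolding A[symmetric] e
      by (simp only: vector_scalar_commute wy vector_smult_assoc mult.commute)
  qed
  ultimately have z0: "(\<Sum>z\<in>S. (c z * (z - y)) *s w z) = 0" by simp
  have "c z * (z - y) = 0" if "z \<in> S" for z
    by (rule insert.IH[OF _ z0 that]) (use insert.prems(1) in blast)
  then have S0: "c z = 0" if "z \<in> S" for z using insert.hyps(2) that by auto
  then have "c y *s w y = 0" using sum0 by simp
  then have "c y = 0" using insert.prems(1) by (simp add: vec_eq_iff) blast
  then show ?case using S0 insert.prems(3) by blast
qed simp

lemma spec_transpose: "spec (transpose M) = spec M"
proof -
  have "mat z - cmat (transpose M) = transpose (mat z - cmat M)" for z
    by (simp add: vec_eq_iff mat_def cmat_def transpose_def)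
  then show ?thesis unfolding spec_def complex_charpoly_eq poly_charp by (simp add: det_transpose)
qed

text \<open>The rows of the coordinate change will be taken from eigenvectors of the transpose. For
  a real eigenvalue the imaginary part is normalised to 0, so that the real part is a nonzero
  row.\<close>

lemma left_eigenvector:
  assumes "z \<in> spec M"
  shows "\<exists>u v. (u ~= 0 \<or> v ~= 0) & (Im z = 0 --> v = 0) \<and>
     transpose M *v u = Re z *\<^sub>R u - Im z *\<^sub>R v & transpose M *v v = Im z *\<^sub>R u + Re z *\<^sub>R v"
proof -
  obtain u v where uv: "u ~= 0 \<or> v ~= 0" "transpose M *v u = Re z *\<^sub>R u - Im z *\<^sub>R v"
     "transpose M *v v = Im z *\<^sub>R u + Re z *\<^sub>R v"
    using assms spec_iff_real[of z "transpose M"] spec_transpose[of M] by blast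
  show ?thesis
  proof (cases "Im z = 0")
    case True
    show ?thesis
    proof (cases "u = 0")
      case True
      then show ?thesis using uv \<open>Im z = 0\<close> by (intro exI[of _ v] exI[of _ 0]) auto
    next
      case False
      then show ?thesis using uv \<open>Im z = 0\<close> by (intro exI[of _ u] exI[of _ 0]) auto
    qed
  qed (use uv in blast)
qed

text \<open>The rows of \<open>C\<close> are real and imaginary parts of left eigenvectors. In these
  coordinates \<open>M\<close> is block diagonal, and on a nonreal block the complex number with
  real part in coordinate i and imaginary part in coordinate j is multiplied by
  \<open>e i\<close>.\<close>

lemma eigen_coordinates:
  fixes M :: "real ^ 'd ^ 'd"
  assumes st: "structured M"
  shows "\<exists>(C :: real ^ 'd ^ 'd) (e :: 'd \<Rightarrow> complex). invertible C & bij_betw e UNIV (spec M) \<and>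
    (\<forall>i x. Im (e i) = 0 --> (C *v (M *v x)) $ i = Re (e i) * (C *v x) $ i) \<and>
    (\<forall>i j x. Im (e i) > 0 --> e j = cnj (e i) -->
       (C *v (M *v x)) $ i = Re (e i) * (C *v x) $ i - Im (e i) * (C *v x) $ j \<and>
       (C *v (M *v x)) $ j = Im (e i) * (C *v x) $ i + Re (e i) * (C *v x) $ j)"
proof -
  obtain e :: "'d \<Rightarrow> complex" where e: "bij_betw e UNIV (spec M)"
    using st finite_same_card_bij[of "UNIV :: 'd set" "spec M"] finite_spec[of M]
    unfolding structured_def by auto
  obtain U V where UV: "\<And>z. z \<in> spec M ==> (U z ~= 0 \<or> V z ~= 0) & (Im z = 0 --> V z = 0) \<and>
     transpose M *v U z = Re z *\<^sub>R U z - Im z *\<^sub>R V z & transpose M *v V z = Im z *\<^sub>R U z + Re z *\<^sub>R V z"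
    using left_eigenvector[of _ M] by metis
  define rw where "rw z = (if Im z \<ge> 0 then U z else V (cnj z))" for z
  define C :: "real ^ 'd ^ 'd" where "C = (\<chi> i. rw (e i))"
  define l where "l z = (if Im z \<ge> 0 then (\<chi> k. Complex (U z $ k) (V z $ k))
     else (\<chi> k. Complex (U (cnj z) $ k) (- V (cnj z) $ k)))" for z
  have eS: "e i \<in> spec M" for i using e by (auto simp: bij_betw_def)
  have l: "l z ~= 0 & cmat (transpose M) *v l z = z *s l z" if z: "z \<in> spec M" for z
  proof (cases "Im z \<ge> 0")
    case True
    have "(\<Sum>j\<in>UNIV. transpose M $ i $ j * U z $ j) = Re z * U z $ i - Im z * V z $ i"
      "(\<Sum>j\<in>UNIV. transpose M $ i $ j * V z $ j) = Im z * U z $ i + Re z * V z $ i" for i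
      using UV[OF z] by (simp_all add: vec_eq_iff matrix_vector_mult_def)
    moreover have "l z ~= 0" using UV[OF z] True by (auto simp: l_def vec_eq_iff complex_eq_iff)
    ultimately show ?thesis using True
      by (simp add: l_def vec_eq_iff matrix_vector_mult_def cmat_def complex_eq_iff)
  next
    case False
    note cz = UV[OF spec_cnj[OF z]]
    have "(\<Sum>j\<in>UNIV. transpose M $ i $ j * U (cnj z) $ j) = Re z * U (cnj z) $ i + Im z * V (cnj z) $ i"
      "(\<Sum>j\<in>UNIV. transpose M $ i $ j * V (cnj z) $ j) = - Im z * U (cnj z) $ i + Re z * V (cnj z) $ i" for i
      using cz by (simp_all add: vec_eq_iff matrix_vector_mult_def)
    moreover have "l z ~= 0" using cz False by (auto simp: l_def vec_eq_iff complex_eq_iff)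
    ultimately show ?thesis using False
      by (simp add: l_def vec_eq_iff matrix_vector_mult_def cmat_def complex_eq_iff sum_negf)
  qed
  have "invertible C"
  proof -
    have "\<forall>i. c i = 0" if c: "(\<Sum>i\<in>UNIV. c i *s row i C) = 0" for c :: "'d \<Rightarrow> real"
    proof -
      define ix where "ix = inv_into UNIV e"
      have ix: "ix (e i) = i" for i using e by (simp add: ix_def bij_betw_def inv_into_f_f)
      define b where "b z = c (ix z)" for z
      \<comment> \<open>Coefficients that turn a real relation between the rows into a complex
        relation between the left eigenvectors \<open>l\<close>. The two sums agree only after z is
        paired with its conjugate, which is why each of them is counted twice below.\<close>
      define a where "a z = (if Im z = 0 then of_real (b z)
          else if Im z > 0 then Complex (b z / 2) (- b (cnj z) / 2)
          else Complex (b (cnj z) / 2) (b z / 2))" for z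
      have "(\<Sum>z\<in>spec M. a z *s l z) = 0"
      proof -
        have "(\<Sum>z\<in>spec M. a z * l z $ k) = 0" for k
        proof -
          let ?F = "\<lambda>z. a z * l z $ k" and ?G = "\<lambda>z. complex_of_real (b z * rw z $ k)"
          have FG: "?F z + ?F (cnj z) = ?G z + ?G (cnj z)" if "z \<in> spec M" for z
          proof -
            consider "Im z = 0" | "Im z > 0" | "Im z < 0" by linarith
            then show ?thesis
            proof cases
              case 1
              then have "cnj z = z" by (simp add: complex_eq_iff)
              then show ?thesis using 1 UV[OF that] by (simp add: a_def l_def rw_def Complex_eq)
            qed (simp_all add: a_def l_def rw_def complex_eq_iff field_simps)
          qed
          have cb: "bij_betw cnj (spec M) (spec M)"
            by (rule bij_betw_byWitness[where f' = cnj]) (auto simp: spec_cnj)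
          have "(\<Sum>z\<in>spec M. ?F z) + (\<Sum>z\<in>spec M. ?F z) = (\<Sum>z\<in>spec M. ?F z) + (\<Sum>z\<in>spec M. ?F (cnj z))"
            using sum.reindex_bij_betw[OF cb, of ?F] by (simp only:)
          also have "\<dots> = (\<Sum>z\<in>spec M. ?F z + ?F (cnj z))" by (simp only: sum.distrib)
          also have "\<dots> = (\<Sum>z\<in>spec M. ?G z + ?G (cnj z))" using FG by (intro sum.cong) auto
          also have "\<dots> = (\<Sum>z\<in>spec M. ?G z) + (\<Sum>z\<in>spec M. ?G (cnj z))" by (simp only: sum.distrib)
          also have "\<dots> = (\<Sum>z\<in>spec M. ?G z) + (\<Sum>z\<in>spec M. ?G z)"
            using sum.reindex_bij_betw[OF cb, of ?G] by (simp only:)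
          also have "(\<Sum>z\<in>spec M. ?G z) = (\<Sum>i\<in>UNIV. ?G (e i))"
            using sum.reindex_bij_betw[OF e, of ?G] by simp
          also have "\<dots> = of_real (\<Sum>i\<in>UNIV. c i * C $ i $ k)" by (simp add: b_def ix C_def)
          also have "(\<Sum>i\<in>UNIV. c i * C $ i $ k) = 0"
            using c by (simp add: vec_eq_iff row_def)
          finally show ?thesis by simp
        qed
        then show ?thesis by (simp add: vec_eq_iff)
      qed
      then have a0: "a z = 0" if "z \<in> spec M" for z
        using eigenvectors_independent[OF finite_spec[of M] l, of a z] that by blast
      have "b z = 0" if "z \<in> spec M" for z
      proof -
        consider "Im z = 0" | "Im z > 0" | "Im z < 0" by linarith
        then show ?thesis
        proof cases
          case 1 then show ?thesis using a0[OF that] by (simp add: a_def)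
        next
          case 2 then show ?thesis using a0[OF that] by (simp add: a_def complex_eq_iff)
        next
          case 3 then show ?thesis using a0[OF that] by (simp add: a_def complex_eq_iff)
        qed
      qed
      then show ?thesis using eS ix b_def by metis
    qed
    then show ?thesis using matrix_right_invertible_independent_rows[of C] invertible_right_inverse[of C] by blast
  qed
  moreover have dot: "(C *v x) $ i = rw (e i) \<bullet> x" for i x
    by (simp add: C_def matrix_vector_mult_def inner_vec_def)
  moreover have adj: "rw (e i) \<bullet> (M *v x) = (transpose M *v rw (e i)) \<bullet> x" for i x
    by (metis dot_lmul_matrix inner_commute transpose_matrix_vector)
  moreover have "(C *v (M *v x)) $ i = Re (e i) * (C *v x) $ i" if "Im (e i) = 0" for i x
    using UV[OF eS[of i]] that unfolding dot adj by (simp add: rw_def)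
  moreover have "(C *v (M *v x)) $ i = Re (e i) * (C *v x) $ i - Im (e i) * (C *v x) $ j \<and>
       (C *v (M *v x)) $ j = Im (e i) * (C *v x) $ i + Re (e i) * (C *v x) $ j"
    if "Im (e i) > 0" "e j = cnj (e i)" for i j x
    using UV[OF eS[of i]] that unfolding dot adj by (simp add: rw_def inner_diff_left inner_add_left)
  ultimately show ?thesis using e by blast
qed

section \<open>Cones and dominated sequences of matrices\<close>

definition pr :: "'d set \<Rightarrow> real ^ 'd \<Rightarrow> real ^ 'd" where
  "pr I v = (\<chi> i. if i \<in> I then v $ i else 0)"

definition en :: "'d set \<Rightarrow> real ^ 'd \<Rightarrow> real" where
  "en I v = norm (pr I v)"

lemma linear_pr: "linear (pr I)"
  by (rule linearI) (auto simp: pr_def vec_eq_iff)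

lemma pr_disj: "J \<inter> I = {} ==> pr (J \<union> I) v = pr J v + pr I v"
  by (auto simp: pr_def vec_eq_iff)

lemma en_nonneg [simp]: "0 <= en I v" by (simp add: en_def)

lemma en_zero [simp]: "en I 0 = 0"
  by (simp add: en_def pr_def vec_eq_iff)

lemma en_scaleR: "en I (c *\<^sub>R v) = \<bar>c\<bar> * en I v"
  unfolding en_def linear_cmul[OF linear_pr] by simp

lemma en_diff: "en I u - en I v <= en I (u - v)"
  unfolding en_def linear_diff[OF linear_pr] by (rule norm_triangle_ineq2)

lemma en_le_norm: "en I v <= norm v"
  unfolding en_def by (rule norm_le_componentwise_cart) (simp add: pr_def)

lemma en_un: "J \<inter> I = {} ==> en (J \<union> I) v <= en J v + en I v"
  unfolding en_def pr_disj by (rule norm_triangle_ineq)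

lemma en_UNIV: "en UNIV v = norm v"
  by (simp add: en_def pr_def)

lemma norm_le_en: "norm v <= en I v + en (- I) v"
  using en_un[of I "- I" v] en_UNIV[of v] by (simp add: Compl_partition)

lemma continuous_en: "continuous_on S (en I)"
  unfolding en_def
  by (intro continuous_on_norm linear_continuous_on) (simp add: linear_pr linear_conv_bounded_linear[symmetric])

lemma tendsto_en: "(f \<longlongrightarrow> v) F ==> ((\<lambda>x. en I (f x)) \<longlongrightarrow> en I v) F"
  using continuous_en[of UNIV I] continuous_on_tendsto_compose[of UNIV "en I" f v F] by simp

lemma norm_matrix_vector_le: "norm (A *v x) <= norm A * norm (x :: real ^ 'n)"
proof -
  have "norm (A *v x) = L2_set (\<lambda>i. norm ((A *v x) $ i)) UNIV"
    by (simp add: norm_vec_def)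
  also have "\<dots> <= L2_set (\<lambda>i. norm (A $ i) * norm x) UNIV"
    by (rule L2_set_mono) (simp_all add: matrix_vector_mul_component Cauchy_Schwarz_ineq2)
  also have "\<dots> = norm A * norm x"
    by (simp add: norm_vec_def L2_set_left_distrib)
  finally show ?thesis .
qed

lemma tendsto_matrix_vector:
  fixes A :: "'a \<Rightarrow> real ^ 'n ^ 'm"
  shows "(A \<longlongrightarrow> B) F ==> (x \<longlongrightarrow> y) F ==> ((\<lambda>t. A t *v x t) \<longlongrightarrow> B *v y) F"
  unfolding matrix_vector_mult_def
  by (intro vec_tendstoI) (auto intro!: tendsto_intros)

lemma tendsto_matrix_matrix:
  fixes A :: "'a \<Rightarrow> real ^ 'n ^ 'm" and B :: "'a \<Rightarrow> real ^ 'k ^ 'n"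
  shows "(A \<longlongrightarrow> A') F ==> (B \<longlongrightarrow> B') F ==> ((\<lambda>t. A t ** B t) \<longlongrightarrow> A' ** B') F"
  unfolding matrix_matrix_mult_def
  by (intro vec_tendstoI) (auto intro!: tendsto_intros)

text \<open>Two apertures are carried together: 1/2 gives the wide cone around the coordinates
  \<open>I\<close>, 2 the narrow one. Images are strictly inside, which makes the condition
  open.\<close>

definition cone_pres :: "real ^ 'd ^ 'd \<Rightarrow> 'd set \<Rightarrow> bool" where
  "cone_pres X I \<longleftrightarrow> (\<forall>c\<in>{1/2, 2}. \<forall>v. v ~= 0 --> c * en (- I) v <= en I v -->
     c * en (- I) (X *v v) < en I (X *v v))"

text \<open>The lower bound is required for v in the wide cone, a condition that
  \<open>cone_pres\<close> transports forward; the upper bound is required when the image is outside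
  the narrow cone, a condition transported backward. This makes the constants multiplicative. No
  order between \<open>a\<close> and \<open>b\<close> is imposed, so a single excursion can have
  such constants too.\<close>

definition grow :: "real ^ 'd ^ 'd \<Rightarrow> 'd set \<Rightarrow> real \<Rightarrow> real \<Rightarrow> bool" where
  "grow X I a b \<longleftrightarrow> (\<forall>v. en (- I) v / 2 <= en I v --> a * en I v <= en I (X *v v)) \<and>
     (\<forall>v. en I (X *v v) <= 2 * en (- I) (X *v v) --> en (- I) (X *v v) <= b * en (- I) v)"

lemma cone_pres_strict:
  "cone_pres X I ==> c = 1/2 \<or> c = 2 ==> v ~= 0 ==> c * en (- I) v <= en I v ==>
    c * en (- I) (X *v v) < en I (X *v v)"
  unfolding cone_pres_def by blast

lemma cone_presD:
  "cone_pres X I ==> c = 1/2 \<or> c = 2 ==> c * en (- I) v <= en I v ==> c * en (- I) (X *v v) <= en I (X *v v)"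
  using cone_pres_strict[of X I c v] by (cases "v = 0") (simp, simp add: less_imp_le)

lemma cone_presD':
  "cone_pres X I ==> c = 1/2 \<or> c = 2 ==> en I (X *v v) <= c * en (- I) (X *v v) ==> en I v <= c * en (- I) v"
  using cone_pres_strict[of X I c v] by (cases "v = 0") (simp, linarith)

lemma cone_pres_mult: "cone_pres X I ==> cone_pres Y I ==> cone_pres (X ** Y) I"
proof -
  assume X: "cone_pres X I" and Y: "cone_pres Y I"
  show ?thesis
    unfolding cone_pres_def
  proof (intro ballI allI impI)
    fix c :: real and v :: "real ^ 'a" assume c: "c \<in> {1/2, 2}" "v ~= 0" "c * en (- I) v <= en I v"
    then have c': "c = 1/2 \<or> c = 2" by blast
    have *: "c * en (- I) (Y *v v) < en I (Y *v v)" using cone_pres_strict[OF Y c'] c by blast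
    moreover have "0 <= c * en (- I) (Y *v v)" using c(1) by auto
    ultimately have "Y *v v ~= 0" by auto
    then show "c * en (- I) (X ** Y *v v) < en I (X ** Y *v v)"
      using cone_pres_strict[OF X c' _ less_imp_le[OF *]] \<open>Y *v v ~= 0\<close> by (simp add: matrix_vector_mul_assoc)
  qed
qed

lemma grow_mult:
  assumes "cone_pres X I" "cone_pres Y I" "grow X I a b" "grow Y I a' b'" "0 <= a" "0 <= b"
  shows "grow (X ** Y) I (a * a') (b * b')"
  unfolding grow_def matrix_vector_mul_assoc[symmetric]
proof (intro conjI allI impI)
  fix v assume v: "en (- I) v / 2 <= en I v"
  have "en (- I) (Y *v v) / 2 <= en I (Y *v v)"
    using cone_presD[OF assms(2), of "1/2" v] v by simp
  then have "a * en I (Y *v v) <= en I (X *v (Y *v v))" using assms(3) unfolding grow_def by blast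
  moreover have "a * (a' * en I v) <= a * en I (Y *v v)"
    using assms(4,5) v unfolding grow_def by (intro mult_left_mono) blast+
  ultimately show "a * a' * en I v <= en I (X *v (Y *v v))" by simp
next
  fix v assume v: "en I (X *v (Y *v v)) <= 2 * en (- I) (X *v (Y *v v))"
  then have "en I (Y *v v) <= 2 * en (- I) (Y *v v)" using cone_presD'[OF assms(1), of 2] by blast
  then have "b * en (- I) (Y *v v) <= b * (b' * en (- I) v)"
    using assms(4,6) unfolding grow_def by (intro mult_left_mono) blast+
  moreover have "en (- I) (X *v (Y *v v)) <= b * en (- I) (Y *v v)"
    using v assms(3) unfolding grow_def by blast
  ultimately show "en (- I) (X *v (Y *v v)) <= b * b' * en (- I) v" by simp
qed

text \<open>The bounds for \<open>N\<close> treat the two groups of coordinates separately, so a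
  perturbation only has to be absorbed by the gap between \<open>rm\<close> and
  \<open>rp\<close>.\<close>

lemma near_dominated:
  assumes lo: "\<And>v. rp * en I v <= en I (N *v v)" and hi: "\<And>v. en (- I) (N *v v) <= rm * en (- I) v"
    and r: "0 <= rm" "rm < b" "b < a" "a < rp"
  shows "\<exists>\<delta>>0. \<forall>L. norm (L - N) < \<delta> --> cone_pres L I & grow L I a b"
proof -
  \<comment> \<open>In the wide cone \<open>norm v\<close> is at most three times
    \<open>en I v\<close>. The error enters once on the side of \<open>I\<close> and with a factor
    c, at most 2, on the other side: in total 9 \<delta>, which has to stay below rp - rm.\<close>
  define \<delta> where "\<delta> = min ((rp - rm) / 18) (min ((rp - a) / 3) ((b - rm) / 3))"
  have \<delta>: "\<delta> > 0" "9 * \<delta> < rp - rm" "3 * \<delta> <= rp - a" "3 * \<delta> <= b - rm"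
    using r by (auto simp: \<delta>_def min_def field_simps)
  have "cone_pres L I & grow L I a b" if L: "norm (L - N) < \<delta>" for L
  proof -
    have d: "norm (L *v v - N *v v) <= \<delta> * norm v" for v
      using norm_matrix_vector_le[of "L - N" v] L
      by (metis (no_types, lifting) matrix_vector_mult_diff_rdistrib less_imp_le mult_right_mono norm_ge_zero order_trans)
    have p: "rp * en I v - \<delta> * norm v <= en I (L *v v)" for v
    proof -
      have "en I (N *v v) - en I (L *v v) <= norm (N *v v - L *v v)"
        using en_diff en_le_norm order_trans by blast
      then show ?thesis using d[of v] lo[of v] by (simp add: norm_minus_commute)
    qed
    have q: "en (- I) (L *v v) <= rm * en (- I) v + \<delta> * norm v" for v
    proof -
      have "en (- I) (L *v v) - en (- I) (N *v v) <= norm (L *v v - N *v v)"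
        using en_diff en_le_norm order_trans by blast
      then show ?thesis using d[of v] hi[of v] by simp
    qed
    have n: "norm v <= 3 * en I v" if "en (- I) v / 2 <= en I v" for v
      using norm_le_en[of v I] that by simp
    have cone: "cone_pres L I"
      unfolding cone_pres_def
    proof (intro ballI allI impI)
      fix c :: real and v :: "real ^ 'a" assume c: "c \<in> {1/2, 2}" "v ~= 0" "c * en (- I) v <= en I v"
      have h: "en (- I) v / 2 <= en I v"
      proof -
        have "1/2 <= c" using c(1) by auto
        then show ?thesis using c(3) mult_right_mono[of "1/2" c "en (- I) v"] by simp
      qed
      have pos: "en I v > 0" using n[OF h] c(2) by (metis mult_zero_right norm_le_zero_iff en_nonneg order_less_le)
      have "c * (rm * en (- I) v) <= rm * en I v" using c(3) r(1)
        by (metis mult.left_commute mult_left_mono)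
      moreover have "c * (\<delta> * norm v) <= 6 * (\<delta> * en I v)"
      proof -
        have "c * (\<delta> * norm v) <= 2 * (\<delta> * norm v)" using c(1) \<delta>(1) by (intro mult_right_mono) auto
        then show ?thesis using mult_left_mono[OF n[OF h], of \<delta>] \<delta>(1) by simp
      qed
      moreover have "c * en (- I) (L *v v) <= c * (rm * en (- I) v + \<delta> * norm v)"
        using q c(1) by (intro mult_left_mono) auto
      moreover have "\<delta> * norm v <= 3 * (\<delta> * en I v)" using mult_left_mono[OF n[OF h], of \<delta>] \<delta>(1) by simp
      moreover have "rm * en I v + 9 * (\<delta> * en I v) < rp * en I v"
        using mult_strict_right_mono[OF \<delta>(2) pos] by (simp add: algebra_simps)
      ultimately show "c * en (- I) (L *v v) < en I (L *v v)"
        using p[of v] by (simp add: distrib_left)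
    qed
    moreover have "grow L I a b"
      unfolding grow_def
    proof (intro conjI allI impI)
      fix v assume h: "en (- I) v / 2 <= en I v"
      have "\<delta> * norm v <= 3 * \<delta> * en I v" using mult_left_mono[OF n[OF h], of \<delta>] \<delta>(1) by simp
      moreover have "3 * \<delta> * en I v <= (rp - a) * en I v" using \<delta>(3) by (intro mult_right_mono) auto
      ultimately show "a * en I v <= en I (L *v v)" using p[of v] by (simp add: algebra_simps)
    next
      fix v assume h: "en I (L *v v) <= 2 * en (- I) (L *v v)"
      then have "en I v <= 2 * en (- I) v" using cone_presD'[OF cone, of 2] by blast
      then have "norm v <= 3 * en (- I) v" using norm_le_en[of v I] by simp
      then have "\<delta> * norm v <= 3 * \<delta> * en (- I) v" using mult_left_mono[of "norm v" _ \<delta>] \<delta>(1) by fastforce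
      moreover have "3 * \<delta> * en (- I) v <= (b - rm) * en (- I) v" using \<delta>(4) by (intro mult_right_mono) auto
      ultimately show "en (- I) (L *v v) <= b * en (- I) v" using q[of v] by (simp add: algebra_simps)
    qed
    ultimately show ?thesis by blast
  qed
  then show ?thesis using \<delta>(1) by blast
qed

text \<open>On the compact set of unit vectors of a cone the strict inequality has a margin \<mu>. A
  perturbation of size below \<mu>/3 costs less than (1 + c) \<mu>/3 of it, and c is at most
  2.\<close>

lemma cone_pres_open:
  assumes X: "cone_pres X I"
  shows "\<exists>\<epsilon>>0. \<forall>Y. norm (Y - X) < \<epsilon> --> cone_pres Y I"
proof -
  have "\<exists>\<epsilon>>0. \<forall>Y. norm (Y - X) < \<epsilon> --> (\<forall>v. v ~= 0 --> c * en (- I) v <= en I v -->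
     c * en (- I) (Y *v v) < en I (Y *v v))" if c: "c \<in> {1/2, 2}" for c :: real
  proof -
    let ?K = "{v. norm v = 1 & c * en (- I) v <= en I v}"
    let ?f = "\<lambda>v. en I (X *v v) - c * en (- I) (X *v v)"
    have "closed {v. c * en (- I) v <= en I v}"
      by (intro closed_Collect_le continuous_intros continuous_en)
    moreover have "?K = sphere 0 1 \<inter> {v. c * en (- I) v <= en I v}" by auto
    ultimately have K: "compact ?K" by (simp add: compact_Int_closed)
    have cX: "continuous_on ?K (\<lambda>v. X *v v)" by (intro linear_continuous_on linear_linear[THEN iffD2]) simp
    have cf: "continuous_on ?K ?f"
      by (intro continuous_intros continuous_on_compose2[OF continuous_en[of UNIV] cX]) auto
    have fpos: "?f v > 0" if "v \<in> ?K" for v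
    proof -
      have "v ~= 0" using that by auto
      then show ?thesis using cone_pres_strict[OF X, of c v] c that by fastforce
    qed
    obtain \<mu> where \<mu>: "\<mu> > 0" "\<And>v. v \<in> ?K ==> \<mu> <= ?f v"
    proof (cases "?K = {}")
      case True
      then show ?thesis by (intro that[of 1]) (simp, blast)
    next
      case False
      then obtain v0 where "v0 \<in> ?K" "\<And>v. v \<in> ?K ==> ?f v0 <= ?f v"
        using continuous_attains_inf[OF K _ cf] by blast
      then show ?thesis using that[of "?f v0"] fpos by blast
    qed
    have "c * en (- I) (Y *v v) < en I (Y *v v)"
      if Y: "norm (Y - X) < \<mu> / 3" and v: "v ~= 0" "c * en (- I) v <= en I v" for Y v
    proof -
      let ?u = "(1 / norm v) *\<^sub>R v"
      have u: "?u \<in> ?K" using v by (simp add: en_scaleR divide_right_mono)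
      have d: "norm (Y *v ?u - X *v ?u) < \<mu> / 3"
        using norm_matrix_vector_le[of "Y - X" ?u] Y v(1) by (simp add: matrix_vector_mult_diff_rdistrib)
      have "en I (X *v ?u) - en I (Y *v ?u) <= norm (Y *v ?u - X *v ?u)"
        using en_diff en_le_norm order_trans norm_minus_commute by metis
      moreover have "en (- I) (Y *v ?u) - en (- I) (X *v ?u) <= norm (Y *v ?u - X *v ?u)"
        using en_diff en_le_norm order_trans by blast
      ultimately have "c * en (- I) (Y *v ?u) < en I (Y *v ?u)"
      proof -
        have "c * en (- I) (Y *v ?u) <= c * en (- I) (X *v ?u) + c * norm (Y *v ?u - X *v ?u)"
          unfolding distrib_left[symmetric]
          using c \<open>en (- I) (Y *v ?u) - en (- I) (X *v ?u) <= norm (Y *v ?u - X *v ?u)\<close>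
          by (intro mult_left_mono) auto
        moreover have "c * norm (Y *v ?u - X *v ?u) <= 2 * norm (Y *v ?u - X *v ?u)"
          using c by (intro mult_right_mono) auto
        ultimately show ?thesis
          using \<mu>(2)[OF u] d \<open>en I (X *v ?u) - en I (Y *v ?u) <= norm (Y *v ?u - X *v ?u)\<close> by linarith
      qed
      moreover have "Y *v ?u = (1 / norm v) *\<^sub>R (Y *v v)" by (rule matrix_vector_mult_scaleR)
      ultimately show ?thesis using v(1) by (simp add: en_scaleR field_simps)
    qed
    then show ?thesis using \<mu>(1) by (intro exI[of _ "\<mu> / 3"]) auto
  qed
  then obtain e1 e2 where "e1 > 0" "e2 > 0"
    "\<forall>Y. norm (Y - X) < e1 --> (\<forall>v. v ~= 0 --> 1/2 * en (- I) v <= en I v -->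
     1/2 * en (- I) (Y *v v) < en I (Y *v v))"
    "\<forall>Y. norm (Y - X) < e2 --> (\<forall>v. v ~= 0 --> 2 * en (- I) v <= en I v -->
     2 * en (- I) (Y *v v) < en I (Y *v v))"
    by (metis insertI1 insertI2)
  then show ?thesis unfolding cone_pres_def
    by (intro exI[of _ "min e1 e2"]) auto
qed

lemma invertible_lower_bound:
  fixes X :: "real ^ 'd ^ 'd"
  assumes "invertible X"
  shows "\<exists>s>0. \<forall>v. s * norm v <= norm (X *v v)"
proof -
  have "inj ((*v) X)" using assms inj_matrix_vector_mult by blast
  then obtain B where "B > 0" "\<And>v. B * norm v <= norm (X *v v)"
    using linear_inj_bounded_below_pos[of "(*v) X"] by auto
  then show ?thesis by blast
qed

text \<open>Cone preservation and invertibility supply growth constants, in general without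
  \<open>b < a\<close>. They serve for the excursion block, whose constants are later dominated by
  the long product near the periodic point.\<close>

lemma grow_open:
  assumes X: "cone_pres X I" and inv: "invertible X"
  shows "\<exists>\<epsilon> a b. \<epsilon> > 0 & a > 0 & b > 0 & (\<forall>Y. norm (Y - X) < \<epsilon> --> cone_pres Y I & grow Y I a b)"
proof -
  obtain \<epsilon> where \<epsilon>: "\<epsilon> > 0" "\<And>Y. norm (Y - X) < \<epsilon> ==> cone_pres Y I"
    using cone_pres_open[OF X] by blast
  obtain s where s: "s > 0" "\<And>v. s * norm v <= norm (X *v v)" using invertible_lower_bound[OF inv] by blast
  let ?e = "min \<epsilon> (s / 2)"
  let ?S = "norm X + s"
  have "grow Y I (s / 6) (3 * ?S)" if Y: "norm (Y - X) < ?e" for Y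
  proof -
    have cone: "cone_pres Y I" using \<epsilon>(2) Y by simp
    have d: "norm (Y *v v - X *v v) <= s / 2 * norm v" for v
      using norm_matrix_vector_le[of "Y - X" v] Y mult_right_mono[of "norm (Y - X)" "s / 2" "norm v"]
      by (simp add: matrix_vector_mult_diff_rdistrib)
    have lo: "s / 2 * norm v <= norm (Y *v v)" for v
      using s(2)[of v] d[of v] norm_triangle_ineq2[of "X *v v" "Y *v v"] by (simp add: norm_minus_commute)
    have hi: "norm (Y *v v) <= ?S * norm v" for v
    proof -
      have "norm (Y *v v) <= norm (X *v v) + s / 2 * norm v"
        using d[of v] norm_triangle_ineq2[of "Y *v v" "X *v v"] by simp
      also have "\<dots> <= ?S * norm v"
      proof -
        have "0 <= s * norm v" using s(1) by simp
        then show ?thesis using norm_matrix_vector_le[of X v] unfolding distrib_right by simp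
      qed
      finally show ?thesis .
    qed
    show ?thesis unfolding grow_def
    proof (intro conjI allI impI)
      fix v assume "en (- I) v / 2 <= en I v"
      then have "1/2 * en (- I) (Y *v v) <= en I (Y *v v)" using cone_presD[OF cone, of "1/2" v] by simp
      then have "norm (Y *v v) <= 3 * en I (Y *v v)" using norm_le_en[of "Y *v v" I] by simp
      moreover have "s / 2 * en I v <= s / 2 * norm v" using s(1) en_le_norm by (intro mult_left_mono) auto
      ultimately show "s / 6 * en I v <= en I (Y *v v)" using lo[of v] by simp
    next
      fix v assume "en I (Y *v v) <= 2 * en (- I) (Y *v v)"
      then have "en I v <= 2 * en (- I) v" using cone_presD'[OF cone, of 2] by blast
      then have "norm v <= 3 * en (- I) v" using norm_le_en[of v I] by simp
      then have "?S * norm v <= ?S * (3 * en (- I) v)" using s(1) by (intro mult_left_mono) auto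
      then show "en (- I) (Y *v v) <= 3 * ?S * en (- I) v"
        using hi[of v] en_le_norm[of "- I" "Y *v v"] by (simp add: algebra_simps)
    qed
  qed
  moreover have "?e > 0" "s / 6 > 0" "3 * ?S > 0" using \<epsilon>(1) s(1) by (auto simp: add_nonneg_pos)
  ultimately show ?thesis using \<epsilon>(2) by (metis min_less_iff_conj)
qed

section \<open>Growth rates versus cones along orbits\<close>

lemma fwd_bound:
  assumes "\<And>n. grow (X n) I a b" "0 <= b" and orb: "\<And>n. x (Suc n) = X n *v x n"
    and out: "\<And>n. en I (x n) <= 2 * en (- I) (x n)"
  shows "norm (x n) <= 3 * en (- I) (x 0) * b ^ n"
proof -
  have "en (- I) (x n) <= b ^ n * en (- I) (x 0)"
  proof (induction n)
    case (Suc n)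
    have "en (- I) (x (Suc n)) <= b * en (- I) (x n)"
      using assms(1)[of n] out[of "Suc n"] unfolding grow_def orb by blast
    also have "\<dots> <= b * (b ^ n * en (- I) (x 0))" using Suc assms(2) by (rule mult_left_mono)
    finally show ?case by (simp add: mult.assoc)
  qed simp
  then show ?thesis using norm_le_en[of "x n" I] out[of n] by (simp add: algebra_simps)
qed

text \<open>An orbit that enters the wide cone stays there and grows like \<open>a ^ n\<close>,
  faster than the assumed bound. Combined with \<open>fwd_bound\<close>, this improves aperture 2 to
  aperture 1/2 for whole forward orbits.\<close>

lemma fwd_cone:
  assumes cone: "\<And>n. cone_pres (X n) I" and gr: "\<And>n. grow (X n) I a b" and ab: "0 < b" "b < a"
    and orb: "\<And>n. x (Suc n) = X n *v x n" and bd: "\<And>n. norm (x n) <= C * b ^ n"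
  shows "en I (x n) <= en (- I) (x n) / 2"
proof (rule ccontr)
  assume "\<not> ?thesis"
  then have n: "en (- I) (x n) / 2 < en I (x n)" by simp
  have m: "en (- I) (x (n + m)) / 2 <= en I (x (n + m)) & a ^ m * en I (x n) <= en I (x (n + m))" for m
  proof (induction m)
    case 0 then show ?case using n by simp
  next
    case (Suc m)
    have "a * en I (x (n + m)) <= en I (x (n + Suc m))"
      using gr[of "n + m"] Suc unfolding grow_def by (simp add: orb)
    moreover have "a * (a ^ m * en I (x n)) <= a * en I (x (n + m))"
      using Suc ab by (intro mult_left_mono) auto
    moreover have "en (- I) (x (n + Suc m)) / 2 <= en I (x (n + Suc m))"
      using cone_presD[OF cone[of "n + m"], of "1/2" "x (n + m)"] Suc by (simp add: orb)
    ultimately show ?case by (simp add: mult.assoc)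
  qed
  have pos: "en I (x n) > 0" using n en_nonneg[of "- I" "x n"] by linarith
  have le: "(a / b) ^ m <= C * b ^ n / en I (x n)" for m
  proof -
    have "a ^ m * en I (x n) <= C * b ^ (n + m)"
      using m[of m] bd[of "n + m"] en_le_norm[of I "x (n + m)"] by linarith
    then show ?thesis using pos ab by (simp add: field_simps power_add)
  qed
  have "a / b > 1" using ab by simp
  then obtain m where "C * b ^ n / en I (x n) < (a / b) ^ m" using real_arch_pow by blast
  then show False using le[of m] by simp
qed

lemma bwd_bound:
  assumes gr: "\<And>n. grow (X n) I a b" "0 < a" and orb: "\<And>n. x n = X n *v x (Suc n)"
    and ins: "\<And>n. en (- I) (x n) / 2 <= en I (x n)"
  shows "norm (x n) <= 3 * en I (x 0) / a ^ n"
proof -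
  have "a ^ n * en I (x n) <= en I (x 0)"
  proof (induction n)
    case (Suc n)
    have "a * en I (x (Suc n)) <= en I (x n)"
      using gr(1)[of n] ins[of "Suc n"] orb[of n] unfolding grow_def by metis
    then have "a ^ n * (a * en I (x (Suc n))) <= a ^ n * en I (x n)" using gr(2) by (intro mult_left_mono) auto
    then show ?case using Suc by (simp add: mult.assoc mult.left_commute)
  qed simp
  then have "en I (x n) <= en I (x 0) / a ^ n" using gr(2) by (simp add: field_simps)
  then show ?thesis using norm_le_en[of "x n" I] ins[of n] by simp
qed

text \<open>Backward in time, an orbit outside the narrow cone stays outside, and its complementary
  part decays no faster than the powers of 1/b; this contradicts decay at the rate 1/a.\<close>

lemma bwd_cone:
  assumes cone: "\<And>n. cone_pres (X n) I" and gr: "\<And>n. grow (X n) I a b" and ab: "0 < b" "b < a"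
    and orb: "\<And>n. x n = X n *v x (Suc n)" and bd: "\<And>n. norm (x n) <= C / a ^ n"
  shows "2 * en (- I) (x n) <= en I (x n)"
proof (rule ccontr)
  assume "\<not> ?thesis"
  then have n: "en I (x n) < 2 * en (- I) (x n)" by simp
  have m: "en I (x (n + m)) <= 2 * en (- I) (x (n + m)) & en (- I) (x n) <= b ^ m * en (- I) (x (n + m))" for m
  proof (induction m)
    case 0 then show ?case using n by simp
  next
    case (Suc m)
    have "en (- I) (x (n + m)) <= b * en (- I) (x (n + Suc m))"
      using gr[of "n + m"] Suc orb[of "n + m"] unfolding grow_def by (metis add_Suc_right)
    then have "b ^ m * en (- I) (x (n + m)) <= b ^ m * (b * en (- I) (x (n + Suc m)))"
      using ab by (intro mult_left_mono) auto
    moreover have "en I (x (n + Suc m)) <= 2 * en (- I) (x (n + Suc m))"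
      using cone_presD'[OF cone[of "n + m"], of 2 "x (n + Suc m)"] Suc orb[of "n + m"] by simp
    ultimately show ?case using Suc by (simp add: mult.assoc mult.left_commute)
  qed
  have pos: "en (- I) (x n) > 0" using n en_nonneg[of I "x n"] by linarith
  have le: "(a / b) ^ m <= C / a ^ n / en (- I) (x n)" for m
  proof -
    have "b ^ m * en (- I) (x (n + m)) <= b ^ m * (C / a ^ (n + m))"
      using bd[of "n + m"] en_le_norm[of "- I" "x (n + m)"] ab by (intro mult_left_mono) auto
    then have "en (- I) (x n) <= b ^ m * (C / a ^ (n + m))" using m[of m] by linarith
    then show ?thesis using pos ab by (simp add: field_simps power_add)
  qed
  have "a / b > 1" using ab by simp
  then obtain m where "C / a ^ n / en (- I) (x n) < (a / b) ^ m" using real_arch_pow by blast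
  then show False using le[of m] by simp
qed

text \<open>Let j, c, s be the sizes of the parts in J, in K - J and outside K. Then j <= (c + s)/2
  and 2 s <= c + j, whence s <= c and j <= c. With aperture 1 in both hypotheses c = 0 and j = s
  would be possible.\<close>

lemma class_bound:
  assumes JK: "J \<subseteq> K" and 1: "en J v <= en (- J) v / 2" and 2: "2 * en (- K) v <= en K v"
  shows "norm v <= 3 * en (K - J) v"
proof -
  have "- J = (K - J) \<union> (- K)" "K = (K - J) \<union> J" using JK by auto
  then have "en (- J) v <= en (K - J) v + en (- K) v" "en K v <= en (K - J) v + en J v"
    using en_un[of "K - J" "- K" v] en_un[of "K - J" J v] by auto
  then show ?thesis using 1 2 norm_le_en[of v J] by linarith
qed

subsection \<open>The spaces of a spectral gap\<close>

text \<open>Used with the rate \<open>a\<close> of the gap below and the rate \<open>b\<close> of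
  the gap above a group of moduli, this is the spectral space of that group. Growth rates make it a
  subspace at once, whereas cones are not linear; the cone lemmas supply the estimates.\<close>

definition Vsp :: "real ^ 'd ^ 'd \<Rightarrow> real \<Rightarrow> real \<Rightarrow> (real ^ 'd) set" where
  "Vsp P b a = {v. (\<exists>C. \<forall>n. norm (((*v) P ^^ n) v) <= C * b ^ n) \<and>
     (\<exists>C. \<forall>n. norm (((*v) (matrix_inv P) ^^ n) v) <= C / a ^ n)}"

lemma linear_funpow: "linear (((*v) P ^^ n) :: real ^ 'd \<Rightarrow> real ^ 'd)"
proof (induction n)
  case (Suc n)
  then show ?case using linear_compose[OF Suc matrix_vector_mul_linear[of P]] by (simp add: comp_def)
qed (simp add: linear_id[unfolded id_def])

lemma subspace_growth:
  fixes F :: "nat \<Rightarrow> real ^ 'd \<Rightarrow> real ^ 'd"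
  assumes "\<And>n. linear (F n)" and s: "\<And>n. (s :: nat \<Rightarrow> real) n \<ge> 0"
  shows "subspace {v. \<exists>C. \<forall>n. norm (F n v) <= C * s n}"
proof (rule subspaceI)
  show "0 \<in> {v. \<exists>C. \<forall>n. norm (F n v) <= C * s n}"
    by (auto simp: linear_0[OF assms(1)] intro!: exI[of _ 0])
next
  fix x y assume "x \<in> {v. \<exists>C. \<forall>n. norm (F n v) <= C * s n}" "y \<in> {v. \<exists>C. \<forall>n. norm (F n v) <= C * s n}"
  then obtain C D where "\<And>n. norm (F n x) <= C * s n" "\<And>n. norm (F n y) <= D * s n" by blast
  then have "norm (F n (x + y)) <= (C + D) * s n" for n
    unfolding linear_add[OF assms(1)] distrib_right by (meson add_mono norm_triangle_le)
  then show "x + y \<in> {v. \<exists>C. \<forall>n. norm (F n v) <= C * s n}" by blast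
next
  fix c x assume "x \<in> {v. \<exists>C. \<forall>n. norm (F n v) <= C * s n}"
  then obtain C where "\<And>n. norm (F n x) <= C * s n" by blast
  then have "norm (F n (c *\<^sub>R x)) <= (\<bar>c\<bar> * C) * s n" for n
    unfolding linear_cmul[OF assms(1)] by (simp add: mult.assoc mult_left_mono)
  then show "c *\<^sub>R x \<in> {v. \<exists>C. \<forall>n. norm (F n v) <= C * s n}" by blast
qed

lemma subspace_Vsp: "0 <= a ==> 0 <= b ==> subspace (Vsp P b a)"
proof -
  assume ab: "0 <= a" "0 <= b"
  have "Vsp P b a = {v. \<exists>C. \<forall>n. norm (((*v) P ^^ n) v) <= C * b ^ n} \<inter>
      {v. \<exists>C. \<forall>n. norm (((*v) (matrix_inv P) ^^ n) v) <= C * (1 / a ^ n)}"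
    by (auto simp: Vsp_def)
  moreover have "subspace {v. \<exists>C. \<forall>n. norm (((*v) P ^^ n) v) <= C * b ^ n}"
    by (rule subspace_growth[OF linear_funpow]) (use ab in simp)
  moreover have "subspace {v. \<exists>C. \<forall>n. norm (((*v) (matrix_inv P) ^^ n) v) <= C * (1 / a ^ n)}"
    by (rule subspace_growth[OF linear_funpow]) (use ab in simp)
  ultimately show ?thesis by (simp add: subspace_inter)
qed

lemma invertible_inv:
  fixes P :: "real ^ 'd ^ 'd"
  assumes "invertible P"
  shows "P *v (matrix_inv P *v v) = v" "matrix_inv P *v (P *v v) = v"
proof -
  have "P ** matrix_inv P = mat 1 & matrix_inv P ** P = mat 1"
    using assms unfolding matrix_inv_def invertible_def by (rule someI_ex)
  then show "P *v (matrix_inv P *v v) = v" "matrix_inv P *v (P *v v) = v"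
    by (simp_all add: matrix_vector_mul_assoc)
qed

lemma Vsp_orbits:
  fixes P :: "real ^ 'd ^ 'd"
  assumes P: "invertible P" and cJ: "cone_pres P J" and gJ: "grow P J aJ bJ" and cK: "cone_pres P K" and gK: "grow P K aK bK"
    and ab: "0 < bJ" "bJ < aJ" "0 < bK" "bK < aK" and v: "v \<in> Vsp P bJ aK"
  shows "en J v <= en (- J) v / 2" "2 * en (- K) v <= en K v"
proof -
  obtain C D where C: "\<And>n. norm (((*v) P ^^ n) v) <= C * bJ ^ n"
    and D: "\<And>n. norm (((*v) (matrix_inv P) ^^ n) v) <= D / aK ^ n"
    using v unfolding Vsp_def by blast
  show "en J v <= en (- J) v / 2"
    using fwd_cone[of "\<lambda>_. P" J aJ bJ "\<lambda>n. ((*v) P ^^ n) v" C 0] cJ gJ ab C by simp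
  show "2 * en (- K) v <= en K v"
    using bwd_cone[of "\<lambda>_. P" K aK bK "\<lambda>n. ((*v) (matrix_inv P) ^^ n) v" D 0] cK gK ab D invertible_inv[OF P] by simp
qed

lemma Vsp_invariant:
  fixes P :: "real ^ 'd ^ 'd"
  assumes P: "invertible P" and v: "v \<in> Vsp P b a" and ab: "0 < a" "0 < b"
  shows "P *v v \<in> Vsp P b a"
proof -
  obtain C D where C: "\<And>n. norm (((*v) P ^^ n) v) <= C * b ^ n"
    and D: "\<And>n. norm (((*v) (matrix_inv P) ^^ n) v) <= D / a ^ n"
    using v unfolding Vsp_def by blast
  have "norm (((*v) P ^^ n) (P *v v)) <= (C * b) * b ^ n" for n
    using C[of "Suc n"] by (simp add: funpow_swap1 mult.assoc)
  moreover have "norm (((*v) (matrix_inv P) ^^ n) (P *v v)) <= max (norm (P *v v)) (D * a) / a ^ n" for n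
  proof (cases n)
    case (Suc m)
    have "norm (((*v) (matrix_inv P) ^^ n) (P *v v)) = norm (((*v) (matrix_inv P) ^^ m) v)"
      using Suc invertible_inv(2)[OF P] by (simp add: funpow_swap1)
    also have "\<dots> <= D * a / a ^ n" using D[of m] ab Suc by simp
    also have "\<dots> <= max (norm (P *v v)) (D * a) / a ^ n" using ab by (intro divide_right_mono) auto
    finally show ?thesis .
  qed simp
  ultimately show ?thesis unfolding Vsp_def by blast
qed

lemma dim_pr_zero: "dim {x :: real ^ 'd. \<forall>i. i \<notin> I --> x $ i = 0} = card I"
  using dim_substandard_cart[of I, where 'a = real] by (simp add: dim_vec_eq)

lemma en_zero_iff: "en I v = 0 \<longleftrightarrow> (\<forall>i\<in>I. v $ i = 0)"
  by (auto simp: en_def pr_def vec_eq_iff)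

lemma bounded_subseq:
  fixes f :: "nat \<Rightarrow> 'a::{heine_borel, real_normed_vector}"
  assumes "\<And>n. norm (f n) <= B"
  shows "\<exists>l r. strict_mono (r :: nat \<Rightarrow> nat) & (f \<circ> r) \<longlonglongrightarrow> l"
proof -
  have "bounded (range f)" using assms by (auto simp: bounded_iff)
  then show ?thesis using bounded_imp_convergent_subsequence[of f] by blast
qed

text \<open>Finite-time approximation: for each s take the vectors whose s-th image is supported off
  J and whose s-th preimage is supported in K. A dimension count shows that there are enough of
  them, \<open>class_bound\<close> makes them a graph over the coordinates K - J, and compactness
  gives a limit as s grows.\<close>

lemma Vsp_exists:
  fixes P :: "real ^ 'd ^ 'd"
  assumes P: "invertible P" and cJ: "cone_pres P J" and gJ: "grow P J aJ bJ" and cK: "cone_pres P K" and gK: "grow P K aK bK"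
    and ab: "0 < bJ" "bJ < aJ" "0 < bK" "bK < aK" and JK: "J \<subseteq> K"
    and w: "\<And>i. i \<notin> K - J ==> w $ i = 0"
  shows "\<exists>v \<in> Vsp P bJ aK. pr (K - J) v = w"
proof -
  let ?f = "\<lambda>n. (*v) P ^^ n" and ?b = "\<lambda>n. (*v) (matrix_inv P) ^^ n"
  let ?A = "{x :: real ^ 'd. \<forall>i. i \<notin> K --> x $ i = 0}" and ?B = "{x :: real ^ 'd. \<forall>i. i \<notin> - J --> x $ i = 0}"
  have fb': "?f n (?b n v) = v & ?b n (?f n v) = v" for n v
  proof (induction n arbitrary: v)
    case (Suc n)
    have 1: "?f (Suc n) (?b (Suc n) v) = ?f n (P *v (matrix_inv P *v ?b n v))"
      by (simp add: funpow_swap1)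
    have 2: "?b (Suc n) (?f (Suc n) v) = ?b n (matrix_inv P *v (P *v ?f n v))"
      by (simp add: funpow_swap1)
    show ?case unfolding 1 2 using Suc invertible_inv[OF P] by simp
  qed simp
  then have fb: "?f n (?b n v) = v" "?b n (?f n v) = v" for n v by blast+
  have subA: "subspace ?A" and subB: "subspace ?B"
    by (auto simp: subspace_def)
  have cl: "en J (?f i v) <= en (- J) (?f i v) / 2" if "?f s v \<in> ?B" "i <= s" for i s v
    using that(2)
  proof (induction rule: inc_induct)
    case base
    have "en J (?f s v) = 0" using that(1) by (simp add: en_zero_iff)
    then show ?case by simp
  next
    case (step i)
    then show ?case using cone_presD'[OF cJ, of "1/2" "?f i v"] by simp
  qed
  have cr: "2 * en (- K) (?b i v) <= en K (?b i v)" if "?b s v \<in> ?A" "i <= s" for i s v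
    using that(2)
  proof (induction rule: inc_induct)
    case base
    have "en (- K) (?b s v) = 0" using that(1) by (simp add: en_zero_iff)
    then show ?case by simp
  next
    case (step i)
    then show ?case using cone_presD[OF cK, of 2 "?b (Suc i) v"] invertible_inv[OF P] by simp
  qed
  have ex: "\<exists>v. ?f s v \<in> ?B & ?b s v \<in> ?A & pr (K - J) v = w" for s
  proof -
    \<comment> \<open>Vectors with \<open>?b s v\<close> in \<open>?A\<close> and
      \<open>?f s v\<close> in \<open>?B\<close>. The dimensions card K and card (- J) exceed the
      full dimension by card (K - J), which bounds the dimension of the intersection from
      below.\<close>
    let ?W = "?f s ` ?A \<inter> ?b s ` ?B"
    have inj: "inj (?f s)" "inj (?b s)" using fb by (metis injI)+
    have sf: "subspace (?f s ` ?A)" "subspace (?b s ` ?B)"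
      by (rule linear_subspace_image[OF linear_funpow subA], rule linear_subspace_image[OF linear_funpow subB])
    have "dim (?f s ` ?A) = dim ?A" "dim (?b s ` ?B) = dim ?B"
      by (rule dim_image_eq[OF linear_funpow inj_on_subset[OF inj(1) subset_UNIV]],
          rule dim_image_eq[OF linear_funpow inj_on_subset[OF inj(2) subset_UNIV]])
    then have "dim (?f s ` ?A) = card K" "dim (?b s ` ?B) = card (- J)"
      by (simp_all only: dim_pr_zero)
    moreover have "dim {x + y |x y. x \<in> ?f s ` ?A & y \<in> ?b s ` ?B} <= CARD('d)"
      using dim_subset_UNIV[of "{x + y |x y. x \<in> ?f s ` ?A & y \<in> ?b s ` ?B}"] by simp
    moreover have "card K + card (- J) = card (K - J) + CARD('d)"
    proof -
      have "card J <= card K" "card K <= CARD('d)" using JK by (auto intro: card_mono)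
      then show ?thesis using JK by (simp add: card_Diff_subset Compl_eq_Diff_UNIV finite_subset[of J K])
    qed
    ultimately have dW: "card (K - J) <= dim ?W"
      using dim_sums_Int[OF sf] by linarith
    have sW: "subspace ?W" using sf by (rule subspace_inter)
    have W: "?f s v \<in> ?B & ?b s v \<in> ?A" if vW: "v \<in> ?W" for v
    proof -
      obtain x where x: "v = ?f s x" "x \<in> ?A" by (rule imageE[OF IntD1[OF vW]])
      obtain y where y: "v = ?b s y" "y \<in> ?B" by (rule imageE[OF IntD2[OF vW]])
      show ?thesis using fb(2)[of s x] fb(1)[of s y] by (simp only: x(2) y(2) x(1)[symmetric] y(1)[symmetric] simp_thms)
    qed
    define W where "W = ?W"
    have n3: "norm v <= 3 * en (K - J) v" if "v \<in> W" for v
      using class_bound[OF JK, of v] cl[of s v 0] cr[of s v 0] W[of v] that unfolding W_def by simp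
    have sW': "subspace W" using sW by (simp only: W_def)
    have "inj_on (pr (K - J)) W"
      unfolding linear_injective_on_subspace_0[OF linear_pr sW'] using n3 unfolding en_def by fastforce
    then have d2: "dim (pr (K - J) ` W) = dim W"
      using sW' by (intro dim_image_eq[OF linear_pr]) (simp add: span_eq_iff[THEN iffD2])
    have sub: "pr (K - J) ` W \<subseteq> {x. \<forall>i. i \<notin> K - J --> x $ i = 0}"
      by (auto simp: pr_def)
    have "subspace {x :: real ^ 'd. \<forall>i. i \<notin> K - J --> x $ i = 0}" by (auto simp: subspace_def)
    then have "pr (K - J) ` W = {x. \<forall>i. i \<notin> K - J --> x $ i = 0}"
      using d2 sub dW dim_pr_zero[of "K - J"] unfolding W_def[symmetric]
      by (intro subspace_dim_equal[OF linear_subspace_image[OF linear_pr sW']]) simp_all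
    then have "w \<in> pr (K - J) ` W" using w by blast
    then show ?thesis using W unfolding W_def by blast
  qed
  have "\<exists>vs. \<forall>s. ?f s (vs s) \<in> ?B & ?b s (vs s) \<in> ?A & pr (K - J) (vs s) = w"
    by (rule choice) (rule allI, rule ex)
  then obtain vs where vs: "\<And>s. ?f s (vs s) \<in> ?B" "\<And>s. ?b s (vs s) \<in> ?A" "\<And>s. pr (K - J) (vs s) = w"
    by blast
  have "norm (vs s) <= 3 * norm w" for s
    using class_bound[OF JK, of "vs s"] cl[OF vs(1), of 0] cr[OF vs(2), of 0] vs(3)[of s] by (simp add: en_def)
  then obtain v r where r: "strict_mono (r :: nat \<Rightarrow> nat)" "(vs \<circ> r) \<longlonglongrightarrow> v"
    using bounded_subseq[of vs] by blast
  have lim: "(\<lambda>n. F (vs (r n))) \<longlonglongrightarrow> F v" if "linear F" for F :: "real ^ 'd \<Rightarrow> real ^ 'd"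
    using r(2) that linear_continuous_at[of F v] isCont_tendsto_compose[of v F]
    by (auto simp: linear_conv_bounded_linear comp_def)
  have big: "\<forall>\<^sub>F n in sequentially. i <= r n" for i
    using seq_suble[OF r(1)] by (intro eventually_sequentiallyI[of i]) (meson order_trans)
  have F: "en J (?f i v) <= en (- J) (?f i v) / 2" for i
  proof (rule tendsto_le[OF sequentially_bot])
    show "(\<lambda>n. en J (?f i (vs (r n)))) \<longlonglongrightarrow> en J (?f i v)" by (intro tendsto_en lim linear_funpow)
    show "(\<lambda>n. en (- J) (?f i (vs (r n))) / 2) \<longlonglongrightarrow> en (- J) (?f i v) / 2"
      by (intro tendsto_intros tendsto_en lim linear_funpow) simp
    show "\<forall>\<^sub>F n in sequentially. en J (?f i (vs (r n))) <= en (- J) (?f i (vs (r n))) / 2"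
      using big[of i] by eventually_elim (rule cl[OF vs(1)])
  qed
  have B: "2 * en (- K) (?b i v) <= en K (?b i v)" for i
  proof (rule tendsto_le[OF sequentially_bot])
    show "(\<lambda>n. en K (?b i (vs (r n)))) \<longlonglongrightarrow> en K (?b i v)" by (intro tendsto_en lim linear_funpow)
    show "(\<lambda>n. 2 * en (- K) (?b i (vs (r n)))) \<longlonglongrightarrow> 2 * en (- K) (?b i v)"
      by (intro tendsto_intros tendsto_en lim linear_funpow)
    show "\<forall>\<^sub>F n in sequentially. 2 * en (- K) (?b i (vs (r n))) <= en K (?b i (vs (r n)))"
      using big[of i] by eventually_elim (rule cr[OF vs(2)])
  qed
  have "norm (?f n v) <= 3 * en (- J) v * bJ ^ n" for n
    using fwd_bound[of "\<lambda>_. P" J aJ bJ "\<lambda>n. ?f n v" n] gJ ab F order_trans[OF F]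
    by (simp add: field_simps)
  moreover have "norm (?b n v) <= 3 * en K v / aK ^ n" for n
  proof -
    have "en (- K) (?b n v) / 2 <= en K (?b n v)" for n
      using B[of n] en_nonneg[of "- K" "?b n v"] by linarith
    then show ?thesis
      using bwd_bound[of "\<lambda>_. P" K aK bK "\<lambda>n. ?b n v" n] gK ab invertible_inv[OF P] by simp
  qed
  ultimately have "v \<in> Vsp P bJ aK" unfolding Vsp_def by blast
  moreover have "pr (K - J) v = w"
    using LIMSEQ_unique[OF lim[OF linear_pr[of "K - J"]], of w] vs(3) by simp
  ultimately show ?thesis by blast
qed

section \<open>Eigenvectors in invariant subspaces\<close>

definition eigp :: "real ^ 'd ^ 'd \<Rightarrow> complex \<Rightarrow> real ^ 'd \<Rightarrow> real ^ 'd \<Rightarrow> bool" where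
  "eigp P z u v \<longleftrightarrow> P *v u = Re z *\<^sub>R u - Im z *\<^sub>R v & P *v v = Im z *\<^sub>R u + Re z *\<^sub>R v"

lemma spec_eigp: "z \<in> spec P \<longleftrightarrow> (\<exists>u v. (u ~= 0 \<or> v ~= 0) & eigp P z u v)"
  unfolding spec_iff_real eigp_def by blast

lemma eigp_norm:
  assumes "eigp P z u v"
  shows "(norm (P *v u))\<^sup>2 + (norm (P *v v))\<^sup>2 = (cmod z)\<^sup>2 * ((norm u)\<^sup>2 + (norm v)\<^sup>2)"
proof -
  have e: "P *v u = Re z *\<^sub>R u - Im z *\<^sub>R v" "P *v v = Im z *\<^sub>R u + Re z *\<^sub>R v"
    using assms unfolding eigp_def by auto
  show ?thesis unfolding e cmod_power2 unfolding power2_norm_eq_inner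
    by (simp add: inner_add_left inner_add_right inner_diff_left inner_diff_right inner_commute
      algebra_simps power2_eq_square)
qed

lemma eigp_pow:
  assumes "eigp P z u v"
  shows "eigp P z (((*v) P ^^ n) u) (((*v) P ^^ n) v) \<and>
    (norm (((*v) P ^^ n) u))\<^sup>2 + (norm (((*v) P ^^ n) v))\<^sup>2 = (cmod z ^ n)\<^sup>2 * ((norm u)\<^sup>2 + (norm v)\<^sup>2)"
proof (induction n)
  case 0 then show ?case using assms by simp
next
  case (Suc n)
  let ?u = "((*v) P ^^ n) u" and ?v = "((*v) P ^^ n) v"
  have e: "eigp P z ?u ?v" using Suc by blast
  have "eigp P z (P *v ?u) (P *v ?v)"
    using e unfolding eigp_def
    by (simp add: matrix_vector_mult_diff_distrib matrix_vector_right_distrib matrix_vector_mult_scaleR)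
  moreover have "(norm (P *v ?u))\<^sup>2 + (norm (P *v ?v))\<^sup>2 = (cmod z ^ Suc n)\<^sup>2 * ((norm u)\<^sup>2 + (norm v)\<^sup>2)"
    using eigp_norm[OF e] Suc by (simp add: power_mult_distrib mult.assoc)
  ultimately show ?case by simp
qed

lemma eigp_inv:
  fixes P :: "real ^ 'd ^ 'd"
  assumes P: "invertible P" and e: "eigp P z u v"
  shows "eigp P z (matrix_inv P *v u) (matrix_inv P *v v)"
proof -
  let ?Q = "matrix_inv P"
  have PQ: "P ** ?Q = mat 1 & ?Q ** P = mat 1"
    using P unfolding matrix_inv_def invertible_def by (rule someI_ex)
  have c: "P *v (?Q *v x) = ?Q *v (P *v x)" for x using PQ by (simp add: matrix_vector_mul_assoc)
  show ?thesis using e unfolding eigp_def c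
    by (simp add: matrix_vector_mult_diff_distrib matrix_vector_right_distrib matrix_vector_mult_scaleR)
qed

text \<open>This is p(A) x, written as a combination of iterates of x.\<close>

definition act :: "complex ^ 'd ^ 'd \<Rightarrow> complex ^ 'd \<Rightarrow> complex poly \<Rightarrow> complex ^ 'd" where
  "act A x p = (\<Sum>i\<le>degree p. coeff p i *s ((*v) A ^^ i) x)"

lemma act_eq: "degree p <= n ==> act A x p = (\<Sum>i\<le>n. coeff p i *s ((*v) A ^^ i) x)"
  unfolding act_def by (rule sum.mono_neutral_left) (auto simp: coeff_eq_0)

lemma act_linear_factor: "act A x ([:-z, 1:] * q) = A *v act A x q - z *s act A x q"
proof -
  let ?n = "degree q"
  let ?X = "\<lambda>i. ((*v) A ^^ i) x"
  have "degree ([:-z, 1:] * q) <= Suc ?n" by (rule order_trans[OF degree_mult_le]) simp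
  then have "act A x ([:-z, 1:] * q) = (\<Sum>i\<le>Suc ?n. coeff ([:-z, 1:] * q) i *s ?X i)" by (rule act_eq)
  also have "\<dots> = (\<Sum>i\<le>Suc ?n. coeff (pCons 0 q) i *s ?X i - z *s (coeff q i *s ?X i))"
    by (intro sum.cong) (simp_all add: vector_sub_rdistrib vector_smult_assoc vec.scale_left_distrib algebra_simps)
  also have "\<dots> = (\<Sum>i\<le>Suc ?n. coeff (pCons 0 q) i *s ?X i) - z *s (\<Sum>i\<le>Suc ?n. coeff q i *s ?X i)"
    by (simp only: sum_subtractf vec.scale_sum_right)
  also have "(\<Sum>i\<le>Suc ?n. coeff q i *s ?X i) = act A x q" by (rule act_eq[symmetric]) simp
  also have "(\<Sum>i\<le>Suc ?n. coeff (pCons 0 q) i *s ?X i) = (\<Sum>i\<le>?n. coeff q i *s ?X (Suc i))"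
    by (subst sum.atMost_Suc_shift) (simp add: vec_eq_iff)
  also have "\<dots> = A *v act A x q"
    unfolding act_def vec.linear_sum[OF matrix_vector_mul_linear_gen, of A] vector_scalar_commute by simp
  finally show ?thesis .
qed

text \<open>Take a nonzero polynomial of least degree that annihilates x and split off a complex
  root z. The cofactor applied to x is an eigenvector, and as a combination of iterates of x it has
  real and imaginary parts in \<open>V\<close>.\<close>

lemma invariant_eigp:
  fixes P :: "real ^ 'd ^ 'd"
  assumes V: "subspace V" and inv: "\<And>x. x \<in> V ==> P *v x \<in> V" and x: "x \<in> V" "x ~= 0"
  shows "\<exists>z u v. (u ~= 0 \<or> v ~= 0) & u \<in> V & v \<in> V & eigp P z u v"
proof -
  let ?X = "\<lambda>i. ((*v) P ^^ i) x"
  let ?cx = "\<chi> i. complex_of_real (x $ i)"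
  have XV: "?X i \<in> V" for i by (induction i) (auto simp: x inv)
  have cX: "((*v) (cmat P) ^^ i) ?cx = (\<chi> k. complex_of_real (?X i $ k))" for i
    by (induction i) (simp_all add: vec_eq_iff matrix_vector_mult_def cmat_def)
  have "\<exists>c. (\<exists>i\<le>CARD('d). c i ~= 0) & (\<Sum>i\<le>CARD('d). c i *\<^sub>R ?X i) = 0"
  proof (cases "inj_on ?X {..CARD('d)}")
    case True
    then have "card (?X ` {..CARD('d)}) > DIM(real ^ 'd)" by (simp add: card_image)
    then have "dependent (?X ` {..CARD('d)})" by (simp add: dependent_biggerset)
    then obtain u where u: "\<exists>v\<in>?X ` {..CARD('d)}. u v ~= 0" "(\<Sum>v\<in>?X ` {..CARD('d)}. u v *\<^sub>R v) = 0"
      by (auto simp: dependent_finite)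
    then have "(\<Sum>i\<le>CARD('d). u (?X i) *\<^sub>R ?X i) = 0"
      using True by (simp add: sum.reindex)
    then show ?thesis using u(1) by (intro exI[of _ "\<lambda>i. u (?X i)"]) auto
  next
    case False
    then obtain i j where ij: "i <= CARD('d)" "j <= CARD('d)" "i ~= j" "?X i = ?X j"
      unfolding inj_on_def by auto
    have "(\<Sum>k\<le>CARD('d). (if k = i then 1 else if k = j then -1 else 0) *\<^sub>R ?X k)
        = (\<Sum>k\<le>CARD('d). (if k = i then ?X i else 0) - (if k = j then ?X j else 0))"
      using ij by (intro sum.cong) auto
    also have "\<dots> = 0" using ij by (simp add: sum_subtractf)
    finally show ?thesis using ij by (intro exI[of _ "\<lambda>k. if k = i then 1 else if k = j then -1 else 0"]) auto
  qed
  then obtain c where c: "\<exists>i\<le>CARD('d). c i ~= (0::real)" "(\<Sum>i\<le>CARD('d). c i *\<^sub>R ?X i) = 0" by blast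
  define p0 where "p0 = (\<Sum>i\<le>CARD('d). monom (complex_of_real (c i)) i)"
  have cp: "coeff p0 i = (if i <= CARD('d) then complex_of_real (c i) else 0)" for i
    by (simp add: p0_def coeff_sum)
  have "p0 ~= 0" using c(1) cp by (metis coeff_0 of_real_eq_0_iff)
  moreover have "act (cmat P) ?cx p0 = 0"
  proof -
    have "degree p0 <= CARD('d)" by (rule degree_le) (simp add: cp)
    then have "act (cmat P) ?cx p0 = (\<Sum>i\<le>CARD('d). coeff p0 i *s ((*v) (cmat P) ^^ i) ?cx)" by (rule act_eq)
    also have "\<dots> = (\<chi> k. complex_of_real ((\<Sum>i\<le>CARD('d). c i *\<^sub>R ?X i) $ k))"
      unfolding cX by (simp add: vec_eq_iff cp)
    finally show ?thesis unfolding c(2) by (simp add: vec_eq_iff)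
  qed
  ultimately obtain p where p: "p ~= 0" "act (cmat P) ?cx p = 0"
    and min: "\<And>q. q ~= 0 ==> act (cmat P) ?cx q = 0 ==> degree p <= degree q"
    using ex_has_least_nat[of "\<lambda>p. p ~= 0 & act (cmat P) ?cx p = 0" p0 degree] by blast
  have "degree p ~= 0"
  proof
    assume "degree p = 0"
    then have "act (cmat P) ?cx p = coeff p 0 *s ?cx" by (simp add: act_def)
    moreover have "coeff p 0 ~= 0" using p(1) \<open>degree p = 0\<close> by (metis leading_coeff_0_iff)
    ultimately show False using p(2) x(2) by (auto simp: vec_eq_iff)
  qed
  then obtain z where "poly p z = 0"
    using fundamental_theorem_of_algebra[of p] constant_degree[of p] by auto
  then obtain q where q: "p = [:-z, 1:] * q" by (auto simp: poly_eq_0_iff_dvd)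
  have q0: "q ~= 0" using p(1) q by auto
  have "degree p = Suc (degree q)" unfolding q using q0 by (subst degree_mult_eq) auto
  then have w0: "act (cmat P) ?cx q ~= 0" using min[OF q0] by auto
  define w where "w = act (cmat P) ?cx q"
  have ew: "cmat P *v w = z *s w"
    using p(2) act_linear_factor[of "cmat P" ?cx z q] unfolding q w_def by simp
  let ?u = "\<chi> i. Re (w $ i)" and ?v = "\<chi> i. Im (w $ i)"
  have "?u = (\<Sum>i\<le>degree q. Re (coeff q i) *\<^sub>R ?X i)" "?v = (\<Sum>i\<le>degree q. Im (coeff q i) *\<^sub>R ?X i)"
    unfolding w_def act_def cX by (simp_all add: vec_eq_iff)
  then have uvV: "?u \<in> V" "?v \<in> V" using XV V by (simp_all add: subspace_sum subspace_scale)
  have e: "(\<Sum>j\<in>UNIV. complex_of_real (P $ i $ j) * w $ j) = z * w $ i" for i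
    using ew by (simp add: vec_eq_iff matrix_vector_mult_def cmat_def)
  have "?u ~= 0 \<or> ?v ~= 0" using w0 unfolding w_def[symmetric] by (auto simp: vec_eq_iff complex_eq_iff)
  moreover have "eigp P z ?u ?v"
    using arg_cong[OF e, of Re] arg_cong[OF e, of Im]
    by (simp add: eigp_def vec_eq_iff matrix_vector_mult_def)
  ultimately show ?thesis using uvV by blast
qed

subsection \<open>Transversality\<close>

definition transv :: "real ^ 'd ^ 'd \<Rightarrow> (real ^ 'd) set \<Rightarrow> (real ^ 'd) set \<Rightarrow> bool" where
  "transv Z U S \<longleftrightarrow> (\<forall>u\<in>U. Z *v u \<in> S --> u = 0)"

lemma subspace_kernel_map:
  fixes S :: "'a::euclidean_space set"
  assumes "subspace S"
  shows "\<exists>f :: 'a \<Rightarrow> 'a. linear f & (\<forall>x. f x = 0 \<longleftrightarrow> x \<in> S)"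
proof -
  obtain B where B: "B \<subseteq> S" "pairwise orthogonal B" "\<And>x. x \<in> B ==> norm x = 1" "independent B" "span B = S"
    using orthonormal_basis_subspace[OF assms] by metis
  have fin: "finite B" using B(4) independent_imp_finite by blast
  let ?f = "\<lambda>x. x - (\<Sum>b\<in>B. (x \<bullet> b) *\<^sub>R b)"
  have "linear ?f"
    by (intro linear_compose_sub linear_compose_sum linear_id[unfolded id_def] ballI)
      (auto intro!: linearI simp: inner_add_left algebra_simps)
  moreover have "?f x = 0 \<longleftrightarrow> x \<in> S" for x
  proof
    assume "?f x = 0"
    then have "x = (\<Sum>b\<in>B. (x \<bullet> b) *\<^sub>R b)" by simp
    then show "x \<in> S" using assms B(1) subspace_sum subspace_scale by (metis (no_types, lifting) subsetD)
  next
    assume "x \<in> S"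
    then show "?f x = 0" using orthonormal_basis_expand[OF B(2,3) _ fin, of x] B(5) by simp
  qed
  ultimately show ?thesis by blast
qed

lemma transv_left_inverse:
  assumes t: "transv Z U S" and U: "subspace U" and S: "subspace S"
  shows "\<exists>h :: real ^ 'd \<Rightarrow> real ^ 'd. linear h & (\<forall>s\<in>S. h s = 0) & (\<forall>u\<in>U. h (Z *v u) = u)"
proof -
  obtain f :: "real ^ 'd \<Rightarrow> real ^ 'd" where f: "linear f" "\<And>x. f x = 0 \<longleftrightarrow> x \<in> S" using subspace_kernel_map[OF S] by blast
  let ?g = "\<lambda>u. f (Z *v u)"
  have g: "linear ?g" using linear_compose[OF matrix_vector_mul_linear f(1)] by (simp add: comp_def)
  have "inj_on ?g U"
    unfolding linear_injective_on_subspace_0[OF g U] using t f(2) unfolding transv_def by blast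
  then obtain k where k: "linear k" "\<forall>u\<in>U. k (?g u) = u" using linear_exists_left_inverse_on[OF g U] by blast
  show ?thesis
  proof (intro exI[of _ "k \<circ> f"] conjI ballI)
    show "linear (k \<circ> f)" by (rule linear_compose[OF f(1) k(1)])
    fix s assume "s \<in> S"
    then have "f s = 0" using f(2) by blast
    then show "(k \<circ> f) s = 0" using linear_0[OF k(1)] by simp
  qed (use k in auto)
qed

text \<open>A left inverse of \<open>Z\<close> on \<open>U\<close> that kills \<open>S\<close> turns
  a failure at the parameter s into the eigenvalue -1/s of a fixed matrix.\<close>

lemma finite_not_transv:
  fixes Z Y :: "real ^ 'd ^ 'd"
  assumes t: "transv Z U S" and U: "subspace U" and S: "subspace S"
  shows "finite {s. \<not> transv (Z + s *\<^sub>R Y) U S}"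
proof -
  obtain h :: "real ^ 'd \<Rightarrow> real ^ 'd" where h: "linear h" "\<And>s. s \<in> S ==> h s = 0" "\<And>u. u \<in> U ==> h (Z *v u) = u"
    using transv_left_inverse[OF assms] by blast
  let ?H = "matrix (\<lambda>u. h (Y *v u))"
  have lin: "linear (\<lambda>u. h (Y *v u))" using linear_compose[OF matrix_vector_mul_linear h(1)] by (simp add: comp_def)
  have H: "?H *v u = h (Y *v u)" for u
    using matrix_works[of "\<lambda>u. h (Y *v u)"] lin by (simp add: linear_matrix_vector_mul_eq)
  have "{s. \<not> transv (Z + s *\<^sub>R Y) U S} \<subseteq> (\<lambda>z. - 1 / Re z) ` spec ?H"
  proof
    fix s assume "s \<in> {s. \<not> transv (Z + s *\<^sub>R Y) U S}"
    then obtain u where u: "u \<in> U" "(Z + s *\<^sub>R Y) *v u \<in> S" "u ~= 0" unfolding transv_def by blast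
    have "h ((Z + s *\<^sub>R Y) *v u) = u + s *\<^sub>R (?H *v u)"
      using u(1) h(3) by (simp add: H matrix_vector_mult_add_rdistrib scaleR_matrix_vector_assoc[symmetric]
          linear_add[OF h(1)] linear_cmul[OF h(1)])
    then have 0: "u + s *\<^sub>R (?H *v u) = 0" using h(2)[OF u(2)] by simp
    then have s: "s ~= 0" using u(3) by auto
    have "s *\<^sub>R (?H *v u) = - u" using 0 by (simp add: add_eq_0_iff)
    then have "(1 / s) *\<^sub>R (s *\<^sub>R (?H *v u)) = (- 1 / s) *\<^sub>R u" by simp
    then have "?H *v u = (- 1 / s) *\<^sub>R u" using s by simp
    then have "complex_of_real (- 1 / s) \<in> spec ?H"
      unfolding spec_iff_real using u(3) by (intro exI[of _ u] exI[of _ 0]) simp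
    then show "s \<in> (\<lambda>z. - 1 / Re z) ` spec ?H" by (rule rev_image_eqI) (use s in simp)
  qed
  then show ?thesis using finite_spec[of ?H] finite_subset by blast
qed

lemma transv_scale: "c ~= 0 ==> subspace S ==> transv (c *\<^sub>R Z) U S \<longleftrightarrow> transv Z U S"
  unfolding transv_def scaleR_matrix_vector_assoc[symmetric] using subspace_scale
  by (metis (no_types, lifting) left_inverse scaleR_one scaleR_scaleR)

text \<open>A map good for \<open>F\<close> and a map good for \<open>k\<close> are joined by a
  line. Each condition fails for finitely many parameters only: those of \<open>F\<close> by
  comparison with s = 0, the new one by comparison with s = infinity, that is, after division by
  s.\<close>

lemma transv_exists:
  fixes U S :: "'i \<Rightarrow> (real ^ 'd) set"
  assumes "finite F" "\<And>i. i \<in> F ==> subspace (U i) & subspace (S i) & dim (U i) + dim (S i) <= CARD('d)"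
  shows "\<exists>X. \<forall>i\<in>F. transv X (U i) (S i)"
  using assms
proof (induction F)
  case (insert k F)
  have "\<exists>X. \<forall>i\<in>F. transv X (U i) (S i)" by (rule insert.IH) (use insert.prems in auto)
  then obtain X where X: "\<And>i. i \<in> F ==> transv X (U i) (S i)" by blast
  have sub: "subspace (U k)" "subspace (S k)" and dm: "dim (U k) + dim (S k) <= CARD('d)" using insert by auto
  define N where "N = {y. \<forall>x\<in>S k. orthogonal x y}"
  have "dim {y \<in> UNIV. \<forall>x\<in>S k. orthogonal x y} + dim (S k) = dim (UNIV :: (real ^ 'd) set)"
    by (rule dim_subspace_orthogonal_to_vectors) (use sub in auto)
  then have dN: "dim (U k) <= dim N" using dm by (simp add: N_def)
  have sN: "subspace N" unfolding N_def by (rule subspace_orthogonal_to_vectors)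
  \<comment> \<open>The dimension hypothesis leaves room to embed \<open>U k\<close> isometrically
    into the orthogonal complement of \<open>S k\<close>.\<close>
  obtain f where f: "linear f" "f \<in> U k \<rightarrow> N" "\<And>x. x \<in> U k ==> norm (f x) = norm x"
    by (rule isometry_subset_subspace[OF sub(1) sN dN]) blast
  have mf: "matrix f *v x = f x" for x
    using matrix_works[of f] f(1) by (simp add: linear_matrix_vector_mul_eq)
  have X': "transv (matrix f) (U k) (S k)"
    unfolding transv_def mf
  proof (intro ballI impI)
    fix u assume u: "u \<in> U k" "f u \<in> S k"
    then have "orthogonal (f u) (f u)" using f(2) unfolding N_def by blast
    then have "f u = 0" by (simp add: orthogonal_def)
    then show "u = 0" using f(3)[OF u(1)] by simp
  qed
  let ?Y = "matrix f"
  have "finite (\<Union>i\<in>F. {s. \<not> transv (X + s *\<^sub>R ?Y) (U i) (S i)})"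
    using insert finite_not_transv[OF X] by auto
  moreover have "finite ((\<lambda>s. 1 / s) ` {s. \<not> transv (?Y + s *\<^sub>R X) (U k) (S k)})"
    using finite_not_transv[OF X' sub] by blast
  ultimately obtain s where s0: "s \<notin> insert 0 ((\<Union>i\<in>F. {s. \<not> transv (X + s *\<^sub>R ?Y) (U i) (S i)}) \<union>
      (\<lambda>s. 1 / s) ` {s. \<not> transv (?Y + s *\<^sub>R X) (U k) (S k)})"
    by (meson ex_new_if_finite infinite_UNIV_char_0 finite_UnI finite_insert)
  then have s: "s ~= 0" "s \<notin> (\<lambda>s. 1 / s) ` {s. \<not> transv (?Y + s *\<^sub>R X) (U k) (S k)}" by simp_all
  have sF: "transv (X + s *\<^sub>R ?Y) (U i) (S i)" if "i \<in> F" for i using s0 that by simp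
  have "transv (?Y + (1 / s) *\<^sub>R X) (U k) (S k)"
  proof (rule ccontr)
    assume "\<not> ?thesis"
    then have "1 / (1 / s) \<in> (\<lambda>s. 1 / s) ` {s. \<not> transv (?Y + s *\<^sub>R X) (U k) (S k)}" by blast
    then show False using s by simp
  qed
  then have "transv (s *\<^sub>R (?Y + (1 / s) *\<^sub>R X)) (U k) (S k)" using transv_scale[OF s(1) sub(2)] by blast
  moreover have "s *\<^sub>R (?Y + (1 / s) *\<^sub>R X) = X + s *\<^sub>R ?Y" using s(1) by (simp add: scaleR_add_right add.commute)
  ultimately have "transv (X + s *\<^sub>R ?Y) (U k) (S k)" by simp
  then show ?case using sF by blast
qed simp

text \<open>On the line X + s 1 the exceptional values are finite in number, hence bounded; after
  rescaling, all small positive s are good for 1 + s X. The transversal maps are thus near the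
  identity and can be realised by small perturbations of a cocycle.\<close>

lemma transv_small:
  fixes U S :: "'i \<Rightarrow> (real ^ 'd) set"
  assumes F: "finite F" and sd: "\<And>i. i \<in> F ==> subspace (U i) & subspace (S i) & dim (U i) + dim (S i) <= CARD('d)"
  shows "\<exists>X. \<exists>\<epsilon>>0. \<forall>s. 0 < s & s < \<epsilon> --> (\<forall>i\<in>F. transv (mat 1 + s *\<^sub>R X) (U i) (S i))"
proof -
  have "\<exists>X. \<forall>i\<in>F. transv X (U i) (S i)" by (rule transv_exists[OF F]) (rule sd)
  then obtain X where X: "\<And>i. i \<in> F ==> transv X (U i) (S i)" by blast
  define T where "T = (\<Union>i\<in>F. {s. \<not> transv (X + s *\<^sub>R mat 1) (U i) (S i)})"
  have T: "finite T" unfolding T_def using F finite_not_transv[OF X] sd by blast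
  then obtain B where B: "B > 0" "\<And>s. s \<in> T ==> \<bar>s\<bar> <= B"
    using finite_imp_bounded[OF T] unfolding bounded_pos by auto
  have "transv (mat 1 + s *\<^sub>R X) (U i) (S i)" if s: "0 < s" "s < 1 / B" and i: "i \<in> F" for s i
  proof -
    have "B < 1 / s" using s B(1) by (simp add: field_simps)
    then have "1 / s \<notin> T" using B(2)[of "1 / s"] s(1) by fastforce
    then have "transv (X + (1 / s) *\<^sub>R mat 1) (U i) (S i)" using i unfolding T_def by blast
    then have "transv (s *\<^sub>R (X + (1 / s) *\<^sub>R mat 1)) (U i) (S i)" using transv_scale s(1) sd[OF i] by (metis less_irrefl)
    moreover have "s *\<^sub>R (X + (1 / s) *\<^sub>R mat 1) = mat 1 + s *\<^sub>R X" using s(1) by (simp add: scaleR_add_right add.commute)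
    ultimately show ?thesis by simp
  qed
  then show ?thesis using B(1) by (intro exI[of _ X] exI[of _ "1 / B"]) auto
qed

lemma pow_le_imp_base_le:
  assumes "\<And>n. x ^ n <= C * y ^ n" "0 <= x" "(0::real) < y"
  shows "x <= y"
proof (rule ccontr)
  assume "\<not> x <= y"
  then have "1 < x / y" using assms by simp
  then obtain n where n: "C < (x / y) ^ n" using real_arch_pow by blast
  have "(x / y) ^ n <= C" using assms(1)[of n] assms(3) by (simp add: power_divide field_simps)
  then show False using n by simp
qed

lemma eigp_inv_pow:
  fixes P :: "real ^ 'd ^ 'd"
  assumes P: "invertible P" and e: "eigp P z u v"
  shows "(cmod z ^ n)\<^sup>2 * ((norm (((*v) (matrix_inv P) ^^ n) u))\<^sup>2 + (norm (((*v) (matrix_inv P) ^^ n) v))\<^sup>2)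
     = (norm u)\<^sup>2 + (norm v)\<^sup>2"
proof -
  let ?b = "\<lambda>n. (*v) (matrix_inv P) ^^ n"
  have "eigp P z (?b n u) (?b n v) & (cmod z ^ n)\<^sup>2 * ((norm (?b n u))\<^sup>2 + (norm (?b n v))\<^sup>2) = (norm u)\<^sup>2 + (norm v)\<^sup>2"
  proof (induction n)
    case 0 then show ?case using e by simp
  next
    case (Suc n)
    have 1: "eigp P z (?b (Suc n) u) (?b (Suc n) v)" using eigp_inv[OF P] Suc by simp
    have "(cmod z)\<^sup>2 * ((norm (?b (Suc n) u))\<^sup>2 + (norm (?b (Suc n) v))\<^sup>2) = (norm (?b n u))\<^sup>2 + (norm (?b n v))\<^sup>2"
      using eigp_norm[OF 1] invertible_inv[OF P] by simp
    then have "(cmod z ^ n)\<^sup>2 * ((cmod z)\<^sup>2 * ((norm (?b (Suc n) u))\<^sup>2 + (norm (?b (Suc n) v))\<^sup>2)) = (norm u)\<^sup>2 + (norm v)\<^sup>2"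
      using Suc by simp
    then show ?case using 1 by (simp add: power_mult_distrib mult.assoc mult.left_commute)
  qed
  then show ?thesis by blast
qed

lemma norm_le_sqrt_sum: "norm u <= sqrt ((norm u)\<^sup>2 + (norm v)\<^sup>2)" "norm v <= sqrt ((norm u)\<^sup>2 + (norm v)\<^sup>2)"
  by (simp_all add: real_le_rsqrt)

lemma eigp_in_Vsp:
  fixes P :: "real ^ 'd ^ 'd"
  assumes P: "invertible P" and e: "eigp P z u v" and z: "a <= cmod z" "cmod z <= b" "0 < a"
  shows "u \<in> Vsp P b a" "v \<in> Vsp P b a"
proof -
  let ?s = "sqrt ((norm u)\<^sup>2 + (norm v)\<^sup>2)"
  have f: "sqrt ((norm (((*v) P ^^ n) u))\<^sup>2 + (norm (((*v) P ^^ n) v))\<^sup>2) <= ?s * b ^ n" for n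
  proof -
    have "sqrt ((norm (((*v) P ^^ n) u))\<^sup>2 + (norm (((*v) P ^^ n) v))\<^sup>2) = cmod z ^ n * ?s"
      using conjunct2[OF eigp_pow[OF e, of n]] by (simp add: real_sqrt_mult)
    also have "\<dots> <= b ^ n * ?s" using z by (intro mult_right_mono power_mono) auto
    finally show ?thesis by (simp add: mult.commute)
  qed
  have g: "sqrt ((norm (((*v) (matrix_inv P) ^^ n) u))\<^sup>2 + (norm (((*v) (matrix_inv P) ^^ n) v))\<^sup>2) <= ?s / a ^ n" for n
  proof -
    let ?t = "sqrt ((norm (((*v) (matrix_inv P) ^^ n) u))\<^sup>2 + (norm (((*v) (matrix_inv P) ^^ n) v))\<^sup>2)"
    have "?s = cmod z ^ n * ?t" unfolding eigp_inv_pow[OF P e, of n, symmetric] by (simp add: real_sqrt_mult)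
    moreover have "a ^ n * ?t <= cmod z ^ n * ?t" using z by (intro mult_right_mono power_mono) auto
    ultimately have "a ^ n * ?t <= ?s" by simp
    then show ?thesis using z(3) by (simp add: field_simps)
  qed
  show "u \<in> Vsp P b a" "v \<in> Vsp P b a" unfolding Vsp_def
    using f g norm_le_sqrt_sum order_trans by blast+
qed

lemma Vsp_eigp_range:
  fixes P :: "real ^ 'd ^ 'd"
  assumes P: "invertible P" and e: "eigp P z u v" and nz: "u ~= 0 \<or> v ~= 0" and ab: "0 < a" "0 < b"
    and uv: "u \<in> Vsp P b a" "v \<in> Vsp P b a"
  shows "a <= cmod z" "cmod z <= b"
proof -
  let ?s = "sqrt ((norm u)\<^sup>2 + (norm v)\<^sup>2)"
  have s: "?s > 0" using nz by (auto simp: add_pos_nonneg add_nonneg_pos)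
  obtain C D C' D' where C: "\<And>n. norm (((*v) P ^^ n) u) <= C * b ^ n" "\<And>n. norm (((*v) P ^^ n) v) <= D * b ^ n"
    and D: "\<And>n. norm (((*v) (matrix_inv P) ^^ n) u) <= C' / a ^ n" "\<And>n. norm (((*v) (matrix_inv P) ^^ n) v) <= D' / a ^ n"
    using uv unfolding Vsp_def by blast
  have le: "sqrt (x\<^sup>2 + y\<^sup>2) <= x + y" if "0 <= x" "0 <= y" for x y :: real
    using that by (rule sqrt_sum_squares_le_sum)
  show "cmod z <= b"
  proof (rule pow_le_imp_base_le[of _ "(C + D) / ?s"])
    fix n
    have "cmod z ^ n * ?s = sqrt ((norm (((*v) P ^^ n) u))\<^sup>2 + (norm (((*v) P ^^ n) v))\<^sup>2)"
      using conjunct2[OF eigp_pow[OF e, of n]] by (simp add: real_sqrt_mult)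
    also have "\<dots> <= (C + D) * b ^ n" using le C[of n] unfolding distrib_right by (smt (verit) norm_ge_zero)
    finally show "cmod z ^ n <= (C + D) / ?s * b ^ n" using s by (simp add: field_simps)
  qed (use ab in auto)
  show "a <= cmod z"
  proof (rule pow_le_imp_base_le[of _ "(C' + D') / ?s"])
    have s1: "?s <= cmod z ^ n * ((C' + D') / a ^ n)" for n
    proof -
      have "?s = cmod z ^ n * sqrt ((norm (((*v) (matrix_inv P) ^^ n) u))\<^sup>2 + (norm (((*v) (matrix_inv P) ^^ n) v))\<^sup>2)"
        unfolding eigp_inv_pow[OF P e, of n, symmetric] by (simp add: real_sqrt_mult)
      also have "\<dots> <= cmod z ^ n * ((C' + D') / a ^ n)"
        using le D[of n] unfolding add_divide_distrib
        by (intro mult_left_mono) (smt (verit) norm_ge_zero, simp)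
      finally show ?thesis .
    qed
    then show "a ^ n <= (C' + D') / ?s * cmod z ^ n" for n
      using s ab s1[of n] by (simp add: field_simps)
    show "0 < cmod z" using s1[of 1] s by (cases "z = 0") auto
  qed (use ab in auto)
qed

text \<open>The spectral space between the two gaps is invariant, and nonzero because it projects
  onto the coordinates K - J; growth rates confine its eigenvalues.\<close>

lemma class_eigenvalue:
  fixes P :: "real ^ 'd ^ 'd"
  assumes P: "invertible P" and cJ: "cone_pres P J" and gJ: "grow P J aJ bJ" and cK: "cone_pres P K" and gK: "grow P K aK bK"
    and ab: "0 < bJ" "bJ < aJ" "0 < bK" "bK < aK" and JK: "J \<subseteq> K" "K - J ~= {}"
  shows "\<exists>z\<in>spec P. aK <= cmod z & cmod z <= bJ"
proof -
  obtain i where i: "i \<in> K - J" using JK(2) by blast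
  have "axis i (1::real) $ k = 0" if "k \<notin> K - J" for k using that i by (auto simp: axis_def)
  then obtain v where v: "v \<in> Vsp P bJ aK" "pr (K - J) v = axis i 1"
    using Vsp_exists[OF assms(1-9) JK(1), of "axis i 1"] by blast
  have "v ~= 0" using v(2) linear_0[OF linear_pr, of "K - J"] axis_eq_0_iff[of i "1::real"] by (metis zero_neq_one)
  have ab': "0 < aK" using ab by linarith
  obtain z x y where "x ~= 0 \<or> y ~= 0" "x \<in> Vsp P bJ aK" "y \<in> Vsp P bJ aK" "eigp P z x y"
    using invariant_eigp[OF subspace_Vsp Vsp_invariant[OF P] v(1) \<open>v ~= 0\<close>] ab ab' less_imp_le by metis
  then show ?thesis using Vsp_eigp_range[OF P] ab ab' spec_eigp by metis
qed

lemma Vsp_inj: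
  fixes P :: "real ^ 'd ^ 'd"
  assumes P: "invertible P" and cJ: "cone_pres P J" and gJ: "grow P J aJ bJ" and cK: "cone_pres P K" and gK: "grow P K aK bK"
    and ab: "0 < bJ" "bJ < aJ" "0 < bK" "bK < aK" and JK: "J \<subseteq> K" and v: "v \<in> Vsp P bJ aK" "pr (K - J) v = 0"
  shows "v = 0"
  using class_bound[OF JK Vsp_orbits[OF assms(1-9) v(1)]] v(2) by (simp add: en_def)

text \<open>With a single central coordinate the spectral space projects injectively to a line, so
  the real and imaginary parts of an eigenvector in it are linearly dependent.\<close>

lemma class_real:
  fixes P :: "real ^ 'd ^ 'd"
  assumes P: "invertible P" and cJ: "cone_pres P J" and gJ: "grow P J aJ bJ" and cK: "cone_pres P K" and gK: "grow P K aK bK"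
    and ab: "0 < bJ" "bJ < aJ" "0 < bK" "bK < aK" and JK: "J \<subseteq> K" "K - J = {i}"
    and z: "z \<in> spec P" "aK <= cmod z" "cmod z <= bJ"
  shows "Im z = 0"
proof (rule ccontr)
  assume im: "Im z ~= 0"
  obtain u v where uv: "u ~= 0 \<or> v ~= 0" "eigp P z u v" using z spec_eigp by blast
  have ab': "0 < aK" using ab by linarith
  note V = eigp_in_Vsp[OF P uv(2) z(2,3) ab']
  have sub: "subspace (Vsp P bJ aK)" using ab ab' by (intro subspace_Vsp) auto
  let ?x = "(v $ i) *\<^sub>R u - (u $ i) *\<^sub>R v"
  have "?x \<in> Vsp P bJ aK" using V sub subspace_diff subspace_scale by blast
  moreover have "pr (K - J) ?x = 0" using JK(2) by (auto simp: pr_def vec_eq_iff)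
  ultimately have x0: "(v $ i) *\<^sub>R u = (u $ i) *\<^sub>R v" using Vsp_inj[OF assms(1-9) JK(1)] by fastforce
  have ne: "u $ i ~= 0 \<or> v $ i ~= 0"
  proof (rule ccontr)
    assume "\<not> ?thesis"
    then have "pr (K - J) u = 0" "pr (K - J) v = 0" using JK(2) by (auto simp: pr_def vec_eq_iff)
    then show False using Vsp_inj[OF assms(1-9) JK(1)] V uv(1) by blast
  qed
  have "(v $ i) *\<^sub>R (P *v u) = (u $ i) *\<^sub>R (P *v v)" using x0 matrix_vector_mult_scaleR by metis
  then have "((v $ i) *\<^sub>R (Re z *\<^sub>R u - Im z *\<^sub>R v)) $ i = ((u $ i) *\<^sub>R (Im z *\<^sub>R u + Re z *\<^sub>R v)) $ i"
    using uv(2) unfolding eigp_def by simp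
  then have "v $ i * (Re z * u $ i - Im z * v $ i) = u $ i * (Im z * u $ i + Re z * v $ i)"
    by simp
  then have "Im z * ((u $ i)\<^sup>2 + (v $ i)\<^sup>2) = 0" by (simp add: algebra_simps power2_eq_square)
  then show False using im ne by (auto simp: sum_power2_eq_zero_iff)
qed

section \<open>Stable and unstable spaces along half orbits\<close>

primrec qp :: "(nat \<Rightarrow> real ^ 'd ^ 'd) \<Rightarrow> nat \<Rightarrow> real ^ 'd ^ 'd" where
  "qp L 0 = mat 1"
| "qp L (Suc n) = L n ** qp L n"

text \<open>\<open>qp\<close> puts later factors on the left, as along a forward half orbit;
  \<open>qm\<close> puts them on the right, because its index counts steps into the past.\<close>

primrec qm :: "(nat \<Rightarrow> real ^ 'd ^ 'd) \<Rightarrow> nat \<Rightarrow> real ^ 'd ^ 'd" where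
  "qm L 0 = mat 1"
| "qm L (Suc n) = qm L n ** L n"

lemma invertible_mat1: "invertible (mat 1 :: real ^ 'd ^ 'd)"
  unfolding invertible_def by (auto intro!: exI[of _ "mat 1"])

lemma invertible_qm: "(\<And>n. invertible (L n)) ==> invertible (qm L n)"
  by (induction n) (simp_all add: invertible_mat1 invertible_mult)

text \<open>The vectors live at the point reached by the past \<open>qm\<close> followed by
  \<open>Z\<close>; backward decay at rate \<open>a\<close> marks the unstable space of a gap there.
  \<open>Ssp\<close> is the stable counterpart, read through \<open>Z\<close> and the
  future.\<close>

definition Usp :: "(nat \<Rightarrow> real ^ 'd ^ 'd) \<Rightarrow> real ^ 'd ^ 'd \<Rightarrow> real \<Rightarrow> (real ^ 'd) set" where
  "Usp L Z a = {w. \<exists>C. \<forall>j. norm (matrix_inv (Z ** qm L j) *v w) <= C * (1 / a ^ j)}"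

definition Ssp :: "(nat \<Rightarrow> real ^ 'd ^ 'd) \<Rightarrow> real ^ 'd ^ 'd \<Rightarrow> real \<Rightarrow> (real ^ 'd) set" where
  "Ssp L Z b = {w. \<exists>C. \<forall>j. norm ((qp L j ** Z) *v w) <= C * b ^ j}"

lemma subspace_Usp: "0 <= a ==> subspace (Usp L Z a)"
  unfolding Usp_def by (rule subspace_growth) simp_all

lemma subspace_Ssp: "0 <= b ==> subspace (Ssp L Z b)"
  unfolding Ssp_def by (rule subspace_growth) simp_all

lemma bwd_orbit:
  fixes Z :: "real ^ 'd ^ 'd"
  assumes "invertible Z" "\<And>n. invertible (L n)"
  shows "matrix_inv (Z ** qm L j) *v w = L j *v (matrix_inv (Z ** qm L (Suc j)) *v w)"
proof -
  let ?A = "Z ** qm L j" and ?B = "Z ** qm L (Suc j)"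
  have A: "invertible ?A" "invertible ?B" using assms invertible_mult invertible_qm by metis+
  have "?A *v (L j *v (matrix_inv ?B *v w)) = ?B *v (matrix_inv ?B *v w)"
    by (simp add: matrix_vector_mul_assoc matrix_mul_assoc)
  also have "\<dots> = w" using invertible_inv[OF A(2)] by simp
  finally show ?thesis using invertible_inv(2)[OF A(1)] by metis
qed

context
  fixes L :: "nat \<Rightarrow> real ^ 'd ^ 'd" and Z :: "real ^ 'd ^ 'd" and I :: "'d set" and a b :: real
  assumes Z: "invertible Z" and L: "\<And>n. invertible (L n)" "\<And>n. cone_pres (L n) I" "\<And>n. grow (L n) I a b"
    and ab: "0 < b" "b < a"
begin

lemma Usp_cone: "w \<in> Usp L Z a ==> 2 * en (- I) (matrix_inv (Z ** qm L j) *v w) <= en I (matrix_inv (Z ** qm L j) *v w)"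
proof -
  assume "w \<in> Usp L Z a"
  then obtain C where "\<And>j. norm (matrix_inv (Z ** qm L j) *v w) <= C / a ^ j" unfolding Usp_def by auto
  then show ?thesis
    using bwd_cone[of L I a b "\<lambda>j. matrix_inv (Z ** qm L j) *v w" C j, OF L(2,3) ab bwd_orbit[of Z L, OF Z L(1)]] by blast
qed

lemma Ssp_cone: "w \<in> Ssp L Z b ==> en I ((qp L j ** Z) *v w) <= en (- I) ((qp L j ** Z) *v w) / 2"
proof -
  assume "w \<in> Ssp L Z b"
  then obtain C where "\<And>j. norm ((qp L j ** Z) *v w) <= C * b ^ j" unfolding Ssp_def by auto
  moreover have "(qp L (Suc j) ** Z) *v w = L j *v ((qp L j ** Z) *v w)" for j
    by (simp add: matrix_vector_mul_assoc matrix_mul_assoc)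
  ultimately show ?thesis using fwd_cone[of L I a b "\<lambda>j. (qp L j ** Z) *v w" C j, OF L(2,3) ab] by blast
qed

lemma in_Usp:
  assumes "\<And>j. en (- I) (matrix_inv (Z ** qm L j) *v w) / 2 <= en I (matrix_inv (Z ** qm L j) *v w)"
  shows "w \<in> Usp L Z a"
proof -
  have "0 < a" using ab by simp
  then have "norm (matrix_inv (Z ** qm L j) *v w) <= 3 * en I (matrix_inv (Z ** qm L 0) *v w) * (1 / a ^ j)" for j
    using bwd_bound[of L I a b "\<lambda>j. matrix_inv (Z ** qm L j) *v w" j, OF L(3) _ bwd_orbit[of Z L, OF Z L(1)] assms] by simp
  then show ?thesis unfolding Usp_def by blast
qed

lemma in_Ssp:
  assumes "\<And>j. en I ((qp L j ** Z) *v w) <= 2 * en (- I) ((qp L j ** Z) *v w)"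
  shows "w \<in> Ssp L Z b"
proof -
  have "(qp L (Suc j) ** Z) *v w = L j *v ((qp L j ** Z) *v w)" for j
    by (simp add: matrix_vector_mul_assoc matrix_mul_assoc)
  then have "norm ((qp L j ** Z) *v w) <= 3 * en (- I) ((qp L 0 ** Z) *v w) * b ^ j" for j
    using fwd_bound[of L I a b "\<lambda>j. (qp L j ** Z) *v w" j, OF L(3) less_imp_le[OF ab(1)]] assms by blast
  then show ?thesis unfolding Ssp_def by blast
qed

lemma dim_supported: "subspace V ==> (\<And>v. v \<in> V ==> pr I' v = 0 ==> v = 0) ==> dim (V :: (real ^ 'd) set) <= card I'"
proof -
  assume V: "subspace V" and inj: "\<And>v. v \<in> V ==> pr I' v = 0 ==> v = 0"
  have "inj_on (pr I') V" unfolding linear_injective_on_subspace_0[OF linear_pr V] using inj by blast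
  then have "dim (pr I' ` V) = dim V"
    using V by (intro dim_image_eq[OF linear_pr]) (simp add: span_eq_iff[THEN iffD2])
  moreover have "dim (pr I' ` V) <= dim {x :: real ^ 'd. \<forall>i. i \<notin> I' --> x $ i = 0}"
    by (rule dim_subset) (auto simp: pr_def)
  ultimately show ?thesis by (simp add: dim_pr_zero)
qed

lemma dim_Usp: "dim (Usp L Z a) <= card I"
proof -
  let ?A = "matrix_inv (Z ** qm L 0)"
  have inv: "invertible (Z ** qm L 0)" using Z by simp
  have V: "subspace ((*v) ?A ` Usp L Z a)"
    using subspace_Usp[of a L Z] ab by (intro linear_subspace_image) auto
  have "inj ((*v) ?A)" using invertible_inv(1)[OF inv] by (metis injI)
  then have "dim ((*v) ?A ` Usp L Z a) = dim (Usp L Z a)"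
    by (intro dim_image_eq) (auto intro: inj_on_subset)
  moreover have "v = 0" if v: "v \<in> (*v) ?A ` Usp L Z a" "pr I v = 0" for v
  proof -
    obtain w where w: "w \<in> Usp L Z a" "v = ?A *v w" using v(1) by blast
    have "2 * en (- I) v <= en I v" using Usp_cone[OF w(1), of 0] w(2) by blast
    moreover have "en I v = 0" using v(2) by (simp add: en_def)
    ultimately have "norm v <= 0" using norm_le_en[of v I] en_nonneg[of "- I" v] by linarith
    then show ?thesis by simp
  qed
  ultimately show ?thesis using dim_supported[OF V, of I] by metis
qed

lemma dim_Ssp: "dim (Ssp L Z b) <= card (- I)"
proof -
  have V: "subspace ((*v) Z ` Ssp L Z b)"
    using subspace_Ssp[of b L Z] ab by (intro linear_subspace_image) auto
  have "inj ((*v) Z)" using Z inj_matrix_vector_mult by blast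
  then have "dim ((*v) Z ` Ssp L Z b) = dim (Ssp L Z b)"
    by (intro dim_image_eq) (auto intro: inj_on_subset)
  moreover have "v = 0" if v: "v \<in> (*v) Z ` Ssp L Z b" "pr (- I) v = 0" for v
  proof -
    obtain w where w: "w \<in> Ssp L Z b" "v = Z *v w" using v(1) by blast
    have "en I v <= en (- I) v / 2" using Ssp_cone[OF w(1), of 0] w(2) by simp
    moreover have "en (- I) v = 0" using v(2) by (simp add: en_def)
    ultimately have "norm v <= 0" using norm_le_en[of v I] by linarith
    then show ?thesis by simp
  qed
  ultimately show ?thesis using dim_supported[OF V, of "- I"] by metis
qed

end

lemma matrix_vector_lim:
  fixes f :: "nat \<Rightarrow> real ^ 'd"
  shows "f \<longlonglongrightarrow> l ==> (\<lambda>n. A *v f n) \<longlonglongrightarrow> A *v l"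
  by (intro tendsto_matrix_vector tendsto_const)

text \<open>If cones failed to be preserved for arbitrarily long pieces, there would be unit vectors
  in the middle of the excursion with long pasts in the wide cone and long futures outside the
  narrow one. A limit would lie in \<open>Usp\<close> and its image under \<open>R\<close> in
  \<open>Ssp\<close>, against transversality.\<close>

lemma excursion_cone:
  fixes Lp Lm :: "nat \<Rightarrow> real ^ 'd ^ 'd"
  assumes inv: "invertible Zp" "invertible Zm" "invertible R" "\<And>n. invertible (Lp n)" "\<And>n. invertible (Lm n)"
    and cp: "\<And>n. cone_pres (Lp n) I" and gp: "\<And>n. grow (Lp n) I a b"
    and cm: "\<And>n. cone_pres (Lm n) I" and gm: "\<And>n. grow (Lm n) I a b" and ab: "0 < b" "b < a"
    and tr: "transv R (Usp Lm Zm a) (Ssp Lp Zp b)"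
  shows "\<exists>K. \<forall>k\<ge>K. cone_pres (qp Lp k ** Zp ** R ** Zm ** qm Lm k) I"
proof (rule ccontr)
  assume neg: "\<not> ?thesis"
  let ?P = "\<lambda>k. qp Lp k ** Zp ** R ** Zm ** qm Lm k"
  have ex: "\<exists>k\<ge>K. \<exists>w. norm w = 1 \<and>
      (\<forall>j\<le>k. en (- I) (matrix_inv (Zm ** qm Lm j) *v w) / 2 <= en I (matrix_inv (Zm ** qm Lm j) *v w)) \<and>
      (\<forall>j\<le>k. en I ((qp Lp j ** Zp) *v (R *v w)) <= 2 * en (- I) ((qp Lp j ** Zp) *v (R *v w)))" for K
  proof -
    obtain k where k: "k \<ge> K" "\<not> cone_pres (?P k) I" using neg by blast
    then obtain c v where c: "c = 1/2 \<or> c = 2" and v: "v ~= 0" "c * en (- I) v <= en I v"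
      "\<not> c * en (- I) (?P k *v v) < en I (?P k *v v)" unfolding cone_pres_def by blast
    have cb: "1/2 * x <= c * x" "c * x <= 2 * x" if "0 <= x" for x :: real
      using mult_right_mono[of "1/2" c x] mult_right_mono[of c 2 x] c that by fastforce+
    let ?Zk = "Zm ** qm Lm k"
    have iZ: "invertible (Zm ** qm Lm j)" for j using inv invertible_mult invertible_qm by metis
    let ?s = "norm (?Zk *v v)"
    have "?Zk *v v ~= 0"
    proof
      assume "?Zk *v v = 0"
      then have "v = matrix_inv ?Zk *v 0" using invertible_inv(2)[OF iZ[of k], of v] by simp
      then show False using v(1) by simp
    qed
    then have s: "?s > 0" by simp
    \<comment> \<open>The normalisation makes the vector in the middle of the excursion, rather than
      the initial one, a unit vector; so the limit taken there is nonzero.\<close>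
    let ?v = "(1 / ?s) *\<^sub>R v"
    let ?w = "?Zk *v ?v"
    have w1: "norm ?w = 1" using s by (simp add: matrix_vector_mult_scaleR)
    have v': "c * en (- I) ?v <= en I ?v" using v(2) s by (simp add: en_scaleR divide_right_mono)
    have b0: "matrix_inv (Zm ** qm Lm k) *v ?w = ?v" using invertible_inv(2)[OF iZ] by simp
    have B: "c * en (- I) (matrix_inv (Zm ** qm Lm j) *v ?w) <= en I (matrix_inv (Zm ** qm Lm j) *v ?w)" if "j <= k" for j
      using that
    proof (induction rule: inc_induct)
      case base then show ?case using v' unfolding b0 .
    next
      case (step n)
      then show ?case using cone_presD[OF cm c] bwd_orbit[of Zm Lm n ?w, OF inv(2,5)] by metis
    qed
    have Pk: "?P k *v ?v = (qp Lp k ** Zp) *v (R *v ?w)" by (simp add: matrix_vector_mul_assoc matrix_mul_assoc)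
    have "\<not> c * en (- I) (?P k *v ?v) < en I (?P k *v ?v)"
      using v(3) s by (simp add: matrix_vector_mult_scaleR en_scaleR divide_less_cancel)
    then have F0: "en I ((qp Lp k ** Zp) *v (R *v ?w)) <= c * en (- I) ((qp Lp k ** Zp) *v (R *v ?w))" unfolding Pk by simp
    have F: "en I ((qp Lp j ** Zp) *v (R *v ?w)) <= c * en (- I) ((qp Lp j ** Zp) *v (R *v ?w))" if "j <= k" for j
      using that
    proof (induction rule: inc_induct)
      case base then show ?case by (rule F0)
    next
      case (step n)
      have "(qp Lp (Suc n) ** Zp) *v (R *v ?w) = Lp n *v ((qp Lp n ** Zp) *v (R *v ?w))"
        by (simp add: matrix_vector_mul_assoc matrix_mul_assoc)
      then show ?case using cone_presD'[OF cp c] step.IH by metis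
    qed
    have B': "en (- I) (matrix_inv (Zm ** qm Lm j) *v ?w) / 2 <= en I (matrix_inv (Zm ** qm Lm j) *v ?w)" if "j <= k" for j
      using B[OF that] cb(1)[OF en_nonneg[of "- I" "matrix_inv (Zm ** qm Lm j) *v ?w"]] by linarith
    have F': "en I ((qp Lp j ** Zp) *v (R *v ?w)) <= 2 * en (- I) ((qp Lp j ** Zp) *v (R *v ?w))" if "j <= k" for j
      using F[OF that] cb(2)[OF en_nonneg[of "- I" "(qp Lp j ** Zp) *v (R *v ?w)"]] by linarith
    show ?thesis
      by (intro exI[of _ k] exI[of _ ?w] conjI allI impI) (fact k(1), fact w1, erule B', erule F')
  qed
  define Q where "Q k w \<longleftrightarrow> norm w = 1 \<and>
      (\<forall>j\<le>k. en (- I) (matrix_inv (Zm ** qm Lm j) *v w) / 2 <= en I (matrix_inv (Zm ** qm Lm j) *v w)) \<and>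
      (\<forall>j\<le>k. en I ((qp Lp j ** Zp) *v (R *v w)) <= 2 * en (- I) ((qp Lp j ** Zp) *v (R *v w)))" for k w
  have "\<forall>K. \<exists>k w. K <= k & Q k w" using ex unfolding Q_def by blast
  then obtain k w where "\<And>K. K <= k K & Q (k K) (w K)" by metis
  then have kw: "\<And>K. k K \<ge> K" "\<And>K. norm (w K) = 1"
    "\<And>K j. j <= k K ==> en (- I) (matrix_inv (Zm ** qm Lm j) *v w K) / 2 <= en I (matrix_inv (Zm ** qm Lm j) *v w K)"
    "\<And>K j. j <= k K ==> en I ((qp Lp j ** Zp) *v (R *v w K)) <= 2 * en (- I) ((qp Lp j ** Zp) *v (R *v w K))"
    unfolding Q_def by auto
  obtain l r where r: "strict_mono (r :: nat \<Rightarrow> nat)" "(w \<circ> r) \<longlonglongrightarrow> l"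
    using bounded_subseq[of w 1] kw(2) by auto
  then have lim: "(\<lambda>n. w (r n)) \<longlonglongrightarrow> l" by (simp add: comp_def)
  have big: "\<forall>\<^sub>F n in sequentially. j <= k (r n)" for j
    using seq_suble[OF r(1)] kw(1) by (intro eventually_sequentiallyI[of j]) (meson order_trans)
  have l1: "norm l = 1" using tendsto_norm[OF lim] kw(2) by (simp add: LIMSEQ_const_iff)
  have "l \<in> Usp Lm Zm a"
  proof (rule in_Usp[of Zm Lm I a b, OF inv(2,5) cm gm ab])
    fix j
    show "en (- I) (matrix_inv (Zm ** qm Lm j) *v l) / 2 <= en I (matrix_inv (Zm ** qm Lm j) *v l)"
    proof (rule tendsto_le[OF sequentially_bot])
      show "(\<lambda>n. en I (matrix_inv (Zm ** qm Lm j) *v w (r n))) \<longlonglongrightarrow> en I (matrix_inv (Zm ** qm Lm j) *v l)"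
        by (intro tendsto_en matrix_vector_lim lim)
      show "(\<lambda>n. en (- I) (matrix_inv (Zm ** qm Lm j) *v w (r n)) / 2) \<longlonglongrightarrow> en (- I) (matrix_inv (Zm ** qm Lm j) *v l) / 2"
        by (intro tendsto_divide tendsto_const tendsto_en matrix_vector_lim lim) simp
      show "\<forall>\<^sub>F n in sequentially. en (- I) (matrix_inv (Zm ** qm Lm j) *v w (r n)) / 2
          <= en I (matrix_inv (Zm ** qm Lm j) *v w (r n))"
        using big[of j] by eventually_elim (rule kw(3))
    qed
  qed
  moreover have "R *v l \<in> Ssp Lp Zp b"
  proof (rule in_Ssp[of Zp Lp I a b, OF inv(1,4) cp gp ab])
    fix j
    show "en I ((qp Lp j ** Zp) *v (R *v l)) <= 2 * en (- I) ((qp Lp j ** Zp) *v (R *v l))"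
    proof (rule tendsto_le[OF sequentially_bot])
      show "(\<lambda>n. 2 * en (- I) ((qp Lp j ** Zp) *v (R *v w (r n)))) \<longlonglongrightarrow> 2 * en (- I) ((qp Lp j ** Zp) *v (R *v l))"
        by (intro tendsto_mult tendsto_const tendsto_en matrix_vector_lim lim)
      show "(\<lambda>n. en I ((qp Lp j ** Zp) *v (R *v w (r n)))) \<longlonglongrightarrow> en I ((qp Lp j ** Zp) *v (R *v l))"
        by (intro tendsto_en matrix_vector_lim lim)
      show "\<forall>\<^sub>F n in sequentially. en I ((qp Lp j ** Zp) *v (R *v w (r n)))
          <= 2 * en (- I) ((qp Lp j ** Zp) *v (R *v w (r n)))"
        using big[of j] by eventually_elim (rule kw(4))
    qed
  qed
  ultimately have "l = 0" using tr unfolding transv_def by blast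
  then show False using l1 by simp
qed

section \<open>Winding of the central direction\<close>

lemma continuous_on_matrix_matrix:
  fixes A :: "'a::topological_space \<Rightarrow> real ^ 'n ^ 'm" and B :: "'a \<Rightarrow> real ^ 'k ^ 'n"
  shows "continuous_on S A ==> continuous_on S B ==> continuous_on S (\<lambda>t. A t ** B t)"
  unfolding continuous_on_def by (intro ballI tendsto_matrix_matrix) blast+

lemma continuous_on_matrix_vector:
  fixes A :: "'a::topological_space \<Rightarrow> real ^ 'n ^ 'm"
  shows "continuous_on S A ==> continuous_on S x ==> continuous_on S (\<lambda>t. A t *v x t)"
  unfolding continuous_on_def by (intro ballI tendsto_matrix_vector) blast+

lemma Vsp_invariant_inv:
  fixes P :: "real ^ 'd ^ 'd"
  assumes P: "invertible P" and v: "v \<in> Vsp P b a" and ab: "0 < a" "0 < b"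
  shows "matrix_inv P *v v \<in> Vsp P b a"
proof -
  let ?w = "matrix_inv P *v v"
  obtain C D where C: "\<And>n. norm (((*v) P ^^ n) v) <= C * b ^ n"
    and D: "\<And>n. norm (((*v) (matrix_inv P) ^^ n) v) <= D / a ^ n"
    using v unfolding Vsp_def by blast
  have "norm (((*v) (matrix_inv P) ^^ n) ?w) <= (D / a) / a ^ n" for n
    using D[of "Suc n"] by (simp add: funpow_swap1)
  moreover have "norm (((*v) P ^^ n) ?w) <= max (norm ?w) (C / b) * b ^ n" for n
  proof (cases n)
    case (Suc m)
    have "norm (((*v) P ^^ n) ?w) = norm (((*v) P ^^ m) v)"
      using Suc invertible_inv(1)[OF P] by (simp add: funpow_swap1)
    also have "\<dots> <= (C / b) * b ^ n" using C[of m] ab Suc by simp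
    also have "\<dots> <= max (norm ?w) (C / b) * b ^ n" using ab by (intro mult_right_mono) auto
    finally show ?thesis .
  qed simp
  ultimately show ?thesis unfolding Vsp_def by blast
qed

lemma Vsp_pow:
  fixes P :: "real ^ 'd ^ 'd"
  assumes P: "invertible P" and v: "v \<in> Vsp P b a" and ab: "0 < a" "0 < b"
  shows "((*v) P ^^ n) v \<in> Vsp P b a" "((*v) (matrix_inv P) ^^ n) v \<in> Vsp P b a"
  by (induction n) (use v Vsp_invariant[OF P _ ab] Vsp_invariant_inv[OF P _ ab] in auto)

lemma Vsp_I:
  fixes P :: "real ^ 'd ^ 'd"
  assumes P: "invertible P" and gJ: "grow P J aJ bJ" and gK: "grow P K aK bK" and ab: "0 < bJ" "0 < aK"
    and F: "\<And>n. en J (((*v) P ^^ n) v) <= en (- J) (((*v) P ^^ n) v) / 2"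
    and B: "\<And>n. 2 * en (- K) (((*v) (matrix_inv P) ^^ n) v) <= en K (((*v) (matrix_inv P) ^^ n) v)"
  shows "v \<in> Vsp P bJ aK"
proof -
  have F': "en J (((*v) P ^^ n) v) <= 2 * en (- J) (((*v) P ^^ n) v)" for n
    using F[of n] en_nonneg[of "- J" "((*v) P ^^ n) v"] by linarith
  have B': "en (- K) (((*v) (matrix_inv P) ^^ n) v) / 2 <= en K (((*v) (matrix_inv P) ^^ n) v)" for n
    using B[of n] en_nonneg[of "- K" "((*v) (matrix_inv P) ^^ n) v"] by linarith
  have "norm (((*v) P ^^ n) v) <= 3 * en (- J) v * bJ ^ n" for n
    using fwd_bound[of "\<lambda>_. P" J aJ bJ "\<lambda>n. ((*v) P ^^ n) v" n] gJ ab F' by simp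
  moreover have "norm (((*v) (matrix_inv P) ^^ n) v) <= 3 * en K v / aK ^ n" for n
    using bwd_bound[of "\<lambda>_. P" K aK bK "\<lambda>n. ((*v) (matrix_inv P) ^^ n) v" n] gK ab B' invertible_inv[OF P] by simp
  ultimately show ?thesis unfolding Vsp_def by blast
qed

lemma inv_vector_lim:
  fixes A :: "nat \<Rightarrow> real ^ 'd ^ 'd"
  assumes A: "A \<longlonglongrightarrow> B" and iA: "\<And>n. invertible (A n)" and iB: "invertible B" and y: "y \<longlonglongrightarrow> z"
  shows "(\<lambda>n. matrix_inv (A n) *v y n) \<longlonglongrightarrow> matrix_inv B *v z"
proof -
  let ?x = "\<lambda>n. matrix_inv (A n) *v y n" and ?l = "matrix_inv B *v z"
  obtain s where s: "s > 0" "\<And>v. s * norm v <= norm (B *v v)" using invertible_lower_bound[OF iB] by blast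
  have "(\<lambda>n. norm (A n - B)) \<longlonglongrightarrow> 0" using A by (simp add: LIM_zero tendsto_norm_zero)
  then have "\<forall>\<^sub>F n in sequentially. norm (A n - B) < s / 2" using s(1) by (intro order_tendstoD(2)) auto
  then have "\<forall>\<^sub>F n in sequentially. norm (?x n - ?l) <= (2 / s) * norm (y n - A n *v ?l)"
  proof eventually_elim
    case (elim n)
    let ?d = "?x n - ?l"
    have "norm (B *v ?d) <= norm (A n *v ?d) + norm ((A n - B) *v ?d)"
      using norm_triangle_ineq4[of "A n *v ?d" "(A n - B) *v ?d"] by (simp add: matrix_vector_mult_diff_rdistrib)
    moreover have "norm ((A n - B) *v ?d) <= s / 2 * norm ?d"
      using norm_matrix_vector_le[of "A n - B" ?d] elim mult_right_mono[of "norm (A n - B)" "s / 2" "norm ?d"] by simp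
    ultimately have "s / 2 * norm ?d <= norm (A n *v ?d)" using s(2)[of ?d] by simp
    moreover have "A n *v ?d = y n - A n *v ?l"
      using invertible_inv(1)[OF iA] by (simp add: matrix_vector_mult_diff_distrib)
    ultimately show ?case using s(1) by (simp add: field_simps)
  qed
  moreover have "(\<lambda>n. (2 / s) * norm (y n - A n *v ?l)) \<longlonglongrightarrow> (2 / s) * norm (z - B *v ?l)"
    by (intro tendsto_intros y tendsto_matrix_vector A)
  then have "(\<lambda>n. (2 / s) * norm (y n - A n *v ?l)) \<longlonglongrightarrow> 0"
    using invertible_inv(1)[OF iB] by simp
  ultimately have "(\<lambda>n. ?x n - ?l) \<longlonglongrightarrow> 0"
    by (rule Lim_null_comparison)
  then show ?thesis by (rule LIM_zero_cancel)
qed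

lemma inv_pow_lim:
  fixes A :: "nat \<Rightarrow> real ^ 'd ^ 'd"
  assumes A: "A \<longlonglongrightarrow> B" and iA: "\<And>n. invertible (A n)" and iB: "invertible B" and y: "y \<longlonglongrightarrow> z"
  shows "(\<lambda>n. ((*v) (matrix_inv (A n)) ^^ m) (y n)) \<longlonglongrightarrow> ((*v) (matrix_inv B) ^^ m) z"
    "(\<lambda>n. ((*v) (A n) ^^ m) (y n)) \<longlonglongrightarrow> ((*v) B ^^ m) z"
  by (induction m) (simp_all add: y inv_vector_lim[OF A iA iB] tendsto_matrix_vector[OF A])

lemma en_lim_le:
  fixes f :: "nat \<Rightarrow> real ^ 'd"
  assumes "f \<longlonglongrightarrow> l" "\<forall>\<^sub>F n in sequentially. c * en I (f n) <= d * en I' (f n)"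
  shows "c * en I l <= d * en I' l"
  by (rule tendsto_le[OF sequentially_bot _ _ assms(2)]) (intro tendsto_intros tendsto_en assms(1))+

text \<open>The constants in growth bounds might blow up along a sequence, cone conditions pass to
  limits. So membership is turned into cone conditions on all iterates, and \<open>Vsp_I\<close>
  turns the limiting conditions back into growth.\<close>

lemma Vsp_closed:
  fixes P :: "nat \<Rightarrow> real ^ 'd ^ 'd"
  assumes P: "\<And>n. invertible (P n) & cone_pres (P n) J & grow (P n) J aJ bJ & cone_pres (P n) K & grow (P n) K aK bK"
    and Q: "invertible Q" "grow Q J aJ bJ" "grow Q K aK bK"
    and ab: "0 < bJ" "bJ < aJ" "0 < bK" "bK < aK"
    and lim: "P \<longlonglongrightarrow> Q" "v \<longlonglongrightarrow> w" and v: "\<And>n. v n \<in> Vsp (P n) bJ aK"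
  shows "w \<in> Vsp Q bJ aK"
proof -
  have ab': "0 < aK" using ab by simp
  have inv: "invertible (P n)" for n using P by blast
  note orb = Vsp_orbits[OF _ _ _ _ _ ab]
  show ?thesis
  proof (rule Vsp_I[OF Q ab(1) ab'])
    fix m
    have "1 * en J (((*v) Q ^^ m) w) <= 1/2 * en (- J) (((*v) Q ^^ m) w)"
      by (rule en_lim_le[OF inv_pow_lim(2)[OF lim(1) inv Q(1) lim(2)]], rule always_eventually)
        (use orb(1)[of "P _" J K] P Vsp_pow(1)[OF inv v ab' ab(1)] in fastforce)
    then show "en J (((*v) Q ^^ m) w) <= en (- J) (((*v) Q ^^ m) w) / 2" by simp
    have "2 * en (- K) (((*v) (matrix_inv Q) ^^ m) w) <= 1 * en K (((*v) (matrix_inv Q) ^^ m) w)"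
      by (rule en_lim_le[OF inv_pow_lim(1)[OF lim(1) inv Q(1) lim(2)]], rule always_eventually)
        (use orb(2)[of "P _" J K] P Vsp_pow(2)[OF inv v ab' ab(1)] in fastforce)
    then show "2 * en (- K) (((*v) (matrix_inv Q) ^^ m) w) <= en K (((*v) (matrix_inv Q) ^^ m) w)" by simp
  qed
qed

text \<open>Reads the last j factors from the end of the product, as the recent past of its
  endpoint.\<close>

lemma qp_split: "j <= n ==> qp X n = qm (\<lambda>i. X (n - 1 - i)) j ** qp X (n - j)"
proof (induction j)
  case (Suc j)
  then have "n - j = Suc (n - Suc j)" by simp
  then have "qp X (n - j) = X (n - 1 - j) ** qp X (n - Suc j)" by simp
  then show ?case using Suc by (simp add: matrix_mul_assoc)
qed simp

text \<open>Cycles indexed by k with a rotation parameter t: \<open>P k t\<close> is the excursion,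
  and \<open>X k t i\<close> for i below \<open>n k\<close> are the returns near the periodic point.
  Here \<open>p\<close> and \<open>q\<close> are the two coordinates of the plane to be rotated, not
  points.\<close>

locale cyc =
  fixes J K :: "'d::finite set" and p q :: 'd and aJ bJ aK bK \<alpha>J \<beta>J \<alpha>K \<beta>K :: real
    and X :: "nat \<Rightarrow> real \<Rightarrow> nat \<Rightarrow> real ^ 'd ^ 'd" and P :: "nat \<Rightarrow> real \<Rightarrow> real ^ 'd ^ 'd"
    and n :: "nat \<Rightarrow> nat" and \<tau> :: real
  assumes JK: "J \<subseteq> K" "K - J = {p, q}" "p ~= q"
    and ab: "0 < bJ" "bJ < aJ" "0 < bK" "bK < aK" "0 < \<alpha>J" "0 < \<beta>J" "0 < \<alpha>K" "0 < \<beta>K"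
    and \<tau>: "0 < \<tau>"
    and X: "\<And>k t i. 0 <= t ==> t <= \<tau> ==> i < n k ==> invertible (X k t i) & cone_pres (X k t i) J \<and>
       grow (X k t i) J aJ bJ & cone_pres (X k t i) K & grow (X k t i) K aK bK"
    and P: "\<And>k t. 0 <= t ==> t <= \<tau> ==> invertible (P k t) & cone_pres (P k t) J \<and>
       grow (P k t) J \<alpha>J \<beta>J & cone_pres (P k t) K & grow (P k t) K \<alpha>K \<beta>K"
    and contX: "\<And>k i. i < n k ==> continuous_on {0..\<tau>} (\<lambda>t. X k t i)"
    and contP: "\<And>k. continuous_on {0..\<tau>} (P k)"
    and n: "filterlim n at_top sequentially"
begin

definition Pi where "Pi k t = qp (X k t) (n k) ** P k t"
definition AJ where "AJ k = aJ ^ n k * \<alpha>J"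
definition BJ where "BJ k = bJ ^ n k * \<beta>J"
definition AK where "AK k = aK ^ n k * \<alpha>K"
definition BK where "BK k = bK ^ n k * \<beta>K"
definition V where "V k t = Vsp (Pi k t) (BJ k) (AK k)"
text \<open>The complex coordinate of the rotated plane; its argument is the angle whose winding is
  counted.\<close>

definition \<zeta> :: "real ^ 'd \<Rightarrow> complex" where "\<zeta> v = Complex (v $ p) (v $ q)"

lemma pos: "0 < AJ k" "0 < BJ k" "0 < AK k" "0 < BK k"
  using ab by (auto simp: AJ_def BJ_def AK_def BK_def)

lemma partial:
  assumes "0 <= t" "t <= \<tau>" "i <= n k"
  shows "invertible (qp (X k t) i ** P k t) & cone_pres (qp (X k t) i ** P k t) J \<and>
     grow (qp (X k t) i ** P k t) J (aJ ^ i * \<alpha>J) (bJ ^ i * \<beta>J) & cone_pres (qp (X k t) i ** P k t) K \<and>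
     grow (qp (X k t) i ** P k t) K (aK ^ i * \<alpha>K) (bK ^ i * \<beta>K)"
  using assms(3)
proof (induction i)
  case 0 then show ?case using P[OF assms(1,2), of k] by simp
next
  case (Suc i)
  let ?Y = "qp (X k t) i ** P k t"
  have e: "qp (X k t) (Suc i) ** P k t = X k t i ** ?Y" by (simp add: matrix_mul_assoc)
  have Xi: "invertible (X k t i) & cone_pres (X k t i) J \<and>
       grow (X k t i) J aJ bJ & cone_pres (X k t i) K & grow (X k t i) K aK bK" using X[OF assms(1,2)] Suc by simp
  have Y: "invertible ?Y & cone_pres ?Y J \<and>
     grow ?Y J (aJ ^ i * \<alpha>J) (bJ ^ i * \<beta>J) & cone_pres ?Y K & grow ?Y K (aK ^ i * \<alpha>K) (bK ^ i * \<beta>K)"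
    using Suc by simp
  have "grow (X k t i ** ?Y) J (aJ * (aJ ^ i * \<alpha>J)) (bJ * (bJ ^ i * \<beta>J))"
    "grow (X k t i ** ?Y) K (aK * (aK ^ i * \<alpha>K)) (bK * (bK ^ i * \<beta>K))"
    by (rule grow_mult; use Xi Y ab in simp)+
  then show ?case unfolding e using Xi Y by (simp add: invertible_mult cone_pres_mult mult.assoc)
qed

lemma Pi: "0 <= t ==> t <= \<tau> ==> invertible (Pi k t) & cone_pres (Pi k t) J & grow (Pi k t) J (AJ k) (BJ k) \<and>
    cone_pres (Pi k t) K & grow (Pi k t) K (AK k) (BK k)"
  using partial[of t "n k" k] unfolding Pi_def AJ_def BJ_def AK_def BK_def by simp

definition good where "good k \<longleftrightarrow> BJ k < AJ k & BK k < AK k"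

lemma eventually_good: "\<forall>\<^sub>F k in sequentially. good k"
proof -
  have *: "\<forall>\<^sub>F k in sequentially. b ^ n k * y < a ^ n k * x" if "0 < b" "b < a" "0 < x" "0 < y" for a b x y :: real
  proof -
    have "1 < a / b" using that by simp
    then obtain m where m: "y / x < (a / b) ^ m" using real_arch_pow by blast
    have "\<forall>\<^sub>F k in sequentially. m <= n k" using n by (simp add: filterlim_at_top)
    then show ?thesis
    proof eventually_elim
      case (elim k)
      have "y / x < (a / b) ^ n k" using m power_increasing[OF elim, of "a / b"] \<open>1 < a / b\<close> by linarith
      then show ?case using that by (simp add: power_divide field_simps)
    qed
  qed
  show ?thesis unfolding good_def AJ_def BJ_def AK_def BK_def
    using *[OF ab(1,2,5,6)] *[OF ab(3,4,7,8)] by eventually_elim simp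
qed

lemma cmod_zeta: "cmod (\<zeta> v) = en (K - J) v"
proof -
  have "(norm (pr (K - J) v))\<^sup>2 = (\<Sum>i\<in>UNIV. (pr (K - J) v $ i)\<^sup>2)"
    by (simp add: norm_vec_def L2_set_def sum_nonneg)
  also have "\<dots> = (\<Sum>i\<in>UNIV. if i \<in> {p, q} then (v $ i)\<^sup>2 else 0)"
    unfolding JK(2) pr_def by (intro sum.cong) auto
  also have "\<dots> = (v $ p)\<^sup>2 + (v $ q)\<^sup>2"
    using JK(3) by (subst sum.inter_restrict[symmetric]) auto
  also have "\<dots> = (cmod (\<zeta> v))\<^sup>2" by (simp add: \<zeta>_def cmod_power2)
  finally show ?thesis unfolding en_def by (metis norm_ge_zero power2_eq_imp_eq)
qed

lemma zeta_le: "cmod (\<zeta> v) <= norm v" unfolding cmod_zeta by (rule en_le_norm)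

lemma zeta_diff: "\<zeta> (u - v) = \<zeta> u - \<zeta> v" "\<zeta> (c *\<^sub>R v) = of_real c * \<zeta> v" "\<zeta> (u + v) = \<zeta> u + \<zeta> v"
  by (simp_all add: \<zeta>_def complex_eq_iff)

lemma tendsto_zeta: "(f \<longlongrightarrow> l) F ==> ((\<lambda>x. \<zeta> (f x)) \<longlongrightarrow> \<zeta> l) F"
  unfolding \<zeta>_def by (intro tendsto_Complex tendsto_vec_nth)

lemma pr_axis_iff: "pr (K - J) u = axis p 1 \<longleftrightarrow> \<zeta> u = 1"
  using JK(3) unfolding JK(2) by (auto simp: pr_def axis_def vec_eq_iff \<zeta>_def complex_eq_iff)

lemma V_unique:
  assumes "0 <= t" "t <= \<tau>" "good k" "u \<in> V k t" "v \<in> V k t" "\<zeta> u = \<zeta> v"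
  shows "u = v"
proof -
  have sub: "subspace (V k t)" unfolding V_def using pos by (intro subspace_Vsp) (auto intro: less_imp_le)
  have "u - v \<in> V k t" using assms sub subspace_diff by blast
  moreover have "pr (K - J) (u - v) = 0"
    using cmod_zeta[of "u - v"] assms(6) by (simp add: zeta_diff en_def)
  ultimately have "u - v = 0"
    using Vsp_inj[of "Pi k t" J "AJ k" "BJ k" K "AK k" "BK k"] Pi[OF assms(1,2), of k] pos assms(3) JK(1)
    unfolding V_def good_def by blast
  then show ?thesis by simp
qed

lemma V_exists: "0 <= t ==> t <= \<tau> ==> good k ==> \<exists>u \<in> V k t. \<zeta> u = 1"
proof -
  assume a: "0 <= t" "t <= \<tau>" "good k"
  have "axis p (1::real) $ i = 0" if "i \<notin> K - J" for i using that JK(2) by (auto simp: axis_def)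
  then show ?thesis
    using Vsp_exists[of "Pi k t" J "AJ k" "BJ k" K "AK k" "BK k" "axis p 1"] Pi[OF a(1,2), of k] pos a(3) JK(1)
    unfolding V_def good_def pr_axis_iff[symmetric] by blast
qed

text \<open>The estimate for J holds at the end of the cycle, where the image is again in
  \<open>V\<close>, and is pulled back; the estimate for K holds at the start and is pushed forward.
  Together they keep every intermediate vector within a factor 3 of its central coordinate.\<close>

lemma V_central:
  assumes t: "0 <= t" "t <= \<tau>" and g: "good k" and u: "u \<in> V k t"
  shows "en J u <= en (- J) u / 2" "2 * en (- K) u <= en K u"
    "i <= n k ==> en J ((qp (X k t) i ** P k t) *v u) <= en (- J) ((qp (X k t) i ** P k t) *v u) / 2"
    "i <= n k ==> 2 * en (- K) ((qp (X k t) i ** P k t) *v u) <= en K ((qp (X k t) i ** P k t) *v u)"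
    "norm u <= 3 * cmod (\<zeta> u)"
    "i <= n k ==> norm ((qp (X k t) i ** P k t) *v u) <= 3 * cmod (\<zeta> ((qp (X k t) i ** P k t) *v u))"
proof -
  note Pt = Pi[OF t, of k]
  have ab': "0 < BJ k" "BJ k < AJ k" "0 < BK k" "BK k < AK k" using pos g by (auto simp: good_def)
  note orb = Vsp_orbits[of "Pi k t" J "AJ k" "BJ k" K "AK k" "BK k", OF _ _ _ _ _ ab']
  show 1: "en J u <= en (- J) u / 2" and 2: "2 * en (- K) u <= en K u"
    using orb Pt u unfolding V_def by blast+
  have "Pi k t *v u \<in> Vsp (Pi k t) (BJ k) (AK k)"
    using Vsp_invariant[of "Pi k t" u] Pt u pos unfolding V_def by blast
  then have e: "en J (Pi k t *v u) <= en (- J) (Pi k t *v u) / 2"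
    using orb(1) Pt by blast
  let ?w = "\<lambda>i. (qp (X k t) i ** P k t) *v u"
  show 3: "en J (?w i) <= en (- J) (?w i) / 2" if "i <= n k"
    using that
  proof (induction rule: inc_induct)
    case base then show ?case using e by (simp add: Pi_def)
  next
    case (step i)
    have "?w (Suc i) = X k t i *v ?w i" by (simp add: matrix_vector_mul_assoc matrix_mul_assoc)
    then show ?case using cone_presD'[of "X k t i" J "1/2" "?w i"] X[OF t, of i k] step by simp
  qed
  show 4: "2 * en (- K) (?w i) <= en K (?w i)" if "i <= n k"
    using cone_presD[of "qp (X k t) i ** P k t" K 2 u] partial[OF t that] 2 by simp
  show "norm u <= 3 * cmod (\<zeta> u)" unfolding cmod_zeta by (rule class_bound[OF JK(1) 1 2])
  show "norm (?w i) <= 3 * cmod (\<zeta> (?w i))" if "i <= n k"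
    unfolding cmod_zeta by (rule class_bound[OF JK(1) 3[OF that] 4[OF that]])
qed

lemma zeta_nonzero:
  assumes t: "0 <= t" "t <= \<tau>" and g: "good k" and u: "u \<in> V k t" "u ~= 0" and i: "i <= n k"
  shows "\<zeta> ((qp (X k t) i ** P k t) *v u) ~= 0"
proof
  assume "\<zeta> ((qp (X k t) i ** P k t) *v u) = 0"
  then have "(qp (X k t) i ** P k t) *v u = 0" using V_central(6)[OF t g u(1) i] by simp
  moreover have "invertible (qp (X k t) i ** P k t)" using partial[OF t i] by blast
  ultimately have "u = 0" using invertible_inv(2) by (metis matrix_vector_mult_0_right)
  then show False using u(2) by simp
qed

lemma continuous_qp: "i <= n k ==> continuous_on {0..\<tau>} (\<lambda>t. qp (X k t) i ** P k t)"
proof (induction i)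
  case 0 then show ?case using contP by simp
next
  case (Suc i)
  then have "continuous_on {0..\<tau>} (\<lambda>t. qp (X k t) i ** P k t)" "continuous_on {0..\<tau>} (\<lambda>t. X k t i)"
    using contX[of i k] by simp_all
  then have "continuous_on {0..\<tau>} (\<lambda>t. X k t i ** (qp (X k t) i ** P k t))"
    by (rule continuous_on_matrix_matrix[rotated])
  then show ?case by (simp add: matrix_mul_assoc)
qed

definition u where "u k t = (SOME u. u \<in> V k t & \<zeta> u = 1)"

lemma u: "0 <= t ==> t <= \<tau> ==> good k ==> u k t \<in> V k t & \<zeta> (u k t) = 1 & u k t ~= 0"
proof -
  assume a: "0 <= t" "t <= \<tau>" "good k"
  have "u k t \<in> V k t & \<zeta> (u k t) = 1"
    unfolding u_def using V_exists[OF a] by (intro someI_ex[of "\<lambda>u. u \<in> V k t & \<zeta> u = 1"]) blast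
  moreover have "\<zeta> 0 = 0" by (simp add: \<zeta>_def complex_eq_iff)
  ultimately show ?thesis by force
qed

text \<open>The bound 3 supplies convergent subsequences; by closedness of the family
  \<open>V\<close> the limit has coordinate 1 and lies in the limiting space, where such a vector is
  unique.\<close>

lemma continuous_u:
  assumes g: "good k"
  shows "continuous_on {0..\<tau>} (u k)"
proof (rule ccontr)
  assume "\<not> ?thesis"
  then obtain x t where t: "t \<in> {0..\<tau>}" "\<And>m. x m \<in> {0..\<tau>}" "x \<longlonglongrightarrow> t" "\<not> (\<lambda>m. u k (x m)) \<longlonglongrightarrow> u k t"
    unfolding continuous_on_sequentially comp_def by blast
  then obtain e where e: "e > 0" "\<not> (\<forall>\<^sub>F m in sequentially. dist (u k (x m)) (u k t) < e)"
    unfolding tendsto_iff by blast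
  then have "\<forall>N. \<exists>m>N. \<not> dist (u k (x m)) (u k t) < e"
    unfolding eventually_sequentially by (meson less_imp_le_nat Suc_le_eq)
  then obtain r where r: "strict_mono (r :: nat \<Rightarrow> nat)" "\<And>m. \<not> dist (u k (x (r m))) (u k t) < e"
    using infinite_enumerate[of "{m. \<not> dist (u k (x m)) (u k t) < e}"] unfolding infinite_nat_iff_unbounded by auto
  have ux: "u k (x m) \<in> V k (x m) & \<zeta> (u k (x m)) = 1" for m using u[of "x m" k] t(2)[of m] g by auto
  have "norm (u k (x (r m))) <= 3" for m using V_central(5)[of "x (r m)" k "u k (x (r m))"] t(2)[of "r m"] g ux[of "r m"] by auto
  then obtain l s where s: "strict_mono (s :: nat \<Rightarrow> nat)" "((\<lambda>m. u k (x (r m))) \<circ> s) \<longlonglongrightarrow> l"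
    using bounded_subseq[of "\<lambda>m. u k (x (r m))" 3] by blast
  let ?y = "\<lambda>m. x (r (s m))"
  have ul: "(\<lambda>m. u k (?y m)) \<longlonglongrightarrow> l" using s(2) by (simp add: comp_def)
  have y: "?y \<longlonglongrightarrow> t" using LIMSEQ_subseq_LIMSEQ[OF LIMSEQ_subseq_LIMSEQ[OF t(3) r(1)] s(1)] by (simp add: comp_def)
  have "(\<lambda>m. Pi k (?y m)) \<longlonglongrightarrow> Pi k t"
    unfolding Pi_def using continuous_qp[of "n k" k] t(1,2) y
    by (intro continuous_on_tendsto_compose[of "{0..\<tau>}" "\<lambda>t. qp (X k t) (n k) ** P k t"]) auto
  then have "l \<in> V k t"
    unfolding V_def using t(1,2) g pos
    by (intro Vsp_closed[of "\<lambda>m. Pi k (?y m)" J "AJ k" "BJ k" K "AK k" "BK k", OF _ _ _ _ _ _ _ _ _ ul])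
      (use Pi[of _ k] ux in \<open>auto simp: good_def V_def\<close>)
  moreover have "\<zeta> l = 1" using tendsto_zeta[OF ul] ux by (simp add: LIMSEQ_const_iff)
  ultimately have "l = u k t" using V_unique[of t k l "u k t"] u[of t k] t(1) g by auto
  then have "(\<lambda>m. u k (?y m)) \<longlonglongrightarrow> u k t" using ul by simp
  then have "\<forall>\<^sub>F m in sequentially. dist (u k (?y m)) (u k t) < e" using e(1) by (rule tendstoD)
  then show False using r(2) by (auto simp: eventually_sequentially)
qed

end

context cyc begin

definition w where "w k t i = (qp (X k t) i ** P k t) *v u k t"

lemma w_Suc: "w k t (Suc i) = X k t i *v w k t i"
  by (simp add: w_def matrix_vector_mul_assoc matrix_mul_assoc)

lemma w_end: "w k t (n k) = Pi k t *v u k t"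
  by (simp add: w_def Pi_def)

lemma continuous_w: "good k ==> i <= n k ==> continuous_on {0..\<tau>} (\<lambda>t. w k t i)"
  unfolding w_def by (intro continuous_on_matrix_vector continuous_qp continuous_u)

lemma zeta_w: "0 <= t ==> t <= \<tau> ==> good k ==> i <= n k ==> \<zeta> (w k t i) ~= 0 & norm (w k t i) <= 3 * cmod (\<zeta> (w k t i))"
  unfolding w_def using zeta_nonzero V_central(6) u by blast

text \<open>\<open>N\<close> acts on the complex coordinate exactly as multiplication by l0
  \<kappa>, so the deviation comes from X - N alone, applied to a vector at most three times as long
  as its central coordinate.\<close>

lemma ratio_bound:
  assumes t: "0 <= t" "t <= \<tau>" and g: "good k" and i: "i < n k" and l0: "l0 ~= 0"
    and N: "\<And>v. \<zeta> (N *v v) = l0 * \<kappa> * \<zeta> v"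
  shows "cmod (\<zeta> (w k t (Suc i)) / (l0 * \<zeta> (w k t i)) - \<kappa>) <= 3 * norm (X k t i - N) / cmod l0"
proof -
  have z: "\<zeta> (w k t i) ~= 0" "norm (w k t i) <= 3 * cmod (\<zeta> (w k t i))"
    using zeta_w[OF t g, of i] i by auto
  have "\<zeta> (w k t (Suc i)) / (l0 * \<zeta> (w k t i)) - \<kappa> = \<zeta> ((X k t i - N) *v w k t i) / (l0 * \<zeta> (w k t i))"
    using z(1) l0 by (simp add: w_Suc matrix_vector_mult_diff_rdistrib zeta_diff N field_simps)
  then have "cmod (\<zeta> (w k t (Suc i)) / (l0 * \<zeta> (w k t i)) - \<kappa>)
      = cmod (\<zeta> ((X k t i - N) *v w k t i)) / (cmod l0 * cmod (\<zeta> (w k t i)))"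
    by (simp add: norm_divide norm_mult)
  also have "\<dots> <= (norm (X k t i - N) * (3 * cmod (\<zeta> (w k t i)))) / (cmod l0 * cmod (\<zeta> (w k t i)))"
  proof (rule divide_right_mono)
    have "cmod (\<zeta> ((X k t i - N) *v w k t i)) <= norm (X k t i - N) * norm (w k t i)"
      using zeta_le norm_matrix_vector_le order_trans by blast
    also have "\<dots> <= norm (X k t i - N) * (3 * cmod (\<zeta> (w k t i)))" using z(2) by (intro mult_left_mono) auto
    finally show "cmod (\<zeta> ((X k t i - N) *v w k t i)) <= norm (X k t i - N) * (3 * cmod (\<zeta> (w k t i)))" .
  qed simp
  also have "\<dots> = 3 * norm (X k t i - N) / cmod l0" using z(1) l0 by (simp add: field_simps)
  finally show ?thesis .
qed

lemma Re_pos: "cmod (z - 1) < 1 ==> 0 < Re z"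
  using abs_Re_le_cmod[of "z - 1"] by simp

lemma Im_Ln_half: "0 < Re z ==> \<bar>Im (Ln z)\<bar> < pi / 2"
  using Re_Ln_pos_lt[of z] by (cases "z = 0") auto

lemma not_nonpos: "0 < Re z ==> z \<notin> \<real>\<^sub>\<le>\<^sub>0"
  by (auto simp: complex_nonpos_Reals_iff)

text \<open>Relative to \<open>l0\<close>, each step turns the central coordinate by the argument of
  a ratio in the right half plane, so the sum \<open>F\<close> of principal arguments is a
  continuous total angle. Between the parameters 0 and \<sigma> nearly every step gains almost the
  argument of \<kappa>. For long cycles the angle thus passes a multiple of \<pi>; there the
  coordinate of the image is real, and the injectivity of the coordinate on \<open>V\<close> gives a
  real eigenvector.\<close>

lemma winding:
  assumes \<sigma>: "0 < \<sigma>" "\<sigma> <= \<tau>" and l0: "l0 ~= 0" and N0: "\<And>v. \<zeta> (N0 *v v) = l0 * \<zeta> v"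
    and N1: "\<And>v. \<zeta> (N1 *v v) = l0 * \<kappa> * \<zeta> v" and \<kappa>: "0 < Im \<kappa>"
    and coarse: "\<And>k t i. 0 <= t ==> t <= \<tau> ==> i < n k ==> norm (X k t i - N0) < cmod l0 / 3"
    and fine: "\<And>\<delta>. 0 < \<delta> ==> \<exists>m k0. \<forall>k\<ge>k0. \<forall>i. m <= i & i + m < n k -->
       norm (X k 0 i - N0) < \<delta> & norm (X k \<sigma> i - N1) < \<delta>"
    and c0: "c0 ~= 0" and c: "\<And>k t. k1 <= k ==> 0 <= t ==> t <= \<sigma> ==> good k ==> cmod (\<zeta> (P k t *v u k t) - c0) < cmod c0"
  shows "\<exists>k0. \<forall>k\<ge>k0. good k & (\<exists>t \<mu>. 0 <= t & t <= \<sigma> & Pi k t *v u k t = \<mu> *\<^sub>R u k t)"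
proof -
  define r where "r k t i = \<zeta> (w k t (Suc i)) / (l0 * \<zeta> (w k t i))" for k t i
  define s where "s k t = \<zeta> (w k t 0) / c0" for k t
  define F where "F k t = (\<Sum>i<n k. Im (Ln (r k t i))) + Im (Ln (s k t))" for k t
  define A where "A = Im (Ln \<kappa>)"
  have A: "0 < A" unfolding A_def using \<kappa> Im_Ln_pos_lt[of \<kappa>] by (cases "\<kappa> = 0") auto
  have cl0: "0 < cmod l0" using l0 by simp
  have rRe: "0 < Re (r k t i)" if "0 <= t" "t <= \<tau>" "good k" "i < n k" for k t i
  proof (rule Re_pos)
    have "cmod (r k t i - 1) <= 3 * norm (X k t i - N0) / cmod l0"
      unfolding r_def by (rule ratio_bound[OF that l0]) (simp add: N0)
    also have "\<dots> < 1" using coarse[OF that(1,2,4)] cl0 by (simp add: field_simps)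
    finally show "cmod (r k t i - 1) < 1" .
  qed
  have sRe: "0 < Re (s k t)" if "k1 <= k" "0 <= t" "t <= \<sigma>" "good k" for k t
  proof (rule Re_pos)
    have "s k t - 1 = (\<zeta> (P k t *v u k t) - c0) / c0" using c0 by (simp add: s_def w_def field_simps)
    then show "cmod (s k t - 1) < 1" using c[OF that] c0 by (simp add: norm_divide)
  qed
  have cont: "continuous_on {0..\<sigma>} (F k)" if "k1 <= k" "good k" for k
  proof -
    have sub: "{0..\<sigma>} \<subseteq> {0..\<tau>}" using \<sigma> by auto
    have cz: "continuous_on {0..\<sigma>} (\<lambda>t. \<zeta> (w k t i))" if "i <= n k" for i
      using continuous_on_subset[OF continuous_w[OF \<open>good k\<close> that] sub] unfolding continuous_on_def
      by (auto intro: tendsto_zeta)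
    have "continuous_on {0..\<sigma>} (\<lambda>t. r k t i)" if "i < n k" for i
      unfolding r_def using cz[of i] cz[of "Suc i"] that l0 zeta_w[of _ k i] \<open>good k\<close> \<sigma>
      by (intro continuous_intros) auto
    moreover have "continuous_on {0..\<sigma>} (\<lambda>t. s k t)"
      unfolding s_def using cz[of 0] c0 by (intro continuous_intros) auto
    ultimately show ?thesis
      unfolding F_def using rRe[of _ k] sRe[OF that(1) _ _ that(2)] that(2) \<sigma> not_nonpos
      by (intro continuous_on_add continuous_on_sum continuous_on_Im continuous_on_Ln') auto
  qed
  have prod: "\<zeta> (w k t j) = c0 * s k t * l0 ^ j * (\<Prod>i<j. r k t i)" if "0 <= t" "t <= \<tau>" "good k" "j <= n k" for k t j
    using that(4)
  proof (induction j)
    case 0 then show ?case using c0 by (simp add: s_def)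
  next
    case (Suc j)
    have "\<zeta> (w k t (Suc j)) = l0 * \<zeta> (w k t j) * r k t j"
      using zeta_w[OF that(1-3), of j] Suc l0 by (simp add: r_def)
    then show ?case using Suc by simp
  qed
  \<comment> \<open>The factor \<open>c0 * l0 ^ n k\<close> carries the turning common to all
    parameters; it is constant in t and only shifts the angle.\<close>
  have real: "Im (\<zeta> (w k t (n k))) = 0"
    if "k1 <= k" "0 <= t" "t <= \<sigma>" "good k" "sin (Arg (c0 * l0 ^ n k) + F k t) = 0" for k t
  proof -
    have t': "t <= \<tau>" using that \<sigma> by simp
    let ?S = "(\<Sum>i<n k. Ln (r k t i)) + Ln (s k t)"
    have r0: "r k t i ~= 0" if "i < n k" for i using rRe[OF \<open>0 <= t\<close> t' \<open>good k\<close> that] by auto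
    have s0: "s k t ~= 0" using sRe[OF that(1-4)] by auto
    have "exp ?S = (\<Prod>i<n k. r k t i) * s k t"
      using r0 s0 by (simp add: exp_add exp_sum)
    then have "\<zeta> (w k t (n k)) = (c0 * l0 ^ n k) * exp ?S"
      using prod[OF that(2) t' that(4), of "n k"] by (simp add: mult_ac)
    also have "exp ?S = of_real (exp (Re ?S)) * exp (\<i> * of_real (Im ?S))"
      by (metis complex_eq exp_add exp_of_real)
    also have "c0 * l0 ^ n k = of_real (cmod (c0 * l0 ^ n k)) * exp (\<i> * of_real (Arg (c0 * l0 ^ n k)))"
      using c0 l0 Arg_eq[of "c0 * l0 ^ n k"] by simp
    finally have "\<zeta> (w k t (n k)) = of_real (cmod (c0 * l0 ^ n k) * exp (Re ?S)) * (exp (\<i> * of_real (Arg (c0 * l0 ^ n k))) * exp (\<i> * of_real (Im ?S)))"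
      by (simp add: mult_ac)
    also have "\<dots> = of_real (cmod (c0 * l0 ^ n k) * exp (Re ?S)) * cis (Arg (c0 * l0 ^ n k) + Im ?S)"
      by (simp add: cis_conv_exp cis_mult[symmetric] exp_add[symmetric] distrib_left)
    finally have "\<zeta> (w k t (n k)) = of_real (cmod (c0 * l0 ^ n k) * exp (Re ?S)) * cis (Arg (c0 * l0 ^ n k) + F k t)"
      by (simp add: F_def)
    then show ?thesis using that(5) by simp
  qed
  obtain \<delta> where \<delta>: "\<delta> > 0" "\<And>z. cmod (z - \<kappa>) < \<delta> ==> \<bar>Im (Ln z) - A\<bar> < A / 4"
    "\<And>z. cmod (z - 1) < \<delta> ==> \<bar>Im (Ln z)\<bar> < A / 4"
  proof -
    have k0: "\<kappa> \<notin> \<real>\<^sub>\<le>\<^sub>0" using \<kappa> by (auto simp: complex_nonpos_Reals_iff)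
    have A4: "0 < A / 4" using A by simp
    have c1: "isCont Ln \<kappa>" and c2: "isCont Ln 1" using k0 by (auto intro!: continuous_at_Ln)
    obtain d1 where d1: "d1 > 0" "\<And>z. dist z \<kappa> < d1 ==> dist (Ln z) (Ln \<kappa>) < A / 4"
      using c1[unfolded continuous_at_eps_delta, rule_format, OF A4] by blast
    obtain d2 where d2: "d2 > 0" "\<And>z. dist z 1 < d2 ==> dist (Ln z) (Ln 1) < A / 4"
      using c2[unfolded continuous_at_eps_delta, rule_format, OF A4] by blast
    have "\<bar>Im (Ln z) - A\<bar> < A / 4" if "cmod (z - \<kappa>) < min d1 d2" for z
      using d1(2)[of z] that abs_Im_le_cmod[of "Ln z - Ln \<kappa>"] by (simp add: dist_norm A_def)
    moreover have "\<bar>Im (Ln z)\<bar> < A / 4" if "cmod (z - 1) < min d1 d2" for z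
      using d2(2)[of z] that abs_Im_le_cmod[of "Ln z"] by (simp add: dist_norm)
    ultimately show ?thesis using that[of "min d1 d2"] d1(1) d2(1) by simp
  qed
  obtain m k2 where mk: "\<And>k i. k2 <= k ==> m <= i ==> i + m < n k ==>
       norm (X k 0 i - N0) < \<delta> * cmod l0 / 3 & norm (X k \<sigma> i - N1) < \<delta> * cmod l0 / 3"
    using fine[of "\<delta> * cmod l0 / 3"] \<delta>(1) cl0 by auto
  \<comment> \<open>An exceptional step may lose up to \<pi> instead of gaining A/2;
    \<open>C\<close> is the difference. The first m and the last m steps are exceptional.\<close>
  define C where "C = A / 2 + pi"
  have C0: "0 < C" unfolding C_def using A pi_gt_zero by linarith
  have diff: "real (n k) * A / 2 - 2 * C * real m - pi <= F k \<sigma> - F k 0" if k: "k1 <= k" "k2 <= k" "good k" for k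
  proof -
    define d where "d i = Im (Ln (r k \<sigma> i)) - Im (Ln (r k 0 i))" for i
    have pt: "A / 2 - (if i < m then C else 0) - (if n k - m <= i then C else 0) <= d i" if i: "i < n k" for i
    proof (cases "m <= i & i + m < n k")
      case True
      then have X: "norm (X k 0 i - N0) < \<delta> * cmod l0 / 3" "norm (X k \<sigma> i - N1) < \<delta> * cmod l0 / 3"
        using mk[OF k(2)] by auto
      have "cmod (r k 0 i - 1) <= 3 * norm (X k 0 i - N0) / cmod l0"
        unfolding r_def by (rule ratio_bound[OF _ _ k(3) i l0]) (use \<tau> N0 in auto)
      moreover have "3 * norm (X k 0 i - N0) / cmod l0 < \<delta>" using X(1) cl0 by (simp add: pos_divide_less_eq)
      ultimately have "cmod (r k 0 i - 1) < \<delta>" by linarith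
      have "cmod (r k \<sigma> i - \<kappa>) <= 3 * norm (X k \<sigma> i - N1) / cmod l0"
        unfolding r_def by (rule ratio_bound[OF _ _ k(3) i l0]) (use \<sigma> N1 in auto)
      moreover have "3 * norm (X k \<sigma> i - N1) / cmod l0 < \<delta>" using X(2) cl0 by (simp add: pos_divide_less_eq)
      ultimately have "cmod (r k \<sigma> i - \<kappa>) < \<delta>" by linarith
      then have "\<bar>Im (Ln (r k \<sigma> i)) - A\<bar> < A / 4" by (rule \<delta>(2))
      moreover have "\<bar>Im (Ln (r k 0 i))\<bar> < A / 4"
        by (rule \<delta>(3)) (rule \<open>cmod (r k 0 i - 1) < \<delta>\<close>)
      ultimately have "A / 2 <= d i" unfolding d_def by linarith
      moreover have "0 <= C" using C0 by simp
      ultimately show ?thesis by simp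
    next
      case False
      have "0 < Re (r k 0 i)" "0 < Re (r k \<sigma> i)"
        using rRe[of 0 k i] rRe[of \<sigma> k i] \<sigma> k(3) i by auto
      then have "\<bar>Im (Ln (r k 0 i))\<bar> < pi / 2" "\<bar>Im (Ln (r k \<sigma> i))\<bar> < pi / 2"
        using Im_Ln_half by blast+
      then have "- pi <= d i" unfolding d_def by linarith
      moreover have "C > 0" using C0 by simp
      moreover have "i < m \<or> n k - m <= i" using False by auto
      ultimately show ?thesis using A by (auto simp: C_def)
    qed
    have "(\<Sum>i<n k. A / 2 - (if i < m then C else 0) - (if n k - m <= i then C else 0)) <= (\<Sum>i<n k. d i)"
      using pt by (intro sum_mono) auto
    moreover have "(\<Sum>i<n k. A / 2 - (if i < m then C else 0) - (if n k - m <= i then C else 0))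
        = real (n k) * A / 2 - C * real (card {i\<in>{..<n k}. i < m}) - C * real (card {i\<in>{..<n k}. n k - m <= i})"
      by (simp add: sum_subtractf sum.If_cases Int_def)
    moreover have "card {i\<in>{..<n k}. i < m} <= card {..<m}" by (intro card_mono) auto
    then have "C * real (card {i\<in>{..<n k}. i < m}) <= C * real m"
      using C0 by (intro mult_left_mono) auto
    moreover have "card {i\<in>{..<n k}. n k - m <= i} <= card {n k - m..<n k}" by (intro card_mono) auto
    then have "C * real (card {i\<in>{..<n k}. n k - m <= i}) <= C * real m"
      using C0 by (intro mult_left_mono) auto
    moreover have "(\<Sum>i<n k. d i) = (\<Sum>i<n k. Im (Ln (r k \<sigma> i))) - (\<Sum>i<n k. Im (Ln (r k 0 i)))"
      by (simp add: d_def sum_subtractf)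
    moreover have "0 < Re (s k 0)" "0 < Re (s k \<sigma>)" using sRe[of k 0] sRe[of k \<sigma>] \<sigma> k by auto
    then have "\<bar>Im (Ln (s k 0))\<bar> < pi / 2" "\<bar>Im (Ln (s k \<sigma>))\<bar> < pi / 2"
      using Im_Ln_half by blast+
    ultimately show ?thesis unfolding F_def by linarith
  qed
  have "\<forall>\<^sub>F k in sequentially. 2 * (2 * pi + 2 * C * real m) / A <= real (n k)"
    using filterlim_compose[OF filterlim_real_sequentially n] by (simp add: filterlim_at_top)
  with eventually_good eventually_ge_at_top[of k1] eventually_ge_at_top[of k2]
  have "\<forall>\<^sub>F k in sequentially. good k & (\<exists>t \<mu>. 0 <= t & t <= \<sigma> & Pi k t *v u k t = \<mu> *\<^sub>R u k t)"
  proof eventually_elim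
    case (elim k)
    let ?G = "\<lambda>t. Arg (c0 * l0 ^ n k) + F k t"
    have "2 * pi + 2 * C * real m <= real (n k) * A / 2" using elim A by (simp add: field_simps)
    then have big: "?G 0 + pi <= ?G \<sigma>" using diff[of k] elim by simp
    \<comment> \<open>The first multiple of \<pi> not below the initial angle; it is attained
      because the angle grows by at least \<pi>.\<close>
    define j where "j = \<lceil>?G 0 / pi\<rceil>"
    have "?G 0 / pi <= of_int j" "of_int j < ?G 0 / pi + 1" unfolding j_def by linarith+
    then have "?G 0 <= of_int j * pi" "of_int j * pi < ?G 0 + pi" using pi_gt_zero by (simp_all add: field_simps)
    then have j: "?G 0 <= of_int j * pi" "of_int j * pi <= ?G \<sigma>" using big by auto
    have "continuous_on {0..\<sigma>} ?G" using cont[of k] elim by (intro continuous_intros) auto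
    from IVT'[of ?G 0 "of_int j * pi" \<sigma>, OF j _ this] obtain t where t: "0 <= t" "t <= \<sigma>" "?G t = of_int j * pi"
      using \<sigma> by auto
    have "sin (?G t) = 0" unfolding t(3) by (rule sin_zero_iff_int2[THEN iffD2]) blast
    then have im: "Im (\<zeta> (w k t (n k))) = 0" using real[of k t] elim t by blast
    have t': "t <= \<tau>" using t \<sigma> by simp
    let ?\<mu> = "Re (\<zeta> (w k t (n k)))"
    note ut = u[OF t(1) t' elim(1)]
    have sub: "subspace (V k t)" unfolding V_def using pos by (intro subspace_Vsp) (auto intro: less_imp_le)
    have "Pi k t *v u k t \<in> V k t"
      using Vsp_invariant[of "Pi k t" "u k t"] Pi[OF t(1) t', of k] ut pos unfolding V_def by blast
    moreover have "?\<mu> *\<^sub>R u k t \<in> V k t" using ut sub subspace_scale by blast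
    moreover have "\<zeta> (Pi k t *v u k t) = \<zeta> (?\<mu> *\<^sub>R u k t)"
      using im ut unfolding w_end zeta_diff by (simp add: complex_eq_iff)
    ultimately have "Pi k t *v u k t = ?\<mu> *\<^sub>R u k t" using V_unique[OF t(1) t' elim(1)] by blast
    then show ?case using t elim(1) by blast
  qed
  then show ?thesis by (simp add: eventually_sequentially)
qed

end

context cyc begin

text \<open>Joint limit as k tends to infinity and t decreases to 0, with a range of t that does not
  depend on k.\<close>

definition lim2 :: "(nat \<Rightarrow> real \<Rightarrow> real ^ 'd ^ 'd) \<Rightarrow> real ^ 'd ^ 'd \<Rightarrow> bool" where
  "lim2 f L \<longleftrightarrow> (\<forall>\<epsilon>>0. \<exists>k0 \<sigma>. 0 < \<sigma> & (\<forall>k t. k0 <= k & 0 <= t & t <= \<sigma> --> norm (f k t - L) < \<epsilon>))"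

lemma lim2_seq:
  assumes "lim2 f L" "\<And>m. m <= k m" "\<And>m. 0 <= t m & t m <= 1 / real (Suc m)"
  shows "(\<lambda>m. f (k m) (t m)) \<longlonglongrightarrow> L"
proof (rule tendstoI)
  fix e :: real assume e: "0 < e"
  obtain k0 \<sigma> where s: "0 < \<sigma>" "\<And>k t. k0 <= k ==> 0 <= t ==> t <= \<sigma> ==> norm (f k t - L) < e"
    using assms(1)[unfolded lim2_def, rule_format, OF e] by auto
  obtain m0 where m0: "1 / real (Suc m0) < \<sigma>"
    using reals_Archimedean[OF s(1)] by (auto simp: inverse_eq_divide)
  have "dist (f (k m) (t m)) L < e" if m: "max k0 m0 <= m" for m
  proof -
    have "1 / real (Suc m) <= 1 / real (Suc m0)" using m by (simp add: frac_le)
    then have "t m <= \<sigma>" using assms(3)[of m] m0 by linarith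
    then show ?thesis using s(2)[of "k m" "t m"] assms(2)[of m] assms(3)[of m] m by (simp add: dist_norm)
  qed
  then show "\<forall>\<^sub>F m in sequentially. dist (f (k m) (t m)) L < e" unfolding eventually_sequentially by blast
qed

lemma qp_lim: "(\<And>i. i < j ==> (\<lambda>m. X' m i) \<longlonglongrightarrow> (L i :: real ^ 'd ^ 'd)) ==> (\<lambda>m. qp (X' m) j) \<longlonglongrightarrow> qp L j"
  by (induction j) (simp_all add: tendsto_matrix_matrix)

lemma qm_lim: "(\<And>i. i < j ==> (\<lambda>m. X' m i) \<longlonglongrightarrow> (L i :: real ^ 'd ^ 'd)) ==> (\<lambda>m. qm (X' m) j) \<longlonglongrightarrow> qm L j"
  by (induction j) (simp_all add: tendsto_matrix_matrix)

lemma qm_cong: "(\<And>i. i < j ==> L i = L' i) ==> qm L j = qm L' j"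
  by (induction j) simp_all

lemma invertible_qm': "(\<And>i. i < j ==> invertible (L i)) ==> invertible (qm L j :: real ^ 'd ^ 'd)"
  by (induction j) (simp_all add: invertible_mat1 invertible_mult)

text \<open>In the limit the cycle opens up into the homoclinic orbit, with past \<open>Lm\<close>,
  excursion \<open>Q\<close> and future \<open>Lp\<close>. There the central vector of coordinate 1
  is unique, so for large k and small t all \<open>u k t\<close> are close to it, and the excursion
  turns them by nearly the argument of \<open>c0\<close>, however long the cycle is. The image under
  \<open>Q\<close> is central as well, whence \<open>c0\<close> is nonzero.\<close>

lemma hom_limit:
  fixes Lp Lm :: "nat \<Rightarrow> real ^ 'd ^ 'd" and Q :: "real ^ 'd ^ 'd"
  assumes Lp: "\<And>j. invertible (Lp j)" "\<And>j. cone_pres (Lp j) J" "\<And>j. grow (Lp j) J aJ bJ"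
    and Lm: "\<And>j. invertible (Lm j)" "\<And>j. cone_pres (Lm j) K" "\<And>j. grow (Lm j) K aK bK"
    and Q: "invertible Q" "cone_pres Q J" "cone_pres Q K"
    and limp: "\<And>j. lim2 (\<lambda>k t. X k t j) (Lp j)" and limm: "\<And>j. lim2 (\<lambda>k t. X k t (n k - 1 - j)) (Lm j)"
    and limP: "lim2 P Q"
  shows "\<exists>c0. c0 ~= 0 & (\<exists>k1 \<sigma>. 0 < \<sigma> & \<sigma> <= \<tau> & (\<forall>k t. k1 <= k & 0 <= t & t <= \<sigma> & good k -->
      cmod (\<zeta> (P k t *v u k t) - c0) < cmod c0))"
proof -
  \<comment> \<open>The central space of the limit: the past decays at the rate of K, and after
    \<open>Q\<close> the future grows at most at the rate of J. All limits of the
    \<open>u k t\<close> will be shown to lie here.\<close>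
  define W where "W = Usp Lm (mat 1) aK \<inter> {v. Q *v v \<in> Ssp Lp (mat 1) bJ}"
  have sW: "subspace W"
  proof -
    have "subspace (Ssp Lp (mat 1) bJ)" "subspace (Usp Lm (mat 1) aK)"
      using ab by (auto intro: subspace_Ssp subspace_Usp)
    moreover have "subspace {v. Q *v v \<in> S}" if "subspace S" for S
      using that unfolding subspace_def by (auto simp: matrix_vector_right_distrib matrix_vector_mult_scaleR)
    ultimately show ?thesis unfolding W_def by (intro subspace_inter) auto
  qed
  have Wc: "en J (Q *v v) <= en (- J) (Q *v v) / 2" "en J v <= en (- J) v / 2" "2 * en (- K) v <= en K v" if "v \<in> W" for v
  proof -
    show 1: "en J (Q *v v) <= en (- J) (Q *v v) / 2"
      using Ssp_cone[of "mat 1" Lp J aJ bJ "Q *v v" 0, OF invertible_mat1 Lp ab(1,2)] that by (simp add: W_def)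
    show "en J v <= en (- J) v / 2" using cone_presD'[OF Q(2), of "1/2" v] 1 by simp
    have "matrix_inv (mat 1 ** qm Lm 0) *v v = v"
      using invertible_inv(1)[OF invertible_mat1, of v] by simp
    then show "2 * en (- K) v <= en K v"
      using Usp_cone[of "mat 1" Lm K aK bK v 0, OF invertible_mat1 Lm ab(3,4)] that by (simp only: W_def Int_iff)
  qed
  have Winj: "v = v'" if "v \<in> W" "v' \<in> W" "\<zeta> v = \<zeta> v'" for v v'
  proof -
    have d: "v - v' \<in> W" using that sW subspace_diff by blast
    have "norm (v - v') <= 3 * en (K - J) (v - v')" by (rule class_bound[OF JK(1) Wc(2)[OF d] Wc(3)[OF d]])
    then show ?thesis using that(3) unfolding cmod_zeta[symmetric] zeta_diff by simp
  qed
  have key: "l \<in> W & (\<lambda>m. \<zeta> (P (k (r m)) (t (r m)) *v u (k (r m)) (t (r m)))) \<longlonglongrightarrow> \<zeta> (Q *v l) & \<zeta> l = 1"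
    if k: "\<And>m. m <= k m" "\<And>m. good (k m)" and t: "\<And>m. 0 <= t m & t m <= 1 / real (Suc m) & t m <= \<tau>"
      and r: "strict_mono (r :: nat \<Rightarrow> nat)" and l: "(\<lambda>m. u (k (r m)) (t (r m))) \<longlonglongrightarrow> l" for k t r l
  proof -
    let ?k = "\<lambda>m. k (r m)" and ?t = "\<lambda>m. t (r m)"
    have rm: "m <= r m" for m by (rule seq_suble[OF r])
    have k': "m <= ?k m" for m using rm k(1) order_trans by blast
    have t': "0 <= ?t m & ?t m <= 1 / real (Suc m)" for m
    proof -
      have "1 / real (Suc (r m)) <= 1 / real (Suc m)" using rm[of m] by (simp add: frac_le)
      then show ?thesis using t[of "r m"] by linarith
    qed
    have t\<tau>: "0 <= ?t m" "?t m <= \<tau>" for m using t[of "r m"] by auto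
    have um: "u (?k m) (?t m) \<in> V (?k m) (?t m) & \<zeta> (u (?k m) (?t m)) = 1" for m
      using u[OF t\<tau> k(2)] by blast
    have lP: "(\<lambda>m. P (?k m) (?t m)) \<longlonglongrightarrow> Q" by (rule lim2_seq[OF limP k' t'])
    have lX: "(\<lambda>m. X (?k m) (?t m) j) \<longlonglongrightarrow> Lp j" for j by (rule lim2_seq[OF limp k' t'])
    have lY: "(\<lambda>m. X (?k m) (?t m) (n (?k m) - 1 - j)) \<longlonglongrightarrow> Lm j" for j by (rule lim2_seq[OF limm k' t'])
    have "filterlim (\<lambda>m. n (?k m)) at_top sequentially"
    proof (rule filterlim_compose[OF n])
      show "filterlim ?k at_top sequentially"
        unfolding filterlim_at_top using k' by (metis eventually_sequentiallyI order_trans)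
    qed
    then have big: "\<forall>\<^sub>F m in sequentially. j <= n (?k m)" for j by (simp add: filterlim_at_top)
    have Pl: "(\<lambda>m. P (?k m) (?t m) *v u (?k m) (?t m)) \<longlonglongrightarrow> Q *v l"
      by (rule tendsto_matrix_vector[OF lP l])
    have "Q *v l \<in> Ssp Lp (mat 1) bJ"
    proof (rule in_Ssp[of "mat 1" Lp J aJ bJ, OF invertible_mat1 Lp ab(1,2)])
      fix j
      have "(\<lambda>m. (qp (X (?k m) (?t m)) j ** P (?k m) (?t m)) *v u (?k m) (?t m)) \<longlonglongrightarrow> (qp Lp j ** Q) *v l"
        by (intro tendsto_matrix_vector tendsto_matrix_matrix qp_lim lX lP l)
      then have "1 * en J ((qp Lp j ** Q) *v l) <= 1/2 * en (- J) ((qp Lp j ** Q) *v l)"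
        by (rule en_lim_le) (use big[of j] in eventually_elim, use V_central(3)[OF t\<tau> k(2) um[THEN conjunct1]] in simp)
      moreover have "(qp Lp j ** mat 1) *v (Q *v l) = (qp Lp j ** Q) *v l" by (simp add: matrix_vector_mul_assoc)
      ultimately show "en J ((qp Lp j ** mat 1) *v (Q *v l)) <= 2 * en (- J) ((qp Lp j ** mat 1) *v (Q *v l))"
        using en_nonneg[of J "(qp Lp j ** Q) *v l"] en_nonneg[of "- J" "(qp Lp j ** Q) *v l"] by (simp only:)
    qed
    moreover have "l \<in> Usp Lm (mat 1) aK"
    proof (rule in_Usp[of "mat 1" Lm K aK bK, OF invertible_mat1 Lm ab(3,4)])
      fix j
      \<comment> \<open>Padding with \<open>mat 1\<close> keeps the product invertible also when the
        cycle has fewer than j returns.\<close>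
      define Y where "Y m i = (if i < n (?k m) then X (?k m) (?t m) (n (?k m) - 1 - i) else mat 1)" for m i
      have Yi: "invertible (qm (Y m) j)" for m
        by (rule invertible_qm') (use X[OF t\<tau>] invertible_mat1 in \<open>auto simp: Y_def\<close>)
      have "(\<lambda>m. Y m i) \<longlonglongrightarrow> Lm i" for i
        by (rule Lim_transform_eventually[OF lY[of i]]) (use big[of "Suc i"] in eventually_elim, simp add: Y_def)
      then have lq: "(\<lambda>m. qm (Y m) j) \<longlonglongrightarrow> qm Lm j" by (intro qm_lim)
      have "(\<lambda>m. matrix_inv (qm (Y m) j) *v u (?k m) (?t m)) \<longlonglongrightarrow> matrix_inv (qm Lm j) *v l"
        by (rule inv_vector_lim[OF lq Yi invertible_qm[OF Lm(1)] l])
      then have "2 * en (- K) (matrix_inv (qm Lm j) *v l) <= 1 * en K (matrix_inv (qm Lm j) *v l)"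
      proof (rule en_lim_le)
        show "\<forall>\<^sub>F m in sequentially. 2 * en (- K) (matrix_inv (qm (Y m) j) *v u (?k m) (?t m))
            <= 1 * en K (matrix_inv (qm (Y m) j) *v u (?k m) (?t m))"
          using big[of j]
        proof eventually_elim
          case (elim m)
          let ?n = "n (?k m)" and ?Pi = "Pi (?k m) (?t m)" and ?X = "X (?k m) (?t m)" and ?P = "P (?k m) (?t m)"
          have iP: "invertible ?Pi" using Pi[OF t\<tau>] by blast
          \<comment> \<open>The cycle is closed, so the past of \<open>u\<close> is the end of the
            preceding turn; \<open>v\<close> is the central vector at the start of that
            turn.\<close>
          define v where "v = matrix_inv ?Pi *v u (?k m) (?t m)"
          have vV: "v \<in> V (?k m) (?t m)"
            using Vsp_invariant_inv[OF iP] um[of m] pos unfolding v_def V_def by blast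
          have "qm (Y m) j = qm (\<lambda>i. ?X (?n - 1 - i)) j"
            by (rule qm_cong) (use elim in \<open>simp add: Y_def\<close>)
          then have "?Pi = qm (Y m) j ** (qp ?X (?n - j) ** ?P)"
            using qp_split[OF elim, of ?X] unfolding Pi_def by (simp add: matrix_mul_assoc)
          then have "u (?k m) (?t m) = qm (Y m) j *v ((qp ?X (?n - j) ** ?P) *v v)"
            using invertible_inv(1)[OF iP] unfolding v_def by (metis matrix_vector_mul_assoc)
          then have "matrix_inv (qm (Y m) j) *v u (?k m) (?t m) = (qp ?X (?n - j) ** ?P) *v v"
            using invertible_inv(2)[OF Yi] by simp
          then show ?case using V_central(4)[OF t\<tau> k(2) vV, of "?n - j"] by simp
        qed
      qed
      then show "en (- K) (matrix_inv (mat 1 ** qm Lm j) *v l) / 2 <= en K (matrix_inv (mat 1 ** qm Lm j) *v l)"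
        using en_nonneg[of "- K" "matrix_inv (qm Lm j) *v l"] unfolding matrix_mul_lid by linarith
    qed
    moreover have "\<zeta> l = 1" using tendsto_zeta[OF l] um by (simp add: LIMSEQ_const_iff)
    ultimately show ?thesis using tendsto_zeta[OF Pl] by (simp add: W_def)
  qed
  obtain g where g: "\<And>k. g <= k ==> good k" using eventually_good unfolding eventually_sequentially by blast
  have bdd: "norm (u k t) <= 3" if "good k" "0 <= t" "t <= \<tau>" for k t
    using V_central(5)[OF that(2,3,1), of "u k t"] u[OF that(2,3,1)] by simp
  obtain us r where r: "strict_mono (r :: nat \<Rightarrow> nat)" "((\<lambda>m. u (g + m) 0) \<circ> r) \<longlonglongrightarrow> us"
    using bounded_subseq[of "\<lambda>m. u (g + m) 0" 3] bdd g \<tau> by auto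
  have us: "us \<in> W & \<zeta> us = 1"
    using key[of "\<lambda>m. g + m" "\<lambda>_. 0" r us] r g \<tau> by (simp add: comp_def)
  define c0 where "c0 = \<zeta> (Q *v us)"
  have c0: "c0 ~= 0"
  proof
    assume "c0 = 0"
    moreover have "2 * en (- K) (Q *v us) <= en K (Q *v us)"
      using cone_presD[OF Q(3), of 2 us] Wc(3) us by simp
    then have "norm (Q *v us) <= 3 * en (K - J) (Q *v us)"
      using class_bound[OF JK(1) Wc(1)] us by blast
    ultimately have "Q *v us = 0" unfolding cmod_zeta[symmetric] c0_def by simp
    then have "us = 0" using invertible_inv(2)[OF Q(1), of us] by simp
    then show False using us by (simp add: \<zeta>_def complex_eq_iff)
  qed
  have "\<exists>k1 \<sigma>. 0 < \<sigma> & \<sigma> <= \<tau> & (\<forall>k t. k1 <= k & 0 <= t & t <= \<sigma> & good k -->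
      cmod (\<zeta> (P k t *v u k t) - c0) < cmod c0)"
  proof (rule ccontr)
    assume neg: "\<not> ?thesis"
    have "\<exists>k t. m <= k & 0 <= t & t <= min \<tau> (1 / real (Suc m)) & good k & \<not> cmod (\<zeta> (P k t *v u k t) - c0) < cmod c0" for m
    proof -
      have "0 < min \<tau> (1 / real (Suc m))" "min \<tau> (1 / real (Suc m)) <= \<tau>" using \<tau> by auto
      then show ?thesis using neg by blast
    qed
    then obtain k t where kt: "\<And>m. m <= k m & 0 <= t m & t m <= min \<tau> (1 / real (Suc m)) & good (k m) \<and>
        \<not> cmod (\<zeta> (P (k m) (t m) *v u (k m) (t m)) - c0) < cmod c0" by metis
    have "norm (u (k m) (t m)) <= 3" for m using kt[of m] by (intro bdd) auto
    then obtain l s where s: "strict_mono (s :: nat \<Rightarrow> nat)" "((\<lambda>m. u (k m) (t m)) \<circ> s) \<longlonglongrightarrow> l"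
      using bounded_subseq[of "\<lambda>m. u (k m) (t m)" 3] by blast
    have kk: "l \<in> W & (\<lambda>m. \<zeta> (P (k (s m)) (t (s m)) *v u (k (s m)) (t (s m)))) \<longlonglongrightarrow> \<zeta> (Q *v l) & \<zeta> l = 1"
      by (rule key[of k t s l]) (use kt s in \<open>auto simp: comp_def\<close>)
    then have "l = us" using Winj us by auto
    then have "(\<lambda>m. \<zeta> (P (k (s m)) (t (s m)) *v u (k (s m)) (t (s m)))) \<longlonglongrightarrow> c0" using kk c0_def by simp
    moreover have "0 < cmod c0" using c0 by simp
    ultimately have "\<forall>\<^sub>F m in sequentially. dist (\<zeta> (P (k (s m)) (t (s m)) *v u (k (s m)) (t (s m)))) c0 < cmod c0"
      by (rule tendstoD)
    then show False using kt by (auto simp: eventually_sequentially dist_norm)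
  qed
  then show ?thesis using c0 by blast
qed

end

section \<open>Homoclinic orbits of factors of subshifts\<close>

definition sh :: "int \<Rightarrow> (int \<Rightarrow> nat) \<Rightarrow> int \<Rightarrow> nat" where
  "sh k z = (\<lambda>i. z (i + k))"

lemma shift_sh: "shift z = sh 1 z" by (simp add: shift_def sh_def)

lemma sh_sh: "sh k (sh l z) = sh (k + l) z" by (simp add: sh_def add.assoc)

lemma shift_pow: "(shift ^^ k) z = sh (int k) z"
  by (induction k) (simp_all add: shift_sh sh_sh, simp add: sh_def)

lemma sh_sft [simp]: "sh k z \<in> sft n a \<longleftrightarrow> z \<in> sft n a"
proof
  assume "sh k z \<in> sft n a"
  then have "z (i + k) \<in> {1..n} & a (z (i + k)) (z (i + 1 + k)) = 1" for i
    by (simp add: sft_def sh_def)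
  then have *: "z (i + k) \<in> {1..n} & a (z (i + k)) (z (i + k + 1)) = 1" for i
    by (metis add.assoc add.commute)
  have "z i \<in> {1..n} & a (z i) (z (i + 1)) = 1" for i using *[of "i - k"] by simp
  then show "z \<in> sft n a" by (simp add: sft_def)
next
  assume "z \<in> sft n a"
  then have "z i \<in> {1..n} & a (z i) (z (i + 1)) = 1" for i by (simp add: sft_def)
  then have "z (i + k) \<in> {1..n} & a (z (i + k)) (z (i + 1 + k)) = 1" for i
    by (metis add.assoc add.commute)
  then show "sh k z \<in> sft n a" by (simp add: sft_def sh_def)
qed

definition cyl :: "(int \<Rightarrow> nat) \<Rightarrow> int \<Rightarrow> (int \<Rightarrow> nat) set" where
  "cyl z J = {y. \<forall>i. \<bar>i\<bar> <= J --> y i = z i}"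

lemma cyl_refl [simp]: "z \<in> cyl z J" by (simp add: cyl_def)

lemma open_cyl: "open (cyl z J)"
proof -
  have "cyl z J = (\<Inter>i\<in>{-J..J}. (\<lambda>y. y i) -` {z i})" by (auto simp: cyl_def abs_le_iff)
  moreover have "open ((\<lambda>y::int \<Rightarrow> nat. y i) -` {c})" for i c
    by (intro open_vimage open_discrete continuous_on_product_coordinates)
  ultimately show ?thesis by (simp add: open_INT)
qed

lemma closed_finite_seqs: "finite F ==> closed (F :: (int \<Rightarrow> nat) set)"
proof (induction F rule: finite_induct)
  case (insert y F)
  have "{y} = (\<Inter>i. (\<lambda>z. z i) -` {y i})" by auto
  moreover have "closed ((\<lambda>y::int \<Rightarrow> nat. y i) -` {c})" for i c
    by (intro closed_vimage closed_singleton continuous_on_product_coordinates)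
  ultimately have "closed {y}" by (metis (no_types, lifting) closed_INT)
  then show ?case using insert.IH closed_Un[of "{y}" F] by simp
qed simp

lemma cyl_basis:
  assumes "open S" "z \<in> S"
  shows "\<exists>J. cyl z J \<subseteq> S"
proof -
  obtain X where X: "z \<in> (\<Pi>\<^sub>E i\<in>UNIV. X i)" "finite {i. X i ~= UNIV}" "(\<Pi>\<^sub>E i\<in>UNIV. X i) \<subseteq> S"
    using product_topology_open_contains_basis[of "\<lambda>_. euclidean" UNIV S z] assms
    by (auto simp: open_fun_def)
  define J where "J = Max (insert 0 (abs ` {i. X i ~= UNIV}))"
  have J: "\<bar>i\<bar> <= J" if "X i ~= UNIV" for i
    unfolding J_def using X(2) that by (intro Max_ge) auto
  have "cyl z J \<subseteq> S"
  proof
    fix y assume y: "y \<in> cyl z J"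
    have "y i \<in> X i" for i
    proof (cases "X i = UNIV")
      case False
      then have "y i = z i" using J y by (simp add: cyl_def)
      then show ?thesis using X(1) by auto
    qed simp
    then show "y \<in> S" using X(3) by auto
  qed
  then show ?thesis by blast
qed

text \<open>Without late returns the cylinder meets the subshift in a finite set, so \<omega> is
  isolated and lies on the orbit of z. Density at the point just before z then makes z periodic, and
  its dense orbit, hence the subshift, finite.\<close>

lemma recurrence:
  assumes z: "z \<in> sft n a" "sft n a \<subseteq> closure (range (\<lambda>k. (shift ^^ k) z))" and inf: "infinite (sft n a)"
    and \<omega>: "\<omega> \<in> sft n a"
  shows "\<exists>k\<ge>K. \<forall>i. \<bar>i\<bar> <= J --> z (i + int k) = \<omega> i"
proof (rule ccontr)
  let ?\<Omega> = "sft n a"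
  assume neg: "\<not> ?thesis"
  have cl: "y \<in> ?\<Omega> ==> open U ==> y \<in> U ==> \<exists>k. sh (int k) z \<in> U" for y U
    using z(2) open_Int_closure_eq_empty[of U "range (\<lambda>k. sh (int k) z)"] unfolding shift_pow by blast
  let ?F = "(\<lambda>k. sh (int k) z) ` {..<K}"
  have "?\<Omega> \<inter> cyl \<omega> J \<subseteq> ?F"
  proof
    fix y assume y: "y \<in> ?\<Omega> \<inter> cyl \<omega> J"
    show "y \<in> ?F"
    proof (rule ccontr)
      assume "y \<notin> ?F"
      moreover have "open (cyl \<omega> J - ?F)" by (intro open_Diff open_cyl closed_finite_seqs) simp
      ultimately obtain k where k: "sh (int k) z \<in> cyl \<omega> J - ?F" using cl[of y] y by blast
      then have "K <= k" by (metis Diff_iff imageI lessThan_iff not_le)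
      then show False using k neg by (auto simp: cyl_def sh_def)
    qed
  qed
  then have fin: "finite (?\<Omega> \<inter> cyl \<omega> J)" using finite_subset by blast
  let ?U = "cyl \<omega> J - (?\<Omega> \<inter> cyl \<omega> J - {\<omega>})"
  have U: "open ?U" using fin by (intro open_Diff open_cyl closed_finite_seqs) simp
  have Uw: "?U \<inter> ?\<Omega> = {\<omega>}" using \<omega> by auto
  obtain k0 where k0: "\<omega> = sh (int k0) z" using cl[OF \<omega> U] Uw z(1) by fastforce
  \<comment> \<open>One more than k0, so that \<open>sh (- ?j) \<omega>\<close> is the predecessor
    of z; a visit near it forces the orbit to come back to \<omega> after the positive time k +
    1.\<close>
  let ?j = "int k0 + 1"
  have "continuous_on UNIV (sh ?j)"
    unfolding sh_def by (intro continuous_on_coordinatewise_then_product continuous_on_product_coordinates)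
  then have "open (sh ?j -` ?U)" using U by (rule open_vimage[rotated])
  moreover have "sh (- ?j) \<omega> \<in> sh ?j -` ?U" by (simp add: sh_sh) (use \<omega> in \<open>simp add: sh_def\<close>)
  ultimately obtain k where k: "sh (int k) z \<in> sh ?j -` ?U"
    using cl[of "sh (- ?j) \<omega>"] \<omega> by (meson sh_sft)
  then have "sh (?j + int k) z \<in> ?U \<inter> ?\<Omega>" using z(1) by (simp add: sh_sh)
  then have e: "sh (?j + int k) z = sh (int k0) z" using Uw k0 by auto
  have per: "z (i + (int k + 1)) = z i" for i
    using fun_cong[OF e, of "i - int k0"] by (simp add: sh_def algebra_simps)
  have "z (i + int c * (int k + 1)) = z i" for i c
  proof (induction c)
    case (Suc c)
    then show ?case using per[of "i + int c * (int k + 1)"] by (simp add: algebra_simps)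
  qed simp
  then have "sh (int l) z = sh (int (l mod (k + 1))) z" for l
  proof -
    have "int l = int (l mod (k + 1)) + int (l div (k + 1)) * (int k + 1)"
      by (metis mod_div_mult_eq of_nat_add of_nat_mult of_nat_Suc Suc_eq_plus1 add.commute)
    then show ?thesis
      using \<open>\<And>i c. z (i + int c * (int k + 1)) = z i\<close>[of "_ + int (l mod (k + 1))" "l div (k + 1)"]
      by (auto simp: sh_def fun_eq_iff add.assoc)
  qed
  then have "range (\<lambda>l. sh (int l) z) \<subseteq> (\<lambda>l. sh (int l) z) ` {..k}"
    by (smt (verit) Suc_eq_plus1 atMost_iff image_iff image_subset_iff le_simps(2) mod_less_divisor zero_less_Suc)
  then have "finite (range (\<lambda>l. sh (int l) z))" using finite_subset by blast
  then have "?\<Omega> \<subseteq> range (\<lambda>l. sh (int l) z)" using z(2) unfolding shift_pow by (simp add: closure_closed closed_finite_seqs)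
  then show False using inf \<open>finite (range (\<lambda>l. sh (int l) z))\<close> finite_subset by blast
qed

lemma periodic_extension:
  fixes z :: "int \<Rightarrow> nat" and c \<Lambda> :: int
  assumes "0 < \<Lambda>" and v: "\<And>i. c <= i ==> i < c + \<Lambda> ==> z i \<in> {1..n} & a (z i) (z (i + 1)) = 1"
    and e: "z (c + \<Lambda>) = z c"
  defines "y \<equiv> \<lambda>i. z (c + (i - c) mod \<Lambda>)"
  shows "y \<in> sft n a" "\<And>i. y (i + \<Lambda>) = y i" "\<And>i. c <= i ==> i <= c + \<Lambda> ==> y i = z i"
proof -
  have m: "0 <= (i - c) mod \<Lambda> & (i - c) mod \<Lambda> < \<Lambda>" for i using assms(1) by simp
  have s: "y (i + 1) = z (c + (i - c) mod \<Lambda> + 1)" for i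
  proof (cases "(i - c) mod \<Lambda> + 1 < \<Lambda>")
    case True
    have "(i + 1 - c) mod \<Lambda> = ((i - c) mod \<Lambda> + 1) mod \<Lambda>"
      by (simp add: mod_simps algebra_simps)
    also have "\<dots> = (i - c) mod \<Lambda> + 1" using True m[of i] by (intro mod_pos_pos_trivial) auto
    finally show ?thesis by (simp add: y_def add.assoc)
  next
    case False
    then have l: "(i - c) mod \<Lambda> + 1 = \<Lambda>" using m[of i] by linarith
    have "(i + 1 - c) mod \<Lambda> = ((i - c) mod \<Lambda> + 1) mod \<Lambda>"
      by (simp add: mod_simps algebra_simps)
    also have "\<dots> = 0" unfolding l by simp
    finally show ?thesis using e l by (simp add: y_def add.assoc)
  qed
  show "y \<in> sft n a"
    unfolding sft_def using v[of "c + (_ - c) mod \<Lambda>"] m s by (auto simp: y_def)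
  show "y (i + \<Lambda>) = y i" for i
  proof -
    have "(i + \<Lambda> - c) mod \<Lambda> = (i - c) mod \<Lambda>" by (metis add_diff_eq add.commute diff_add_eq mod_add_self1)
    then show ?thesis by (simp add: y_def)
  qed
  show "y i = z i" if "c <= i" "i <= c + \<Lambda>" for i
  proof (cases "i = c + \<Lambda>")
    case True then show ?thesis using e by (simp add: y_def)
  next
    case False then show ?thesis using that by (simp add: y_def)
  qed
qed

text \<open>Recurrence and not just density, because the second letter has to be read after the
  first.\<close>

lemma connecting_path:
  assumes z: "z \<in> sft n a" "sft n a \<subseteq> closure (range (\<lambda>k. (shift ^^ k) z))" and inf: "infinite (sft n a)"
    and \<omega>: "\<omega> \<in> sft n a" "\<xi> \<in> sft n a"
  shows "\<exists>k l. k < l & z k = \<omega> i & z l = \<xi> j"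
proof -
  obtain k where k: "z (i + int k) = \<omega> i" using recurrence[OF z inf \<omega>(1), of 0 "\<bar>i\<bar>"] by auto
  obtain l where l: "l \<ge> nat (\<bar>i\<bar> + int k + \<bar>j\<bar> + 1)" "z (j + int l) = \<xi> j"
    using recurrence[OF z inf \<omega>(2), of "nat (\<bar>i\<bar> + int k + \<bar>j\<bar> + 1)" "\<bar>j\<bar>"] by auto
  have "i + int k < j + int l" using l(1) by linarith
  then show ?thesis using k l(2) by blast
qed

text \<open>Concatenates the past of \<omega>, a connecting word, a window of \<xi>, another
  connecting word and the future of \<omega>. Both tails are attached at the letter
  \<open>\<omega> 0\<close>, which fixes the phase on either side.\<close>

lemma homoclinic_point:
  assumes z: "z \<in> sft n a" "sft n a \<subseteq> closure (range (\<lambda>k. (shift ^^ k) z))" and inf: "infinite (sft n a)"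
    and \<omega>: "\<omega> \<in> sft n a" and \<xi>: "\<xi> \<in> sft n a" and J: "0 <= J"
  shows "\<exists>y \<alpha> \<beta>. y \<in> sft n a & 0 < \<alpha> & 0 < \<beta> & y \<in> cyl \<xi> J & (\<forall>i\<le>-\<alpha>. y i = \<omega> (i + \<alpha>)) & (\<forall>i\<ge>\<beta>. y i = \<omega> (i - \<beta>))"
proof -
  obtain k1 l1 where 1: "k1 < l1" "z k1 = \<omega> 0" "z l1 = \<xi> (- J)"
    using connecting_path[OF z inf \<omega> \<xi>] by blast
  obtain k2 l2 where 2: "k2 < l2" "z k2 = \<xi> J" "z l2 = \<omega> 0"
    using connecting_path[OF z inf \<xi> \<omega>] by blast
  define \<alpha> where "\<alpha> = J + (l1 - k1)"
  define \<beta> where "\<beta> = J + (l2 - k2)"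
  define y where "y i = (if i <= -\<alpha> then \<omega> (i + \<alpha>) else if i <= -J then z (l1 + i + J)
     else if i <= J then \<xi> i else if i <= \<beta> then z (k2 + i - J) else \<omega> (i - \<beta>))" for i
  have v: "w i \<in> {1..n}" "a (w i) (w (i + 1)) = 1" if "w \<in> sft n a" for w i using that by (auto simp: sft_def)
  \<comment> \<open>The five formulas overlap at the seams, so that every transition can be checked
    inside a single piece.\<close>
  have r1: "y i = \<omega> (i + \<alpha>)" if "i <= -\<alpha>" for i using that by (simp add: y_def)
  have r2: "y i = z (l1 + i + J)" if "-\<alpha> <= i" "i <= -J" for i
    using that 1 by (cases "i = -\<alpha>") (auto simp: y_def \<alpha>_def)
  have r3: "y i = \<xi> i" if "-J <= i" "i <= J" for i
    using that 1 J by (cases "i = -J") (auto simp: y_def \<alpha>_def)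
  have r4: "y i = z (k2 + i - J)" if "J <= i" "i <= \<beta>" for i
  proof (cases "i = J")
    case True then show ?thesis using r3[of i] J 2 by simp
  qed (use that 1 2 J in \<open>auto simp: y_def \<alpha>_def\<close>)
  have r5: "y i = \<omega> (i - \<beta>)" if "\<beta> <= i" for i
  proof (cases "i = \<beta>")
    case True then show ?thesis using r4[of i] 2 J by (simp add: \<beta>_def)
  qed (use that 1 2 J in \<open>auto simp: y_def \<alpha>_def \<beta>_def\<close>)
  have "y i \<in> {1..n} & a (y i) (y (i + 1)) = 1" for i
  proof -
    consider "i + 1 <= -\<alpha>" | "-\<alpha> <= i" "i + 1 <= -J" | "-J <= i" "i + 1 <= J" | "J <= i" "i + 1 <= \<beta>" | "\<beta> <= i"
      by linarith
    then show ?thesis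
    proof cases
      case 1 then show ?thesis using r1[of i] r1[of "i + 1"] v[OF \<omega>, of "i + \<alpha>"] by (simp add: algebra_simps)
    next
      case 2 then show ?thesis using r2[of i] r2[of "i + 1"] v[OF z(1), of "l1 + i + J"] by (simp add: algebra_simps)
    next
      case 3 then show ?thesis using r3[of i] r3[of "i + 1"] v[OF \<xi>, of i] by simp
    next
      case 4 then show ?thesis using r4[of i] r4[of "i + 1"] v[OF z(1), of "k2 + i - J"] by (simp add: algebra_simps)
    next
      case 5 then show ?thesis using r5[of i] r5[of "i + 1"] v[OF \<omega>, of "i - \<beta>"] by (simp add: algebra_simps)
    qed
  qed
  then have "y \<in> sft n a" by (simp add: sft_def)
  moreover have "y \<in> cyl \<xi> J" using r3 by (auto simp: cyl_def abs_le_iff)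
  moreover have "0 < \<alpha>" "0 < \<beta>" using 1 2 J by (auto simp: \<alpha>_def \<beta>_def)
  ultimately show ?thesis using r1 r5 by blast
qed

lemma int_periodic:
  fixes z :: "int \<Rightarrow> 'a"
  assumes "\<And>i. z (i + l) = z i"
  shows "z (i + c * l) = z i"
proof (induction c rule: int_induct[where k = 0])
  case (step1 c) then show ?case using assms[of "i + c * l"] by (simp add: algebra_simps)
next
  case (step2 c) then show ?case using assms[of "i + (c - 1) * l"] by (simp add: algebra_simps)
qed simp

locale sft_factor =
  fixes n :: nat and a :: "nat \<Rightarrow> nat \<Rightarrow> nat" and X :: "'m::t2_space set" and T :: "'m \<Rightarrow> 'm" and q :: "(int \<Rightarrow> nat) \<Rightarrow> 'm"
  assumes trans: "transitive_on (sft n a) shift" and infX: "infinite X"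
    and cq: "continuous_on (sft n a) q" and imq: "q ` sft n a = X" and comm: "\<And>z. z \<in> sft n a ==> q (shift z) = T (q z)"
    and TX: "T ` X \<subseteq> X" and cT: "continuous_on X T"
begin

text \<open>Images of periodic sequences rather than all periodic points of \<open>T\<close>:
  excursions are built in the subshift and start from a periodic lift.\<close>

definition Per :: "'m set" where
  "Per = {q \<omega> | \<omega>. \<omega> \<in> sft n a & (\<exists>l>0. \<forall>i. \<omega> (i + l) = \<omega> i)}"

lemma q_sh: "z \<in> sft n a ==> q (sh (i + 1) z) = T (q (sh i z))"
  using comm[of "sh i z"] by (simp add: shift_sh sh_sh add.commute)

lemma q_sh_nat: "z \<in> sft n a ==> q (sh (i + int k) z) = (T ^^ k) (q (sh i z))"
proof (induction k)
  case (Suc k)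
  then show ?case using q_sh[of z "i + int k"] by (simp add: algebra_simps)
qed simp

lemma qX: "z \<in> sft n a ==> q (sh i z) \<in> X" using imq by auto

lemma inf_sft: "infinite (sft n a)" using infX imq finite_imageI by blast

lemma q_nbhd:
  assumes "z \<in> sft n a" "open W" "q z \<in> W"
  shows "\<exists>J\<ge>0. \<forall>y\<in>sft n a. y \<in> cyl z J --> q y \<in> W"
proof -
  obtain A where A: "open A" "z \<in> A" "\<And>y. y \<in> sft n a ==> y \<in> A ==> q y \<in> W"
    using cq assms unfolding continuous_on_topological by metis
  obtain J where J: "cyl z J \<subseteq> A" using cyl_basis[OF A(1,2)] by blast
  have "cyl z (max J 0) \<subseteq> cyl z J" by (auto simp: cyl_def)
  then show ?thesis using J A(3) by (intro exI[of _ "max J 0"]) auto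
qed

lemma T_pow_X: "x \<in> X ==> (T ^^ k) x \<in> X" by (induction k) (use TX in auto)

lemma continuous_T_pow: "continuous_on X (T ^^ k)"
proof (induction k)
  case (Suc k)
  have "(T ^^ k) ` X \<subseteq> X" using T_pow_X by blast
  then show ?case using continuous_on_compose[OF Suc continuous_on_subset[OF cT]] by simp
qed (simp add: id_def continuous_on_id)

lemma Per_X: "Per \<subseteq> X" using imq by (auto simp: Per_def)

lemma Per_nonempty: "Per ~= {}"
proof -
  obtain z where z: "z \<in> sft n a" "sft n a \<subseteq> closure (range (\<lambda>k. (shift ^^ k) z))"
    using trans unfolding transitive_on_def by blast
  obtain k l where kl: "k < l" "z k = z 0" "z l = z 0" using connecting_path[OF z inf_sft z(1) z(1), of 0 0] by blast
  have zv: "\<And>i. k <= i ==> i < k + (l - k) ==> z i \<in> {1..n} & a (z i) (z (i + 1)) = 1" using z(1) by (auto simp: sft_def)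
  have "0 < l - k" "z (k + (l - k)) = z k" using kl by auto
  note pe = periodic_extension[of "l - k" k z n a, OF this(1) zv this(2)]
  show ?thesis using pe(1,2) \<open>0 < l - k\<close> unfolding Per_def by blast
qed

lemma Per_periodic:
  assumes "p \<in> Per"
  shows "\<exists>m>0. (T ^^ m) p = p"
proof -
  obtain \<omega> l where \<omega>: "p = q \<omega>" "\<omega> \<in> sft n a" "0 < (l::int)" "\<And>i. \<omega> (i + l) = \<omega> i"
    using assms unfolding Per_def by blast
  have "sh (0 + int (nat l)) \<omega> = \<omega>" using \<omega>(3,4) by (auto simp: sh_def)
  moreover have "sh 0 \<omega> = \<omega>" by (simp add: sh_def)
  ultimately have "(T ^^ nat l) p = p" using q_sh_nat[OF \<omega>(2), of 0 "nat l"] \<omega>(1) by simp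
  then show ?thesis using \<omega>(3) by (metis zero_less_nat_eq)
qed

lemma has_period_exists:
  assumes "p \<in> Per"
  shows "\<exists>m. has_period T p m"
proof -
  let ?Q = "\<lambda>m. 0 < m & (T ^^ m) p = p"
  have "\<exists>m. ?Q m" using Per_periodic[OF assms] by blast
  then have "?Q (Least ?Q)" by (rule LeastI_ex)
  then have "has_period T p (Least ?Q)" unfolding has_period_def using not_less_Least[of _ ?Q] by blast
  then show ?thesis by blast
qed

lemma T_pow_mult: "(T ^^ m) p = p ==> (T ^^ (m * k)) p = p"
  by (induction k) (simp_all add: funpow_add)

text \<open>Time near p is counted in multiples of a period m of p, while the lift \<omega> has its
  own period l. Closing up the homoclinic sequence after a long stay in the periodic part gives the
  orbits \<open>y k\<close>, again images of periodic sequences, which shadow \<open>x\<close> for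
  longer and longer times.\<close>

lemma homoclinic_data:
  assumes p: "p \<in> Per" and m: "0 < m" "(T ^^ m) p = p"
  shows "\<exists>x \<alpha> \<beta> N y. (\<forall>i. x i \<in> X & T (x i) = x (i + 1)) & (\<forall>j. x 0 ~= (T ^^ j) p) & 0 < \<alpha> & 0 < \<beta> \<and>
    filterlim N at_top sequentially \<and>
    (\<forall>k i. y k i \<in> Per & T (y k i) = y k (i + 1) & y k (i + (\<alpha> + \<beta> + int m * int (N k))) = y k i) \<and>
    (\<forall>i. (\<lambda>k. y k i) \<longlonglongrightarrow> x i) \<and>
    (\<forall>W. open W & p \<in> W --> (\<exists>J. (\<forall>j\<ge>J. x (- \<alpha> - int m * int j) \<in> W & x (\<beta> + int m * int j) \<in> W) \<and>
       (\<forall>k j. J <= j & j + J <= N k --> y k (\<beta> + int m * int j) \<in> W)))"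
proof -
  obtain \<omega> l where \<omega>: "p = q \<omega>" "\<omega> \<in> sft n a" "0 < (l::int)" "\<And>i. \<omega> (i + l) = \<omega> i"
    using p unfolding Per_def by blast
  obtain z0 where z0: "z0 \<in> sft n a" "sft n a \<subseteq> closure (range (\<lambda>k. (shift ^^ k) z0))"
    using trans unfolding transitive_on_def by blast
  let ?O = "range (\<lambda>j. (T ^^ j) p)"
  have finO: "finite ?O"
  proof -
    have "(T ^^ j) p \<in> (\<lambda>j. (T ^^ j) p) ` {..<m}" for j
      using funpow_mod_eq[OF m(2), of j] m(1) by (metis imageI lessThan_iff mod_less_divisor)
    then show ?thesis by (meson finite_imageI finite_lessThan finite_subset image_subsetI)
  qed
  then have "\<not> X \<subseteq> ?O" using infX by (metis finite_subset)
  then obtain x' where "x' \<in> X" "x' \<notin> ?O" unfolding subset_eq by blast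
  then obtain \<xi> where \<xi>: "\<xi> \<in> sft n a" "q \<xi> \<notin> ?O" using imq by blast
  have "open (- ?O)" using finO by (simp add: finite_imp_closed open_Compl)
  then obtain J where J: "0 <= J" "\<And>y. y \<in> sft n a ==> y \<in> cyl \<xi> J ==> q y \<notin> ?O"
    using q_nbhd[OF \<xi>(1), of "- ?O"] \<xi>(2) by auto
  obtain z \<alpha> \<beta> where z: "z \<in> sft n a" "0 < \<alpha>" "0 < \<beta>" "z \<in> cyl \<xi> J"
    "\<And>i. i <= -\<alpha> ==> z i = \<omega> (i + \<alpha>)" "\<And>i. \<beta> <= i ==> z i = \<omega> (i - \<beta>)"
    using homoclinic_point[OF z0 inf_sft \<omega>(2) \<xi>(1) J(1)] by blast
  define x where "x i = q (sh i z)" for i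
  \<comment> \<open>A multiple of l, so that the stay near p also closes up in the lift.\<close>
  define N where "N k = k * nat l" for k
  have L: "int m * int (N k) = int (m * k) * l" for k using \<omega>(3) by (simp add: N_def)
  define \<Lambda> where "\<Lambda> k = \<alpha> + \<beta> + int m * int (N k)" for k
  define yy where "yy k i = z (- \<alpha> + (i - - \<alpha>) mod \<Lambda> k)" for k i
  have \<omega>L: "\<omega> (i + c * l) = \<omega> i" for i c using int_periodic[of \<omega> l, OF \<omega>(4)] .
  have \<Lambda>pos: "0 < \<Lambda> k" for k using z(2,3) by (simp add: \<Lambda>_def add_pos_nonneg)
  have ze: "z (- \<alpha> + \<Lambda> k) = z (- \<alpha>)" for k
  proof -
    have "z (- \<alpha> + \<Lambda> k) = \<omega> (int m * int (N k))" using z(6)[of "- \<alpha> + \<Lambda> k"] by (simp add: \<Lambda>_def)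
    also have "\<dots> = \<omega> 0" unfolding L using \<omega>L[of 0 "int (m * k)"] by simp
    also have "\<dots> = z (- \<alpha>)" using z(5)[of "- \<alpha>"] by simp
    finally show ?thesis .
  qed
  have zv: "z i \<in> {1..n} & a (z i) (z (i + 1)) = 1" for i using z(1) by (auto simp: sft_def)
  note pe = periodic_extension[of "\<Lambda> _" "- \<alpha>" z n a, OF \<Lambda>pos zv ze, folded yy_def]
  have yy: "yy k \<in> sft n a" "yy k (i + \<Lambda> k) = yy k i" for k i using pe by auto
  have yz: "yy k i = z i" if "- \<alpha> <= i" "i <= - \<alpha> + \<Lambda> k" for k i using pe(3) that by auto
  \<comment> \<open>To the left of the excursion the periodic sequence has wrapped around, but there
    it reads \<omega> in the same phase as the tail of z, so the agreement reaches m N k further on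
    that side too.\<close>
  have yz2: "yy k i = z i" if "- \<alpha> - int m * int (N k) <= i" "i <= \<beta> + int m * int (N k)" for k i
  proof (cases "- \<alpha> <= i")
    case True then show ?thesis using yz that by (simp add: \<Lambda>_def)
  next
    case False
    have "yy k i = yy k (i + \<Lambda> k)" using yy(2) by simp
    also have "\<dots> = z (i + \<Lambda> k)" using False that z(2,3) by (intro yz) (auto simp: \<Lambda>_def)
    also have "\<dots> = \<omega> (i + \<alpha> + int m * int (N k))" using z(6)[of "i + \<Lambda> k"] that by (simp add: \<Lambda>_def algebra_simps)
    also have "\<dots> = \<omega> (i + \<alpha> + int (m * k) * l)" unfolding L ..
    also have "\<dots> = z i" using \<omega>L z(5)[of i] False by simp
    finally show ?thesis .
  qed
  define y where "y k i = q (sh i (yy k))" for k i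
  have shper: "sh i (yy k) \<in> sft n a & (\<exists>l>0. \<forall>j. sh i (yy k) (j + l) = sh i (yy k) j)" for i k
  proof (intro conjI exI[of _ "\<Lambda> k"] allI)
    show "sh i (yy k) \<in> sft n a" using yy(1) by simp
    show "0 < \<Lambda> k" by (rule \<Lambda>pos)
    fix j
    have "sh i (yy k) (j + \<Lambda> k) = yy k (j + i + \<Lambda> k)" by (simp add: sh_def algebra_simps)
    then show "sh i (yy k) (j + \<Lambda> k) = sh i (yy k) j" using yy(2) by (simp add: sh_def)
  qed
  have 1: "\<forall>i. x i \<in> X & T (x i) = x (i + 1)" using qX[OF z(1)] q_sh[OF z(1)] by (simp add: x_def)
  have 2: "\<forall>j. x 0 ~= (T ^^ j) p"
  proof
    fix j
    have "sh 0 z = z" by (simp add: sh_def)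
    then have "x 0 \<notin> ?O" using J(2)[OF z(1,4)] by (simp only: x_def) simp
    then show "x 0 ~= (T ^^ j) p" by blast
  qed
  have nl: "k <= N k" for k using \<omega>(3) by (simp add: N_def Suc_le_eq)
  then have 3: "filterlim N at_top sequentially"
    unfolding filterlim_at_top by (metis eventually_sequentiallyI order_trans)
  have 4: "\<forall>k i. y k i \<in> Per & T (y k i) = y k (i + 1) & y k (i + (\<alpha> + \<beta> + int m * int (N k))) = y k i"
  proof (intro allI conjI)
    fix k i
    show "y k i \<in> Per" unfolding Per_def y_def using shper by blast
    show "T (y k i) = y k (i + 1)" unfolding y_def by (rule q_sh[OF yy(1), symmetric])
    have "sh (i + \<Lambda> k) (yy k) = sh i (yy k)" using yy(2) by (auto simp: sh_def fun_eq_iff add.assoc[symmetric])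
    then show "y k (i + (\<alpha> + \<beta> + int m * int (N k))) = y k i" by (simp add: y_def \<Lambda>_def)
  qed
  have mN: "k <= m * N k" for k
    using nl[of k] m(1) by (metis le_trans mult_le_mono1 nat_mult_1 Suc_leI One_nat_def)
  have 5: "\<forall>i. (\<lambda>k. y k i) \<longlonglongrightarrow> x i"
  proof (intro allI topological_tendstoI)
    fix i W assume W: "open W" "x i \<in> W"
    obtain J where J: "0 <= J" "\<And>y. y \<in> sft n a ==> y \<in> cyl (sh i z) J ==> q y \<in> W"
      using q_nbhd[of "sh i z" W] z(1) W by (auto simp: x_def)
    have "y k i \<in> W" if k: "nat (\<bar>i\<bar> + J) <= k" for k
      unfolding y_def
    proof (rule J(2))
      show "sh i (yy k) \<in> cyl (sh i z) J"
        unfolding cyl_def sh_def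
      proof (intro CollectI allI impI)
        fix j :: int assume j: "\<bar>j\<bar> <= J"
        have "\<bar>i\<bar> + J <= int m * int (N k)" using k mN[of k] J(1) by (simp flip: of_nat_mult)
        then show "yy k (j + i) = z (j + i)" using j z(2,3) by (intro yz2) auto
      qed
    qed (use yy(1) in simp)
    then show "\<forall>\<^sub>F k in sequentially. y k i \<in> W" unfolding eventually_sequentially by blast
  qed
  \<comment> \<open>For negative j there is no iterate of \<open>T\<close> to apply; adding a
    multiple of l makes the shift nonnegative without changing the sequence.\<close>
  have qphase: "q (sh (int m * j) \<omega>) = p" for j
  proof -
    have "sh (int m * j) \<omega> = sh (int m * (j + (\<bar>j\<bar> * l))) \<omega>"
    proof
      fix x
      have "x + int m * (j + \<bar>j\<bar> * l) = (x + int m * j) + (int m * \<bar>j\<bar>) * l" by (simp add: algebra_simps)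
      then show "sh (int m * j) \<omega> x = sh (int m * (j + (\<bar>j\<bar> * l))) \<omega> x"
        unfolding sh_def by (simp only: \<omega>L)
    qed
    moreover have "0 <= j + \<bar>j\<bar> * l" using \<omega>(3) by (smt (verit) mult_le_cancel_left1 zero_le_mult_iff)
    then obtain t where t: "j + \<bar>j\<bar> * l = int t" using zero_le_imp_eq_int by blast
    ultimately have "sh (int m * j) \<omega> = sh (0 + int (m * t)) \<omega>" by (simp only: t of_nat_mult add_0_left)
    then have "q (sh (int m * j) \<omega>) = (T ^^ (m * t)) (q (sh 0 \<omega>))"
      by (simp only: q_sh_nat[OF \<omega>(2)])
    also have "sh 0 \<omega> = \<omega>" by (simp add: sh_def)
    finally show ?thesis using T_pow_mult[OF m(2)] \<omega>(1) by simp
  qed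
  have 6: "\<exists>J. (\<forall>j\<ge>J. x (- \<alpha> - int m * int j) \<in> W & x (\<beta> + int m * int j) \<in> W) \<and>
       (\<forall>k j. J <= j & j + J <= N k --> y k (\<beta> + int m * int j) \<in> W)" if W: "open W" "p \<in> W" for W
  proof -
    have "\<exists>J\<ge>0. \<forall>y\<in>sft n a. y \<in> cyl (sh i \<omega>) J --> q y \<in> W" if "q (sh i \<omega>) = p" for i
      using q_nbhd[of "sh i \<omega>" W] \<omega>(2) W that by simp
    then obtain G where G: "\<And>i. q (sh i \<omega>) = p ==> 0 <= G i & (\<forall>y\<in>sft n a. y \<in> cyl (sh i \<omega>) (G i) --> q y \<in> W)" by metis
    \<comment> \<open>Shifts of \<omega> by multiples of m have finitely many phases modulo l, so
      one cylinder radius serves for all of them.\<close>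
    define J0 where "J0 = Max (G ` {0..<l})"
    have near: "q w \<in> W" if w: "w \<in> sft n a" "\<And>i. \<bar>i\<bar> <= J0 ==> w i = \<omega> (i + int m * j)" for w j
    proof -
      let ?r = "(int m * j) mod l"
      have s: "sh (int m * j) \<omega> = sh ?r \<omega>"
      proof -
        have "int m * j = ?r + ((int m * j) div l) * l" by simp
        then have "x + int m * j = (x + ?r) + ((int m * j) div l) * l" for x by simp
        then show ?thesis unfolding sh_def by (metis \<omega>L)
      qed
      have r: "?r \<in> {0..<l}" using \<omega>(3) by simp
      have "G ?r <= J0" unfolding J0_def using r by (intro Max_ge) auto
      then have "w \<in> cyl (sh (int m * j) \<omega>) (G ?r)" using w(2) by (auto simp: cyl_def sh_def)
      moreover have "q (sh ?r \<omega>) = p" using qphase[of j] s by simp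
      ultimately show ?thesis using G[of ?r] w(1) unfolding s by blast
    qed
    define J where "J = nat J0"
    have J: "J0 <= int m * int j" if "J <= j" for j
    proof -
      have "1 * int j <= int m * int j" by (rule mult_right_mono) (use m(1) in linarith, simp)
      then show ?thesis using that unfolding J_def by linarith
    qed
    have "x (- \<alpha> - int m * int j) \<in> W & x (\<beta> + int m * int j) \<in> W" if j: "J <= j" for j
    proof
      show "x (- \<alpha> - int m * int j) \<in> W" unfolding x_def
      proof (rule near[of _ "- int j"])
        fix i assume "\<bar>i\<bar> <= J0"
        then have "i + (- \<alpha> - int m * int j) <= - \<alpha>" using J[OF j] by linarith
        from z(5)[OF this] show "sh (- \<alpha> - int m * int j) z i = \<omega> (i + int m * - int j)"
          by (simp add: sh_def)
      qed (use z(1) in simp)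
      show "x (\<beta> + int m * int j) \<in> W" unfolding x_def
      proof (rule near[of _ "int j"])
        fix i assume "\<bar>i\<bar> <= J0"
        then have "\<beta> <= i + (\<beta> + int m * int j)" using J[OF j] by linarith
        from z(6)[OF this] show "sh (\<beta> + int m * int j) z i = \<omega> (i + int m * int j)"
          by (simp add: sh_def)
      qed (use z(1) in simp)
    qed
    moreover have "y k (\<beta> + int m * int j) \<in> W" if j: "J <= j & j + J <= N k" for k j
      unfolding y_def
    proof (rule near[of _ "int j"])
      fix i :: int assume i: "\<bar>i\<bar> <= J0"
      have "J0 <= int m * int (N k - j)" using j by (intro J) auto
      then have 1: "J0 + int m * int j <= int m * int (N k)" using j by (simp add: of_nat_diff right_diff_distrib)
      have 2: "J0 <= int m * int j" using J j by blast
      have "yy k (i + (\<beta> + int m * int j)) = z (i + (\<beta> + int m * int j))"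
        using i 1 2 z(2,3) by (intro yz2) auto
      also have "\<dots> = \<omega> (i + int m * int j)" using z(6)[of "i + (\<beta> + int m * int j)"] i 2 by (simp add: algebra_simps)
      finally show "sh (\<beta> + int m * int j) (yy k) i = \<omega> (i + int m * int j)" by (simp add: sh_def)
    qed (use yy(1) in simp)
    ultimately show ?thesis by blast
  qed
  show ?thesis
    by (intro exI[of _ x] exI[of _ \<alpha>] exI[of _ \<beta>] exI[of _ N] exI[of _ y] conjI)
      (rule 1, rule 2, rule z(2), rule z(3), rule 3, rule 4, rule 5, intro allI impI, elim conjE, rule 6)
qed

end

section \<open>Bump functions\<close>

lemma frechet_eq: "(f has_derivative f') (at y) ==> frechet_derivative f (at y) = f'"
  using frechet_derivative_at by metis

lemma frechet_cong:
  assumes "open S" "y \<in> S" "\<And>z. z \<in> S ==> f z = g z"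
  shows "frechet_derivative f (at y) = frechet_derivative g (at y)"
proof -
  have "(f has_derivative f') (at y) \<longleftrightarrow> (g has_derivative f') (at y)" for f'
    using has_derivative_transform_within_open[of f f' y UNIV S g] has_derivative_transform_within_open[of g f' y UNIV S f] assms
    by auto
  then show ?thesis unfolding frechet_derivative_def by simp
qed

lemma Cr_on_Suc_has:
  "Cr_on (Suc r) S f ==> y \<in> S ==> (f has_derivative frechet_derivative f (at y)) (at y)"
  by (simp add: frechet_derivative_works[symmetric])

lemma Cr_on_SucI:
  assumes S: "open S" and d: "\<And>y. y \<in> S ==> (f has_derivative f' y) (at y)"
    and c: "\<And>b. b \<in> Basis ==> Cr_on r S (\<lambda>y. f' y b)"
  shows "Cr_on (Suc r) S f"
proof -
  have "Cr_on r S (\<lambda>y. frechet_derivative f (at y) b)" if "b \<in> Basis" for b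
    by (rule Cr_on_cong[OF S c[OF that]]) (simp add: frechet_eq[OF d])
  then show ?thesis using d by (auto simp: differentiable_def)
qed

lemma Cr_on_pred: "Cr_on (Suc r) S f ==> Cr_on r S f"
proof (induction r arbitrary: f)
  case 0
  then show ?case using Cr_on_imp_continuous by (metis Cr_on.simps(1))
next
  case (Suc r)
  have "Cr_on (Suc r) S (\<lambda>y. frechet_derivative f (at y) b)" if "b \<in> Basis" for b
    using Suc.prems that Cr_on.simps(2)[of "Suc r" S f] by blast
  then have "Cr_on r S (\<lambda>y. frechet_derivative f (at y) b)" if "b \<in> Basis" for b using Suc.IH that by blast
  moreover have "\<forall>y\<in>S. f differentiable (at y)" using Suc.prems Cr_on.simps(2)[of "Suc r" S f] by blast
  ultimately show ?case using Cr_on.simps(2)[of r S f] by blast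
qed

lemma Cr_on_add: "open S ==> Cr_on r S f ==> Cr_on r S g ==> Cr_on r S (\<lambda>y. f y + g y)"
proof (induction r arbitrary: f g)
  case (Suc r)
  show ?case
  proof (rule Cr_on_SucI[OF Suc.prems(1)])
    show "((\<lambda>y. f y + g y) has_derivative (\<lambda>h. frechet_derivative f (at y) h + frechet_derivative g (at y) h)) (at y)"
      if "y \<in> S" for y
      by (rule has_derivative_add[OF Cr_on_Suc_has[OF Suc.prems(2) that] Cr_on_Suc_has[OF Suc.prems(3) that]])
    show "Cr_on r S (\<lambda>y. frechet_derivative f (at y) b + frechet_derivative g (at y) b)" if "b \<in> Basis" for b
      using Suc.prems that by (intro Suc.IH) auto
  qed
qed (simp add: continuous_on_add)

lemma Cr_on_bilinear:
  assumes b: "bounded_bilinear prd"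
  shows "open S ==> Cr_on r S f ==> Cr_on r S g ==> Cr_on r S (\<lambda>y. prd (f y) (g y))"
proof (induction r arbitrary: f g)
  case 0
  then show ?case using bounded_bilinear.continuous_on[OF b] by simp
next
  case (Suc r)
  note fg = Suc.prems(2,3)
  show ?case
  proof (rule Cr_on_SucI[OF Suc.prems(1)])
    show "((\<lambda>y. prd (f y) (g y)) has_derivative
        (\<lambda>h. prd (f y) (frechet_derivative g (at y) h) + prd (frechet_derivative f (at y) h) (g y))) (at y)"
      if "y \<in> S" for y
      by (rule bounded_bilinear.FDERIV[OF b Cr_on_Suc_has[OF Suc.prems(2) that] Cr_on_Suc_has[OF Suc.prems(3) that]])
    show "Cr_on r S (\<lambda>y. prd (f y) (frechet_derivative g (at y) b) + prd (frechet_derivative f (at y) b) (g y))"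
      if "b \<in> Basis" for b
      using Suc.prems that Cr_on_pred[OF fg(1)] Cr_on_pred[OF fg(2)]
      by (intro Cr_on_add Suc.IH) auto
  qed
qed

lemma Cr_on_subset: "Cr_on r S f ==> T \<subseteq> S ==> Cr_on r T f"
proof (induction r arbitrary: f)
  case 0 then show ?case using continuous_on_subset by auto
qed auto

lemma Cr_on_Un: "open S ==> open T ==> Cr_on r S f ==> Cr_on r T f ==> Cr_on r (S \<union> T) f"
proof (induction r arbitrary: f)
  case 0 then show ?case by (simp add: continuous_on_open_Un)
qed auto

lemma pos_power_deriv:
  "((\<lambda>s::real. (max 0 s) ^ Suc (Suc k)) has_real_derivative (real (Suc (Suc k)) * (max 0 s) ^ Suc k)) (at s)"
proof -
  consider "s < 0" | "s = 0" | "s > 0" by linarith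
  then show ?thesis
  proof cases
    case 1
    have "((\<lambda>s. 0) has_real_derivative 0) (at s)" by simp
    then have "((\<lambda>s::real. (max 0 s) ^ Suc (Suc k)) has_real_derivative 0) (at s)"
      by (rule has_field_derivative_transform_within_open[of _ _ _ "{..<0}"]) (use 1 in auto)
    then show ?thesis using 1 by simp
  next
    case 3
    have "((\<lambda>s. s ^ Suc (Suc k)) has_real_derivative (real (Suc (Suc k)) * s ^ Suc k)) (at s)"
      using DERIV_pow[of "Suc (Suc k)" s UNIV] by simp
    then have "((\<lambda>s::real. (max 0 s) ^ Suc (Suc k)) has_real_derivative (real (Suc (Suc k)) * s ^ Suc k)) (at s)"
      by (rule has_field_derivative_transform_within_open[of _ _ _ "{0<..}"]) (use 3 in auto)
    then show ?thesis using 3 by simp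
  next
    case 2
    have "isCont (\<lambda>s::real. (max 0 s) ^ Suc k) 0" by (intro continuous_intros)
    moreover have "(max 0 z) ^ Suc (Suc k) - (max 0 0) ^ Suc (Suc k) = (max 0 z) ^ Suc k * (z - 0)" for z :: real
      by (simp add: max_def)
    ultimately have "((\<lambda>s::real. (max 0 s) ^ Suc (Suc k)) has_real_derivative (max 0 0) ^ Suc k) (at 0)"
      unfolding CARAT_DERIV by (intro exI[of _ "\<lambda>s. (max 0 s) ^ Suc k"]) auto
    then show ?thesis using 2 by simp
  qed
qed

text \<open>Each derivative lowers the exponent by one and leaves a power of the positive part, so
  an exponent above r keeps all r derivatives continuous across the zero set of g.\<close>

lemma Cr_on_pos_power:
  fixes g :: "'e::euclidean_space \<Rightarrow> real"
  shows "open S ==> Cr_on r S g ==> Suc r <= n ==> Cr_on r S (\<lambda>y. (max 0 (g y)) ^ n)"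
proof (induction r arbitrary: n)
  case 0
  then show ?case by (auto intro!: continuous_intros)
next
  case (Suc r)
  then obtain k where n: "n = Suc (Suc k)" by (metis Suc_le_D Suc_le_mono)
  show ?case
  proof (rule Cr_on_SucI[OF Suc.prems(1)])
    show "((\<lambda>y. (max 0 (g y)) ^ n) has_derivative
        (\<lambda>h. frechet_derivative g (at y) h * (real n * (max 0 (g y)) ^ Suc k))) (at y)" if "y \<in> S" for y
      unfolding n by (rule DERIV_compose_FDERIV[OF pos_power_deriv Cr_on_Suc_has[OF Suc.prems(2) that]])
    show "Cr_on r S (\<lambda>y. frechet_derivative g (at y) b * (real n * (max 0 (g y)) ^ Suc k))" if "b \<in> Basis" for b
    proof (intro Cr_on_bilinear[OF bounded_bilinear_mult Suc.prems(1)] Cr_on_const)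
      show "Cr_on r S (\<lambda>y. frechet_derivative g (at y) b)" using Suc.prems(2) that by simp
      show "Cr_on r S (\<lambda>y. (max 0 (g y)) ^ Suc k)"
        using Suc.prems n Cr_on_pred[OF Suc.prems(2)] by (intro Suc.IH) auto
    qed
  qed
qed

lemma partial_derivs_cong:
  assumes S: "open S"
  shows "(\<And>z. z \<in> S ==> f z = g z) ==> y \<in> S ==> partial_derivs bs f y = partial_derivs bs g y"
proof (induction bs arbitrary: f g)
  case (Cons b bs)
  have "partial_derivs bs (\<lambda>y. frechet_derivative f (at y) b) y = partial_derivs bs (\<lambda>y. frechet_derivative g (at y) b) y"
    by (rule Cons.IH) (use frechet_cong[OF S, of _ f g] Cons.prems in simp_all)
  then show ?case by simp
qed simp

lemma partial_derivs_scale: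
  assumes S: "open S"
  shows "Cr_on r S f ==> set bs \<subseteq> Basis ==> length bs <= r ==>
    continuous_on S (partial_derivs bs f) & (\<forall>y\<in>S. partial_derivs bs (\<lambda>y. c *\<^sub>R f y) y = c *\<^sub>R partial_derivs bs f y)"
proof (induction bs arbitrary: f r)
  case Nil
  then show ?case using Cr_on_imp_continuous by simp
next
  case (Cons b bs)
  then obtain r' where r: "r = Suc r'" by (cases r) auto
  let ?f = "\<lambda>y. frechet_derivative f (at y) b"
  have "Cr_on r' S ?f" using Cons.prems r by simp
  then have IH: "continuous_on S (partial_derivs bs ?f)" "\<And>y. y \<in> S ==> partial_derivs bs (\<lambda>y. c *\<^sub>R ?f y) y = c *\<^sub>R partial_derivs bs ?f y"
    using Cons.IH[of r' ?f] Cons.prems r by auto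
  have fd: "frechet_derivative (\<lambda>y. c *\<^sub>R f y) (at z) b = c *\<^sub>R ?f z" if "z \<in> S" for z
    using frechet_eq[OF has_derivative_scaleR_right[OF Cr_on_Suc_has[OF Cons.prems(1)[unfolded r] that], of c]] by simp
  have "partial_derivs (b # bs) (\<lambda>y. c *\<^sub>R f y) y = partial_derivs bs (\<lambda>y. c *\<^sub>R ?f y) y" if "y \<in> S" for y
    unfolding partial_derivs.simps by (rule partial_derivs_cong[OF S fd that])
  then show ?case using IH by simp
qed

lemma chart_image_open:
  assumes "smooth_atlas \<Phi>" "(U, \<phi>) \<in> \<Phi>" "open W"
  shows "open (\<phi> ` (U \<inter> W))"
proof -
  note c = smooth_atlas_chart[OF assms(1,2)]
  have "openin (top_of_set U) (U \<inter> W)" using assms(3) by (rule openin_open_Int)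
  then have "openin (top_of_set (\<phi> ` U)) (\<phi> ` (U \<inter> W))" by (rule homeomorphism_imp_open_map[OF c(3)])
  then show ?thesis using c(2) openin_open_trans by blast
qed

text \<open>Only class C^r for the given r is asked for, so the power r + 1 of the positive part of
  a quadratic in one chart suffices. Its support lies in a compact set C, whose complement is open,
  and the function is continued by 0.\<close>

lemma bump_function:
  fixes \<Phi> :: "('m::{t2_space, second_countable_topology}, 'e::euclidean_space) chart set"
  assumes \<Phi>: "smooth_atlas \<Phi>" and B: "open B" "x \<in> B"
  shows "\<exists>\<beta> :: 'm \<Rightarrow> real. \<exists>C. closed C & C \<subseteq> B & \<beta> x = 1 & (\<forall>y. 0 <= \<beta> y & \<beta> y <= 1) \<and>
     (\<forall>y. y \<notin> C --> \<beta> y = 0) & Cr_on_manifold \<Phi> r UNIV \<beta>"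
proof -
  obtain c0 where c0: "c0 \<in> \<Phi>" "x \<in> fst c0" using smooth_atlas_cover[OF \<Phi>] by blast
  obtain U \<phi> where "c0 = (U, \<phi>)" by (cases c0)
  then have c: "(U, \<phi>) \<in> \<Phi>" and xU: "x \<in> U" using c0 by auto
  note ch = smooth_atlas_chart[OF \<Phi> c]
  let ?i = "inv_into U \<phi>"
  have i1: "?i (\<phi> y) = y" if "y \<in> U" for y using homeomorphism_apply1[OF ch(3) that] .
  have "open (\<phi> ` (U \<inter> B))" by (rule chart_image_open[OF \<Phi> c B(1)])
  moreover have "\<phi> x \<in> \<phi> ` (U \<inter> B)" using xU B by blast
  ultimately obtain \<rho> where \<rho>: "\<rho> > 0" "cball (\<phi> x) \<rho> \<subseteq> \<phi> ` (U \<inter> B)" by (meson open_contains_cball)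
  define g where "g e = 1 - (1 / \<rho>\<^sup>2) * ((e - \<phi> x) \<bullet> (e - \<phi> x))" for e
  define \<beta> where "\<beta> y = (if y \<in> U then (max 0 (g (\<phi> y))) ^ Suc r else 0)" for y
  define C where "C = ?i ` cball (\<phi> x) \<rho>"
  have CB: "C \<subseteq> U \<inter> B" using \<rho>(2) i1 by (auto simp: C_def)
  have "continuous_on (cball (\<phi> x) \<rho>) ?i"
    using homeomorphism_cont2[OF ch(3)] \<rho>(2) continuous_on_subset by blast
  then have cC: "closed C" unfolding C_def by (intro compact_imp_closed compact_continuous_image compact_cball)
  have \<beta>0: "\<beta> y = 0" if "y \<notin> C" for y
  proof (cases "y \<in> U")
    case True
    have "\<phi> y \<notin> cball (\<phi> x) \<rho>" using that i1[OF True] unfolding C_def by (metis imageI)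
    then have "\<rho>\<^sup>2 <= (norm (\<phi> y - \<phi> x))\<^sup>2" using \<rho>(1)
      by (intro power_mono) (auto simp: dist_norm norm_minus_commute)
    then have "g (\<phi> y) <= 0" using \<rho>(1) by (simp add: g_def power2_norm_eq_inner field_simps)
    then show ?thesis by (simp add: \<beta>_def)
  qed (simp add: \<beta>_def)
  have g1: "g e <= 1" for e by (simp add: g_def)
  have b01: "0 <= \<beta> y & \<beta> y <= 1" for y
    using g1[of "\<phi> y"] by (auto simp: \<beta>_def simp del: power_Suc intro!: power_le_one)
  have b1: "\<beta> x = 1" using xU by (simp add: \<beta>_def g_def)
  have "Cr_on r (\<phi>' ` (U' \<inter> UNIV)) (\<beta> \<circ> inv_into U' \<phi>')" if c': "(U', \<phi>') \<in> \<Phi>" for U' \<phi>'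
  proof -
    note ch' = smooth_atlas_chart[OF \<Phi> c']
    let ?j = "inv_into U' \<phi>'"
    have j1: "?j (\<phi>' y) = y" if "y \<in> U'" for y using homeomorphism_apply1[OF ch'(3) that] .
    \<comment> \<open>Two open pieces cover the chart: one where the formula applies and one where
      the function vanishes.\<close>
    let ?S = "\<phi>' ` (U' \<inter> U)" and ?T = "\<phi>' ` (U' \<inter> - C)"
    have oS: "open ?S" by (rule chart_image_open[OF \<Phi> c' ch(1)])
    have oT: "open ?T" using cC by (intro chart_image_open[OF \<Phi> c']) auto
    have "Cr_on r ?S (\<phi> \<circ> ?j)"
      using \<Phi> c c' unfolding smooth_atlas_def by fast
    then have tr: "Cr_on r ?S (\<lambda>e. (\<phi> \<circ> ?j) e + (- \<phi> x))"
      using Cr_on_add[OF oS _ Cr_on_const] by blast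
    have "Cr_on r ?S (\<lambda>e. (1 :: real) + (- 1 / \<rho>\<^sup>2) * (((\<phi> \<circ> ?j) e + (- \<phi> x)) \<bullet> ((\<phi> \<circ> ?j) e + (- \<phi> x))))"
      by (intro Cr_on_add[OF oS] Cr_on_const Cr_on_bilinear[OF bounded_bilinear_mult oS]
          Cr_on_bilinear[OF bounded_bilinear_inner oS] tr)
    then have "Cr_on r ?S (\<lambda>e. (max 0 (1 + (- 1 / \<rho>\<^sup>2) * (((\<phi> \<circ> ?j) e + (- \<phi> x)) \<bullet> ((\<phi> \<circ> ?j) e + (- \<phi> x))))) ^ Suc r)"
      by (rule Cr_on_pos_power[OF oS]) simp
    then have "Cr_on r ?S (\<beta> \<circ> ?j)"
      by (rule Cr_on_cong[OF oS]) (auto simp: j1 \<beta>_def g_def simp del: power_Suc)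
    moreover have "Cr_on r ?T (\<beta> \<circ> ?j)"
      by (rule Cr_on_cong[OF oT Cr_on_const[where c = 0]]) (auto simp: j1 \<beta>0)
    ultimately have "Cr_on r (?S \<union> ?T) (\<beta> \<circ> ?j)" by (rule Cr_on_Un[OF oS oT])
    moreover have "\<phi>' ` (U' \<inter> UNIV) \<subseteq> ?S \<union> ?T" using CB by blast
    ultimately show ?thesis by (rule Cr_on_subset)
  qed
  then have "Cr_on_manifold \<Phi> r UNIV \<beta>" unfolding Cr_on_manifold_def by blast
  then show ?thesis using cC CB b1 b01 \<beta>0 by (intro exI[of _ \<beta>] exI[of _ C]) auto
qed

section \<open>Matrices of cocycles\<close>

lemma fiber_rep:
  assumes E: "smooth_vector_bundle \<Phi> Y E" and U: "(U, \<psi>) \<in> trivs E" "(U', \<psi>') \<in> trivs E"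
    and x: "x \<in> U" and y: "y \<in> U'" and L: "fiber_linear E x y L" and v: "v \<in> fiber E x"
  shows "matrix (\<lambda>w. \<psi>' (L (triv_inv E \<psi> x w))) *v \<psi> v = \<psi>' (L v)"
proof -
  note ti = triv_inv_simps[OF E U(1) x]
  note add = smooth_vector_bundle_triv(3)[OF E U(1) x] and sc = smooth_vector_bundle_triv(4)[OF E U(1) x]
  note add' = smooth_vector_bundle_triv(3)[OF E U(2) y] and sc' = smooth_vector_bundle_triv(4)[OF E U(2) y]
  have "x \<in> Y" using trivs_cover[OF E] U x by fastforce
  note addm = smooth_vector_bundle_ops(1)[OF E this] and scm = smooth_vector_bundle_ops(2)[OF E this]
  have inv_add: "triv_inv E \<psi> x (a + b) = fadd E (triv_inv E \<psi> x a) (triv_inv E \<psi> x b)" for a b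
    by (metis ti add addm)
  have inv_sc: "triv_inv E \<psi> x (c *\<^sub>R a) = fscale E c (triv_inv E \<psi> x a)" for c a
    by (metis ti sc scm)
  have Lm: "L v \<in> fiber E y" if "v \<in> fiber E x" for v
    using L that by (auto simp: fiber_linear_def)
  have "linear (\<lambda>w. \<psi>' (L (triv_inv E \<psi> x w)))"
  proof (rule linearI)
    fix a b
    have "L (triv_inv E \<psi> x (a + b)) = fadd E (L (triv_inv E \<psi> x a)) (L (triv_inv E \<psi> x b))"
      using L ti(1) by (simp add: inv_add fiber_linear_def)
    then show "\<psi>' (L (triv_inv E \<psi> x (a + b))) = \<psi>' (L (triv_inv E \<psi> x a)) + \<psi>' (L (triv_inv E \<psi> x b))"
      using add'[OF Lm Lm] ti(1) by simp
  next
    fix c a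
    have "L (triv_inv E \<psi> x (c *\<^sub>R a)) = fscale E c (L (triv_inv E \<psi> x a))"
      using L ti(1) by (simp add: inv_sc fiber_linear_def)
    then show "\<psi>' (L (triv_inv E \<psi> x (c *\<^sub>R a))) = c *\<^sub>R \<psi>' (L (triv_inv E \<psi> x a))"
      using sc'[OF Lm] ti(1) by simp
  qed
  then have "matrix (\<lambda>w. \<psi>' (L (triv_inv E \<psi> x w))) *v \<psi> v = \<psi>' (L (triv_inv E \<psi> x (\<psi> v)))"
    by (intro matrix_works) (simp add: linear_matrix_vector_mul_eq)
  then show ?thesis using ti(3)[OF v] by simp
qed

lemma matrix_eqI: "(\<And>w. M *v w = N *v w) ==> M = (N :: real ^ 'n ^ 'm)"
  by (simp add: matrix_eq)

lemma fiber_linear_of_matrix: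
  assumes E: "smooth_vector_bundle \<Phi> Y E" and U: "(U, \<psi>) \<in> trivs E" and x: "x \<in> U"
    and Lf: "\<And>v. v \<in> fiber E x ==> L v \<in> fiber E x" and LM: "\<And>v. v \<in> fiber E x ==> \<psi> (L v) = M *v \<psi> v"
  shows "fiber_linear E x x L" "triv_matrix E \<psi> x L = M" "invertible M ==> fiber_iso E x x L"
proof -
  note ti = triv_inv_simps[OF E U x]
  note add = smooth_vector_bundle_triv(3)[OF E U x] and sc = smooth_vector_bundle_triv(4)[OF E U x]
  have "x \<in> Y" using trivs_cover[OF E] U x by fastforce
  note addm = smooth_vector_bundle_ops(1)[OF E this] and scm = smooth_vector_bundle_ops(2)[OF E this]
  have inj: "v = w" if "v \<in> fiber E x" "w \<in> fiber E x" "\<psi> v = \<psi> w" for v w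
    using ti(3)[OF that(1)] ti(3)[OF that(2)] that(3) by metis
  show lin: "fiber_linear E x x L"
    unfolding fiber_linear_def
  proof (intro conjI ballI allI)
    fix v w assume v: "v \<in> fiber E x" and w: "w \<in> fiber E x"
    show "L (fadd E v w) = fadd E (L v) (L w)"
      by (rule inj) (use v w Lf addm LM add in \<open>simp_all add: matrix_vector_right_distrib\<close>)
  next
    fix c v assume v: "v \<in> fiber E x"
    show "L (fscale E c v) = fscale E c (L v)"
      by (rule inj) (use v Lf scm LM sc in \<open>simp_all add: matrix_vector_mult_scaleR\<close>)
  qed (rule Lf)
  have "triv_matrix E \<psi> x L *v w = M *v w" for w
    using triv_matrix_works[OF E U x lin ti(1)[of w]] LM[OF ti(1)[of w]] ti(2) by simp
  then show "triv_matrix E \<psi> x L = M" by (rule matrix_eqI)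
  assume M: "invertible M"
  have "bij_betw L (fiber E x) (fiber E x)"
  proof (rule bij_betw_byWitness[where f' = "\<lambda>v. triv_inv E \<psi> x (matrix_inv M *v \<psi> v)"])
    show "\<forall>a\<in>fiber E x. triv_inv E \<psi> x (matrix_inv M *v \<psi> (L a)) = a"
      using LM ti(3) invertible_inv[OF M] by simp
    show "\<forall>a'\<in>fiber E x. L (triv_inv E \<psi> x (matrix_inv M *v \<psi> a')) = a'"
      using LM ti invertible_inv[OF M] Lf by (auto intro!: inj)
  qed (use Lf ti in auto)
  then show "fiber_iso E x x L" using lin by (simp add: fiber_iso_def)
qed

lemma invertible_if_inj: "(\<And>v. M *v v = 0 ==> v = 0) ==> invertible (M :: real ^ 'n ^ 'n)"
  by (metis invertible_left_inverse matrix_left_invertible_ker)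

lemma small_perturb_invertible:
  fixes M :: "real ^ 'n ^ 'n"
  assumes "\<bar>s\<bar> * norm M < 1"
  shows "invertible (mat 1 + s *\<^sub>R M)"
proof (rule invertible_if_inj)
  fix v assume "(mat 1 + s *\<^sub>R M) *v v = 0"
  then have "v = - (s *\<^sub>R (M *v v))"
    by (simp add: matrix_vector_mult_add_rdistrib scaleR_matrix_vector_assoc add_eq_0_iff)
  then have "norm v = \<bar>s\<bar> * norm (M *v v)" by (metis norm_minus_cancel norm_scaleR)
  also have "\<dots> <= \<bar>s\<bar> * (norm M * norm v)" by (intro mult_left_mono norm_matrix_vector_le) auto
  finally have "norm v * (1 - \<bar>s\<bar> * norm M) <= 0" by (simp add: algebra_simps)
  then show "v = 0" using assms by (simp add: mult_le_0_iff)
qed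

definition tr :: "('m, 'v, 'd::finite) vbundle \<Rightarrow> ('v \<Rightarrow> real ^ 'd) \<Rightarrow> ('v \<Rightarrow> real ^ 'd) \<Rightarrow> 'm \<Rightarrow> real ^ 'd ^ 'd" where
  "tr E \<psi> \<psi>' x = matrix (\<lambda>w. \<psi>' (triv_inv E \<psi> x w))"

lemma tr_works:
  assumes E: "smooth_vector_bundle \<Phi> Y E" and U: "(U, \<psi>) \<in> trivs E" "(U', \<psi>') \<in> trivs E"
    and x: "x \<in> U" "x \<in> U'" and v: "v \<in> fiber E x"
  shows "tr E \<psi> \<psi>' x *v \<psi> v = \<psi>' v"
  using fiber_rep[OF E U x, of "\<lambda>v. v" v] v by (simp add: tr_def fiber_linear_def)

lemma tr_Cr:
  "smooth_vector_bundle \<Phi> Y E ==> (U, \<psi>) \<in> trivs E ==> (U', \<psi>') \<in> trivs E ==> Cr_on_manifold \<Phi> r (U \<inter> U') (tr E \<psi> \<psi>')"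
  by (simp add: smooth_vector_bundle_def tr_def[abs_def] Ball_def)

lemma Cr_on_manifoldD: "Cr_on_manifold \<Phi> r W f ==> (U, \<phi>) \<in> \<Phi> ==> Cr_on r (\<phi> ` (U \<inter> W)) (f \<circ> inv_into U \<phi>)"
  by (simp add: Cr_on_manifold_def Ball_def)

lemma bounded_bilinear_matrix: "bounded_bilinear (\<lambda>(A :: real ^ 'n ^ 'm) (B :: real ^ 'k ^ 'n). A ** B)"
proof -
  have "bilinear (\<lambda>(A :: real ^ 'n ^ 'm) (B :: real ^ 'k ^ 'n). A ** B)"
    unfolding bilinear_def
    by (intro conjI allI linearI)
      (simp_all add: vec_eq_iff matrix_matrix_mult_def sum_distrib_left sum.distrib algebra_simps)
  then show ?thesis by (simp add: bilinear_conv_bounded_bilinear)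
qed

section \<open>Localised perturbations\<close>

locale bundle_dyn =
  fixes \<Phi> :: "('m::{t2_space, second_countable_topology}, 'e::euclidean_space) chart set"
    and E :: "('m, 'v::topological_space, 'd::finite) vbundle"
    and X Y K :: "'m set" and T :: "'m \<Rightarrow> 'm"
    and D :: "(('m, 'e) chart \<times> ('m set \<times> ('v \<Rightarrow> real ^ 'd)) \<times> 'm set) set"
    and r :: nat
  assumes \<Phi>: "smooth_atlas \<Phi>" and E: "smooth_vector_bundle \<Phi> Y E" and XY: "X \<subseteq> Y" and Xne: "X ~= {}"
    and TX: "T ` X \<subseteq> X" and Tc: "continuous_on X T" and XK: "X \<subseteq> K" and KY: "K \<subseteq> Y" and D: "norm_cover \<Phi> E K D"
begin

abbreviation "V \<equiv> bundle_over E X"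
abbreviation "LC \<equiv> linear_cocycles E X T"

text \<open>The bump times t \<open>M0\<close> in one trivialization, continued by 0;
  \<open>fscale E 0 v\<close> denotes the zero of the fiber through v.\<close>

definition sec :: "'m set \<Rightarrow> ('v \<Rightarrow> real ^ 'd) \<Rightarrow> ('m \<Rightarrow> real) \<Rightarrow> real ^ 'd ^ 'd \<Rightarrow> real \<Rightarrow> 'v \<Rightarrow> 'v" where
  "sec U \<psi> \<beta> M0 t v = (if proj E v \<in> U then triv_inv E \<psi> (proj E v) ((t * \<beta> (proj E v)) *\<^sub>R (M0 *v \<psi> v)) else fscale E 0 v)"

definition pert :: "'m set \<Rightarrow> ('v \<Rightarrow> real ^ 'd) \<Rightarrow> ('m \<Rightarrow> real) \<Rightarrow> real ^ 'd ^ 'd \<Rightarrow> real \<Rightarrow> 'v \<Rightarrow> 'v" where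
  "pert U \<psi> \<beta> M0 t v = fadd E v (sec U \<psi> \<beta> M0 t v)"

lemma triv_at: "y \<in> Y ==> \<exists>U \<psi>. (U, \<psi>) \<in> trivs E & y \<in> U"
  using trivs_cover[OF E] by force

lemma triv_Y: "(U, \<psi>) \<in> trivs E ==> U \<subseteq> Y"
  using trivs_cover[OF E] by force

definition Cr_vals :: "('v \<Rightarrow> 'v) \<Rightarrow> real set" where
  "Cr_vals S = {norm (partial_derivs bs ((\<lambda>x. triv_matrix E \<psi> x S) \<circ> inv_into U \<phi>) (\<phi> x)) | bs U \<phi> W \<psi> C x.
     ((U, \<phi>), (W, \<psi>), C) \<in> D & x \<in> C & set bs \<subseteq> Basis & length bs <= r}"

text \<open>A real supremum is informative only for nonempty bounded sets, hence both claims. There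
  are finitely many compact pieces and lists of directions, each with a continuous and hence bounded
  derivative, and t enters linearly. \<open>Ts\<close> will be the whole line for the perturbations
  and {1} for one given section.\<close>

lemma Cr_vals_bound:
  assumes F: "\<And>U' \<psi>'. (U', \<psi>') \<in> trivs E ==> Cr_on_manifold \<Phi> r U' (F \<psi>')"
    and S: "\<And>U' \<psi>' t y. t \<in> Ts ==> (U', \<psi>') \<in> trivs E ==> y \<in> U' ==> triv_matrix E \<psi>' y (S t) = t *\<^sub>R F \<psi>' y"
  shows "\<exists>Bd\<ge>0. \<forall>t\<in>Ts. Cr_vals (S t) ~= {} & (\<forall>z\<in>Cr_vals (S t). z <= \<bar>t\<bar> * Bd)"
proof -
  define LB where "LB = {bs :: 'e list. set bs \<subseteq> Basis & length bs <= r}"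
  have finLB: "finite LB" unfolding LB_def by (rule finite_lists_length_le) simp
  have finD: "finite D" using D by (simp add: norm_cover_def)
  have DD: "(U, \<phi>) \<in> \<Phi> & (W, \<psi>) \<in> trivs E & compact C & C \<subseteq> U \<inter> W" if "((U, \<phi>), (W, \<psi>), C) \<in> D" for U \<phi> W \<psi> C
    using D that unfolding norm_cover_def by fast
  define g where "g U \<phi> \<psi> bs x = partial_derivs bs (F \<psi> \<circ> inv_into U \<phi>) (\<phi> x)"
    for U :: "'m set" and \<phi> :: "'m \<Rightarrow> 'e" and \<psi> bs x
  have main: "continuous_on C (g U \<phi> \<psi> bs) \<and>
      (\<forall>t\<in>Ts. \<forall>x\<in>C. partial_derivs bs ((\<lambda>x. triv_matrix E \<psi> x (S t)) \<circ> inv_into U \<phi>) (\<phi> x) = t *\<^sub>R g U \<phi> \<psi> bs x)"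
    if d: "((U, \<phi>), (W, \<psi>), C) \<in> D" and bs: "bs \<in> LB" for U \<phi> W \<psi> C bs
  proof -
    note dd = DD[OF d]
    have ch: "(U, \<phi>) \<in> \<Phi>" and W: "(W, \<psi>) \<in> trivs E" using dd by auto
    note c = smooth_atlas_chart[OF \<Phi> ch]
    let ?O = "\<phi> ` (U \<inter> W)"
    have oO: "open ?O" by (rule chart_image_open[OF \<Phi> ch smooth_vector_bundle_triv(1)[OF E W]])
    have fC: "Cr_on r ?O (F \<psi> \<circ> inv_into U \<phi>)" by (rule Cr_on_manifoldD[OF F[OF W] ch])
    have bs': "set bs \<subseteq> Basis" "length bs <= r" using bs by (auto simp: LB_def)
    have i1: "inv_into U \<phi> (\<phi> y) = y" if "y \<in> U" for y using homeomorphism_apply1[OF c(3) that] .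
    have CO: "\<phi> ` C \<subseteq> ?O" using dd by blast
    have "continuous_on C \<phi>" using homeomorphism_cont1[OF c(3)] dd continuous_on_subset by blast
    then have 1: "continuous_on C (g U \<phi> \<psi> bs)" unfolding g_def
      by (rule continuous_on_compose2[OF conjunct1[OF partial_derivs_scale[OF oO fC bs']] _ CO])
    have 2: "partial_derivs bs ((\<lambda>x. triv_matrix E \<psi> x (S t)) \<circ> inv_into U \<phi>) (\<phi> x) = t *\<^sub>R g U \<phi> \<psi> bs x"
      if x: "x \<in> C" and t: "t \<in> Ts" for t x
    proof -
      have xO: "\<phi> x \<in> ?O" using x CO by blast
      have "partial_derivs bs ((\<lambda>x. triv_matrix E \<psi> x (S t)) \<circ> inv_into U \<phi>) (\<phi> x)
          = partial_derivs bs (\<lambda>y. t *\<^sub>R (F \<psi> \<circ> inv_into U \<phi>) y) (\<phi> x)"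
        by (rule partial_derivs_cong[OF oO _ xO]) (use S[OF t W] i1 in auto)
      then show ?thesis unfolding g_def
        using conjunct2[OF partial_derivs_scale[OF oO fC bs', of t], rule_format, OF xO] by (rule trans)
    qed
    show ?thesis using 1 2 by blast
  qed
  have "\<exists>Bd\<ge>0. \<forall>x\<in>C. norm (g U \<phi> \<psi> bs x) <= Bd" if d: "((U, \<phi>), (W, \<psi>), C) \<in> D" and bs: "bs \<in> LB" for U \<phi> W \<psi> C bs
  proof -
    have "compact (g U \<phi> \<psi> bs ` C)" using main[OF d bs] DD[OF d] by (intro compact_continuous_image) auto
    then have "bounded (g U \<phi> \<psi> bs ` C)" by (rule compact_imp_bounded)
    then obtain b where "\<forall>z\<in>g U \<phi> \<psi> bs ` C. norm z <= b" unfolding bounded_iff by blast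
    then show ?thesis by (intro exI[of _ "max b 0"]) auto
  qed
  note bnd = this
  define ok where "ok p b \<longleftrightarrow> 0 <= b & (\<forall>U \<phi> W \<psi> C bs x. p = (((U, \<phi>), (W, \<psi>), C), bs) --> x \<in> C --> norm (g U \<phi> \<psi> bs x) <= b)"
    for p :: "(('m, 'e) chart \<times> ('m set \<times> ('v \<Rightarrow> real ^ 'd)) \<times> 'm set) \<times> 'e list" and b :: real
  have "\<forall>p\<in>D \<times> LB. \<exists>b. ok p b"
  proof
    fix p assume p: "p \<in> D \<times> LB"
    obtain U \<phi> W \<psi> C bs where pe: "p = (((U, \<phi>), (W, \<psi>), C), bs)" by (metis surj_pair)
    then have "((U, \<phi>), (W, \<psi>), C) \<in> D" "bs \<in> LB" using p by auto
    from bnd[OF this] obtain b where "b \<ge> 0" "\<forall>x\<in>C. norm (g U \<phi> \<psi> bs x) <= b" by (elim exE conjE)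
    then have "ok p b" unfolding ok_def pe by simp
    then show "\<exists>b. ok p b" ..
  qed
  then have "\<exists>bd. \<forall>p\<in>D \<times> LB. ok p (bd p)" by (rule bchoice)
  then obtain bd where bd': "\<forall>p\<in>D \<times> LB. ok p (bd p)" by (rule exE)
  have bd: "ok p (bd p)" if "p \<in> D \<times> LB" for p using bd' that by (rule bspec)
  have bd0: "0 <= bd p" if "p \<in> D \<times> LB" for p using bd[OF that] by (simp add: ok_def)
  define Bd where "Bd = (\<Sum>p\<in>D \<times> LB. bd p)"
  have fin: "finite (D \<times> LB)" using finD finLB by simp
  have Bd0: "Bd \<ge> 0" unfolding Bd_def by (rule sum_nonneg) (rule bd0)
  have bound: "norm (g U \<phi> \<psi> bs x) <= Bd" if d: "((U, \<phi>), (W, \<psi>), C) \<in> D" and bs: "bs \<in> LB" and x: "x \<in> C" for U \<phi> W \<psi> C bs x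
  proof -
    have p: "(((U, \<phi>), (W, \<psi>), C), bs) \<in> D \<times> LB" using d bs by simp
    have "norm (g U \<phi> \<psi> bs x) <= bd (((U, \<phi>), (W, \<psi>), C), bs)" using bd[OF p] x unfolding ok_def by simp
    also have "\<dots> <= Bd" unfolding Bd_def by (rule member_le_sum[OF p _ fin]) (rule bd0, simp)
    finally show ?thesis .
  qed
  obtain x0 where "x0 \<in> K" using Xne XK by blast
  then obtain c0 where c0: "c0 \<in> D" "x0 \<in> snd (snd c0)" using D unfolding norm_cover_def by fastforce
  have "Cr_vals (S t) ~= {} & (\<forall>z\<in>Cr_vals (S t). z <= \<bar>t\<bar> * Bd)" if t: "t \<in> Ts" for t
  proof
    obtain U \<phi> W \<psi> C where "c0 = ((U, \<phi>), (W, \<psi>), C)" by (metis surj_pair)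
    then have c: "((U, \<phi>), (W, \<psi>), C) \<in> D" "x0 \<in> C" using c0 by auto
    show "Cr_vals (S t) ~= {}" unfolding Cr_vals_def ex_in_conv[symmetric] mem_Collect_eq
      by (rule exI, rule exI[of _ "[]"], intro exI conjI, rule refl, rule c(1), rule c(2)) simp_all
    show "\<forall>z\<in>Cr_vals (S t). z <= \<bar>t\<bar> * Bd"
    proof
      fix z assume "z \<in> Cr_vals (S t)"
      then obtain bs U \<phi> W \<psi> C x where z: "z = norm (partial_derivs bs ((\<lambda>x. triv_matrix E \<psi> x (S t)) \<circ> inv_into U \<phi>) (\<phi> x))"
        "((U, \<phi>), (W, \<psi>), C) \<in> D" "x \<in> C" "bs \<in> LB" unfolding LB_def Cr_vals_def by blast
      then have "z = \<bar>t\<bar> * norm (g U \<phi> \<psi> bs x)" using main[OF z(2,4)] t by simp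
      then show "z <= \<bar>t\<bar> * Bd" using bound[OF z(2,4,3)] by (simp add: mult_left_mono)
    qed
  qed
  then show ?thesis using Bd0 by blast
qed

lemma Cr_norm_Sup: "Cr_norm E D r S = Sup (Cr_vals S)"
  unfolding Cr_norm_def Cr_vals_def ..

context
  fixes U :: "'m set" and \<psi> :: "'v \<Rightarrow> real ^ 'd" and \<beta> :: "'m \<Rightarrow> real" and C :: "'m set" and M0 :: "real ^ 'd ^ 'd"
  assumes U: "(U, \<psi>) \<in> trivs E" and C: "closed C" "C \<subseteq> U" and \<beta>0: "\<And>y. y \<notin> C ==> \<beta> y = 0"
    and \<beta>1: "\<And>y. 0 <= \<beta> y & \<beta> y <= 1" and \<beta>C: "Cr_on_manifold \<Phi> r UNIV \<beta>"
begin

text \<open>The matrix of \<open>sec\<close> at t = 1 in an arbitrary trivialization: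
  \<open>M0\<close> seen through the transition matrices.\<close>

definition Fm :: "('v \<Rightarrow> real ^ 'd) \<Rightarrow> 'm \<Rightarrow> real ^ 'd ^ 'd" where
  "Fm \<psi>' y = (if y \<in> U then \<beta> y *\<^sub>R (tr E \<psi> \<psi>' y ** (M0 ** tr E \<psi>' \<psi> y)) else 0)"

lemma sec_fiber: "v \<in> fiber E y ==> y \<in> Y ==> sec U \<psi> \<beta> M0 t v \<in> fiber E y"
  unfolding sec_def using triv_inv_simps(1)[OF E U] smooth_vector_bundle_ops(2)[OF E] by (auto simp: fiber_def)

lemma sec_works:
  assumes U': "(U', \<psi>') \<in> trivs E" and y: "y \<in> U'" and v: "v \<in> fiber E y"
  shows "\<psi>' (sec U \<psi> \<beta> M0 t v) = (t *\<^sub>R Fm \<psi>' y) *v \<psi>' v"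
proof -
  have p: "proj E v = y" using v by (simp add: fiber_def)
  show ?thesis
  proof (cases "y \<in> U")
    case True
    have t: "triv_inv E \<psi> y z \<in> fiber E y" for z by (rule triv_inv_simps(1)[OF E U True])
    have "\<psi>' (sec U \<psi> \<beta> M0 t v) = \<psi>' (triv_inv E \<psi> y ((t * \<beta> y) *\<^sub>R (M0 *v \<psi> v)))" using True p by (simp add: sec_def)
    also have "\<dots> = tr E \<psi> \<psi>' y *v ((t * \<beta> y) *\<^sub>R (M0 *v \<psi> v))"
      using tr_works[OF E U U' True y t] triv_inv_simps(2)[OF E U True] by metis
    also have "\<psi> v = tr E \<psi>' \<psi> y *v \<psi>' v" using tr_works[OF E U' U y True v] by simp
    finally show ?thesis using True
      by (simp add: Fm_def matrix_vector_mul_assoc matrix_vector_mult_scaleR matrix_mul_assoc flip: scaleR_matrix_vector_assoc)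
  next
    case False
    then show ?thesis using p smooth_vector_bundle_triv(4)[OF E U' y v] by (simp add: sec_def Fm_def)
  qed
qed

lemma pert_fiber: "v \<in> fiber E y ==> y \<in> Y ==> pert U \<psi> \<beta> M0 t v \<in> fiber E y"
  unfolding pert_def using sec_fiber smooth_vector_bundle_ops(1)[OF E] by blast

lemma pert_works:
  assumes U': "(U', \<psi>') \<in> trivs E" and y: "y \<in> U'" and v: "v \<in> fiber E y"
  shows "\<psi>' (pert U \<psi> \<beta> M0 t v) = (mat 1 + t *\<^sub>R Fm \<psi>' y) *v \<psi>' v"
proof -
  have "sec U \<psi> \<beta> M0 t v \<in> fiber E y" using sec_fiber v triv_Y[OF U'] y by blast
  then show ?thesis
    unfolding pert_def using smooth_vector_bundle_triv(3)[OF E U' y v] sec_works[OF U' y v]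
    by (simp add: matrix_vector_mult_add_rdistrib)
qed

lemma tr_self: "y \<in> U ==> tr E \<psi> \<psi> y = mat 1"
  by (rule matrix_eqI) (metis tr_works[OF E U U] triv_inv_simps(1,2)[OF E U] matrix_vector_mul_lid)

lemma Fm_self: "y \<in> U ==> Fm \<psi> y = \<beta> y *\<^sub>R M0"
  by (simp add: Fm_def tr_self)

lemma pert_id: "v \<in> fiber E y ==> y \<in> Y ==> \<beta> y = 0 ==> pert U \<psi> \<beta> M0 t v = v"
proof -
  assume v: "v \<in> fiber E y" and y: "y \<in> Y" and b: "\<beta> y = 0"
  obtain U' \<psi>' where U': "(U', \<psi>') \<in> trivs E" "y \<in> U'" using triv_at y by blast
  have "Fm \<psi>' y = 0" using b by (simp add: Fm_def)
  then have "\<psi>' (pert U \<psi> \<beta> M0 t v) = \<psi>' v" using pert_works[OF U' v] by simp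
  then show ?thesis using triv_inv_simps(3)[OF E U'] v pert_fiber[OF v y] by metis
qed

lemma Fm_Cr: "(U', \<psi>') \<in> trivs E ==> Cr_on_manifold \<Phi> r U' (Fm \<psi>')"
  unfolding Cr_on_manifold_def
proof safe
  fix O' \<phi> assume U': "(U', \<psi>') \<in> trivs E" and ch: "(O', \<phi>) \<in> \<Phi>"
  note c = smooth_atlas_chart[OF \<Phi> ch]
  have i1: "inv_into O' \<phi> (\<phi> y) = y" if "y \<in> O'" for y using homeomorphism_apply1[OF c(3) that] .
  have oU: "open U" "open U'" using smooth_vector_bundle_triv(1)[OF E] U U' by auto
  let ?S = "\<phi> ` (O' \<inter> (U' \<inter> U))" and ?T = "\<phi> ` (O' \<inter> (U' \<inter> - C))"
  have oS: "open ?S" and oT: "open ?T"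
    using oU C(1) by (auto intro!: chart_image_open[OF \<Phi> ch] simp del: Int_iff)
  have "?S = \<phi> ` (O' \<inter> (U \<inter> U'))" by blast
  then have t1: "Cr_on r ?S (tr E \<psi> \<psi>' \<circ> inv_into O' \<phi>)"
    using Cr_on_manifoldD[OF tr_Cr[OF E U U'] ch] by simp
  have t2: "Cr_on r ?S (tr E \<psi>' \<psi> \<circ> inv_into O' \<phi>)"
    by (rule Cr_on_manifoldD[OF tr_Cr[OF E U' U] ch])
  have "Cr_on r (\<phi> ` (O' \<inter> UNIV)) (\<beta> \<circ> inv_into O' \<phi>)" by (rule Cr_on_manifoldD[OF \<beta>C ch])
  then have t3: "Cr_on r ?S (\<beta> \<circ> inv_into O' \<phi>)" by (rule Cr_on_subset) blast
  have "Cr_on r ?S (\<lambda>y. (\<beta> \<circ> inv_into O' \<phi>) y *\<^sub>R ((tr E \<psi> \<psi>' \<circ> inv_into O' \<phi>) y ** (M0 ** (tr E \<psi>' \<psi> \<circ> inv_into O' \<phi>) y)))"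
    by (intro Cr_on_bilinear[OF bounded_bilinear_scaleR oS] Cr_on_bilinear[OF bounded_bilinear_matrix oS] t1 t2 t3 Cr_on_const)
  then have "Cr_on r ?S (Fm \<psi>' \<circ> inv_into O' \<phi>)"
    by (rule Cr_on_cong[OF oS]) (auto simp: Fm_def i1)
  moreover have "Cr_on r ?T (Fm \<psi>' \<circ> inv_into O' \<phi>)"
    by (rule Cr_on_cong[OF oT Cr_on_const[where c = 0]]) (auto simp: Fm_def i1 \<beta>0)
  ultimately have "Cr_on r (?S \<union> ?T) (Fm \<psi>' \<circ> inv_into O' \<phi>)" by (rule Cr_on_Un[OF oS oT])
  moreover have "\<phi> ` (O' \<inter> U') \<subseteq> ?S \<union> ?T" using C by blast
  ultimately show "Cr_on r (\<phi> ` (O' \<inter> U')) (Fm \<psi>' \<circ> inv_into O' \<phi>)" by (rule Cr_on_subset)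
qed

lemma sec_lin:
  assumes U': "(U', \<psi>') \<in> trivs E" and y: "y \<in> U'"
  shows "fiber_linear E y y (sec U \<psi> \<beta> M0 t)" "triv_matrix E \<psi>' y (sec U \<psi> \<beta> M0 t) = t *\<^sub>R Fm \<psi>' y"
    "fiber_linear E y y (pert U \<psi> \<beta> M0 t)" "triv_matrix E \<psi>' y (pert U \<psi> \<beta> M0 t) = mat 1 + t *\<^sub>R Fm \<psi>' y"
proof -
  have yY: "y \<in> Y" using triv_Y[OF U'] y by blast
  have 1: "sec U \<psi> \<beta> M0 t v \<in> fiber E y" "pert U \<psi> \<beta> M0 t v \<in> fiber E y" if "v \<in> fiber E y" for v
    using sec_fiber[OF that yY] pert_fiber[OF that yY] by auto
  show "fiber_linear E y y (sec U \<psi> \<beta> M0 t)"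
    by (rule fiber_linear_of_matrix(1)[where M = "t *\<^sub>R Fm \<psi>' y", OF E U' y])
      (rule 1(1) sec_works[OF U' y], assumption)+
  show "triv_matrix E \<psi>' y (sec U \<psi> \<beta> M0 t) = t *\<^sub>R Fm \<psi>' y"
    by (rule fiber_linear_of_matrix(2)[OF E U' y])
      (rule 1(1) sec_works[OF U' y], assumption)+
  show "fiber_linear E y y (pert U \<psi> \<beta> M0 t)"
    by (rule fiber_linear_of_matrix(1)[where M = "mat 1 + t *\<^sub>R Fm \<psi>' y", OF E U' y])
      (rule 1(2) pert_works[OF U' y], assumption)+
  show "triv_matrix E \<psi>' y (pert U \<psi> \<beta> M0 t) = mat 1 + t *\<^sub>R Fm \<psi>' y"
    by (rule fiber_linear_of_matrix(2)[OF E U' y])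
      (rule 1(2) pert_works[OF U' y], assumption)+
qed

lemma sec_Cr: "Cr_End_section \<Phi> E r Y (sec U \<psi> \<beta> M0 t)" and pert_Cr: "Cr_End_section \<Phi> E r Y (pert U \<psi> \<beta> M0 t)"
proof -
  have "Cr_on_manifold \<Phi> r (U' \<inter> Y) (\<lambda>y. triv_matrix E \<psi>' y (sec U \<psi> \<beta> M0 t)) \<and>
      Cr_on_manifold \<Phi> r (U' \<inter> Y) (\<lambda>y. triv_matrix E \<psi>' y (pert U \<psi> \<beta> M0 t))"
    if U': "(U', \<psi>') \<in> trivs E" for U' \<psi>'
    unfolding Cr_on_manifold_def
  proof (intro conjI ballI; clarsimp)
    fix O' \<phi> assume ch: "(O', \<phi>) \<in> \<Phi>"
    note c = smooth_atlas_chart[OF \<Phi> ch]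
    have i1: "inv_into O' \<phi> (\<phi> y) = y" if "y \<in> O'" for y using homeomorphism_apply1[OF c(3) that] .
    let ?S = "\<phi> ` (O' \<inter> (U' \<inter> Y))"
    have oS: "open ?S"
      using smooth_vector_bundle_triv(1)[OF E U'] smooth_vector_bundle_base(1)[OF E] by (intro chart_image_open[OF \<Phi> ch]) auto
    have "Cr_on r (\<phi> ` (O' \<inter> U')) (Fm \<psi>' \<circ> inv_into O' \<phi>)" by (rule Cr_on_manifoldD[OF Fm_Cr[OF U'] ch])
    then have f: "Cr_on r ?S (Fm \<psi>' \<circ> inv_into O' \<phi>)" by (rule Cr_on_subset) blast
    have 1: "Cr_on r ?S (\<lambda>y. t *\<^sub>R (Fm \<psi>' \<circ> inv_into O' \<phi>) y)"
      by (intro Cr_on_bilinear[OF bounded_bilinear_scaleR oS] f Cr_on_const)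
    then show "Cr_on r ?S ((\<lambda>y. triv_matrix E \<psi>' y (sec U \<psi> \<beta> M0 t)) \<circ> inv_into O' \<phi>)"
      by (rule Cr_on_cong[OF oS]) (use sec_lin(2)[OF U'] i1 in auto)
    have "Cr_on r ?S (\<lambda>y. mat 1 + t *\<^sub>R (Fm \<psi>' \<circ> inv_into O' \<phi>) y)"
      by (intro Cr_on_add[OF oS] 1 Cr_on_const)
    then show "Cr_on r ?S ((\<lambda>y. triv_matrix E \<psi>' y (pert U \<psi> \<beta> M0 t)) \<circ> inv_into O' \<phi>)"
      by (rule Cr_on_cong[OF oS]) (use sec_lin(4)[OF U'] i1 in auto)
  qed
  note cr = this
  have lin: "fiber_linear E y y (sec U \<psi> \<beta> M0 t) & fiber_linear E y y (pert U \<psi> \<beta> M0 t)" if y: "y \<in> Y" for y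
  proof -
    obtain U' \<psi>' where U': "(U', \<psi>') \<in> trivs E" "y \<in> U'" using triv_at[OF y] by blast
    show ?thesis using sec_lin(1,3)[OF U'] by simp
  qed
  show "Cr_End_section \<Phi> E r Y (sec U \<psi> \<beta> M0 t)" "Cr_End_section \<Phi> E r Y (pert U \<psi> \<beta> M0 t)"
    unfolding Cr_End_section_def using lin cr by (simp_all add: split_beta')
qed

lemma pert_iso:
  assumes t: "\<bar>t\<bar> * norm M0 < 1" and y: "y \<in> Y"
  shows "fiber_iso E y y (pert U \<psi> \<beta> M0 t)"
proof (cases "y \<in> U")
  case True
  have "\<bar>t * \<beta> y\<bar> * norm M0 <= \<bar>t\<bar> * norm M0"
    using \<beta>1[of y] by (intro mult_right_mono) (auto simp: abs_mult mult_left_le)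
  then have "invertible (mat 1 + (t * \<beta> y) *\<^sub>R M0)" using t by (intro small_perturb_invertible) linarith
  then have M: "invertible (mat 1 + t *\<^sub>R Fm \<psi> y)" using Fm_self[OF True] by simp
  show ?thesis
    by (rule fiber_linear_of_matrix(3)[where M = "mat 1 + t *\<^sub>R Fm \<psi> y", OF E U True])
      (rule pert_fiber[OF _ y] pert_works[OF U True] M, assumption?)+
next
  case False
  then have b: "\<beta> y = 0" using \<beta>0 C by blast
  obtain U' \<psi>' where U': "(U', \<psi>') \<in> trivs E" "y \<in> U'" using triv_at y by blast
  have *: "\<psi>' (pert U \<psi> \<beta> M0 t v) = mat 1 *v \<psi>' v" if "v \<in> fiber E y" for v using pert_id[OF that y b] by simp
  show ?thesis
    by (rule fiber_linear_of_matrix(3)[where M = "mat 1", OF E U'])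
      (rule pert_fiber[OF _ y] * invertible_mat1, assumption?)+
qed

lemma pert_continuous: "continuous_on (UNIV \<times> bundle_over E Y) (\<lambda>p. pert U \<psi> \<beta> M0 (fst p) (snd p))"
proof -
  obtain g where h: "homeomorphism (bundle_over E U) (U \<times> UNIV) (\<lambda>v. (proj E v, \<psi> v)) g"
    using smooth_vector_bundle_triv(2)[OF E U] by blast
  have pc: "continuous_on B (proj E)" for B
    using smooth_vector_bundle_base(2)[OF E] continuous_on_subset by blast
  have op: "open (bundle_over E B)" if "open B" for B
    unfolding bundle_over_def using that pc open_vimage by blast
  have oY: "open Y" "open U" using smooth_vector_bundle_base(1)[OF E] smooth_vector_bundle_triv(1)[OF E U] by auto
  have "continuous_on UNIV \<beta>" by (rule Cr_on_manifold_imp_continuous[OF \<Phi> open_UNIV \<beta>C])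
  then have c\<beta>: "continuous_on B (\<lambda>v. \<beta> (proj E v))" for B by (rule continuous_on_compose2[OF _ pc]) auto
  have "continuous_on (bundle_over E U) (\<lambda>v. snd (proj E v, \<psi> v))"
    using homeomorphism_cont1[OF h] continuous_on_snd by blast
  then have c\<psi>: "continuous_on (bundle_over E U) \<psi>" by simp
  let ?S = "UNIV \<times> bundle_over E U :: (real \<times> 'v) set" and ?R = "UNIV \<times> bundle_over E (Y - C) :: (real \<times> 'v) set"
  have sn: "continuous_on ?S snd" "continuous_on ?S fst" by (intro continuous_intros)+
  have 1: "continuous_on ?S (\<lambda>p. \<beta> (proj E (snd p)))" by (rule continuous_on_compose2[OF c\<beta>[of UNIV] sn(1)]) auto
  have 2: "continuous_on ?S (\<lambda>p. \<psi> (snd p))" by (rule continuous_on_compose2[OF c\<psi> sn(1)]) auto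
  have 3: "continuous_on ?S (\<lambda>p. proj E (snd p))" by (rule continuous_on_compose2[OF pc[of UNIV] sn(1)]) auto
  have "continuous_on ?S (\<lambda>p. (mat 1 + (fst p * \<beta> (proj E (snd p))) *\<^sub>R M0) *v \<psi> (snd p))"
    by (intro continuous_on_matrix_vector 1 2 sn continuous_intros)
  then have "continuous_on ?S (\<lambda>p. g (proj E (snd p), (mat 1 + (fst p * \<beta> (proj E (snd p))) *\<^sub>R M0) *v \<psi> (snd p)))"
    by (intro continuous_on_compose2[OF homeomorphism_cont2[OF h]] continuous_on_Pair 3)
      (auto simp: bundle_over_def)
  moreover have "g (proj E v, (mat 1 + (t * \<beta> (proj E v)) *\<^sub>R M0) *v \<psi> v) = pert U \<psi> \<beta> M0 t v" if v: "v \<in> bundle_over E U" for t v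
  proof -
    have x: "proj E v \<in> U" and vf: "v \<in> fiber E (proj E v)" using v by (auto simp: bundle_over_def fiber_def)
    have pf: "pert U \<psi> \<beta> M0 t v \<in> fiber E (proj E v)" using pert_fiber[OF vf] triv_Y[OF U] x by blast
    then have "proj E (pert U \<psi> \<beta> M0 t v) = proj E v" by (simp add: fiber_def)
    then show ?thesis using pert_works[OF U x vf, of t] Fm_self[OF x] homeomorphism_apply1[OF h, of "pert U \<psi> \<beta> M0 t v"] x
      by (simp add: bundle_over_def)
  qed
  ultimately have A: "continuous_on ?S (\<lambda>p. pert U \<psi> \<beta> M0 (fst p) (snd p))"
    by (rule continuous_on_eq) auto
  have "continuous_on ?R snd" by (intro continuous_intros)
  moreover have "snd p = pert U \<psi> \<beta> M0 (fst p) (snd p)" if "p \<in> ?R" for p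
    using pert_id[of "snd p" "proj E (snd p)" "fst p"] \<beta>0 that by (auto simp: bundle_over_def fiber_def)
  ultimately have B: "continuous_on ?R (\<lambda>p. pert U \<psi> \<beta> M0 (fst p) (snd p))" by (rule continuous_on_eq)
  have "continuous_on (?S \<union> ?R) (\<lambda>p. pert U \<psi> \<beta> M0 (fst p) (snd p))"
    using oY C by (intro continuous_on_open_Un A B open_Times op open_UNIV open_Diff)
  then show ?thesis by (rule continuous_on_subset) (use C in \<open>auto simp: bundle_over_def\<close>)
qed

lemma pert_in_ball:
  shows "\<exists>Bd\<ge>0. \<forall>t. \<bar>t\<bar> * norm M0 < 1 --> \<bar>t\<bar> * Bd < \<epsilon> -->
    restrict (pert U \<psi> \<beta> M0 t) V \<in> LC_Id_ball \<Phi> E X D r (restrict id V) \<epsilon>"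
proof -
  have "\<exists>Bd\<ge>0. \<forall>t\<in>UNIV. Cr_vals (sec U \<psi> \<beta> M0 t) ~= {} & (\<forall>z\<in>Cr_vals (sec U \<psi> \<beta> M0 t). z <= \<bar>t\<bar> * Bd)"
    by (rule Cr_vals_bound[of Fm]) (use Fm_Cr sec_lin(2) in auto)
  then obtain Bd where Bd0: "Bd \<ge> 0" "\<And>t. Cr_vals (sec U \<psi> \<beta> M0 t) ~= {}" "\<And>t z. z \<in> Cr_vals (sec U \<psi> \<beta> M0 t) ==> z <= \<bar>t\<bar> * Bd" by blast
  have Bd: "Bd \<ge> 0" "Cr_norm E D r (sec U \<psi> \<beta> M0 t) <= \<bar>t\<bar> * Bd" for t
    unfolding Cr_norm_Sup using Bd0 by (auto intro: cSup_least)
  have "restrict (pert U \<psi> \<beta> M0 t) V \<in> LC_Id_ball \<Phi> E X D r (restrict id V) \<epsilon>"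
    if t: "\<bar>t\<bar> * norm M0 < 1" "\<bar>t\<bar> * Bd < \<epsilon>" for t
  proof -
    have Y: "open Y" "range (proj E) = Y" using smooth_vector_bundle_base[OF E] by auto
    have "restrict (pert U \<psi> \<beta> M0 t) V \<in> LC_Id \<Phi> E X r"
      unfolding LC_Id_def using Y XY pert_Cr[of t] pert_iso[OF t(1)] by blast
    moreover have "sec U \<psi> \<beta> M0 t v = fadd E (pert U \<psi> \<beta> M0 t v) (fscale E (- 1) v)" if v: "v \<in> V" for v
    proof -
      let ?y = "proj E v"
      have y: "?y \<in> Y" "v \<in> fiber E ?y" using v XY by (auto simp: bundle_over_def fiber_def)
      obtain U' \<psi>' where U': "(U', \<psi>') \<in> trivs E" "?y \<in> U'" using triv_at y by blast
      note f = sec_fiber[OF y(2,1), of t] pert_fiber[OF y(2,1), of t] smooth_vector_bundle_ops(2)[OF E y(1,2), of "-1"]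
      note f2 = smooth_vector_bundle_ops(1)[OF E y(1) f(2,3)]
      have "\<psi>' (fadd E (pert U \<psi> \<beta> M0 t v) (fscale E (- 1) v)) = \<psi>' (pert U \<psi> \<beta> M0 t v) - \<psi>' v"
        using smooth_vector_bundle_triv(3)[OF E U' f(2,3)] smooth_vector_bundle_triv(4)[OF E U' y(2)] by simp
      also have "\<dots> = \<psi>' (sec U \<psi> \<beta> M0 t v)"
        using pert_works[OF U' y(2)] sec_works[OF U' y(2)] by (simp add: matrix_vector_mult_add_rdistrib)
      finally show ?thesis using triv_inv_simps(3)[OF E U' f(1)] triv_inv_simps(3)[OF E U' f2] by metis
    qed
    ultimately show ?thesis
      unfolding LC_Id_ball_def using sec_Cr[of t] Y Bd(2)[of t] t(2) by (auto intro!: exI[of _ "sec U \<psi> \<beta> M0 t"])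
  qed
  then show ?thesis using Bd0(1) by blast
qed

end

text \<open>Neighbourhoods of a cocycle are given by composition on the right, so the modification
  acts before \<open>A\<close>: over x the vector is first multiplied by 1 + t \<open>M0\<close>.
  The bump function confines the change to \<open>B\<close>.\<close>

lemma perturbation:
  assumes G: "openin (LC_topology \<Phi> E X T D r) G" "A \<in> G" and U: "(U, \<psi>) \<in> trivs E" and x: "x \<in> X" "x \<in> U"
    and B: "open B" "x \<in> B"
  shows "\<exists>Q \<epsilon>. 0 < \<epsilon> & (\<forall>t. \<bar>t\<bar> < \<epsilon> --> Q t \<in> G) & Q 0 = A & continuous_on (UNIV \<times> V) (\<lambda>p. Q (fst p) (snd p)) \<and>
    (\<forall>t v. v \<in> V --> proj E v \<notin> B --> Q t v = A v) \<and>
    (\<forall>t. \<forall>v\<in>fiber E x. \<exists>w\<in>fiber E x. Q t v = A w & \<psi> w = (mat 1 + t *\<^sub>R M0) *v \<psi> v)"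
proof -
  have oU: "open U" by (rule smooth_vector_bundle_triv(1)[OF E U])
  have "open (B \<inter> U)" "x \<in> B \<inter> U" using B oU x by auto
  from bump_function[OF \<Phi> this, of r] obtain \<beta> :: "'m \<Rightarrow> real" and C where bf: "closed C & C \<subseteq> B \<inter> U & \<beta> x = 1 & (\<forall>y. 0 <= \<beta> y & \<beta> y <= 1) \<and>
     (\<forall>y. y \<notin> C --> \<beta> y = 0) & Cr_on_manifold \<Phi> r UNIV \<beta>" by (elim exE)
  have C: "closed C" "C \<subseteq> B \<inter> U" and \<beta>x: "\<beta> x = 1"
    and b1: "\<And>y. 0 <= \<beta> y & \<beta> y <= 1" and b0: "\<And>y. y \<notin> C ==> \<beta> y = 0" and bC: "Cr_on_manifold \<Phi> r UNIV \<beta>"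
    using bf by auto
  have CU: "C \<subseteq> U" using C by blast
  note hyp = U C(1) CU b0 b1 bC
  have GL: "G \<subseteq> LC" and GN: "\<exists>N. openin (LC_Id_topology \<Phi> E X D r) N & restrict id V \<in> N & (\<lambda>R. compose V A R) ` N \<subseteq> G"
    using G unfolding openin_LC_topology by auto
  obtain N where N: "openin (LC_Id_topology \<Phi> E X D r) N" "restrict id V \<in> N" "(\<lambda>R. compose V A R) ` N \<subseteq> G" using GN by blast
  have "\<exists>\<epsilon>>0. LC_Id_ball \<Phi> E X D r (restrict id V) \<epsilon> \<subseteq> N" using N(1,2) unfolding openin_LC_Id_topology by blast
  then obtain \<epsilon> where \<epsilon>: "\<epsilon> > 0" "LC_Id_ball \<Phi> E X D r (restrict id V) \<epsilon> \<subseteq> N" by blast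
  obtain Bd where Bd: "Bd \<ge> 0" "\<And>t. \<bar>t\<bar> * norm M0 < 1 ==> \<bar>t\<bar> * Bd < \<epsilon> ==>
    restrict (pert U \<psi> \<beta> M0 t) V \<in> LC_Id_ball \<Phi> E X D r (restrict id V) \<epsilon>"
    using pert_in_ball[OF hyp, of M0 \<epsilon>] by blast
  define P where "P = pert U \<psi> \<beta> M0"
  define Q where "Q t = compose V A (restrict (P t) V)" for t
  have Pf: "P t v \<in> fiber E y" if "v \<in> fiber E y" "y \<in> X" for t v y
    using pert_fiber[OF hyp that(1), of M0 t] that XY unfolding P_def by blast
  have PV: "P t v \<in> V" if "v \<in> V" for t v
    using Pf[of v "proj E v" t] that by (auto simp: bundle_over_def fiber_def)
  have Qe: "Q t v = A (P t v)" if "v \<in> V" for t v using that by (simp add: Q_def compose_def)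
  have Pid: "P t v = v" if "v \<in> V" "t = 0 \<or> \<beta> (proj E v) = 0" for t v
  proof -
    have y: "proj E v \<in> Y" "v \<in> fiber E (proj E v)" using that(1) XY by (auto simp: bundle_over_def fiber_def)
    show ?thesis
    proof (cases "t = 0")
      case True
      obtain U' \<psi>' where U': "(U', \<psi>') \<in> trivs E" "proj E v \<in> U'" using triv_at y by blast
      have "\<psi>' (P t v) = \<psi>' v" using pert_works[OF hyp U' y(2), of M0 t] True by (simp add: P_def)
      then show ?thesis using triv_inv_simps(3)[OF E U' y(2)] triv_inv_simps(3)[OF E U'] pert_fiber[OF hyp y(2,1), of M0 t]
        unfolding P_def by metis
    qed (use pert_id[OF hyp y(2,1)] that in \<open>auto simp: P_def\<close>)
  qed
  have AL: "A \<in> LC" using G GL by blast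
  \<comment> \<open>The first bound keeps the modification invertible, the second keeps it in the
    chosen ball; the added 1 avoids division by zero.\<close>
  define \<epsilon>' where "\<epsilon>' = min (1 / (norm M0 + 1)) (\<epsilon> / (Bd + 1))"
  have \<epsilon>': "\<epsilon>' > 0" using \<epsilon> Bd by (simp add: \<epsilon>'_def add_nonneg_pos)
  have r1: "\<forall>t. \<bar>t\<bar> < \<epsilon>' --> Q t \<in> G"
  proof (intro allI impI)
    fix t :: real assume t: "\<bar>t\<bar> < \<epsilon>'"
    have "\<bar>t\<bar> * (norm M0 + 1) < 1" "\<bar>t\<bar> * (Bd + 1) < \<epsilon>"
      using t Bd(1) by (auto simp: \<epsilon>'_def less_divide_eq add_nonneg_pos)
    then have "\<bar>t\<bar> * norm M0 < 1" "\<bar>t\<bar> * Bd < \<epsilon>" using abs_ge_zero[of t] by (simp_all only: distrib_left mult_1_right)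
    then have "restrict (P t) V \<in> N" using Bd(2)[of t] \<epsilon>(2) unfolding P_def by blast
    then show "Q t \<in> G" using N(3) unfolding Q_def by blast
  qed
  have r2: "Q 0 = A"
  proof (rule extensionalityI[of _ V])
    show "Q 0 \<in> extensional V" by (simp add: Q_def compose_extensional)
    show "A \<in> extensional V" using AL by (simp add: linear_cocycles_def)
  qed (use Qe Pid in simp)
  have r3: "continuous_on (UNIV \<times> V) (\<lambda>p. Q (fst p) (snd p))"
  proof -
    have "continuous_on (UNIV \<times> V) (\<lambda>p. P (fst p) (snd p))"
    proof (rule continuous_on_subset)
      show "continuous_on (UNIV \<times> bundle_over E Y) (\<lambda>p. P (fst p) (snd p))"
        unfolding P_def by (rule pert_continuous[OF hyp])
    qed (use XY in \<open>auto simp: bundle_over_def\<close>)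
    note cP = this
    have cA: "continuous_on V A" using AL by (simp add: linear_cocycles_def)
    have "continuous_on (UNIV \<times> V) (\<lambda>p. A (P (fst p) (snd p)))"
      by (rule continuous_on_compose2[OF cA cP]) (use PV in auto)
    then show ?thesis by (rule continuous_on_eq) (use Qe in auto)
  qed
  have r4: "\<forall>t v. v \<in> V --> proj E v \<notin> B --> Q t v = A v"
    using Qe Pid b0 C(2) by (metis IntD1 subsetD)
  have r5: "\<forall>t. \<forall>v\<in>fiber E x. \<exists>w\<in>fiber E x. Q t v = A w & \<psi> w = (mat 1 + t *\<^sub>R M0) *v \<psi> v"
  proof (intro allI ballI)
    fix t v assume v: "v \<in> fiber E x"
    show "\<exists>w\<in>fiber E x. Q t v = A w & \<psi> w = (mat 1 + t *\<^sub>R M0) *v \<psi> v"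
    proof (intro bexI conjI)
      show "Q t v = A (P t v)" using v x by (intro Qe) (auto simp: bundle_over_def fiber_def)
      show "\<psi> (P t v) = (mat 1 + t *\<^sub>R M0) *v \<psi> v"
        using pert_works[OF hyp U x(2) v, of M0 t] Fm_self[OF hyp x(2)] \<beta>x by (simp add: P_def)
      show "P t v \<in> fiber E x" by (rule Pf[OF v x(1)])
    qed
  qed
  show ?thesis
    by (rule exI[of _ Q], rule exI[of _ \<epsilon>'], intro conjI) (rule \<epsilon>' r1 r2 r3 r4 r5)+
qed

end

section \<open>Gaps of a structured matrix and lower bounds for the number of moduli\<close>

lemma spec_conj_le:
  fixes C M :: "real ^ 'd ^ 'd"
  assumes C: "invertible C" and z: "z \<in> spec M"
  shows "z \<in> spec (C ** M ** matrix_inv C)"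
proof -
  obtain u v where uv: "u ~= 0 \<or> v ~= 0" "M *v u = Re z *\<^sub>R u - Im z *\<^sub>R v" "M *v v = Im z *\<^sub>R u + Re z *\<^sub>R v"
    using z unfolding spec_iff_real by blast
  have i: "matrix_inv C *v (C *v x) = x" for x using invertible_inv[OF C] by simp
  have e: "(C ** M ** matrix_inv C) *v (C *v x) = C *v (M *v x)" for x
    using i[of x] by (simp flip: matrix_vector_mul_assoc)
  have nz: "C *v x = 0 \<longleftrightarrow> x = 0" for x using i[of x] by (metis matrix_vector_mult_0_right)
  show ?thesis unfolding spec_iff_real
    by (intro exI[of _ "C *v u"] exI[of _ "C *v v"])
      (use uv in \<open>simp add: e nz matrix_vector_right_distrib matrix_vector_mult_diff_distrib matrix_vector_mult_scaleR\<close>)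
qed

lemma inv_C:
  fixes C :: "real ^ 'd ^ 'd"
  shows "invertible C ==> C ** matrix_inv C = mat 1" "invertible C ==> matrix_inv C ** C = mat 1"
  using someI_ex[of "\<lambda>A'. C ** A' = mat 1 & A' ** C = mat 1"] unfolding invertible_def matrix_inv_def by auto

lemma invertible_matrix_inv: "invertible C ==> invertible (matrix_inv C :: real ^ 'd ^ 'd)"
  using inv_C unfolding invertible_def by blast

lemma invertible_conj: "invertible (C :: real ^ 'd ^ 'd) ==> invertible M ==> invertible (C ** M ** matrix_inv C :: real ^ 'd ^ 'd)"
  by (intro invertible_mult invertible_matrix_inv)

lemma conj_mult: "invertible C ==> (C ** M ** matrix_inv C) ** (C ** N ** matrix_inv C) = C ** (M ** N) ** (matrix_inv C :: real ^ 'd ^ 'd)"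
proof -
  assume C: "invertible C"
  have "(C ** M ** matrix_inv C) ** (C ** N ** matrix_inv C) = C ** M ** (matrix_inv C ** C) ** N ** matrix_inv C"
    by (simp add: matrix_mul_assoc)
  then show ?thesis using inv_C(2)[OF C] by (simp add: matrix_mul_assoc)
qed

lemma spec_conj:
  fixes C M :: "real ^ 'd ^ 'd"
  assumes C: "invertible C"
  shows "spec (C ** M ** matrix_inv C) = spec M"
proof (intro equalityI subsetI)
  fix z assume z: "z \<in> spec (C ** M ** matrix_inv C)"
  have D: "invertible (matrix_inv C)" by (rule invertible_matrix_inv[OF C])
  have "matrix_inv C ** (C ** M ** matrix_inv C) ** matrix_inv (matrix_inv C)
      = (matrix_inv C ** C) ** M ** (matrix_inv C ** matrix_inv (matrix_inv C))" by (simp add: matrix_mul_assoc)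
  then have "matrix_inv C ** (C ** M ** matrix_inv C) ** matrix_inv (matrix_inv C) = M"
    using inv_C(2)[OF C] inv_C(1)[OF D] by simp
  then show "z \<in> spec M" using spec_conj_le[OF D z] by simp
qed (rule spec_conj_le[OF C])

lemma nmod_conj: "invertible (C :: real ^ 'd ^ 'd) ==> nmod (C ** M ** matrix_inv C) = nmod (M :: real ^ 'd ^ 'd)"
  by (simp add: nmod_def spec_conj)

lemma structured_conj: "invertible (C :: real ^ 'd ^ 'd) ==> structured (C ** M ** matrix_inv C) = structured (M :: real ^ 'd ^ 'd)"
  by (simp add: structured_def spec_conj)

lemma structured_if_nmod_max:
  fixes M :: "real ^ 'd ^ 'd"
  assumes "nmod M = CARD('d)"
  shows "structured M"
proof -
  have f: "finite (spec M)" by (rule finite_spec[of M])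
  have "card (cmod ` spec M) <= card (spec M)" by (rule card_image_le[OF f])
  then have c: "card (spec M) = CARD('d)" "card (cmod ` spec M) = card (spec M)"
    using assms card_spec_le[of M] by (auto simp: nmod_def)
  then have "inj_on cmod (spec M)" using eq_card_imp_inj_on[OF f] by blast
  then show ?thesis using c unfolding structured_def inj_on_def by metis
qed

lemma invertible_zero_spec: "invertible M ==> 0 \<notin> spec (M :: real ^ 'd ^ 'd)"
proof
  assume M: "invertible M" and "0 \<in> spec M"
  then obtain u v where "u ~= 0 \<or> v ~= 0" "M *v u = 0" "M *v v = 0" unfolding spec_iff_real by auto
  then show False using invertible_inv[OF M] by (metis matrix_vector_mult_0_right)
qed

section \<open>Gaps between the moduli of the eigenvalues\<close>

definition gaps :: "('d \<Rightarrow> real) \<Rightarrow> 'd set set" where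
  "gaps rad = {I. \<forall>i\<in>I. \<forall>j\<in>- I. rad j < rad i}"
text \<open>The empty and the full set of coordinates are gaps too; the inserted 0, and in
  \<open>rmin\<close> the inserted rmax + 1, give them meaningful values. \<open>ga\<close> and
  \<open>gb\<close> then cut the interval between the two bounds into thirds.\<close>

definition rmax :: "('d::finite \<Rightarrow> real) \<Rightarrow> 'd set \<Rightarrow> real" where
  "rmax rad I = Max (insert 0 (rad ` (- I)))"
definition rmin :: "('d::finite \<Rightarrow> real) \<Rightarrow> 'd set \<Rightarrow> real" where
  "rmin rad I = Min (insert (rmax rad I + 1) (rad ` I))"
definition ga :: "('d::finite \<Rightarrow> real) \<Rightarrow> 'd set \<Rightarrow> real" where "ga rad I = (rmax rad I + 2 * rmin rad I) / 3"
definition gb :: "('d::finite \<Rightarrow> real) \<Rightarrow> 'd set \<Rightarrow> real" where "gb rad I = (2 * rmax rad I + rmin rad I) / 3"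

lemma gap_bounds:
  assumes rad: "\<And>i. 0 < rad i" and I: "I \<in> gaps rad"
  shows "0 <= rmax rad I" "rmax rad I < gb rad I" "gb rad I < ga rad I" "ga rad I < rmin rad I" "0 < gb rad I"
proof -
  show 0: "0 <= rmax rad I" by (simp add: rmax_def)
  have "rmax rad I < rad i" if "i \<in> I" for i using I rad that by (auto simp: rmax_def gaps_def)
  then have "rmax rad I < rmin rad I" by (auto simp: rmin_def)
  then show "rmax rad I < gb rad I" "gb rad I < ga rad I" "ga rad I < rmin rad I" "0 < gb rad I"
    using 0 by (auto simp: ga_def gb_def)
qed

lemma rmax_ge: "i \<notin> I ==> rad i <= rmax rad I"
  unfolding rmax_def by (intro Max_ge) auto

lemma rmin_le: "i \<in> I ==> rmin rad I <= rad i"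
  unfolding rmin_def by (intro Min_le) auto

lemma gap_mono:
  assumes "I' \<subseteq> I"
  shows "rmax rad I <= rmax rad I'" "rmin rad I <= rmin rad I'" "ga rad I <= ga rad I'"
proof -
  show 1: "rmax rad I <= rmax rad I'" unfolding rmax_def using assms by (intro Max_mono) auto
  have "rmin rad I <= x" if "x \<in> insert (rmax rad I' + 1) (rad ` I')" for x
  proof -
    have "rmin rad I <= rmax rad I + 1" unfolding rmin_def by (intro Min_le) auto
    then show ?thesis using 1 that rmin_le[of _ I rad] assms by auto
  qed
  then show 2: "rmin rad I <= rmin rad I'" unfolding rmin_def[of rad I'] by (intro Min.boundedI) auto
  show "ga rad I <= ga rad I'" using 1 2 by (simp add: ga_def)
qed

lemma en_sq: "(en I v)\<^sup>2 = (\<Sum>i\<in>I. (v $ i)\<^sup>2)"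
proof -
  have "(en I v)\<^sup>2 = (\<Sum>i\<in>UNIV. (pr I v $ i)\<^sup>2)"
    unfolding en_def power2_norm_eq_inner inner_vec_def by (simp add: power2_eq_square)
  also have "\<dots> = (\<Sum>i\<in>UNIV. if i \<in> I then (v $ i)\<^sup>2 else 0)"
    by (rule sum.cong) (auto simp: pr_def)
  also have "\<dots> = (\<Sum>i\<in>I. (v $ i)\<^sup>2)" by (simp add: sum.If_cases)
  finally show ?thesis .
qed

text \<open>The block of a conjugate pair multiplies the length of its two coordinates by their
  common modulus, and both coordinates lie on the same side of any gap. So the matrix in
  eigen-coordinates satisfies the two estimates of \<open>near_dominated\<close>.\<close>

lemma structured_gap:
  fixes M C :: "real ^ 'd ^ 'd" and e :: "'d \<Rightarrow> complex"
  assumes C: "invertible C" and e: "bij_betw e UNIV (spec M)" and z0: "0 \<notin> spec M"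
    and re': "\<forall>i x. Im (e i) = 0 --> (C *v (M *v x)) $ i = Re (e i) * (C *v x) $ i"
    and im': "\<forall>i j x. Im (e i) > 0 --> e j = cnj (e i) -->
       (C *v (M *v x)) $ i = Re (e i) * (C *v x) $ i - Im (e i) * (C *v x) $ j \<and>
       (C *v (M *v x)) $ j = Im (e i) * (C *v x) $ i + Re (e i) * (C *v x) $ j"
    and I: "I \<in> gaps (\<lambda>i. cmod (e i))"
  shows "\<exists>\<delta>>0. \<forall>L. norm (L - C ** M ** matrix_inv C) < \<delta> -->
    cone_pres L I & grow L I (ga (\<lambda>i. cmod (e i)) I) (gb (\<lambda>i. cmod (e i)) I)"
proof -
  note re = re'[rule_format] and im = im'[rule_format]
  define rad where "rad = (\<lambda>i. cmod (e i))"
  define N where "N = C ** M ** matrix_inv C"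
  have es: "e i \<in> spec M" for i using e by (auto simp: bij_betw_def)
  have rad0: "0 < rad i" for i using es[of i] z0 unfolding rad_def by (metis zero_less_norm_iff)
  note gb = gap_bounds[of rad I, OF rad0 I[folded rad_def]]
  \<comment> \<open>The index of the conjugate eigenvalue; for a real eigenvalue this is i
    itself.\<close>
  define cj where "cj i = inv_into UNIV e (cnj (e i))" for i
  have ecj: "e (cj i) = cnj (e i)" for i
    unfolding cj_def using spec_cnj[OF es[of i]] e by (intro f_inv_into_f) (auto simp: bij_betw_def)
  have inj: "i = j" if "e i = e j" for i j using e that by (auto simp: bij_betw_def inj_on_def)
  have cjcj: "cj (cj i) = i" for i by (rule inj) (simp add: ecj)
  have rcj: "rad (cj i) = rad i" for i by (simp add: rad_def ecj)
  have Nv: "N *v (C *v x) = C *v (M *v x)" for x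
    using invertible_inv[OF C] unfolding N_def by (simp flip: matrix_vector_mul_assoc)
  have sq: "((N *v v) $ i)\<^sup>2 + ((N *v v) $ cj i)\<^sup>2 = (rad i)\<^sup>2 * ((v $ i)\<^sup>2 + (v $ cj i)\<^sup>2)" for v i
  proof -
    define x where "x = matrix_inv C *v v"
    have v: "v = C *v x" using invertible_inv[OF C] by (simp add: x_def)
    have r2: "(rad i)\<^sup>2 = (Re (e i))\<^sup>2 + (Im (e i))\<^sup>2" by (simp add: rad_def cmod_power2)
    consider "Im (e i) = 0" | "Im (e i) > 0" | "Im (e i) < 0" by linarith
    then show ?thesis
    proof cases
      case 1
      have "cj i = i" by (rule inj) (simp add: ecj complex_eq_iff 1)
      then show ?thesis using re[OF 1, of x] r2 1 unfolding v Nv by (simp add: power_mult_distrib)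
    next
      case 2
      show ?thesis unfolding v Nv r2 using im[OF 2 ecj, of x] by (simp only:) (simp add: power2_eq_square algebra_simps)
    next
      case 3
      have "Im (e (cj i)) > 0" using 3 by (simp add: ecj)
      from im[OF this, of i x] show ?thesis unfolding v Nv r2 using ecj[of i]
        by simp (simp add: power2_eq_square algebra_simps)
    qed
  qed
  have inv: "bij_betw cj B B" if B: "\<And>i. i \<in> B ==> cj i \<in> B" for B
    by (rule bij_betw_byWitness[where f' = cj]) (use B cjcj in auto)
  have sumcj: "(\<Sum>i\<in>B. f (cj i)) = (\<Sum>i\<in>B. f i)" if "\<And>i. i \<in> B ==> cj i \<in> B" for B and f :: "'d \<Rightarrow> real"
    by (rule sum.reindex_bij_betw[OF inv[OF that]])
  \<comment> \<open>Reindexing by \<open>cj\<close> doubles each sum of squares and makes the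
    conjugate pairs visible.\<close>
  have en2: "2 * (en B (N *v v))\<^sup>2 = (\<Sum>i\<in>B. (rad i)\<^sup>2 * ((v $ i)\<^sup>2 + (v $ cj i)\<^sup>2))"
    "2 * (en B v)\<^sup>2 = (\<Sum>i\<in>B. (v $ i)\<^sup>2 + (v $ cj i)\<^sup>2)" if B: "\<And>i. i \<in> B ==> cj i \<in> B" for B v
    using sumcj[of B "\<lambda>i. ((N *v v) $ i)\<^sup>2", OF B] sumcj[of B "\<lambda>i. (v $ i)\<^sup>2", OF B]
    by (simp_all add: en_sq sum.distrib flip: sq)
  have BI: "cj i \<in> I" if "i \<in> I" for i
  proof (rule ccontr)
    assume "cj i \<notin> I"
    then have "rad (cj i) < rad i" using I[folded rad_def] that unfolding gaps_def by blast
    then show False using rcj[of i] by simp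
  qed
  have BI': "cj i \<in> - I" if "i \<in> - I" for i
    using BI[of "cj i"] cjcj[of i] that by auto
  have e1: "2 * (en I (N *v v))\<^sup>2 = (\<Sum>i\<in>I. (rad i)\<^sup>2 * ((v $ i)\<^sup>2 + (v $ cj i)\<^sup>2))"
    "2 * (en I v)\<^sup>2 = (\<Sum>i\<in>I. (v $ i)\<^sup>2 + (v $ cj i)\<^sup>2)" for v
    by (rule en2(1), rule BI, assumption) (rule en2(2), rule BI)
  have e2: "2 * (en (- I) (N *v v))\<^sup>2 = (\<Sum>i\<in>- I. (rad i)\<^sup>2 * ((v $ i)\<^sup>2 + (v $ cj i)\<^sup>2))"
    "2 * (en (- I) v)\<^sup>2 = (\<Sum>i\<in>- I. (v $ i)\<^sup>2 + (v $ cj i)\<^sup>2)" for v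
    by (rule en2(1), rule BI', assumption) (rule en2(2), rule BI')
  have lo: "rmin rad I * en I v <= en I (N *v v)" for v
  proof -
    have r0: "0 <= rmin rad I" using gb by linarith
    have "(rmin rad I)\<^sup>2 * (2 * (en I v)\<^sup>2) <= 2 * (en I (N *v v))\<^sup>2"
      unfolding e1[of v] sum_distrib_left
      by (intro sum_mono mult_right_mono power_mono rmin_le r0) auto
    then have "(rmin rad I * en I v)\<^sup>2 <= (en I (N *v v))\<^sup>2" by (simp add: power_mult_distrib)
    then show ?thesis using en_nonneg power2_le_imp_le by blast
  qed
  have hi: "en (- I) (N *v v) <= rmax rad I * en (- I) v" for v
  proof -
    have "2 * (en (- I) (N *v v))\<^sup>2 <= (rmax rad I)\<^sup>2 * (2 * (en (- I) v)\<^sup>2)"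
      unfolding e2[of v] sum_distrib_left
      by (intro sum_mono mult_right_mono power_mono rmax_ge) (auto simp: less_imp_le[OF rad0])
    then have "(en (- I) (N *v v))\<^sup>2 <= (rmax rad I * en (- I) v)\<^sup>2" by (simp add: power_mult_distrib)
    moreover have "0 <= rmax rad I * en (- I) v" using gb(1) by simp
    ultimately show ?thesis using power2_le_imp_le by blast
  qed
  show ?thesis
    using near_dominated[of "rmin rad I" I N "rmax rad I" "gb rad I" "ga rad I", OF lo hi gb(1,2,3,4)]
    unfolding N_def rad_def .
qed

section \<open>Counting eigenvalues class by class\<close>

definition dom :: "('d::finite set \<Rightarrow> real) \<Rightarrow> ('d set \<Rightarrow> real) \<Rightarrow> real ^ 'd ^ 'd \<Rightarrow> 'd set \<Rightarrow> bool" where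
  "dom A B P I \<longleftrightarrow> cone_pres P I & grow P I (A I) (B I) & 0 < B I & B I < A I"

text \<open>The coordinates of modulus s form \<open>Kc rad s - Jc rad s\<close>, the class between
  two consecutive gaps.\<close>

definition Kc :: "('d \<Rightarrow> real) \<Rightarrow> real \<Rightarrow> 'd set" where "Kc rad s = {i. s <= rad i}"
definition Jc :: "('d \<Rightarrow> real) \<Rightarrow> real \<Rightarrow> 'd set" where "Jc rad s = {i. s < rad i}"

lemma Kc_gap: "Kc rad s \<in> gaps rad" and Jc_gap: "Jc rad s \<in> gaps rad"
  by (auto simp: gaps_def Kc_def Jc_def)

lemma Kc_Jc: "Jc rad s \<subseteq> Kc rad s" "Kc rad s - Jc rad s = {i. rad i = s}" "s < s' ==> Kc rad s' \<subseteq> Jc rad s"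
  by (auto simp: Kc_def Jc_def)

lemma gap_sep: "(\<And>i. 0 < rad i) ==> s < s' ==> gb rad (Jc rad s) < ga rad (Kc rad s')"
  using gap_mono(3)[OF Kc_Jc(3), of s s' rad rad] gap_bounds(3)[OF _ Jc_gap, of rad s] by fastforce

text \<open>Each class contributes an eigenvalue, and the separation hypothesis makes the intervals
  of moduli belonging to different classes disjoint.\<close>

lemma class_moduli:
  fixes P :: "real ^ 'd ^ 'd" and rad :: "'d \<Rightarrow> real"
  assumes P: "invertible P" and dm: "\<forall>I\<in>gaps rad. dom A B P I"
    and sep: "\<forall>s\<in>range rad. \<forall>s'\<in>range rad. s < s' --> B (Jc rad s) < A (Kc rad s')"
  shows "\<exists>z. inj_on (\<lambda>s. cmod (z s)) (range rad) \<and>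
    (\<forall>s\<in>range rad. z s \<in> spec P & A (Kc rad s) <= cmod (z s) & cmod (z s) <= B (Jc rad s))"
proof -
  have "\<exists>z\<in>spec P. A (Kc rad s) <= cmod z & cmod z <= B (Jc rad s)" if s: "s \<in> range rad" for s
  proof -
    have "Kc rad s - Jc rad s ~= {}" using s by (auto simp: Kc_Jc(2))
    then show ?thesis
      using class_eigenvalue[OF P, of "Jc rad s" "A (Jc rad s)" "B (Jc rad s)" "Kc rad s" "A (Kc rad s)" "B (Kc rad s)"]
        dm[rule_format, OF Jc_gap, of s] dm[rule_format, OF Kc_gap, of s] Kc_Jc(1)[of rad s] unfolding dom_def by blast
  qed
  then have "\<forall>s\<in>range rad. \<exists>z. z \<in> spec P & A (Kc rad s) <= cmod z & cmod z <= B (Jc rad s)" by blast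
  then have "\<exists>z. \<forall>s\<in>range rad. z s \<in> spec P & A (Kc rad s) <= cmod (z s) & cmod (z s) <= B (Jc rad s)" by (rule bchoice)
  then obtain z where z: "\<forall>s\<in>range rad. z s \<in> spec P & A (Kc rad s) <= cmod (z s) & cmod (z s) <= B (Jc rad s)" by (rule exE)
  have lt: "cmod (z s) < cmod (z s')" if "s \<in> range rad" "s' \<in> range rad" "s < s'" for s s'
    using bspec[OF z that(1)] bspec[OF z that(2)] sep[rule_format, OF that] by linarith
  have "inj_on (\<lambda>s. cmod (z s)) (range rad)"
  proof (rule inj_onI)
    fix s s' assume "s \<in> range rad" "s' \<in> range rad" "cmod (z s) = cmod (z s')"
    then show "s = s'" using lt[of s s'] lt[of s' s] by (metis less_irrefl linorder_neqE_linordered_idom)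
  qed
  then show ?thesis using z by (intro exI conjI)
qed

lemma class_card:
  fixes P :: "real ^ 'd ^ 'd" and rad :: "'d \<Rightarrow> real"
  assumes P: "invertible P" and dm: "\<forall>I\<in>gaps rad. dom A B P I"
    and sep: "\<forall>s\<in>range rad. \<forall>s'\<in>range rad. s < s' --> B (Jc rad s) < A (Kc rad s')"
  shows "card (range rad) <= nmod P"
proof -
  obtain z where z: "inj_on (\<lambda>s. cmod (z s)) (range rad)" "\<forall>s\<in>range rad. z s \<in> spec P & A (Kc rad s) <= cmod (z s) & cmod (z s) <= B (Jc rad s)"
    using class_moduli[OF assms] by (elim exE conjE)
  have "(\<lambda>s. cmod (z s)) ` range rad \<subseteq> cmod ` spec P" using z(2) by blast
  then have "card ((\<lambda>s. cmod (z s)) ` range rad) <= nmod P"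
    unfolding nmod_def by (intro card_mono finite_imageI finite_spec[of P])
  then show ?thesis using card_image[OF z(1)] by simp
qed

text \<open>The bound on \<open>nmod\<close> leaves no modulus besides those of the classes, and by
  structure each of these moduli carries at most a conjugate pair. A class of one coordinate has a
  real eigenvalue, so only one; the class of \<open>p\<close> has size at least two but contains a
  real eigenvalue, so it also has only one. The eigenvalues are then fewer than the
  dimension.\<close>

lemma no_extra_real:
  fixes P :: "real ^ 'd ^ 'd" and rad :: "'d \<Rightarrow> real"
  assumes P: "invertible P" and dm: "\<forall>I\<in>gaps rad. dom A B P I"
    and sep: "\<forall>s\<in>range rad. \<forall>s'\<in>range rad. s < s' --> B (Jc rad s) < A (Kc rad s')"
    and st: "structured P" and nm: "nmod P <= card (range rad)"
    and pq: "p ~= q" "rad p = rad q" and \<mu>: "complex_of_real \<mu> \<in> spec P" "A (Kc rad (rad p)) <= \<bar>\<mu>\<bar>" "\<bar>\<mu>\<bar> <= B (Jc rad (rad p))"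
  shows False
proof -
  let ?S = "range rad"
  obtain z where z: "inj_on (\<lambda>s. cmod (z s)) ?S" "\<forall>s\<in>?S. z s \<in> spec P & A (Kc rad s) <= cmod (z s) & cmod (z s) <= B (Jc rad s)"
    using class_moduli[OF P dm sep] by (elim exE conjE)
  have fs: "finite (spec P)" by (rule finite_spec[of P])
  have im: "(\<lambda>s. cmod (z s)) ` ?S = cmod ` spec P"
  proof (rule card_seteq)
    show "(\<lambda>s. cmod (z s)) ` ?S \<subseteq> cmod ` spec P" using z(2) by blast
    show "card (cmod ` spec P) <= card ((\<lambda>s. cmod (z s)) ` ?S)"
      using nm card_image[OF z(1)] by (simp add: nmod_def)
  qed (use fs in simp)
  define cl where "cl s = {w \<in> spec P. cmod w = cmod (z s)}" for s
  have un: "spec P = (\<Union>s\<in>?S. cl s)"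
  proof
    show "spec P \<subseteq> (\<Union>s\<in>?S. cl s)"
    proof
      fix w assume "w \<in> spec P"
      then have "cmod w \<in> (\<lambda>s. cmod (z s)) ` ?S" unfolding im by blast
      then show "w \<in> (\<Union>s\<in>?S. cl s)" using \<open>w \<in> spec P\<close> by (auto simp: cl_def)
    qed
  qed (auto simp: cl_def)
  have fcl: "finite (cl s)" for s using fs by (simp add: cl_def)
  have two: "w' = w \<or> w' = cnj w" if "w \<in> cl s" "w' \<in> cl s" for w w' s
    using st that unfolding structured_def cl_def by simp
  have one: "card (cl s) <= 1" if "w \<in> cl s" "Im w = 0" for w s
  proof -
    have "cnj w = w" using that(2) by (simp add: complex_eq_iff)
    then have "cl s \<subseteq> {w}" using two[OF that(1)] by auto
    then show ?thesis using card_mono[of "{w}" "cl s"] by simp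
  qed
  define m where "m s = card {i. rad i = s}" for s
  have le: "card (cl s) <= m s" if s: "s \<in> ?S" for s
  proof -
    have "m s ~= 0" using s by (auto simp: m_def)
    then consider "m s = 1" | "2 <= m s" by linarith
    then show ?thesis
    proof cases
      case 1
      then obtain i where "{i. rad i = s} = {i}" unfolding m_def by (metis card_1_singletonE)
      then have i: "Kc rad s - Jc rad s = {i}" by (simp add: Kc_Jc(2))
      have "Im (z s) = 0"
        using class_real[OF P, of "Jc rad s" "A (Jc rad s)" "B (Jc rad s)" "Kc rad s" "A (Kc rad s)" "B (Kc rad s)" i "z s"]
          dm[rule_format, OF Jc_gap, of s] dm[rule_format, OF Kc_gap, of s] Kc_Jc(1)[of rad s] bspec[OF z(2) s] i unfolding dom_def by blast
      moreover have "z s \<in> cl s" using bspec[OF z(2) s] by (simp add: cl_def)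
      ultimately show ?thesis using one[of "z s" s] 1 by simp
    next
      case 2
      have "z s \<in> cl s" using bspec[OF z(2) s] by (simp add: cl_def)
      then have "cl s \<subseteq> {z s, cnj (z s)}" using two[of "z s" s] by auto
      then have "card (cl s) <= card {z s, cnj (z s)}" by (intro card_mono) auto
      also have "\<dots> <= 2" by (simp add: card_insert_if)
      finally show ?thesis using 2 by simp
    qed
  qed
  have "card (cl (rad p)) < m (rad p)"
  proof -
    have "{p, q} \<subseteq> {i. rad i = rad p}" using pq by auto
    then have "card {p, q} <= m (rad p)" unfolding m_def by (intro card_mono) auto
    then have 2: "2 <= m (rad p)" using pq by simp
    have "cmod (complex_of_real \<mu>) \<in> (\<lambda>s. cmod (z s)) ` ?S" unfolding im using \<mu>(1) by blast
    then obtain s where s: "s \<in> ?S" "\<bar>\<mu>\<bar> = cmod (z s)" by auto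
    have "s = rad p"
    proof (rule ccontr)
      assume "s ~= rad p"
      then consider "s < rad p" | "rad p < s" by linarith
      then show False
      proof cases
        case 1 then show ?thesis using sep[rule_format, of s "rad p"] s bspec[OF z(2) s(1)] \<mu> by auto
      next
        case 2 then show ?thesis using sep[rule_format, of "rad p" s] s bspec[OF z(2) s(1)] \<mu> by auto
      qed
    qed
    then have "complex_of_real \<mu> \<in> cl (rad p)" using s \<mu>(1) by (simp add: cl_def)
    then have "card (cl (rad p)) <= 1" using one by fastforce
    then show ?thesis using 2 by simp
  qed
  then have "(\<Sum>s\<in>?S. card (cl s)) < (\<Sum>s\<in>?S. m s)"
    using le by (intro sum_strict_mono_ex1) auto
  moreover have "card (spec P) <= (\<Sum>s\<in>?S. card (cl s))" unfolding un by (intro card_UN_le) auto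
  moreover have "(\<Sum>s\<in>?S. m s) = CARD('d)"
    using sum.group[of "UNIV :: 'd set" ?S rad "\<lambda>_. 1 :: nat"] by (simp add: m_def)
  moreover have "card (spec P) = CARD('d)" using st by (simp add: structured_def)
  ultimately show False by simp
qed

text \<open>The gaps of a structured matrix persist as dominated cones of nearby matrices, where
  every class keeps an eigenvalue. This takes the place of continuity of roots.\<close>

lemma nmod_lsc:
  fixes M :: "real ^ 'd ^ 'd"
  assumes st: "structured M" and z0: "0 \<notin> spec M" and f: "(f \<longlongrightarrow> M) F" and inv: "\<And>x. invertible (f x)"
  shows "\<forall>\<^sub>F x in F. nmod M <= nmod (f x)"
proof -
  obtain C e where C: "invertible (C :: real ^ 'd ^ 'd)" and e: "bij_betw e UNIV (spec M)"
    and re: "\<forall>i x. Im (e i) = 0 --> (C *v (M *v x)) $ i = Re (e i) * (C *v x) $ i"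
    and im: "\<forall>i j x. Im (e i) > 0 --> e j = cnj (e i) -->
       (C *v (M *v x)) $ i = Re (e i) * (C *v x) $ i - Im (e i) * (C *v x) $ j \<and>
       (C *v (M *v x)) $ j = Im (e i) * (C *v x) $ i + Re (e i) * (C *v x) $ j"
    using eigen_coordinates[OF st] by (elim exE conjE)
  define rad where "rad = (\<lambda>i. cmod (e i))"
  have "e i \<in> spec M" for i using e by (auto simp: bij_betw_def)
  then have rad0: "0 < rad i" for i using z0 unfolding rad_def by (metis zero_less_norm_iff)
  have g: "\<forall>I\<in>gaps rad. \<exists>\<delta>. 0 < \<delta> & (\<forall>L. norm (L - C ** M ** matrix_inv C) < \<delta> -->
    cone_pres L I & grow L I (ga rad I) (gb rad I))"
    using structured_gap[OF C e z0 re im] unfolding rad_def by blast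
  have "\<forall>\<^sub>F x in F. dom (ga rad) (gb rad) (C ** f x ** matrix_inv C) I" if I: "I \<in> gaps rad" for I
  proof -
    obtain \<delta> where d: "0 < \<delta>" "\<forall>L. norm (L - C ** M ** matrix_inv C) < \<delta> -->
      cone_pres L I & grow L I (ga rad I) (gb rad I)" using bspec[OF g I] by (elim exE conjE)
    have "((\<lambda>x. C ** f x ** matrix_inv C) \<longlongrightarrow> C ** M ** matrix_inv C) F"
      by (intro tendsto_matrix_matrix tendsto_const f)
    then have "\<forall>\<^sub>F x in F. norm (C ** f x ** matrix_inv C - C ** M ** matrix_inv C) < \<delta>"
      using d(1) unfolding tendsto_iff dist_norm by blast
    then show ?thesis
      by (rule eventually_mono) (use d(2) gap_bounds[of rad, OF rad0 I] in \<open>simp add: dom_def\<close>)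
  qed
  then have "\<forall>\<^sub>F x in F. \<forall>I\<in>gaps rad. dom (ga rad) (gb rad) (C ** f x ** matrix_inv C) I"
    by (simp add: eventually_ball_finite)
  then show ?thesis
  proof (rule eventually_mono)
    fix x assume d: "\<forall>I\<in>gaps rad. dom (ga rad) (gb rad) (C ** f x ** matrix_inv C) I"
    have "\<forall>s\<in>range rad. \<forall>s'\<in>range rad. s < s' --> gb rad (Jc rad s) < ga rad (Kc rad s')" using gap_sep[of rad, OF rad0] by simp
    then have "card (range rad) <= nmod (C ** f x ** matrix_inv C)"
      by (rule class_card[OF invertible_conj[OF C inv[of x]] d])
    moreover have "range rad = cmod ` spec M" using e unfolding rad_def bij_betw_def by (metis image_image)
    ultimately show "nmod M <= nmod (f x)" using nmod_conj[OF C] by (simp add: nmod_def)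
  qed
qed

context sft_factor begin

text \<open>A perturbation inside \<open>B\<close> is to act exactly once per turn of
  \<open>y k\<close> and to leave the orbit of p alone. Points near p stay away from
  \<open>x 0\<close> for m steps, and the remaining part of a turn converges to a finite piece of
  the homoclinic orbit.\<close>

lemma homoclinic_isolated:
  assumes p: "p \<in> Per" and m: "0 < m" "(T ^^ m) p = p"
  shows "\<exists>x \<alpha> \<beta> N y B. (\<forall>i. x i \<in> X & T (x i) = x (i + 1)) & 0 < \<alpha> & 0 < \<beta> \<and>
    filterlim N at_top sequentially \<and>
    (\<forall>k i. y k i \<in> Per & T (y k i) = y k (i + 1) & y k (i + (\<alpha> + \<beta> + int m * int (N k))) = y k i) \<and>
    (\<forall>i. (\<lambda>k. y k i) \<longlonglongrightarrow> x i) \<and>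
    (\<forall>W. open W & p \<in> W --> (\<exists>J. (\<forall>j\<ge>J. x (- \<alpha> - int m * int j) \<in> W & x (\<beta> + int m * int j) \<in> W) \<and>
       (\<forall>k j. J <= j & j + J <= N k --> y k (\<beta> + int m * int j) \<in> W))) \<and>
    open B & x 0 \<in> B & (\<forall>j. (T ^^ j) p \<notin> B) & (\<forall>i. i ~= 0 --> x i \<notin> B) \<and>
    (\<forall>k. y k 0 \<in> B & (\<forall>i. 0 < i & i < \<alpha> + \<beta> + int m * int (N k) --> y k i \<notin> B))"
proof -
  from homoclinic_data[OF p m] obtain x \<alpha> \<beta> N y where
    x: "\<forall>i. x i \<in> X & T (x i) = x (i + 1)" and x0: "\<forall>j. x 0 ~= (T ^^ j) p" and ab: "0 < \<alpha>" "0 < \<beta>"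
    and N: "filterlim N at_top sequentially"
    and y: "\<forall>k i. y k i \<in> Per & T (y k i) = y k (i + 1) & y k (i + (\<alpha> + \<beta> + int m * int (N k))) = y k i"
    and lim: "\<forall>i. (\<lambda>k. y k i) \<longlonglongrightarrow> x i"
    and W: "\<forall>W. open W & p \<in> W --> (\<exists>J. (\<forall>j\<ge>J. x (- \<alpha> - int m * int j) \<in> W & x (\<beta> + int m * int j) \<in> W) \<and>
       (\<forall>k j. J <= j & j + J <= N k --> y k (\<beta> + int m * int j) \<in> W))"
    by (elim exE conjE)
  define R where "R W J \<longleftrightarrow> (\<forall>j\<ge>J. x (- \<alpha> - int m * int j) \<in> W & x (\<beta> + int m * int j) \<in> W) \<and>
       (\<forall>k j. J <= j & j + J <= N k --> y k (\<beta> + int m * int j) \<in> W)" for W J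
  have WR: "\<exists>J. R W J" if "open W" "p \<in> W" for W
    unfolding R_def by (rule mp[OF spec[OF W]]) (use that in simp)
  define \<Lambda> where "\<Lambda> k = \<alpha> + \<beta> + int m * int (N k)" for k
  have xT: "(T ^^ j) (x i) = x (i + int j)" for i j
    by (induction j) (use x in \<open>simp_all add: ac_simps\<close>)
  have yT: "(T ^^ j) (y k i) = y k (i + int j)" for i j k
    by (induction j) (use y in \<open>simp_all add: ac_simps\<close>)
  have yX: "y k i \<in> X" for k i using y Per_X by blast
  have pX: "p \<in> X" using p Per_X by blast
  \<comment> \<open>If \<open>x i = x 0\<close> with \<open>i ~= 0\<close>, then \<open>x 0\<close> is periodic, hence on the orbit of its limit \<open>p\<close>.\<close>
  have xi: "x i ~= x 0" if "i ~= 0" for i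
  proof
    assume e: "x i = x 0"
    define c where "c = nat \<bar>i\<bar>"
    have c: "0 < c" using that by (simp add: c_def)
    have "\<exists>i0. (T ^^ c) (x i0) = x i0 & i0 <= 0"
      by (cases "0 < i") (use e xT[of c 0] xT[of c i] in \<open>auto simp: c_def intro!: exI[of _ "min 0 i"]\<close>)
    then obtain i0 where i0: "(T ^^ c) (x i0) = x i0" "i0 <= 0" by blast
    have per: "x (i + int (c * k)) = x i" if "i0 <= i" for i k
    proof -
      have "(T ^^ (c * k)) (x i0) = x i0" by (rule T_pow_mult[OF i0(1)])
      then have "x (i0 + int (c * k)) = x i0" using xT[of "c * k" i0] by simp
      then have "(T ^^ nat (i - i0)) (x (i0 + int (c * k))) = (T ^^ nat (i - i0)) (x i0)" by simp
      then show ?thesis using xT[of "nat (i - i0)" "i0 + int (c * k)"] xT[of "nat (i - i0)" i0] that by (simp del: of_nat_mult add: add.commute add.left_commute)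
    qed
    have "x \<beta> = p"
    proof (rule ccontr)
      assume "x \<beta> ~= p"
      then have "open (- {x \<beta>})" "p \<in> - {x \<beta>}" by auto
      then obtain J where "R (- {x \<beta>}) J" using WR by blast
      then have J: "\<forall>j\<ge>J. x (\<beta> + int m * int j) ~= x \<beta>" unfolding R_def by simp
      have "J <= c * J" using c by (cases c) auto
      then have "x (\<beta> + int m * int (c * J)) ~= x \<beta>" by (rule J[rule_format])
      moreover have e: "\<beta> + int m * int (c * J) = \<beta> + int (c * (m * J))" by (simp add: algebra_simps)
      moreover have "i0 <= \<beta>" using i0(2) ab by linarith
      ultimately show False using per[of \<beta> "m * J"] unfolding e by blast
    qed
    moreover have "(T ^^ nat (int (c * nat \<beta>) - \<beta>)) (x \<beta>) = x (int (c * nat \<beta>))"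
    proof -
      have "\<beta> <= int (c * nat \<beta>)" using c ab by (cases c) auto
      then show ?thesis using xT[of "nat (int (c * nat \<beta>) - \<beta>)" \<beta>] by simp
    qed
    moreover have "x (int (c * nat \<beta>)) = x 0" using per[of 0 "nat \<beta>"] i0(2) by simp
    ultimately show False using x0 by metis
  qed
  have "\<exists>U1 U2. open U1 & open U2 & x 0 \<in> U1 & (T ^^ j) p \<in> U2 & U1 \<inter> U2 = {}" for j
    using x0 by (intro hausdorff) simp
  then obtain U1 U2 where U: "\<And>j. open (U1 j)" "\<And>j. open (U2 j)" "\<And>j. x 0 \<in> U1 j" "\<And>j. (T ^^ j) p \<in> U2 j"
    "\<And>j. U1 j \<inter> U2 j = {}" by metis
  have "\<exists>A. open A & A \<inter> X = (T ^^ j) -` U2 j \<inter> X" for j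
    using continuous_T_pow U(2) unfolding continuous_on_open_invariant by blast
  then obtain A where A: "\<And>j. open (A j)" "\<And>j. A j \<inter> X = (T ^^ j) -` U2 j \<inter> X" by metis
  \<comment> \<open>For j < m the j-th iterate of a point of X in \<open>W0\<close> lies in
    \<open>U2 j\<close>, which is disjoint from a neighbourhood of \<open>x 0\<close>; so one visit
    to \<open>W0\<close> excludes \<open>B\<close> for a whole period.\<close>
  define W0 where "W0 = (\<Inter>j<m. A j)"
  have "p \<in> A j" for j using A(2)[of j] U(4)[of j] pX by blast
  then have "open W0" "p \<in> W0" unfolding W0_def using A(1) by (auto intro!: open_INT)
  then obtain J where "R W0 J" using WR by blast
  then have J: "y k (\<beta> + int m * int j) \<in> W0" if "J <= j" "j + J <= N k" for k j using that unfolding R_def by simp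
  define F where "F = {- \<alpha> - int m * int J .. \<beta> + int m * int J} - {0}"
  have "\<exists>U1 U2. open U1 & open U2 & x 0 \<in> U1 & x i \<in> U2 & U1 \<inter> U2 = {}" if "i ~= 0" for i
    using xi[OF that] by (intro hausdorff) simp
  then obtain V1 V2 where V: "\<And>i. i ~= 0 ==> open (V1 i) & open (V2 i) & x 0 \<in> V1 i & x i \<in> V2 i & V1 i \<inter> V2 i = {}" by metis
  define B where "B = (\<Inter>j<m. U1 j) \<inter> (\<Inter>i\<in>F. V1 i)"
  have oB: "open B" unfolding B_def using U(1) V by (intro open_Int open_INT) (auto simp: F_def)
  have xB: "x 0 \<in> B" unfolding B_def using U(3) V by (auto simp: F_def)
  have pB: "(T ^^ j) p \<notin> B" for j
  proof -
    have "(T ^^ j) p = (T ^^ (j mod m)) p" using funpow_mod_eq[OF m(2), of j] by simp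
    moreover have "j mod m < m" using m(1) by simp
    then have "B \<inter> U2 (j mod m) = {}" using U(5)[of "j mod m"] unfolding B_def by blast
    ultimately show ?thesis using U(4)[of "j mod m"] by auto
  qed
  have "\<forall>\<^sub>F k in sequentially. y k 0 \<in> B & (\<forall>i\<in>F. y k i \<in> V2 i)"
  proof (intro eventually_conj eventually_ball_finite)
    show "\<forall>\<^sub>F k in sequentially. y k 0 \<in> B" using lim oB xB by (metis topological_tendstoD)
    show "finite F" by (simp add: F_def)
    show "\<forall>i\<in>F. \<forall>\<^sub>F k in sequentially. y k i \<in> V2 i"
      using lim V by (auto simp: F_def intro: topological_tendstoD)
  qed
  moreover have "\<forall>\<^sub>F k in sequentially. 2 * J + 1 <= N k" using N unfolding filterlim_at_top by blast
  ultimately have "\<forall>\<^sub>F k in sequentially. (y k 0 \<in> B & (\<forall>i\<in>F. y k i \<in> V2 i)) & 2 * J + 1 <= N k" by (rule eventually_conj)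
  then obtain k0 where k0: "\<And>k. k0 <= k ==> y k 0 \<in> B & (\<forall>i\<in>F. y k i \<in> V2 i) & 2 * J + 1 <= N k"
    unfolding eventually_sequentially by blast
  have yF: "y k i \<notin> B" if "i \<in> F" "k0 <= k" for k i
    using k0[OF that(2)] V[of i] that(1) unfolding B_def F_def by blast
  have yB: "y k i \<notin> B" if k: "k0 <= k" and i: "0 < i" "i < \<Lambda> k" for k i
  proof -
    have mJ: "0 <= int m * int J" by simp
    \<comment> \<open>The part of the turn just after the visit to \<open>B\<close>, the part just
      before the next visit, which is moved back by one turn, and the long stay near p.\<close>
    consider "i <= \<beta> + int m * int J" | "\<beta> + int m * int (N k - J) < i" | "\<beta> + int m * int J < i" "i <= \<beta> + int m * int (N k - J)" by linarith
    then show ?thesis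
    proof cases
      case 1
      then have "- \<alpha> - int m * int J <= i" "i <= \<beta> + int m * int J" "i ~= 0" using i ab mJ by linarith+
      then have "i \<in> F" by (simp add: F_def)
      then show ?thesis using k by (rule yF)
    next
      case 2
      have "int (N k - J) = int (N k) - int J" using k0[OF k] by auto
      then have "int m * int (N k - J) = int m * int (N k) - int m * int J" by (simp add: algebra_simps)
      then have "- \<alpha> - int m * int J <= i - \<Lambda> k" "i - \<Lambda> k <= \<beta> + int m * int J" "i - \<Lambda> k ~= 0"
        using 2 i ab mJ unfolding \<Lambda>_def by linarith+
      then have "i - \<Lambda> k \<in> F" by (simp add: F_def)
      then have "y k (i - \<Lambda> k) \<notin> B" using yF k by blast
      then show ?thesis using y[rule_format, of k "i - \<Lambda> k"] unfolding \<Lambda>_def by (simp add: algebra_simps)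
    next
      case 3
      define s where "s = nat (i - \<beta>)"
      have s: "int s = i - \<beta>" "int m * int J < int s" "int s <= int m * int (N k - J)"
      proof -
        have "\<beta> <= i" using 3 mJ by linarith
        then show "int s = i - \<beta>" "int m * int J < int s" "int s <= int m * int (N k - J)" using 3 by (auto simp: s_def)
      qed
      have s': "m * J < s" "s <= m * (N k - J)" using s by (simp_all only: of_nat_mult[symmetric] of_nat_less_iff of_nat_le_iff)
      define j where "j = s div m"
      have j1: "J <= j" using s'(1) m(1) by (simp add: j_def less_eq_div_iff_mult_less_eq mult.commute)
      have j2: "j <= N k - J" using div_le_mono[OF s'(2), of m] m(1) by (simp add: j_def)
      then have "j + J <= N k" using k0[OF k] by linarith
      then have w: "y k (\<beta> + int m * int j) \<in> W0" using J j1 by blast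
      have sm: "s = m * j + s mod m" "s mod m < m" using m(1) by (simp_all add: j_def)
      have "y k i = (T ^^ (s mod m)) (y k (\<beta> + int m * int j))"
      proof -
        have "i = \<beta> + int m * int j + int (s mod m)" using s(1) sm(1) by (metis add.assoc add.commute diff_add_cancel of_nat_add of_nat_mult)
        then show ?thesis by (simp add: yT)
      qed
      moreover have "y k (\<beta> + int m * int j) \<in> A (s mod m) \<inter> X" using w sm(2) yX by (auto simp: W0_def)
      then have "(T ^^ (s mod m)) (y k (\<beta> + int m * int j)) \<in> U2 (s mod m)" using A(2) by blast
      moreover have "B \<subseteq> U1 (s mod m)" using sm(2) unfolding B_def by blast
      ultimately show ?thesis using U(5)[of "s mod m"] by auto
    qed
  qed
  have N\<Lambda>: "\<forall>\<^sub>F k in sequentially. nat c <= N k" for c using N unfolding filterlim_at_top by blast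
  have xB': "x i \<notin> B" if i: "i ~= 0" for i
  proof
    assume "x i \<in> B"
    then have "\<forall>\<^sub>F k in sequentially. y k i \<in> B" using lim oB by (metis topological_tendstoD)
    moreover have "\<forall>\<^sub>F k in sequentially. k0 <= k" by (rule eventually_ge_at_top)
    ultimately have "\<forall>\<^sub>F k in sequentially. y k i \<in> B & k0 <= k & nat \<bar>i\<bar> <= N k"
      using N\<Lambda>[of "\<bar>i\<bar>"] by (simp add: eventually_conj)
    then obtain k where k: "y k i \<in> B" "k0 <= k" "nat \<bar>i\<bar> <= N k" unfolding eventually_sequentially by blast
    have "int (N k) <= int m * int (N k)" using mult_right_mono[of 1 "int m" "int (N k)"] m(1) by simp
    then have L: "\<bar>i\<bar> < \<Lambda> k" using k(3) ab by (simp add: \<Lambda>_def)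
    show False
    proof (cases "0 < i")
      case True then show ?thesis using yB[OF k(2), of i] L k(1) by simp
    next
      case False
      then have "y k (i + \<Lambda> k) \<notin> B" using yB[OF k(2), of "i + \<Lambda> k"] L i by simp
      then show ?thesis using y k(1) unfolding \<Lambda>_def by auto
    qed
  qed
  have shift: "filterlim (\<lambda>k. k + k0) at_top sequentially" by (rule filterlim_add_const_nat_at_top)
  have s1: "filterlim (\<lambda>k. N (k + k0)) at_top sequentially" by (rule filterlim_compose[OF N shift])
  have s2: "\<forall>i. (\<lambda>k. y (k + k0) i) \<longlonglongrightarrow> x i" using lim by (intro allI) (rule LIMSEQ_ignore_initial_segment, simp)
  have s3: "\<forall>W. open W & p \<in> W --> (\<exists>J. (\<forall>j\<ge>J. x (- \<alpha> - int m * int j) \<in> W & x (\<beta> + int m * int j) \<in> W) \<and>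
       (\<forall>k j. J <= j & j + J <= N (k + k0) --> y (k + k0) (\<beta> + int m * int j) \<in> W))"
  proof (intro allI impI)
    fix W assume "open W & p \<in> W"
    then obtain J where "R W J" using WR by blast
    then show "\<exists>J. (\<forall>j\<ge>J. x (- \<alpha> - int m * int j) \<in> W & x (\<beta> + int m * int j) \<in> W) \<and>
       (\<forall>k j. J <= j & j + J <= N (k + k0) --> y (k + k0) (\<beta> + int m * int j) \<in> W)"
      unfolding R_def by (intro exI[of _ J]) simp
  qed
  have s4: "\<forall>k i. y (k + k0) i \<in> Per & T (y (k + k0) i) = y (k + k0) (i + 1) & y (k + k0) (i + (\<alpha> + \<beta> + int m * int (N (k + k0)))) = y (k + k0) i"
    using y by blast
  have s5: "\<forall>k. y (k + k0) 0 \<in> B & (\<forall>i. 0 < i & i < \<alpha> + \<beta> + int m * int (N (k + k0)) --> y (k + k0) i \<notin> B)"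
    using yB k0 unfolding \<Lambda>_def by simp
  have s6: "\<forall>j. (T ^^ j) p \<notin> B" "\<forall>i. i ~= 0 --> x i \<notin> B" using pB xB' by auto
  show ?thesis
    by (rule exI[of _ x], rule exI[of _ \<alpha>], rule exI[of _ \<beta>], rule exI[of _ "\<lambda>k. N (k + k0)"], rule exI[of _ "\<lambda>k. y (k + k0)"],
        rule exI[of _ B], intro conjI) (rule x ab s1 s2 s3 s4 s5 s6 oB xB)+
qed

end

section \<open>Iterated cocycle matrices and openness\<close>

text \<open>Source and target have their own trivializations, because an orbit leaves the domain of
  any single one.\<close>

definition cm :: "('m, 'v, 'd::finite) vbundle \<Rightarrow> ('m \<Rightarrow> 'm) \<Rightarrow> ('v \<Rightarrow> 'v) \<Rightarrow> ('v \<Rightarrow> real ^ 'd) \<Rightarrow> ('v \<Rightarrow> real ^ 'd) \<Rightarrow> 'm \<Rightarrow> nat \<Rightarrow> real ^ 'd ^ 'd" where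
  "cm E T A \<psi> \<psi>' y n = matrix (\<lambda>w. \<psi>' ((A ^^ n) (triv_inv E \<psi> y w)))"

context bundle_dyn begin

lemma TnX: "y \<in> X ==> (T ^^ n) y \<in> X"
  by (induction n) (use TX in auto)

lemma fib_V: "v \<in> fiber E y ==> y \<in> X ==> v \<in> V"
  by (simp add: fiber_def bundle_over_def)

lemma LC_fiber: "A \<in> LC ==> y \<in> X ==> v \<in> fiber E y ==> A v \<in> fiber E (T y)"
  by (auto simp: linear_cocycles_def fiber_iso_def fiber_linear_def)

lemma LC_V: "A \<in> LC ==> v \<in> V ==> A v \<in> V"
  using LC_fiber[of A "proj E v" v] TX by (auto simp: fiber_def bundle_over_def)

lemma LC_pow:
  assumes A: "A \<in> LC" and y: "y \<in> X"
  shows "fiber_iso E y ((T ^^ n) y) (A ^^ n)"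
proof (induction n)
  case 0
  then show ?case by (simp add: fiber_iso_def fiber_linear_def bij_betw_def)
next
  case (Suc n)
  have 1: "fiber_iso E ((T ^^ n) y) (T ((T ^^ n) y)) A" using A TnX[OF y] by (simp add: linear_cocycles_def)
  have b: "bij_betw (A \<circ> (A ^^ n)) (fiber E y) (fiber E (T ((T ^^ n) y)))"
    using Suc 1 bij_betw_trans unfolding fiber_iso_def by blast
  have l: "fiber_linear E y (T ((T ^^ n) y)) (A \<circ> (A ^^ n))"
    using Suc 1 unfolding fiber_iso_def fiber_linear_def by simp
  show ?case using b l unfolding fiber_iso_def funpow.simps comp_def by simp
qed

lemma LC_pow_fiber: "A \<in> LC ==> y \<in> X ==> v \<in> fiber E y ==> (A ^^ n) v \<in> fiber E ((T ^^ n) y)"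
  using LC_pow[of A y n] by (auto simp: fiber_iso_def fiber_linear_def)

lemma cm_works:
  assumes A: "A \<in> LC" and U: "(U, \<psi>) \<in> trivs E" "(U', \<psi>') \<in> trivs E" and y: "y \<in> X" "y \<in> U" "(T ^^ n) y \<in> U'" and v: "v \<in> fiber E y"
  shows "cm E T A \<psi> \<psi>' y n *v \<psi> v = \<psi>' ((A ^^ n) v)"
  unfolding cm_def using LC_pow[OF A y(1), of n] by (intro fiber_rep[OF E U y(2,3) _ v]) (simp add: fiber_iso_def)

lemma triv_matrix_eqI:
  assumes U: "(U, \<psi>) \<in> trivs E" "y \<in> U" and e: "\<And>v. v \<in> fiber E y ==> M *v \<psi> v = N *v \<psi> v"
  shows "M = (N :: real ^ 'd ^ 'd)"
proof (rule matrix_eqI)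
  fix w
  show "M *v w = N *v w" using e[OF triv_inv_simps(1)[OF E U, of w]] triv_inv_simps(2)[OF E U, of w] by simp
qed

lemma cm_add:
  assumes A: "A \<in> LC" and U: "(U, \<psi>) \<in> trivs E" "(U1, \<psi>1) \<in> trivs E" "(U2, \<psi>2) \<in> trivs E"
    and y: "y \<in> X" "y \<in> U" "(T ^^ m) y \<in> U1" "(T ^^ n) ((T ^^ m) y) \<in> U2"
  shows "cm E T A \<psi> \<psi>2 y (m + n) = cm E T A \<psi>1 \<psi>2 ((T ^^ m) y) n ** cm E T A \<psi> \<psi>1 y m"
proof (rule triv_matrix_eqI[OF U(1) y(2)])
  fix v assume v: "v \<in> fiber E y"
  have Tmn: "(T ^^ (m + n)) y = (T ^^ n) ((T ^^ m) y)" by (simp add: funpow_add add.commute[of m n])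
  have "cm E T A \<psi> \<psi>2 y (m + n) *v \<psi> v = \<psi>2 ((A ^^ n) ((A ^^ m) v))"
    using cm_works[OF A U(1,3) y(1,2), of "m + n" v] y v Tmn by (simp add: funpow_add add.commute[of m n])
  also have "\<dots> = cm E T A \<psi>1 \<psi>2 ((T ^^ m) y) n *v \<psi>1 ((A ^^ m) v)"
    using cm_works[OF A U(2,3) TnX[OF y(1)] y(3,4) LC_pow_fiber[OF A y(1) v]] by simp
  also have "\<psi>1 ((A ^^ m) v) = cm E T A \<psi> \<psi>1 y m *v \<psi> v"
    using cm_works[OF A U(1,2) y(1,2,3) v] by simp
  finally show "cm E T A \<psi> \<psi>2 y (m + n) *v \<psi> v = (cm E T A \<psi>1 \<psi>2 ((T ^^ m) y) n ** cm E T A \<psi> \<psi>1 y m) *v \<psi> v"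
    by (simp add: matrix_vector_mul_assoc)
qed

lemma cm_invertible:
  assumes A: "A \<in> LC" and U: "(U, \<psi>) \<in> trivs E" "(U', \<psi>') \<in> trivs E" and y: "y \<in> X" "y \<in> U" "(T ^^ n) y \<in> U'"
  shows "invertible (cm E T A \<psi> \<psi>' y n)"
proof (rule invertible_if_inj)
  fix w assume w: "cm E T A \<psi> \<psi>' y n *v w = 0"
  let ?v = "triv_inv E \<psi> y w" and ?o = "triv_inv E \<psi> y 0"
  have f: "?v \<in> fiber E y" "?o \<in> fiber E y" by (rule triv_inv_simps(1)[OF E U(1) y(2)])+
  have p: "\<psi> ?v = w" "\<psi> ?o = 0" by (rule triv_inv_simps(2)[OF E U(1) y(2)])+
  have "\<psi>' ((A ^^ n) ?v) = \<psi>' ((A ^^ n) ?o)"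
    using cm_works[OF A U y f(1)] cm_works[OF A U y f(2)] w p by simp
  then have "(A ^^ n) ?v = (A ^^ n) ?o"
    using triv_inv_simps(3)[OF E U(2) y(3)] LC_pow_fiber[OF A y(1)] f by metis
  then have "?v = ?o" using LC_pow[OF A y(1), of n] f unfolding fiber_iso_def bij_betw_def inj_on_def by blast
  then show "w = 0" using p by metis
qed

lemma pow_cong:
  assumes A: "A \<in> LC" and y: "y \<in> X" and e: "\<And>i v. i < n ==> v \<in> fiber E ((T ^^ i) y) ==> A' v = A v" and v: "v \<in> fiber E y"
  shows "(A' ^^ n) v = (A ^^ n) v"
  using e
proof (induction n)
  case (Suc n)
  have "(A' ^^ n) v = (A ^^ n) v" by (rule Suc.IH, rule Suc.prems) auto
  then show ?case using Suc.prems[of n] LC_pow_fiber[OF A y v, of n] by simp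
qed simp

lemma cm_cong:
  assumes A: "A \<in> LC" and U: "(U, \<psi>) \<in> trivs E" and y: "y \<in> X" "y \<in> U"
    and e: "\<And>i v. i < n ==> v \<in> fiber E ((T ^^ i) y) ==> A' v = A v"
  shows "cm E T A' \<psi> \<psi>' y n = cm E T A \<psi> \<psi>' y n"
proof -
  have "(A' ^^ n) (triv_inv E \<psi> y w) = (A ^^ n) (triv_inv E \<psi> y w)" for w
    by (rule pow_cong[OF A y(1) _ triv_inv_simps(1)[OF E U y(2)]]) (rule e)
  then show ?thesis by (simp add: cm_def)
qed

text \<open>A change felt only at time 0 becomes a factor on the right, since it acts before the
  cocycle.\<close>

lemma cm_pert:
  assumes A: "A \<in> LC" and A': "A' \<in> LC" and U: "(U, \<psi>) \<in> trivs E" "(U', \<psi>') \<in> trivs E"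
    and y: "y \<in> X" "y \<in> U" "(T ^^ n) y \<in> U'" and n: "0 < n"
    and e: "\<And>i v. 0 < i ==> i < n ==> v \<in> fiber E ((T ^^ i) y) ==> A' v = A v"
    and M: "\<forall>v\<in>fiber E y. \<exists>w\<in>fiber E y. A' v = A w & \<psi> w = M *v \<psi> v"
  shows "cm E T A' \<psi> \<psi>' y n = cm E T A \<psi> \<psi>' y n ** M"
proof (rule triv_matrix_eqI[OF U(1) y(2)])
  fix v assume v: "v \<in> fiber E y"
  obtain w where w: "w \<in> fiber E y" "A' v = A w" "\<psi> w = M *v \<psi> v" using M v by blast
  obtain k where k: "n = Suc k" using n by (cases n) auto
  have f: "A w \<in> fiber E (T y)" by (rule LC_fiber[OF A y(1) w(1)])
  have Ty: "T y \<in> X" using TX y(1) by blast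
  have "(A' ^^ k) (A w) = (A ^^ k) (A w)"
  proof (rule pow_cong[OF A Ty _ f])
    fix i v assume "i < k" "v \<in> fiber E ((T ^^ i) (T y))"
    then show "A' v = A v" using e[of "Suc i" v] k by (simp add: funpow_swap1)
  qed
  then have "(A' ^^ n) v = (A ^^ n) w" by (simp add: k w(2) funpow_Suc_right del: funpow.simps)
  then show "cm E T A' \<psi> \<psi>' y n *v \<psi> v = (cm E T A \<psi> \<psi>' y n ** M) *v \<psi> v"
    using cm_works[OF A' U y v] cm_works[OF A U y w(1)] w(3) by (simp flip: matrix_vector_mul_assoc)
qed

lemma cm_continuous:
  fixes S :: "real set" and Q :: "real \<Rightarrow> 'v \<Rightarrow> 'v"
  assumes Q: "\<And>t. t \<in> S ==> Q t \<in> LC" and c: "continuous_on (S \<times> V) (\<lambda>p. Q (fst p) (snd p))"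
    and U: "(U, \<psi>) \<in> trivs E" "(U', \<psi>') \<in> trivs E"
  shows "continuous_on (S \<times> {y \<in> X \<inter> U. (T ^^ n) y \<in> U'}) (\<lambda>p. cm E T (Q (fst p)) \<psi> \<psi>' (snd p) n)"
proof -
  let ?D = "S \<times> {y \<in> X \<inter> U. (T ^^ n) y \<in> U'}"
  obtain g where h: "homeomorphism (bundle_over E U) (U \<times> UNIV) (\<lambda>v. (proj E v, \<psi> v)) g"
    using smooth_vector_bundle_triv(2)[OF E U(1)] by blast
  obtain g' where h': "homeomorphism (bundle_over E U') (U' \<times> UNIV) (\<lambda>v. (proj E v, \<psi>' v)) g'"
    using smooth_vector_bundle_triv(2)[OF E U(2)] by blast
  have c\<psi>: "continuous_on (bundle_over E U') \<psi>'"
    using continuous_on_snd[OF homeomorphism_cont1[OF h']] by simp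
  have ti: "triv_inv E \<psi> y w = g (y, w)" if y: "y \<in> U" for y w
  proof -
    note t = triv_inv_simps(1,2)[OF E U(1) y, of w]
    have "g (proj E (triv_inv E \<psi> y w), \<psi> (triv_inv E \<psi> y w)) = triv_inv E \<psi> y w"
      using homeomorphism_apply1[OF h, of "triv_inv E \<psi> y w"] t y by (simp add: bundle_over_def fiber_def)
    then show ?thesis using t by (simp add: fiber_def)
  qed
  have powV: "(Q t ^^ k) v \<in> V" if "t \<in> S" "v \<in> V" for t v k
    by (induction k) (use LC_V[OF Q] that in auto)
  have cpow: "continuous_on (S \<times> V) (\<lambda>p. (Q (fst p) ^^ k) (snd p))" for k
  proof (induction k)
    case 0 show ?case by (simp add: continuous_on_snd)
  next
    case (Suc k)
    have "continuous_on (S \<times> V) (\<lambda>p. (fst p, (Q (fst p) ^^ k) (snd p)))"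
      by (intro continuous_on_Pair Suc continuous_on_fst continuous_on_id)
    then have "continuous_on (S \<times> V) (\<lambda>p. Q (fst (fst p, (Q (fst p) ^^ k) (snd p))) (snd (fst p, (Q (fst p) ^^ k) (snd p))))"
      by (rule continuous_on_compose2[OF c]) (use powV in auto)
    then show ?case by simp
  qed
  have entry: "continuous_on ?D (\<lambda>p. \<psi>' ((Q (fst p) ^^ n) (triv_inv E \<psi> (snd p) w)))" for w
  proof -
    have 1: "continuous_on ?D (\<lambda>p. g (snd p, w))"
      by (rule continuous_on_compose2[OF homeomorphism_cont2[OF h]])
        (auto intro!: continuous_on_Pair continuous_on_snd continuous_on_id continuous_on_const)
    have gf: "g (y, w) \<in> fiber E y" if "y \<in> U" for y using ti[OF that] triv_inv_simps(1)[OF E U(1) that] by metis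
    have gV: "g (y, w) \<in> V" if "y \<in> X" "y \<in> U" for y by (rule fib_V[OF gf[OF that(2)] that(1)])
    have "continuous_on ?D (\<lambda>p. (fst p, g (snd p, w)))"
      by (intro continuous_on_Pair 1 continuous_on_fst continuous_on_id)
    then have "continuous_on ?D (\<lambda>p. (Q (fst (fst p, g (snd p, w))) ^^ n) (snd (fst p, g (snd p, w))))"
      by (rule continuous_on_compose2[OF cpow]) (use gV in auto)
    then have 2: "continuous_on ?D (\<lambda>p. (Q (fst p) ^^ n) (g (snd p, w)))" by simp
    have "(Q t ^^ n) (g (y, w)) \<in> bundle_over E U'" if "t \<in> S" "y \<in> X" "y \<in> U" "(T ^^ n) y \<in> U'" for t y
      using LC_pow_fiber[OF Q[OF that(1)] that(2) gf[OF that(3)], of n] that(4) by (simp add: bundle_over_def fiber_def)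
    then have "continuous_on ?D (\<lambda>p. \<psi>' ((Q (fst p) ^^ n) (g (snd p, w))))"
      by (intro continuous_on_compose2[OF c\<psi> 2]) auto
    then show ?thesis by (rule continuous_on_eq) (use ti in auto)
  qed
  have "continuous_on ?D (\<lambda>p. \<chi> i j. \<psi>' ((Q (fst p) ^^ n) (triv_inv E \<psi> (snd p) (axis j 1))) $ i)"
    by (intro continuous_on_vec_lambda continuous_on_component entry)
  then show ?thesis unfolding cm_def matrix_def .
qed

lemma triv_change:
  assumes U: "(U, \<psi>) \<in> trivs E" "(U', \<psi>') \<in> trivs E" and y: "y \<in> U" "y \<in> U'" and L: "fiber_linear E y y L"
  shows "triv_matrix E \<psi>' y L = tr E \<psi> \<psi>' y ** triv_matrix E \<psi> y L ** tr E \<psi>' \<psi> y"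
proof (rule triv_matrix_eqI[OF U(2) y(2)])
  fix v assume v: "v \<in> fiber E y"
  have Lv: "L v \<in> fiber E y" using L v by (simp add: fiber_linear_def)
  show "triv_matrix E \<psi>' y L *v \<psi>' v = (tr E \<psi> \<psi>' y ** triv_matrix E \<psi> y L ** tr E \<psi>' \<psi> y) *v \<psi>' v"
    using triv_matrix_works[OF E U(2) y(2) L v] triv_matrix_works[OF E U(1) y(1) L v]
      tr_works[OF E U(2,1) y(2,1) v] tr_works[OF E U y Lv] by (simp flip: matrix_vector_mul_assoc)
qed

lemma LC_Id_fiber: "R \<in> LC_Id \<Phi> E X r ==> y \<in> X ==> fiber_iso E y y R"
proof -
  assume R: "R \<in> LC_Id \<Phi> E X r" and y: "y \<in> X"
  obtain S W where "X \<subseteq> W" "\<forall>x\<in>W. fiber_iso E x x S" and RS: "R = restrict S V" using R unfolding LC_Id_def by blast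
  then have S: "fiber_iso E y y S" using y by blast
  have yY: "y \<in> Y" using y XY by blast
  have e: "R v = S v" if "v \<in> fiber E y" for v using fib_V[OF that y] by (simp add: RS)
  have "fiber_linear E y y R"
    using S e smooth_vector_bundle_ops[OF E yY] unfolding fiber_iso_def fiber_linear_def by simp
  moreover have "bij_betw R (fiber E y) (fiber E y)" using S e bij_betw_cong unfolding fiber_iso_def by metis
  ultimately show ?thesis by (simp add: fiber_iso_def)
qed

text \<open>Only the term of order 0 of the C^r norm is used, at a single point; transition matrices
  carry the convergence from the trivialization of the norm to the given one.\<close>

lemma ball_converges:
  assumes R: "R \<in> LC_Id \<Phi> E X r" and Rk: "\<And>k. Rk k \<in> LC_Id_ball \<Phi> E X D r R (\<epsilon> k)" and \<epsilon>: "\<epsilon> \<longlonglongrightarrow> 0"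
    and y: "y \<in> X" and U: "(U, \<psi>) \<in> trivs E" "y \<in> U"
  shows "(\<lambda>k. triv_matrix E \<psi> y (Rk k)) \<longlonglongrightarrow> triv_matrix E \<psi> y R"
proof -
  have yK: "y \<in> K" using y XK by blast
  then obtain c0 where c0: "c0 \<in> D" "y \<in> snd (snd c0)" using D unfolding norm_cover_def by fastforce
  obtain U0 \<phi> W \<psi>0 C where "c0 = ((U0, \<phi>), (W, \<psi>0), C)" by (metis surj_pair)
  then have d: "((U0, \<phi>), (W, \<psi>0), C) \<in> D" "y \<in> C" using c0 by auto
  then have dd: "(U0, \<phi>) \<in> \<Phi>" "(W, \<psi>0) \<in> trivs E" "C \<subseteq> U0 \<inter> W" using D unfolding norm_cover_def by fast+
  have yW: "y \<in> W" "y \<in> U0" using d dd by auto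
  have Rk': "Rk k \<in> LC_Id \<Phi> E X r" for k using Rk by (simp add: LC_Id_ball_def)
  have lin: "fiber_linear E y y (Rk k)" "fiber_linear E y y R" for k
    using LC_Id_fiber[OF Rk' y] LC_Id_fiber[OF R y] by (simp_all add: fiber_iso_def)
  have Yr: "range (proj E) = Y" by (rule smooth_vector_bundle_base(3)[OF E])
  have bd: "norm (triv_matrix E \<psi>0 y (Rk k) - triv_matrix E \<psi>0 y R) <= \<epsilon> k" for k
  proof -
    obtain S where S: "Cr_End_section \<Phi> E r Y S" "\<forall>v\<in>V. S v = fadd E (Rk k v) (fscale E (-1) (R v))" "Cr_norm E D r S < \<epsilon> k"
      using Rk[of k] Yr unfolding LC_Id_ball_def by blast
    have Sl: "fiber_linear E y y S" using S(1) y XY unfolding Cr_End_section_def by blast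
    have yY: "y \<in> Y" using y XY by blast
    have M: "triv_matrix E \<psi>0 y S = triv_matrix E \<psi>0 y (Rk k) - triv_matrix E \<psi>0 y R"
    proof (rule triv_matrix_eqI[OF dd(2) yW(1)])
      fix v assume v: "v \<in> fiber E y"
      have f: "Rk k v \<in> fiber E y" "R v \<in> fiber E y" using lin v by (simp_all add: fiber_linear_def)
      have f2: "fscale E (-1) (R v) \<in> fiber E y" by (rule smooth_vector_bundle_ops(2)[OF E yY f(2)])
      have "\<psi>0 (S v) = \<psi>0 (Rk k v) - \<psi>0 (R v)"
        using S(2) fib_V[OF v y] smooth_vector_bundle_triv(3)[OF E dd(2) yW(1) f(1) f2] smooth_vector_bundle_triv(4)[OF E dd(2) yW(1) f(2)] by simp
      then show "triv_matrix E \<psi>0 y S *v \<psi>0 v = (triv_matrix E \<psi>0 y (Rk k) - triv_matrix E \<psi>0 y R) *v \<psi>0 v"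
        using triv_matrix_works[OF E dd(2) yW(1) _ v] lin Sl by (simp add: matrix_vector_mult_diff_rdistrib)
    qed
    have "\<exists>Bd\<ge>0. \<forall>t\<in>{1::real}. Cr_vals S ~= {} & (\<forall>z\<in>Cr_vals S. z <= \<bar>t\<bar> * Bd)"
    proof (rule Cr_vals_bound[of "\<lambda>\<psi> y. triv_matrix E \<psi> y S"])
      fix U' \<psi>' assume U': "(U', \<psi>') \<in> trivs E"
      have "U' \<inter> Y = U'" using triv_Y[OF U'] by blast
      moreover have "Cr_on_manifold \<Phi> r (U' \<inter> Y) (\<lambda>x. triv_matrix E \<psi>' x S)" using S(1) U' unfolding Cr_End_section_def by fast
      ultimately show "Cr_on_manifold \<Phi> r U' (\<lambda>y. triv_matrix E \<psi>' y S)" by simp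
    qed simp
    then have "bdd_above (Cr_vals S)" by (auto intro: bdd_aboveI)
    moreover have "norm (triv_matrix E \<psi>0 y S) \<in> Cr_vals S"
    proof -
      have "inv_into U0 \<phi> (\<phi> y) = y" by (rule homeomorphism_apply1[OF smooth_atlas_chart(3)[OF \<Phi> dd(1)] yW(2)])
      then have "norm (triv_matrix E \<psi>0 y S) = norm (partial_derivs [] ((\<lambda>x. triv_matrix E \<psi>0 x S) \<circ> inv_into U0 \<phi>) (\<phi> y))" by simp
      then show ?thesis unfolding Cr_vals_def mem_Collect_eq
        by (intro exI conjI) (assumption, rule d(1), rule d(2), simp_all)
    qed
    ultimately have "norm (triv_matrix E \<psi>0 y S) <= Cr_norm E D r S" unfolding Cr_norm_Sup by (intro cSup_upper)
    then show ?thesis using S(3) M by simp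
  qed
  have "(\<lambda>k. triv_matrix E \<psi>0 y (Rk k) - triv_matrix E \<psi>0 y R) \<longlonglongrightarrow> 0"
    by (rule Lim_null_comparison[OF _ \<epsilon>]) (use bd in simp)
  then have "(\<lambda>k. triv_matrix E \<psi>0 y (Rk k)) \<longlonglongrightarrow> triv_matrix E \<psi>0 y R" by (simp add: LIM_zero_iff)
  then have "(\<lambda>k. tr E \<psi>0 \<psi> y ** triv_matrix E \<psi>0 y (Rk k) ** tr E \<psi> \<psi>0 y) \<longlonglongrightarrow> tr E \<psi>0 \<psi> y ** triv_matrix E \<psi>0 y R ** tr E \<psi> \<psi>0 y"
    by (intro tendsto_matrix_matrix tendsto_const)
  then show ?thesis using triv_change[OF dd(2) U(1) yW(1) U(2) lin(1)] triv_change[OF dd(2) U(1) yW(1) U(2) lin(2)] by simp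
qed

lemma cm_compose:
  assumes A: "A \<in> LC" and R: "R \<in> LC_Id \<Phi> E X r" and U: "(U, \<psi>) \<in> trivs E" "(U', \<psi>') \<in> trivs E" and y: "y \<in> X" "y \<in> U" "(T ^^ 1) y \<in> U'"
  shows "cm E T (compose V A R) \<psi> \<psi>' y 1 = cm E T A \<psi> \<psi>' y 1 ** triv_matrix E \<psi> y R"
proof (rule triv_matrix_eqI[OF U(1) y(2)])
  fix v assume v: "v \<in> fiber E y"
  have lin: "fiber_linear E y y R" using LC_Id_fiber[OF R y(1)] by (simp add: fiber_iso_def)
  then have Rv: "R v \<in> fiber E y" using v by (simp add: fiber_linear_def)
  have C: "compose V A R \<in> LC" by (rule compose_in_linear_cocycles[OF \<Phi> E A R])
  have "compose V A R v = A (R v)" using fib_V[OF v y(1)] by (simp add: compose_def)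
  then show "cm E T (compose V A R) \<psi> \<psi>' y 1 *v \<psi> v = (cm E T A \<psi> \<psi>' y 1 ** triv_matrix E \<psi> y R) *v \<psi> v"
    using cm_works[OF C U y v] cm_works[OF A U y Rv] triv_matrix_works[OF E U(1) y(2) lin v] by (simp flip: matrix_vector_mul_assoc)
qed

lemma cm_converges:
  assumes A: "A \<in> LC" and R: "R \<in> LC_Id \<Phi> E X r" and Rk: "\<And>k. Rk k \<in> LC_Id_ball \<Phi> E X D r R (\<epsilon> k)" and \<epsilon>: "\<epsilon> \<longlonglongrightarrow> 0"
  shows "(U, \<psi>) \<in> trivs E ==> (U', \<psi>') \<in> trivs E ==> y \<in> X ==> y \<in> U ==> (T ^^ n) y \<in> U' ==>
    (\<lambda>k. cm E T (compose V A (Rk k)) \<psi> \<psi>' y n) \<longlonglongrightarrow> cm E T (compose V A R) \<psi> \<psi>' y n"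
proof (induction n arbitrary: U \<psi> y)
  case 0
  then show ?case by (simp add: cm_def)
next
  case (Suc n)
  note U = Suc.prems(1,2) and y = Suc.prems(3,4)
  have Ty: "(T ^^ 1) y \<in> X" by (rule TnX[OF y(1)])
  then obtain U1 \<psi>1 where U1: "(U1, \<psi>1) \<in> trivs E" "(T ^^ 1) y \<in> U1" using triv_at XY by blast
  have Rk': "Rk k \<in> LC_Id \<Phi> E X r" for k using Rk by (simp add: LC_Id_ball_def)
  have yn: "(T ^^ n) ((T ^^ 1) y) \<in> U'" using Suc.prems(5) by (simp add: funpow_swap1)
  have dec: "cm E T (compose V A R') \<psi> \<psi>' y (Suc n) = cm E T (compose V A R') \<psi>1 \<psi>' ((T ^^ 1) y) n ** (cm E T A \<psi> \<psi>1 y 1 ** triv_matrix E \<psi> y R')"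
    if R': "R' \<in> LC_Id \<Phi> E X r" for R'
    using cm_add[OF compose_in_linear_cocycles[OF \<Phi> E A R'] U(1) U1(1) U(2) y U1(2) yn] cm_compose[OF A R' U(1) U1(1) y U1(2)]
    by simp
  show ?case unfolding dec[OF Rk'] dec[OF R]
    by (intro tendsto_matrix_matrix tendsto_const Suc.IH[OF U1(1) U(2) Ty U1(2) yn] ball_converges[OF R Rk \<epsilon> y(1) U(1) y(2)])
qed

text \<open>The neighbourhood \<open>N\<close> of the identity must itself be open, so a ball is
  sought around every \<open>R\<close> in \<open>N\<close>, not just around the identity. If none
  existed, radii 1/(k + 1) would give a convergent sequence of return matrices contradicting the
  semicontinuity of \<open>nmod\<close> at its largest value.\<close>

lemma simple_open: "openin (LC_topology \<Phi> E X T D r) {A \<in> LC. simple_at_periodic_point E X T A}"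
  unfolding openin_LC_topology
proof (intro conjI ballI)
  fix A assume "A \<in> {A \<in> LC. simple_at_periodic_point E X T A}"
  then have A: "A \<in> LC" and s: "simple_at_periodic_point E X T A" by auto
  then obtain x p U \<psi> where x: "x \<in> X" "has_period T x p" "(U, \<psi>) \<in> trivs E" "x \<in> U"
    and dm: "distinct_moduli (eigenvalues (triv_matrix E \<psi> x (A ^^ p)))"
    unfolding simple_at_periodic_point_def simple_spectrum_at_def by blast
  have Tp: "(T ^^ p) x = x" using x(2) by (simp add: has_period_def)
  have Tp': "(T ^^ p) x \<in> U" using Tp x(4) by simp
  have ret: "triv_matrix E \<psi> x (A' ^^ p) = cm E T A' \<psi> \<psi> x p" for A' by (simp add: triv_matrix_def cm_def)
  define N where "N = {R \<in> LC_Id \<Phi> E X r. nmod (cm E T (compose V A R) \<psi> \<psi> x p) = CARD('d)}"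
  show "\<exists>N. openin (LC_Id_topology \<Phi> E X D r) N & restrict id V \<in> N & compose V A ` N \<subseteq> {A \<in> LC. simple_at_periodic_point E X T A}"
  proof (intro exI[of _ N] conjI)
    show "openin (LC_Id_topology \<Phi> E X D r) N" unfolding openin_LC_Id_topology
    proof (intro conjI ballI)
      show "N \<subseteq> LC_Id \<Phi> E X r" by (auto simp: N_def)
      fix R assume "R \<in> N"
      then have R: "R \<in> LC_Id \<Phi> E X r" and nm: "nmod (cm E T (compose V A R) \<psi> \<psi> x p) = CARD('d)" by (auto simp: N_def)
      show "\<exists>\<epsilon>>0. LC_Id_ball \<Phi> E X D r R \<epsilon> \<subseteq> N"
      proof (rule ccontr)
        assume neg: "\<not> ?thesis"
        have "\<forall>k. \<exists>R'. R' \<in> LC_Id_ball \<Phi> E X D r R (1 / real (Suc k)) & R' \<notin> N"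
        proof
          fix k have "(0::real) < 1 / real (Suc k)" by simp
          then show "\<exists>R'. R' \<in> LC_Id_ball \<Phi> E X D r R (1 / real (Suc k)) & R' \<notin> N" using neg by blast
        qed
        then have "\<exists>Rk. \<forall>k. Rk k \<in> LC_Id_ball \<Phi> E X D r R (1 / real (Suc k)) & Rk k \<notin> N" by (rule choice)
        then obtain Rk where Rk': "\<forall>k. Rk k \<in> LC_Id_ball \<Phi> E X D r R (1 / real (Suc k)) & Rk k \<notin> N" by (rule exE)
        have Rk: "Rk k \<in> LC_Id_ball \<Phi> E X D r R (1 / real (Suc k))" and RkN: "Rk k \<notin> N" for k using Rk' by auto
        have RkL: "Rk k \<in> LC_Id \<Phi> E X r" for k using Rk by (simp add: LC_Id_ball_def)
        have l0: "(\<lambda>k. 1 / real (Suc k)) \<longlonglongrightarrow> 0" using LIMSEQ_inverse_real_of_nat by (simp add: inverse_eq_divide)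
        have lim: "(\<lambda>k. cm E T (compose V A (Rk k)) \<psi> \<psi> x p) \<longlonglongrightarrow> cm E T (compose V A R) \<psi> \<psi> x p"
          by (rule cm_converges[OF A R Rk l0 x(3,3) x(1,4) Tp'])
        have inv: "invertible (cm E T (compose V A (Rk k)) \<psi> \<psi> x p)" for k
          by (rule cm_invertible[OF compose_in_linear_cocycles[OF \<Phi> E A RkL] x(3,3) x(1,4) Tp'])
        have inv0: "invertible (cm E T (compose V A R) \<psi> \<psi> x p)"
          by (rule cm_invertible[OF compose_in_linear_cocycles[OF \<Phi> E A R] x(3,3) x(1,4) Tp'])
        have "\<forall>\<^sub>F k in sequentially. nmod (cm E T (compose V A R) \<psi> \<psi> x p) <= nmod (cm E T (compose V A (Rk k)) \<psi> \<psi> x p)"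
          by (rule nmod_lsc[OF structured_if_nmod_max[OF nm] invertible_zero_spec[OF inv0] lim inv])
        then obtain k where "CARD('d) <= nmod (cm E T (compose V A (Rk k)) \<psi> \<psi> x p)"
          unfolding eventually_sequentially nm by blast
        then have "Rk k \<in> N" using nmod_le[of "cm E T (compose V A (Rk k)) \<psi> \<psi> x p"] RkL[of k] by (simp add: N_def)
        then show False using RkN by blast
      qed
    qed
    have "compose V A (restrict id V) = A"
      using A by (intro extensionalityI[of _ V]) (auto simp: linear_cocycles_def compose_extensional compose_def)
    then show "restrict id V \<in> N"
      using id_in_LC_Id[OF \<Phi> E XY] dm unfolding N_def ret distinct_moduli_iff by simp
    show "compose V A ` N \<subseteq> {A \<in> LC. simple_at_periodic_point E X T A}"
    proof
      fix A' assume "A' \<in> compose V A ` N"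
      then obtain R where R: "R \<in> LC_Id \<Phi> E X r" "nmod (cm E T (compose V A R) \<psi> \<psi> x p) = CARD('d)" and A': "A' = compose V A R"
        by (auto simp: N_def)
      have "distinct_moduli (eigenvalues (triv_matrix E \<psi> x (A' ^^ p)))" unfolding distinct_moduli_iff ret A' by (rule R(2))
      then have "simple_at_periodic_point E X T A'" unfolding simple_at_periodic_point_def simple_spectrum_at_def using x by blast
      then show "A' \<in> {A \<in> LC. simple_at_periodic_point E X T A}" using compose_in_linear_cocycles[OF \<Phi> E A R(1)] A' by simp
    qed
  qed
qed auto

end

section \<open>Perturbing return matrices\<close>

lemma qp_dom:
  fixes X :: "nat \<Rightarrow> real ^ 'd ^ 'd"
  assumes X: "\<And>i. i < n ==> cone_pres (X i) I & grow (X i) I a b" and P: "cone_pres P I" "grow P I \<alpha> \<beta>"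
    and ab: "0 <= a" "0 <= b"
  shows "cone_pres (qp X n ** P) I & grow (qp X n ** P) I (a ^ n * \<alpha>) (b ^ n * \<beta>)"
  using X
proof (induction n)
  case 0 then show ?case using P by simp
next
  case (Suc n)
  have e: "qp X (Suc n) ** P = X n ** (qp X n ** P)" by (simp add: matrix_mul_assoc)
  have Y: "cone_pres (qp X n ** P) I & grow (qp X n ** P) I (a ^ n * \<alpha>) (b ^ n * \<beta>)" by (rule Suc.IH) (rule Suc.prems, simp)
  have Xn: "cone_pres (X n) I & grow (X n) I a b" by (rule Suc.prems) simp
  have "grow (X n ** (qp X n ** P)) I (a * (a ^ n * \<alpha>)) (b * (b ^ n * \<beta>))"
    by (rule grow_mult; use Xn Y ab in simp)
  then show ?case unfolding e using Xn Y by (simp add: cone_pres_mult mult.assoc)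
qed

lemma eventually_power_dominates:
  fixes a b \<alpha> \<beta> :: real
  assumes "0 < b" "b < a" "0 < \<alpha>" and n: "filterlim n at_top sequentially"
  shows "\<forall>\<^sub>F k in sequentially. b ^ n k * \<beta> < a ^ n k * \<alpha>"
proof -
  have "(\<lambda>j. (b / a) ^ j * \<beta>) \<longlonglongrightarrow> 0"
    using assms by (intro tendsto_mult_left_zero LIMSEQ_power_zero) simp
  then have "(\<lambda>k. (b / a) ^ n k * \<beta>) \<longlonglongrightarrow> 0" using n by (rule filterlim_compose)
  then have "\<forall>\<^sub>F k in sequentially. (b / a) ^ n k * \<beta> < \<alpha>" using assms(3) by (rule order_tendstoD(2))
  then show ?thesis
  proof (rule eventually_mono)
    fix k assume k: "(b / a) ^ n k * \<beta> < \<alpha>"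
    have ap: "0 < a ^ n k" using assms by simp
    have "a ~= 0" using assms by simp
    then have "b ^ n k * \<beta> = a ^ n k * ((b / a) ^ n k * \<beta>)" by (simp add: power_divide)
    also have "\<dots> < a ^ n k * \<alpha>" using k ap by simp
    finally show "b ^ n k * \<beta> < a ^ n k * \<alpha>" .
  qed
qed

lemma dim_Usp_Ssp:
  fixes L L' :: "nat \<Rightarrow> real ^ 'd ^ 'd"
  assumes Z: "invertible Z" "invertible Z'" and L: "\<And>n. invertible (L n) & cone_pres (L n) I & grow (L n) I a b"
    and L': "\<And>n. invertible (L' n) & cone_pres (L' n) I & grow (L' n) I a b" and ab: "0 < b" "b < a"
  shows "subspace (Usp L Z a) & subspace (Ssp L' Z' b) & dim (Usp L Z a) + dim (Ssp L' Z' b) <= CARD('d)"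
proof -
  have 1: "dim (Usp L Z a) <= card I" by (rule dim_Usp[OF Z(1), of L I a b]) (use L ab in auto)
  have 2: "dim (Ssp L' Z' b) <= card (- I)" by (rule dim_Ssp[OF Z(2), of L' I a b]) (use L' ab in auto)
  have "card I + card (- I) = card (I \<union> - I)" by (rule card_Un_disjoint[symmetric]) auto
  then have "card I + card (- I) = CARD('d)" by simp
  then show ?thesis using 1 2 subspace_Usp[of a L Z] subspace_Ssp[of b L' Z'] ab by simp
qed

context bundle_dyn begin

lemma continuous_Tn: "continuous_on X (T ^^ n)"
proof (induction n)
  case (Suc n)
  have "(T ^^ n) ` X \<subseteq> X" using TnX by blast
  then show ?case using continuous_on_compose[OF Suc continuous_on_subset[OF Tc]] by simp
qed (simp add: id_def continuous_on_id)

lemma cm_near: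
  fixes S :: "real set" and Q :: "real \<Rightarrow> 'v \<Rightarrow> 'v" and C C' :: "real ^ 'd ^ 'd"
  assumes Q: "\<And>t. t \<in> S ==> Q t \<in> LC" and c: "continuous_on (S \<times> V) (\<lambda>p. Q (fst p) (snd p))"
    and U: "(U, \<psi>) \<in> trivs E" "(U', \<psi>') \<in> trivs E" and y0: "y0 \<in> X" "y0 \<in> U" "(T ^^ n) y0 \<in> U'" and t0: "t0 \<in> S" and e: "0 < e"
  shows "\<exists>\<tau> W. 0 < \<tau> & open W & y0 \<in> W & (\<forall>t y. t \<in> S & \<bar>t - t0\<bar> < \<tau> & y \<in> X & y \<in> W --> y \<in> U & (T ^^ n) y \<in> U' \<and>
    norm (C ** cm E T (Q t) \<psi> \<psi>' y n ** C' - C ** cm E T (Q t0) \<psi> \<psi>' y0 n ** C') < e)"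
proof -
  define f where "f p = C ** cm E T (Q (fst p)) \<psi> \<psi>' (snd p) n ** C'" for p
  let ?B = "{y \<in> X \<inter> U. (T ^^ n) y \<in> U'}"
  have "continuous_on (S \<times> ?B) f" unfolding f_def
    by (intro continuous_on_matrix_matrix continuous_on_const cm_continuous[OF Q c U])
  then have "\<exists>A. open A & A \<inter> (S \<times> ?B) = f -` ball (f (t0, y0)) e \<inter> (S \<times> ?B)"
    unfolding continuous_on_open_invariant by simp
  then obtain A where A: "open A" "A \<inter> (S \<times> ?B) = f -` ball (f (t0, y0)) e \<inter> (S \<times> ?B)" by blast
  have tA: "(t0, y0) \<in> A" using A(2) t0 y0 e by auto
  obtain A1 A2 where A12': "open A1" "open A2" "(t0, y0) \<in> A1 \<times> A2" "A1 \<times> A2 \<subseteq> A"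
    by (rule open_prod_elim[OF A(1) tA])
  then have A12: "open A1" "open A2" "t0 \<in> A1" "y0 \<in> A2" "A1 \<times> A2 \<subseteq> A" by auto
  obtain \<tau> where \<tau>: "0 < \<tau>" "ball t0 \<tau> \<subseteq> A1" using A12(1,3) open_contains_ball by blast
  have oU: "open U" "open U'" using smooth_vector_bundle_triv(1)[OF E] U by auto
  have "\<exists>A. open A & A \<inter> X = (T ^^ n) -` U' \<inter> X" using continuous_Tn oU(2) unfolding continuous_on_open_invariant by blast
  then obtain A3 where A3: "open A3" "A3 \<inter> X = (T ^^ n) -` U' \<inter> X" by blast
  have main: "y \<in> U & (T ^^ n) y \<in> U' & norm (f (t, y) - f (t0, y0)) < e"
    if t: "t \<in> S" "\<bar>t - t0\<bar> < \<tau>" and y: "y \<in> X" "y \<in> A2 \<inter> A3 \<inter> U" for t y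
  proof -
    have yU: "y \<in> U" "(T ^^ n) y \<in> U'" using y A3(2) by auto
    have "t \<in> A1" using \<tau>(2) t(2) by (auto simp: dist_real_def)
    then have "(t, y) \<in> A \<inter> (S \<times> ?B)" using A12(5) y yU t(1) by auto
    then have "f (t, y) \<in> ball (f (t0, y0)) e" unfolding A(2) by blast
    then show ?thesis using yU by (simp add: dist_norm norm_minus_commute)
  qed
  have W: "open (A2 \<inter> A3 \<inter> U)" "y0 \<in> A2 \<inter> A3 \<inter> U" using A12 A3 oU y0 by auto
  have "\<forall>t y. t \<in> S & \<bar>t - t0\<bar> < \<tau> & y \<in> X & y \<in> A2 \<inter> A3 \<inter> U --> y \<in> U & (T ^^ n) y \<in> U' & norm (f (t, y) - f (t0, y0)) < e"
    using main by blast
  then show ?thesis using W \<tau>(1) unfolding f_def fst_conv snd_conv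
    by (intro exI[of _ \<tau>] exI[of _ "A2 \<inter> A3 \<inter> U"] conjI)
qed

lemma orbit_pow:
  fixes x :: "int \<Rightarrow> 'm"
  assumes "\<forall>i. x i \<in> X & T (x i) = x (i + 1)"
  shows "(T ^^ j) (x i) = x (i + int j)"
  by (induction j) (use assms in \<open>simp_all add: ac_simps\<close>)

lemma orbit_qp:
  fixes x :: "int \<Rightarrow> 'm" and C :: "real ^ 'd ^ 'd"
  assumes A: "A \<in> LC" and U: "(U, \<psi>) \<in> trivs E" and x: "\<forall>i. x i \<in> X & T (x i) = x (i + 1)" and C: "invertible C"
    and u: "\<And>j. j <= k ==> x (b + int m * int j) \<in> U"
  shows "C ** cm E T A \<psi> \<psi> (x b) (m * k) ** matrix_inv C = qp (\<lambda>j. C ** cm E T A \<psi> \<psi> (x (b + int m * int j)) m ** matrix_inv C) k"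
  using u
proof (induction k)
  case 0
  have "x b \<in> U" using 0[of 0] by simp
  have "cm E T A \<psi> \<psi> (x b) 0 = mat 1"
    unfolding cm_def using triv_inv_simps(2)[OF E U \<open>x b \<in> U\<close>] by (simp add: matrix_id_mat_1 flip: id_def)
  then show ?case using inv_C(1)[OF C] by simp
next
  case (Suc k)
  have IH: "C ** cm E T A \<psi> \<psi> (x b) (m * k) ** matrix_inv C = qp (\<lambda>j. C ** cm E T A \<psi> \<psi> (x (b + int m * int j)) m ** matrix_inv C) k"
    by (rule Suc.IH) (rule Suc.prems, simp)
  have xb: "x b \<in> U" using Suc.prems[of 0] by simp
  have T1: "(T ^^ (m * k)) (x b) = x (b + int m * int k)" using orbit_pow[OF x, of "m * k" b] by simp
  have T2: "(T ^^ m) (x (b + int m * int k)) = x (b + int m * int (Suc k))" using orbit_pow[OF x, of m] by (simp add: algebra_simps)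
  have "cm E T A \<psi> \<psi> (x b) (m * k + m) = cm E T A \<psi> \<psi> (x (b + int m * int k)) m ** cm E T A \<psi> \<psi> (x b) (m * k)"
    using cm_add[OF A U U U, of "x b" "m * k" m] x xb Suc.prems[of k] Suc.prems[of "Suc k"] unfolding T1 T2 by simp
  then have e: "cm E T A \<psi> \<psi> (x b) (m * Suc k) = cm E T A \<psi> \<psi> (x (b + int m * int k)) m ** cm E T A \<psi> \<psi> (x b) (m * k)"
    by (simp add: add.commute)
  show ?case unfolding e qp.simps IH[symmetric] conj_mult[OF C] ..
qed

text \<open>Factor number j starts at time b - m (j + 1), because it has to end at b - m j, where
  the factor to its left starts.\<close>

lemma orbit_qm:
  fixes x :: "int \<Rightarrow> 'm" and C :: "real ^ 'd ^ 'd"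
  assumes A: "A \<in> LC" and U: "(U, \<psi>) \<in> trivs E" and x: "\<forall>i. x i \<in> X & T (x i) = x (i + 1)" and C: "invertible C"
    and u: "\<And>j. j <= k ==> x (b - int m * int j) \<in> U"
  shows "C ** cm E T A \<psi> \<psi> (x (b - int m * int k)) (m * k) ** matrix_inv C
    = qm (\<lambda>j. C ** cm E T A \<psi> \<psi> (x (b - int m * int (Suc j))) m ** matrix_inv C) k"
  using u
proof (induction k)
  case 0
  have "x b \<in> U" using 0[of 0] by simp
  have "cm E T A \<psi> \<psi> (x b) 0 = mat 1"
    unfolding cm_def using triv_inv_simps(2)[OF E U \<open>x b \<in> U\<close>] by (simp add: matrix_id_mat_1 flip: id_def)
  then show ?case using inv_C(1)[OF C] by simp
next
  case (Suc k)
  have IH: "C ** cm E T A \<psi> \<psi> (x (b - int m * int k)) (m * k) ** matrix_inv C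
    = qm (\<lambda>j. C ** cm E T A \<psi> \<psi> (x (b - int m * int (Suc j))) m ** matrix_inv C) k"
    by (rule Suc.IH) (rule Suc.prems, simp)
  define z where "z = x (b - int m * int (Suc k))"
  have zU: "z \<in> U" "z \<in> X" using Suc.prems[of "Suc k"] x by (simp_all add: z_def)
  have T1: "(T ^^ m) z = x (b - int m * int k)" using orbit_pow[OF x, of m] by (simp add: z_def algebra_simps)
  have T2: "(T ^^ (m * k)) (x (b - int m * int k)) = x b" using orbit_pow[OF x, of "m * k"] by simp
  have "x (b - int m * int k) \<in> U" using Suc.prems[of k] by simp
  moreover have "x b \<in> U" using Suc.prems[of 0] by simp
  ultimately have "cm E T A \<psi> \<psi> z (m + m * k) = cm E T A \<psi> \<psi> (x (b - int m * int k)) (m * k) ** cm E T A \<psi> \<psi> z m"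
    using cm_add[OF A U U U zU(2,1), of m "m * k"] unfolding T1 T2 by simp
  then have e: "cm E T A \<psi> \<psi> z (m * Suc k) = cm E T A \<psi> \<psi> (x (b - int m * int k)) (m * k) ** cm E T A \<psi> \<psi> z m" by simp
  show ?case unfolding z_def[symmetric] e qm.simps IH[symmetric] conj_mult[OF C] ..
qed

lemma isolate_orbit:
  assumes "has_period T y l"
  shows "\<exists>B. open B & y \<in> B & (\<forall>i. 0 < i & i < l --> (T ^^ i) y \<notin> B)"
proof -
  have "finite ((\<lambda>i. (T ^^ i) y) ` {0<..<l})" by simp
  then have "open (- (\<lambda>i. (T ^^ i) y) ` {0<..<l})" by (simp add: finite_imp_closed open_Compl)
  moreover have "y \<notin> (\<lambda>i. (T ^^ i) y) ` {0<..<l}" using assms unfolding has_period_def by fastforce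
  ultimately show ?thesis by (intro exI[of _ "- (\<lambda>i. (T ^^ i) y) ` {0<..<l}"]) auto
qed

lemma perturb_return:
  assumes G: "openin (LC_topology \<Phi> E X T D r) G" "A \<in> G" and y: "y \<in> X" "has_period T y l" and U: "(U, \<psi>) \<in> trivs E" "y \<in> U"
  shows "\<exists>Q \<epsilon>. 0 < \<epsilon> & (\<forall>t. \<bar>t\<bar> < \<epsilon> --> Q t \<in> G) & Q 0 = A & continuous_on (UNIV \<times> V) (\<lambda>p. Q (fst p) (snd p)) \<and>
    (\<forall>t. \<bar>t\<bar> < \<epsilon> --> cm E T (Q t) \<psi> \<psi> y l = cm E T A \<psi> \<psi> y l ** (mat 1 + t *\<^sub>R M0))"
proof -
  obtain B where B: "open B" "y \<in> B" "\<forall>i. 0 < i & i < l --> (T ^^ i) y \<notin> B" using isolate_orbit[OF y(2)] by blast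
  have GL: "G \<subseteq> LC" using G(1) unfolding openin_LC_topology by simp
  from perturbation[OF G U(1) y(1) U(2) B(1,2), of M0] obtain Q \<epsilon> where
    Q: "0 < \<epsilon>" "\<forall>t. \<bar>t\<bar> < \<epsilon> --> Q t \<in> G" "Q 0 = A" "continuous_on (UNIV \<times> V) (\<lambda>p. Q (fst p) (snd p))"
    and QB: "\<forall>t v. v \<in> V --> proj E v \<notin> B --> Q t v = A v"
    and QM: "\<forall>t. \<forall>v\<in>fiber E y. \<exists>w\<in>fiber E y. Q t v = A w & \<psi> w = (mat 1 + t *\<^sub>R M0) *v \<psi> v"
    by (elim exE conjE)
  have l: "0 < l" "(T ^^ l) y = y" using y(2) by (auto simp: has_period_def)
  have AL: "A \<in> LC" using G(2) GL by blast
  have "cm E T (Q t) \<psi> \<psi> y l = cm E T A \<psi> \<psi> y l ** (mat 1 + t *\<^sub>R M0)" if t: "\<bar>t\<bar> < \<epsilon>" for t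
  proof (rule cm_pert[OF AL _ U(1,1) y(1) U(2) _ l(1)])
    show "Q t \<in> LC" using Q(2) t GL by blast
    show "(T ^^ l) y \<in> U" using l U by simp
    show "Q t v = A v" if "0 < i" "i < l" "v \<in> fiber E ((T ^^ i) y)" for i v
      using QB B(3) that fib_V[OF that(3) TnX[OF y(1)]] by (simp add: fiber_def)
    show "\<forall>v\<in>fiber E y. \<exists>w\<in>fiber E y. Q t v = A w & \<psi> w = (mat 1 + t *\<^sub>R M0) *v \<psi> v" by (rule spec[OF QM])
  qed
  then show ?thesis using Q by (intro exI[of _ Q] exI[of _ \<epsilon>]) simp
qed

text \<open>Every direction of change of the return matrix is realised inside \<open>G\<close> by a
  perturbation near y, so maximality within \<open>G\<close> yields the hypothesis of
  \<open>structured_of_max\<close>.\<close>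

lemma max_structured:
  assumes G: "openin (LC_topology \<Phi> E X T D r) G" "A \<in> G" and y: "y \<in> X" "has_period T y l" and U: "(U, \<psi>) \<in> trivs E" "y \<in> U"
    and max: "\<And>A'. A' \<in> G ==> nmod (cm E T A' \<psi> \<psi> y l) <= nmod (cm E T A \<psi> \<psi> y l)"
  shows "structured (cm E T A \<psi> \<psi> y l)"
proof (rule structured_of_max)
  have AL: "A \<in> LC" using G unfolding openin_LC_topology by blast
  have "(T ^^ l) y \<in> U" using y(2) U by (simp add: has_period_def)
  then show "0 \<notin> spec (cm E T A \<psi> \<psi> y l)" by (intro invertible_zero_spec cm_invertible[OF AL U(1,1) y(1) U(2)])
  fix B
  from perturb_return[OF G y U, of B] obtain Q \<epsilon> where Q: "0 < \<epsilon>" "\<forall>t. \<bar>t\<bar> < \<epsilon> --> Q t \<in> G"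
    and QM: "\<forall>t. \<bar>t\<bar> < \<epsilon> --> cm E T (Q t) \<psi> \<psi> y l = cm E T A \<psi> \<psi> y l ** (mat 1 + t *\<^sub>R B)" by (elim exE conjE)
  show "\<exists>\<epsilon>>0. \<forall>t. 0 < t & t < \<epsilon> --> nmod (cm E T A \<psi> \<psi> y l ** (mat 1 + t *\<^sub>R B)) <= nmod (cm E T A \<psi> \<psi> y l)"
  proof (intro exI[of _ \<epsilon>] conjI allI impI Q(1))
    fix t assume "0 < t & t < \<epsilon>"
    then have t: "\<bar>t\<bar> < \<epsilon>" by simp
    show "nmod (cm E T A \<psi> \<psi> y l ** (mat 1 + t *\<^sub>R B)) <= nmod (cm E T A \<psi> \<psi> y l)"
      using max[of "Q t"] Q(2) QM t by simp
  qed
qed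

end

section \<open>Creating a real eigenvalue along a homoclinic excursion\<close>

text \<open>Fewer moduli than dimensions force two coordinates of equal modulus, and by structure
  these come from a nonreal conjugate pair. One \<delta> then serves for all gaps.\<close>

lemma spectral_frame:
  fixes M :: "real ^ 'd ^ 'd"
  assumes st: "structured M" and inv: "invertible M" and lt: "nmod M < CARD('d)"
  shows "\<exists>C rad a0 b0 l0 \<delta>. invertible (C :: real ^ 'd ^ 'd) & (\<forall>i. 0 < rad i) & card (range rad) = nmod M \<and>
    a0 ~= b0 & {i :: 'd. rad i = rad a0} = {a0, b0} & l0 ~= 0 \<and>
    (\<forall>v. Complex ((C ** M ** matrix_inv C *v v) $ a0) ((C ** M ** matrix_inv C *v v) $ b0) = l0 * Complex (v $ a0) (v $ b0)) \<and>
    0 < \<delta> & \<delta> <= cmod l0 / 3 & (\<forall>I\<in>gaps rad. \<forall>L. norm (L - C ** M ** matrix_inv C) < \<delta> -->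
      cone_pres L I & grow L I (ga rad I) (gb rad I))"
proof -
  have z0: "0 \<notin> spec M" by (rule invertible_zero_spec[OF inv])
  obtain C e where C: "invertible (C :: real ^ 'd ^ 'd)" and e: "bij_betw e UNIV (spec M)"
    and re: "\<forall>i x. Im (e i) = 0 --> (C *v (M *v x)) $ i = Re (e i) * (C *v x) $ i"
    and im: "\<forall>i j x. Im (e i) > 0 --> e j = cnj (e i) -->
       (C *v (M *v x)) $ i = Re (e i) * (C *v x) $ i - Im (e i) * (C *v x) $ j \<and>
       (C *v (M *v x)) $ j = Im (e i) * (C *v x) $ i + Re (e i) * (C *v x) $ j"
    using eigen_coordinates[OF st] by (elim exE conjE)
  define rad where "rad = (\<lambda>i. cmod (e i))"
  define N where "N = C ** M ** matrix_inv C"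
  have es: "e i \<in> spec M" for i using e by (auto simp: bij_betw_def)
  have einj: "i = j" if "e i = e j" for i j using e that by (auto simp: bij_betw_def inj_on_def)
  have rad0: "0 < rad i" for i using es[of i] z0 unfolding rad_def by (metis zero_less_norm_iff)
  have "range rad = cmod ` spec M" using e unfolding rad_def bij_betw_def by (metis image_image)
  then have card: "card (range rad) = nmod M" by (simp add: nmod_def)
  have "\<not> inj rad" using card_image[of rad UNIV] card lt by auto
  then obtain i j where ij: "i ~= j" "rad i = rad j" unfolding inj_on_def by blast
  have two: "e j = e i \<or> e j = cnj (e i)" if "rad i = rad j" for i j
    using st es[of i] es[of j] that unfolding structured_def rad_def by blast
  have "e j = cnj (e i)" using two[OF ij(2)] einj[of i j] ij(1) by auto
  moreover have "Im (e i) ~= 0"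
  proof
    assume "Im (e i) = 0"
    then have "cnj (e i) = e i" by (simp add: complex_eq_iff)
    then show False using \<open>e j = cnj (e i)\<close> einj[of j i] ij(1) by simp
  qed
  ultimately have "\<exists>a0 b0. 0 < Im (e a0) & e b0 = cnj (e a0)"
    by (cases "0 < Im (e i)") (metis, metis complex_cnj_cnj cnj.sel(2) linorder_neqE_linordered_idom neg_0_less_iff_less)
  then obtain a0 b0 where ab: "0 < Im (e a0)" "e b0 = cnj (e a0)" by blast
  have ne: "a0 ~= b0"
  proof
    assume "a0 = b0"
    then have "Im (e a0) = - Im (e a0)" using ab(2) by (metis cnj.sel(2))
    then show False using ab(1) by simp
  qed
  have cls: "{i. rad i = rad a0} = {a0, b0}"
  proof (intro equalityI subsetI)
    fix i assume "i \<in> {i. rad i = rad a0}"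
    then have "e i = e a0 \<or> e i = cnj (e a0)" using two[of a0 i] by simp
    then show "i \<in> {a0, b0}" using einj[of i a0] einj[of i b0] ab(2) by auto
  qed (use ab(2) in \<open>auto simp: rad_def\<close>)
  define l0 where "l0 = e a0"
  have l0: "l0 ~= 0" using ab(1) by (auto simp: l0_def)
  have rot: "Complex ((N *v v) $ a0) ((N *v v) $ b0) = l0 * Complex (v $ a0) (v $ b0)" for v
  proof -
    define x where "x = matrix_inv C *v v"
    have v: "v = C *v x" using invertible_inv[OF C] by (simp add: x_def)
    have Nv: "N *v v = C *v (M *v x)" unfolding N_def x_def by (simp flip: matrix_vector_mul_assoc)
    show ?thesis using im[rule_format, OF ab, of x] unfolding Nv unfolding v by (simp add: complex_eq_iff l0_def)
  qed
  have g: "\<forall>I\<in>gaps rad. \<exists>\<delta>. 0 < \<delta> & (\<forall>L. norm (L - N) < \<delta> --> cone_pres L I & grow L I (ga rad I) (gb rad I))"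
    using structured_gap[OF C e z0 re im] unfolding rad_def N_def by blast
  then have "\<exists>df. \<forall>I\<in>gaps rad. 0 < df I & (\<forall>L. norm (L - N) < df I --> cone_pres L I & grow L I (ga rad I) (gb rad I))" by (rule bchoice)
  then obtain df where df: "\<forall>I\<in>gaps rad. 0 < df I & (\<forall>L. norm (L - N) < df I --> cone_pres L I & grow L I (ga rad I) (gb rad I))" by (rule exE)
  \<comment> \<open>Below |l0|/3 the ratio of successive central coordinates, divided by
    \<open>l0\<close>, stays in the right half plane; \<open>winding\<close> relies on this
    bound.\<close>
  define \<delta> where "\<delta> = Min (insert (cmod l0 / 3) (df ` gaps rad))"
  have d0: "0 < \<delta>" unfolding \<delta>_def using df l0 by (subst Min_gr_iff) auto
  have d1: "\<delta> <= cmod l0 / 3" unfolding \<delta>_def by (rule Min_le) auto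
  have d2: "\<delta> <= df I" if "I \<in> gaps rad" for I unfolding \<delta>_def using that by (intro Min_le) auto
  have gg: "\<forall>I\<in>gaps rad. \<forall>L. norm (L - N) < \<delta> --> cone_pres L I & grow L I (ga rad I) (gb rad I)"
    using df d2 by (meson less_le_trans)
  show ?thesis
    by (rule exI[of _ C], rule exI[of _ rad], rule exI[of _ a0], rule exI[of _ b0], rule exI[of _ l0], rule exI[of _ \<delta>])
      (unfold N_def[symmetric], intro conjI allI C rad0 card ne cls l0 rot d0 d1 gg)
qed

context bundle_dyn begin

text \<open>Along both tails the returns are \<delta>-close to that of p, so every gap has an
  unstable space arriving at \<open>x 0\<close> and a stable space leaving it. One small factor
  inserted at \<open>x 0\<close> makes all these pairs transversal simultaneously, and it does not
  touch the tails.\<close>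

lemma excursion:
  fixes x :: "int \<Rightarrow> 'm" and C :: "real ^ 'd ^ 'd" and F :: "'d set set" and a b :: "'d set \<Rightarrow> real" and \<alpha> \<beta> :: int
  assumes G: "openin (LC_topology \<Phi> E X T D r) G" "A \<in> G" and U: "(U, \<psi>) \<in> trivs E" and p: "p \<in> X" "p \<in> U" "0 < m" "(T ^^ m) p = p"
    and C: "invertible C" and F: "finite F" and ab: "\<forall>I\<in>F. 0 < b I & b I < a I" and \<delta>: "0 < \<delta>"
    and dom: "\<forall>I\<in>F. \<forall>L. norm (L - C ** cm E T A \<psi> \<psi> p m ** matrix_inv C) < \<delta> --> cone_pres L I & grow L I (a I) (b I)"
    and x: "\<forall>i. x i \<in> X & T (x i) = x (i + 1)" and al: "0 < \<alpha>" "0 < \<beta>"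
    and hW: "\<forall>W. open W & p \<in> W --> (\<exists>J. \<forall>j\<ge>J. x (- \<alpha> - int m * int j) \<in> W & x (\<beta> + int m * int j) \<in> W)"
    and B: "open B" "x 0 \<in> B" "\<forall>i. i ~= 0 --> x i \<notin> B" "\<forall>j. (T ^^ j) p \<notin> B"
  shows "\<exists>A' J. A' \<in> G & cm E T A' \<psi> \<psi> p m = cm E T A \<psi> \<psi> p m & (\<forall>v\<in>V. proj E v \<notin> B --> A' v = A v) \<and>
    (\<forall>z. (\<exists>j\<ge>J. z = x (\<beta> + int m * int j) \<or> z = x (- \<alpha> - int m * int j)) --> z \<in> U & (T ^^ m) z \<in> U \<and>
       norm (C ** cm E T A' \<psi> \<psi> z m ** matrix_inv C - C ** cm E T A \<psi> \<psi> p m ** matrix_inv C) < \<delta>) \<and>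
    (\<forall>k\<ge>J. \<forall>I\<in>F. cone_pres (C ** cm E T A' \<psi> \<psi> (x (- \<alpha> - int m * int k)) (nat (\<alpha> + \<beta>) + 2 * m * k) ** matrix_inv C) I)"
proof -
  define N where "N = C ** cm E T A \<psi> \<psi> p m ** matrix_inv C"
  define cc where "cc A' z = C ** cm E T A' \<psi> \<psi> z m ** matrix_inv C" for A' z
  have GL: "G \<subseteq> LC" using G(1) unfolding openin_LC_topology by simp
  have AL: "A \<in> LC" using G(2) GL by blast
  have xX: "x i \<in> X" for i using x by blast
  note xT = orbit_pow[OF x]
  have cV: "continuous_on V A" using AL by (simp add: linear_cocycles_def)
  have cA: "continuous_on ({0::real} \<times> V) (\<lambda>p. A (snd p))"
    by (rule continuous_on_compose2[OF cV continuous_on_snd[OF continuous_on_id]]) auto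
  have pU: "(T ^^ m) p \<in> U" using p by simp
  have "\<exists>\<tau> W. 0 < \<tau> & open W & p \<in> W & (\<forall>t y. t \<in> {0::real} & \<bar>t - 0\<bar> < \<tau> & y \<in> X & y \<in> W --> y \<in> U & (T ^^ m) y \<in> U \<and>
    norm (C ** cm E T A \<psi> \<psi> y m ** matrix_inv C - C ** cm E T A \<psi> \<psi> p m ** matrix_inv C) < \<delta>)"
    using cm_near[of "{0}" "\<lambda>_. A", OF _ cA U U p(1,2) pU _ \<delta>, of 0 C "matrix_inv C"] AL by simp
  then obtain \<tau> W0 where W0: "0 < \<tau>" "open W0" "p \<in> W0"
    and W0': "\<forall>t y. t \<in> {0::real} & \<bar>t - 0\<bar> < \<tau> & y \<in> X & y \<in> W0 --> y \<in> U & (T ^^ m) y \<in> U \<and>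
    norm (C ** cm E T A \<psi> \<psi> y m ** matrix_inv C - C ** cm E T A \<psi> \<psi> p m ** matrix_inv C) < \<delta>" by (elim exE conjE)
  have near: "y \<in> U & (T ^^ m) y \<in> U & norm (cc A y - N) < \<delta>" if "y \<in> X" "y \<in> W0" for y
    using W0'[rule_format, of 0 y] W0(1) that unfolding cc_def N_def by simp
  obtain J1 where J1: "\<forall>j\<ge>J1. x (- \<alpha> - int m * int j) \<in> W0 & x (\<beta> + int m * int j) \<in> W0"
    using mp[OF spec[OF hW, of W0]] W0(2,3) by blast
  \<comment> \<open>The excursion is prolonged by J1 periods on either side, so that every return
    left outside it is controlled.\<close>
  define \<alpha>1 where "\<alpha>1 = \<alpha> + int m * int J1"
  define \<beta>1 where "\<beta>1 = \<beta> + int m * int J1"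
  have al1: "0 < \<alpha>1" "0 < \<beta>1" using al by (simp_all add: \<alpha>1_def \<beta>1_def add_pos_nonneg)
  have nearp: "x (\<beta>1 + int m * int j) \<in> W0" "x (- \<alpha>1 - int m * int j) \<in> W0" for j
    using J1[rule_format, of "J1 + j"] by (simp_all add: \<alpha>1_def \<beta>1_def algebra_simps)
  define Lp where "Lp j = cc A (x (\<beta>1 + int m * int j))" for j
  define Lm where "Lm j = cc A (x (- \<alpha>1 - int m * int (Suc j)))" for j
  have Ln: "norm (Lp j - N) < \<delta>" "norm (Lm j - N) < \<delta>" for j
    using near[OF xX nearp(1)[of j]] near[OF xX nearp(2)[of "Suc j"]] by (simp_all add: Lp_def Lm_def)
  have Linv: "invertible (Lp j)" "invertible (Lm j)" for j
    unfolding Lp_def Lm_def cc_def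
    using near[OF xX nearp(1)[of j]] near[OF xX nearp(2)[of "Suc j"]]
    by (intro invertible_conj[OF C] cm_invertible[OF AL U U xX]; simp)+
  have Ld: "invertible (Lp j) & cone_pres (Lp j) I & grow (Lp j) I (a I) (b I)"
    "invertible (Lm j) & cone_pres (Lm j) I & grow (Lm j) I (a I) (b I)" if "I \<in> F" for I j
    using Linv Ln dom that unfolding N_def by blast+
  obtain U0 \<psi>0 where U0: "(U0, \<psi>0) \<in> trivs E" "x 0 \<in> U0" using triv_at[of "x 0"] xX[of 0] XY by blast
  define na where "na = nat \<alpha>1"
  define nb where "nb = nat \<beta>1"
  have Tna: "(T ^^ na) (x (- \<alpha>1)) = x 0" using xT[of na "- \<alpha>1"] al1 by (simp add: na_def)
  have Tnb: "(T ^^ nb) (x 0) = x \<beta>1" using xT[of nb 0] al1 by (simp add: nb_def)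
  have xU: "x (- \<alpha>1) \<in> U" "x \<beta>1 \<in> U" using near[OF xX nearp(1)[of 0]] near[OF xX nearp(2)[of 0]] by simp_all
  define Zm where "Zm = cm E T A \<psi> \<psi>0 (x (- \<alpha>1)) na ** matrix_inv C"
  define Zp where "Zp = C ** cm E T A \<psi>0 \<psi> (x 0) nb"
  have Zi: "invertible Zm" "invertible Zp" unfolding Zm_def Zp_def
    using xU U0 Tna Tnb by (intro invertible_mult C invertible_matrix_inv[OF C] cm_invertible[OF AL] U U0(1) xX; simp)+
  have dims: "subspace (Usp Lm Zm (a I)) & subspace (Ssp Lp Zp (b I)) & dim (Usp Lm Zm (a I)) + dim (Ssp Lp Zp (b I)) <= CARD('d)"
    if "I \<in> F" for I
    by (rule dim_Usp_Ssp[where I = I, OF Zi]) (use Ld[OF that] ab that in auto)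
  have "\<exists>Xs. \<exists>\<epsilon>>0. \<forall>s. 0 < s & s < \<epsilon> --> (\<forall>I\<in>F. transv (mat 1 + s *\<^sub>R Xs) (Usp Lm Zm (a I)) (Ssp Lp Zp (b I)))"
    by (rule transv_small[OF F]) (rule dims)
  then obtain Xs \<epsilon> where Xs: "0 < \<epsilon>" "\<forall>s. 0 < s & s < \<epsilon> --> (\<forall>I\<in>F. transv (mat 1 + s *\<^sub>R Xs) (Usp Lm Zm (a I)) (Ssp Lp Zp (b I)))"
    by (elim exE conjE)
  from perturbation[OF G U0(1) xX U0(2) B(1,2), of Xs] obtain Q \<epsilon>' where
    Q: "0 < \<epsilon>'" "\<forall>t. \<bar>t\<bar> < \<epsilon>' --> Q t \<in> G"
    and QB: "\<forall>t v. v \<in> V --> proj E v \<notin> B --> Q t v = A v"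
    and QM: "\<forall>t. \<forall>v\<in>fiber E (x 0). \<exists>w\<in>fiber E (x 0). Q t v = A w & \<psi>0 w = (mat 1 + t *\<^sub>R Xs) *v \<psi>0 v"
    by (elim exE conjE)
  \<comment> \<open>Small enough for transversality, for staying in \<open>G\<close> and for an
    invertible factor.\<close>
  define s0 where "s0 = min (min \<epsilon> \<epsilon>') (1 / (norm Xs + 1)) / 2"
  have nX: "0 < norm Xs + 1" by (simp add: add_nonneg_pos)
  have s0: "0 < s0" "s0 < \<epsilon>" "s0 < \<epsilon>'" using Xs(1) Q(1) nX by (auto simp: s0_def)
  define R where "R = mat 1 + s0 *\<^sub>R Xs"
  have "s0 < 1 / (norm Xs + 1)" using Xs(1) Q(1) nX by (auto simp: s0_def min_def field_simps)
  then have "s0 * (norm Xs + 1) < 1" using nX by (simp add: field_simps)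
  then have "s0 * norm Xs < 1" using s0(1) by (simp add: distrib_left)
  then have Ri: "invertible R" unfolding R_def using s0(1) by (intro small_perturb_invertible) simp
  define A' where "A' = Q s0"
  have A'G: "A' \<in> G" unfolding A'_def using Q(2) s0 by simp
  have A'L: "A' \<in> LC" using A'G GL by blast
  have A'B: "A' v = A v" if "v \<in> fiber E y" "y \<in> X" "y \<notin> B" for v y
    using QB fib_V[OF that(1,2)] that unfolding A'_def by (simp add: fiber_def)
  have eqx: "cm E T A' \<psi>1 \<psi>2 (x i) n = cm E T A \<psi>1 \<psi>2 (x i) n"
    if "(U1, \<psi>1) \<in> trivs E" "x i \<in> U1" "0 < i \<or> i + int n <= 0" for U1 \<psi>1 \<psi>2 i n
  proof (rule cm_cong[OF AL that(1) xX that(2)])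
    fix j v assume j: "j < n" and v: "v \<in> fiber E ((T ^^ j) (x i))"
    then have v': "v \<in> fiber E (x (i + int j))" by (simp add: xT)
    have "i + int j ~= 0" using that(3) j by auto
    then show "A' v = A v" using A'B[OF v' xX] B(3) by blast
  qed
  have eqp: "cm E T A' \<psi> \<psi> p m = cm E T A \<psi> \<psi> p m"
    by (rule cm_cong[OF AL U p(1,2)]) (use A'B TnX[OF p(1)] B(4) in blast)
  have eq0: "cm E T A' \<psi>0 \<psi> (x 0) nb = cm E T A \<psi>0 \<psi> (x 0) nb ** R"
    unfolding R_def
  proof (rule cm_pert[OF AL A'L U0(1) U xX U0(2)])
    show "(T ^^ nb) (x 0) \<in> U" using Tnb xU by simp
    show "0 < nb" using al1 by (simp add: nb_def)
    show "A' v = A v" if i: "0 < i" and v: "v \<in> fiber E ((T ^^ i) (x 0))" for i v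
    proof -
      have "v \<in> fiber E (x (int i))" using v by (simp add: xT)
      then show ?thesis using A'B[OF _ xX] B(3) i by simp
    qed
    show "\<forall>v\<in>fiber E (x 0). \<exists>w\<in>fiber E (x 0). A' v = A w & \<psi>0 w = (mat 1 + s0 *\<^sub>R Xs) *v \<psi>0 v"
      unfolding A'_def by (rule spec[OF QM])
  qed
  have eqm: "cc A' (x (- \<alpha>1 - int m * int (Suc j))) = cc A (x (- \<alpha>1 - int m * int (Suc j)))" for j
  proof -
    have "- \<alpha>1 - int m * int (Suc j) + int m = - \<alpha>1 - int m * int j" by (simp add: algebra_simps)
    moreover have "0 <= int m * int j" by simp
    ultimately have "- \<alpha>1 - int m * int (Suc j) + int m <= 0" using al1(1) by linarith
    then show ?thesis unfolding cc_def using eqx[OF U, of "- \<alpha>1 - int m * int (Suc j)" m] near[OF xX nearp(2)[of "Suc j"]] by simp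
  qed
  have eqpl: "cc A' (x (\<beta>1 + int m * int j)) = cc A (x (\<beta>1 + int m * int j))" for j
  proof -
    have "0 < \<beta>1 + int m * int j" using al1(2) by (simp add: add_pos_nonneg)
    then show ?thesis unfolding cc_def using eqx[OF U, of "\<beta>1 + int m * int j" m] near[OF xX nearp(1)[of j]] by simp
  qed
  define Ex where "Ex k = C ** cm E T A' \<psi> \<psi> (x (- \<alpha>1 - int m * int k)) (m * k + (na + (nb + m * k))) ** matrix_inv C" for k
  have Exk: "Ex k = qp Lp k ** Zp ** R ** Zm ** qm Lm k" for k
  proof -
    define z where "z = x (- \<alpha>1 - int m * int k)"
    have z: "z \<in> X" "z \<in> U" unfolding z_def using near[OF xX nearp(2)[of k]] xX by simp_all
    have Tz: "(T ^^ (m * k)) z = x (- \<alpha>1)" unfolding z_def by (simp add: xT)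
    have Te: "(T ^^ (m * k)) (x \<beta>1) = x (\<beta>1 + int m * int k)" by (simp add: xT)
    have eU: "x (\<beta>1 + int m * int k) \<in> U" using near[OF xX nearp(1)[of k]] by simp
    have T3: "(T ^^ (nb + m * k)) (x 0) \<in> U"
    proof -
      have "(T ^^ (nb + m * k)) (x 0) = (T ^^ (m * k)) ((T ^^ nb) (x 0))" by (simp add: funpow_add add.commute[of nb])
      then show ?thesis using Tnb Te eU by simp
    qed
    have T2: "(T ^^ (na + (nb + m * k))) (x (- \<alpha>1)) \<in> U"
    proof -
      have "(T ^^ (na + (nb + m * k))) (x (- \<alpha>1)) = (T ^^ (nb + m * k)) ((T ^^ na) (x (- \<alpha>1)))"
        by (simp add: funpow_add add.commute[of na] del: funpow.simps)
      then show ?thesis using Tna T3 by simp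
    qed
    have 1: "cm E T A' \<psi> \<psi> z (m * k + (na + (nb + m * k))) = cm E T A' \<psi> \<psi> (x (- \<alpha>1)) (na + (nb + m * k)) ** cm E T A' \<psi> \<psi> z (m * k)"
      using cm_add[OF A'L U U U z, of "m * k" "na + (nb + m * k)"] xU T2 unfolding Tz by simp
    have 2: "cm E T A' \<psi> \<psi> (x (- \<alpha>1)) (na + (nb + m * k)) = cm E T A' \<psi>0 \<psi> (x 0) (nb + m * k) ** cm E T A' \<psi> \<psi>0 (x (- \<alpha>1)) na"
      using cm_add[OF A'L U U0(1) U xX xU(1), of na "nb + m * k"] U0(2) T3 unfolding Tna by simp
    have 3: "cm E T A' \<psi>0 \<psi> (x 0) (nb + m * k) = cm E T A' \<psi> \<psi> (x \<beta>1) (m * k) ** cm E T A' \<psi>0 \<psi> (x 0) nb"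
      using cm_add[OF A'L U0(1) U U xX U0(2), of nb "m * k"] xU(2) eU unfolding Tnb Te by simp
    have 4: "cm E T A' \<psi> \<psi>0 (x (- \<alpha>1)) na = cm E T A \<psi> \<psi>0 (x (- \<alpha>1)) na"
      using eqx[OF U xU(1), of na \<psi>0] al1 by (simp add: na_def)
    have 5: "C ** cm E T A' \<psi> \<psi> (x \<beta>1) (m * k) ** matrix_inv C = qp Lp k"
    proof -
      have "C ** cm E T A' \<psi> \<psi> (x \<beta>1) (m * k) ** matrix_inv C = qp (\<lambda>j. cc A' (x (\<beta>1 + int m * int j))) k"
        unfolding cc_def by (rule orbit_qp[OF A'L U x C]) (use near[OF xX nearp(1)] in blast)
      then show ?thesis unfolding eqpl Lp_def .
    qed
    have 6: "C ** cm E T A' \<psi> \<psi> z (m * k) ** matrix_inv C = qm Lm k"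
    proof -
      have "C ** cm E T A' \<psi> \<psi> z (m * k) ** matrix_inv C = qm (\<lambda>j. cc A' (x (- \<alpha>1 - int m * int (Suc j)))) k"
        unfolding cc_def z_def by (rule orbit_qm[OF A'L U x C]) (use near[OF xX nearp(2)] in blast)
      then show ?thesis unfolding eqm Lm_def .
    qed
    let ?Ci = "matrix_inv C"
    have "Ex k = C ** (cm E T A' \<psi> \<psi> (x \<beta>1) (m * k) ** (cm E T A \<psi>0 \<psi> (x 0) nb ** R) ** cm E T A \<psi> \<psi>0 (x (- \<alpha>1)) na ** cm E T A' \<psi> \<psi> z (m * k)) ** ?Ci"
      unfolding Ex_def z_def[symmetric] 1 2 3 4 eq0 by (simp add: matrix_mul_assoc)
    also have "\<dots> = C ** cm E T A' \<psi> \<psi> (x \<beta>1) (m * k) ** (?Ci ** C) ** cm E T A \<psi>0 \<psi> (x 0) nb ** R ** cm E T A \<psi> \<psi>0 (x (- \<alpha>1)) na ** (?Ci ** C) ** cm E T A' \<psi> \<psi> z (m * k) ** ?Ci"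
      unfolding inv_C(2)[OF C] by (simp add: matrix_mul_assoc)
    also have "\<dots> = (C ** cm E T A' \<psi> \<psi> (x \<beta>1) (m * k) ** ?Ci) ** Zp ** R ** Zm ** (C ** cm E T A' \<psi> \<psi> z (m * k) ** ?Ci)"
      unfolding Zp_def Zm_def by (simp add: matrix_mul_assoc)
    finally show ?thesis unfolding 5 6 .
  qed
  have "\<forall>\<^sub>F k in sequentially. cone_pres (Ex k) I" if I: "I \<in> F" for I
  proof -
    have "transv R (Usp Lm Zm (a I)) (Ssp Lp Zp (b I))" using Xs(2) s0 I unfolding R_def by blast
    then have "\<exists>K. \<forall>k\<ge>K. cone_pres (qp Lp k ** Zp ** R ** Zm ** qm Lm k) I"
      using Ld[OF I] ab I by (intro excursion_cone[OF Zi(2,1) Ri, where a = "a I" and b = "b I"]) auto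
    then show ?thesis unfolding Exk eventually_sequentially .
  qed
  then have "\<forall>\<^sub>F k in sequentially. \<forall>I\<in>F. cone_pres (Ex k) I" using F by (simp add: eventually_ball_finite)
  then obtain K where K: "\<forall>k\<ge>K. \<forall>I\<in>F. cone_pres (Ex k) I" unfolding eventually_sequentially by blast
  \<comment> \<open>The extra 1 is for the past: the m steps starting at
    \<open>x (- \<alpha>1)\<close> may cross time 0, where the cocycle was changed; those starting a
    period earlier end before it.\<close>
  define J where "J = J1 + K + 1"
  have fin1: "\<forall>z. (\<exists>j\<ge>J. z = x (\<beta> + int m * int j) \<or> z = x (- \<alpha> - int m * int j)) --> z \<in> U & (T ^^ m) z \<in> U & norm (cc A' z - N) < \<delta>"
  proof (intro allI impI, elim exE conjE)
    fix z j assume j: "J <= j" and z: "z = x (\<beta> + int m * int j) \<or> z = x (- \<alpha> - int m * int j)"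
    define i where "i = j - J1 - 1"
    have ji: "j = J1 + Suc i" using j by (simp add: i_def J_def)
    have "\<beta> + int m * int j = \<beta>1 + int m * int (Suc i)" "- \<alpha> - int m * int j = - \<alpha>1 - int m * int (Suc i)"
      by (simp_all add: ji \<alpha>1_def \<beta>1_def algebra_simps)
    then consider "z = x (\<beta>1 + int m * int (Suc i))" | "z = x (- \<alpha>1 - int m * int (Suc i))" using z by auto
    then show "z \<in> U & (T ^^ m) z \<in> U & norm (cc A' z - N) < \<delta>"
    proof cases
      case 1
      show ?thesis unfolding 1 eqpl using near[OF xX nearp(1)[of "Suc i"]] .
    next
      case 2
      show ?thesis unfolding 2 eqm using near[OF xX nearp(2)[of "Suc i"]] .
    qed
  qed
  have fin2: "cone_pres (C ** cm E T A' \<psi> \<psi> (x (- \<alpha> - int m * int k)) (nat (\<alpha> + \<beta>) + 2 * m * k) ** matrix_inv C) I" if k: "J <= k" and I: "I \<in> F" for k I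
  proof -
    define i where "i = k - J1"
    have ki: "k = J1 + i" "K <= i" using k by (simp_all add: i_def J_def)
    have e1: "- \<alpha> - int m * int k = - \<alpha>1 - int m * int i" by (simp add: ki \<alpha>1_def algebra_simps)
    have nab: "na = nat \<alpha> + m * J1" "nb = nat \<beta> + m * J1" using al by (simp_all add: na_def nb_def \<alpha>1_def \<beta>1_def nat_add_distrib nat_mult_distrib)
    have e2: "nat (\<alpha> + \<beta>) + 2 * m * k = m * i + (na + (nb + m * i))" using al unfolding nab ki by (simp add: nat_add_distrib algebra_simps)
    show ?thesis using K ki(2) I unfolding e1 e2 Ex_def by blast
  qed
  show ?thesis
    by (rule exI[of _ A'], rule exI[of _ J]) (use A'G eqp QB fin1 fin2 in \<open>unfold cc_def N_def A'_def, blast\<close>)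
qed

end

text \<open>Multiplication by the imaginary unit on the plane of the coordinates a and b, zero on
  all others.\<close>

definition rotm :: "'d \<Rightarrow> 'd \<Rightarrow> real ^ 'd ^ 'd" where
  "rotm a b = (\<chi> i j. if i = a & j = b then - 1 else if i = b & j = a then 1 else 0)"

lemma rotm:
  assumes "a ~= b"
  shows "(rotm a b *v v) $ a = - (v $ b)" "(rotm a b *v v) $ b = v $ a"
proof -
  have "(rotm a b *v v) $ i = (\<Sum>j\<in>UNIV. rotm a b $ i $ j * v $ j)" for i by (simp add: matrix_vector_mult_def)
  moreover have "(\<Sum>j\<in>UNIV. rotm a b $ a $ j * v $ j) = (\<Sum>j\<in>UNIV. if j = b then - (v $ j) else 0)"
    by (rule sum.cong[OF refl]) (use assms in \<open>auto simp: rotm_def\<close>)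
  moreover have "(\<Sum>j\<in>UNIV. rotm a b $ b $ j * v $ j) = (\<Sum>j\<in>UNIV. if j = a then v $ j else 0)"
    by (rule sum.cong[OF refl]) (use assms in \<open>auto simp: rotm_def\<close>)
  ultimately show "(rotm a b *v v) $ a = - (v $ b)" "(rotm a b *v v) $ b = v $ a" by simp_all
qed

lemma common_grow:
  fixes M :: "real ^ 'd ^ 'd"
  assumes F: "finite F" and c: "\<forall>I\<in>F. cone_pres M I" and inv: "invertible M"
  shows "\<exists>\<epsilon> \<alpha> \<beta>. 0 < \<epsilon> & (\<forall>I\<in>F. 0 < \<alpha> I & 0 < \<beta> I & (\<forall>L. norm (L - M) < \<epsilon> --> cone_pres L I & grow L I (\<alpha> I) (\<beta> I)))"
proof -
  define ok where "ok I w \<longleftrightarrow> 0 < fst w & 0 < fst (snd w) & 0 < snd (snd w) \<and>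
    (\<forall>L. norm (L - M) < fst w --> cone_pres L I & grow L I (fst (snd w)) (snd (snd w)))" for I and w :: "real \<times> real \<times> real"
  have "\<forall>I\<in>F. \<exists>w. ok I w"
  proof
    fix I assume "I \<in> F"
    then obtain e a b where "e > 0 & a > 0 & b > 0 & (\<forall>Y. norm (Y - M) < e --> cone_pres Y I & grow Y I a b)"
      using grow_open[of M I] c inv by blast
    then have "ok I (e, a, b)" by (simp add: ok_def)
    then show "\<exists>w. ok I w" ..
  qed
  then have "\<exists>w. \<forall>I\<in>F. ok I (w I)" by (rule bchoice)
  then obtain w where w: "\<forall>I\<in>F. ok I (w I)" by (rule exE)
  define \<epsilon> where "\<epsilon> = Min (insert 1 ((\<lambda>I. fst (w I)) ` F))"
  have e0: "0 < \<epsilon>" unfolding \<epsilon>_def using F w by (subst Min_gr_iff) (auto simp: ok_def)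
  have e1: "\<epsilon> <= fst (w I)" if "I \<in> F" for I unfolding \<epsilon>_def using that F by (intro Min_le) auto
  have "0 < fst (snd (w I)) & 0 < snd (snd (w I)) & (\<forall>L. norm (L - M) < \<epsilon> --> cone_pres L I & grow L I (fst (snd (w I))) (snd (snd (w I))))" if "I \<in> F" for I
    using bspec[OF w that] e1[OF that] unfolding ok_def by (meson less_le_trans)
  then show ?thesis using e0
    by (intro exI[of _ \<epsilon>] exI[of _ "\<lambda>I. fst (snd (w I))"] exI[of _ "\<lambda>I. snd (snd (w I))"]) simp
qed

context bundle_dyn begin

text \<open>Two perturbations are made inside \<open>G\<close>, one at \<open>x 0\<close> for
  transversality and then a rotation at p. The second may also affect the excursion, because the
  homoclinic and the long orbits pass close to p; continuity in t keeps the transversality gained by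
  the first.\<close>

lemma no_submaximal_return:
  fixes x :: "int \<Rightarrow> 'm" and y :: "nat \<Rightarrow> int \<Rightarrow> 'm" and N :: "nat \<Rightarrow> nat" and \<alpha> \<beta> :: int and Per :: "'m set"
  assumes G: "openin (LC_topology \<Phi> E X T D r) G" "A \<in> G" and Per: "Per \<subseteq> X" and p: "p \<in> Per" "has_period T p m" and U: "(U, \<psi>) \<in> trivs E" "p \<in> U"
    and max: "\<And>A' y l U' \<psi>'. A' \<in> G ==> y \<in> Per ==> has_period T y l ==> (U', \<psi>') \<in> trivs E ==> y \<in> U' ==>
       nmod (cm E T A' \<psi>' \<psi>' y l) <= nmod (cm E T A \<psi> \<psi> p m)"
    and lt: "nmod (cm E T A \<psi> \<psi> p m) < CARD('d)"
    and x: "\<forall>i. x i \<in> X & T (x i) = x (i + 1)" and al: "0 < \<alpha>" "0 < \<beta>"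
    and N: "filterlim N at_top sequentially"
    and y: "\<forall>k i. y k i \<in> Per & T (y k i) = y k (i + 1) & y k (i + (\<alpha> + \<beta> + int m * int (N k))) = y k i"
    and lim: "\<forall>i. (\<lambda>k. y k i) \<longlonglongrightarrow> x i"
    and hW: "\<forall>W. open W & p \<in> W --> (\<exists>J. (\<forall>j\<ge>J. x (- \<alpha> - int m * int j) \<in> W & x (\<beta> + int m * int j) \<in> W) \<and>
       (\<forall>k j. J <= j & j + J <= N k --> y k (\<beta> + int m * int j) \<in> W))"
    and B: "open B" "x 0 \<in> B" "\<forall>j. (T ^^ j) p \<notin> B" "\<forall>i. i ~= 0 --> x i \<notin> B"
    and yB: "\<forall>k. y k 0 \<in> B & (\<forall>i. 0 < i & i < \<alpha> + \<beta> + int m * int (N k) --> y k i \<notin> B)"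
  shows False
proof -
  have GL: "G \<subseteq> LC" using G(1) unfolding openin_LC_topology by simp
  have AL: "A \<in> LC" using G(2) GL by blast
  have pX: "p \<in> X" using p(1) Per by blast
  have m: "0 < m" "(T ^^ m) p = p" using p(2) by (auto simp: has_period_def)
  have pU: "(T ^^ m) p \<in> U" using m U by simp
  have xX: "x i \<in> X" for i using x by blast
  have yP: "y k i \<in> Per" "y k i \<in> X" for k i using y Per by blast+
  have yo: "\<forall>i. y k i \<in> X & T (y k i) = y k (i + 1)" for k using y Per by blast
  note xT = orbit_pow[OF x]
  note yT = orbit_pow[OF yo]
  define M where "M = cm E T A \<psi> \<psi> p m"
  have Mi: "invertible M" unfolding M_def by (rule cm_invertible[OF AL U(1,1) pX U(2) pU])
  have "structured (cm E T A \<psi> \<psi> p m)"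
    by (rule max_structured[OF G pX p(2) U]) (rule max[OF _ p U])
  then have Ms: "structured M" by (simp add: M_def)
  have Mlt: "nmod M < CARD('d)" using lt by (simp add: M_def)
  from spectral_frame[OF Ms Mi Mlt] obtain C rad a0 b0 l0 \<delta> where C: "invertible (C :: real ^ 'd ^ 'd)" and rad0: "\<forall>i. 0 < rad i"
    and crad: "card (range rad) = nmod M" and ab0: "a0 ~= b0" and cls: "{i :: 'd. rad i = rad a0} = {a0, b0}" and l0: "l0 ~= 0"
    and rot: "\<forall>v. Complex ((C ** M ** matrix_inv C *v v) $ a0) ((C ** M ** matrix_inv C *v v) $ b0) = l0 * Complex (v $ a0) (v $ b0)"
    and \<delta>: "0 < \<delta>" "\<delta> <= cmod l0 / 3"
    and dm: "\<forall>I\<in>gaps rad. \<forall>L. norm (L - C ** M ** matrix_inv C) < \<delta> --> cone_pres L I & grow L I (ga rad I) (gb rad I)"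
    by (elim exE conjE)
  define NN where "NN = C ** M ** matrix_inv C"
  note gapb = gap_bounds[of rad, OF rad0[rule_format]]
  have gab: "\<forall>I\<in>gaps rad. 0 < gb rad I & gb rad I < ga rad I" using gapb by blast
  have hx: "\<forall>W. open W & p \<in> W --> (\<exists>J. \<forall>j\<ge>J. x (- \<alpha> - int m * int j) \<in> W & x (\<beta> + int m * int j) \<in> W)"
  proof (intro allI impI)
    fix W assume W: "open W & p \<in> W"
    from mp[OF spec[OF hW, of W] W] obtain J where "(\<forall>j\<ge>J. x (- \<alpha> - int m * int j) \<in> W & x (\<beta> + int m * int j) \<in> W) \<and>
       (\<forall>k j. J <= j & j + J <= N k --> y k (\<beta> + int m * int j) \<in> W)" by (rule exE)
    then show "\<exists>J. \<forall>j\<ge>J. x (- \<alpha> - int m * int j) \<in> W & x (\<beta> + int m * int j) \<in> W" by (intro exI[of _ J]) (rule conjunct1)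
  qed
  from excursion[OF G U(1) pX U(2) m C finite gab \<delta>(1) dm[unfolded M_def] x al hx B(1,2,4,3)]
  obtain A' J where A'G: "A' \<in> G" and eqp: "cm E T A' \<psi> \<psi> p m = cm E T A \<psi> \<psi> p m"
    and xnear: "\<forall>z. (\<exists>j\<ge>J. z = x (\<beta> + int m * int j) \<or> z = x (- \<alpha> - int m * int j)) --> z \<in> U & (T ^^ m) z \<in> U \<and>
       norm (C ** cm E T A' \<psi> \<psi> z m ** matrix_inv C - C ** cm E T A \<psi> \<psi> p m ** matrix_inv C) < \<delta>"
    and exc: "\<forall>k\<ge>J. \<forall>I\<in>gaps rad. cone_pres (C ** cm E T A' \<psi> \<psi> (x (- \<alpha> - int m * int k)) (nat (\<alpha> + \<beta>) + 2 * m * k) ** matrix_inv C) I"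
    by (elim exE conjE)
  have A'L: "A' \<in> LC" using A'G GL by blast
  define Rt where "Rt = rotm a0 b0"
  \<comment> \<open>Conjugated by \<open>C\<close>, the return at p becomes \<open>NN\<close> times
    1 + t \<open>Rt\<close>, which multiplies the complex coordinate of the plane by l0 (1 + i
    t).\<close>
  from perturb_return[OF G(1) A'G pX p(2) U, of "matrix_inv C ** Rt ** C"] obtain Q \<epsilon> where
    Q: "0 < \<epsilon>" "\<forall>t. \<bar>t\<bar> < \<epsilon> --> Q t \<in> G" "Q 0 = A'" and cQ: "continuous_on (UNIV \<times> V) (\<lambda>p. Q (fst p) (snd p))"
    and QM: "\<forall>t. \<bar>t\<bar> < \<epsilon> --> cm E T (Q t) \<psi> \<psi> p m = cm E T A' \<psi> \<psi> p m ** (mat 1 + t *\<^sub>R (matrix_inv C ** Rt ** C))"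
    by (elim exE conjE)
  define S where "S = {0..\<epsilon> / 2}"
  have QS: "Q t \<in> LC" "Q t \<in> G" if "t \<in> S" for t
    using Q(1,2) that GL by (auto simp: S_def)
  have cS: "continuous_on (S \<times> V) (\<lambda>p. Q (fst p) (snd p))" by (rule continuous_on_subset[OF cQ]) auto
  have S0: "0 \<in> S" using Q(1) by (simp add: S_def)
  define cc where "cc t z n = C ** cm E T (Q t) \<psi> \<psi> z n ** matrix_inv C" for t z n
  have ccp: "cc t p m = NN ** (mat 1 + t *\<^sub>R Rt)" if t: "t \<in> S" for t
  proof -
    have "\<bar>t\<bar> < \<epsilon>" using t Q(1) by (auto simp: S_def)
    then have "cc t p m = C ** M ** (mat 1 + t *\<^sub>R (matrix_inv C ** Rt ** C)) ** matrix_inv C"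
      using QM eqp by (simp add: cc_def M_def matrix_mul_assoc)
    also have "\<dots> = C ** M ** ((mat 1 + t *\<^sub>R (matrix_inv C ** Rt ** C)) ** matrix_inv C)" by (simp add: matrix_mul_assoc)
    also have "(mat 1 + t *\<^sub>R (matrix_inv C ** Rt ** C)) ** matrix_inv C = matrix_inv C ** (mat 1 + t *\<^sub>R Rt)"
    proof (rule matrix_eqI)
      fix w
      have "(matrix_inv C ** Rt ** C) *v (matrix_inv C *v w) = matrix_inv C *v (Rt *v w)"
        using invertible_inv[OF C] by (simp flip: matrix_vector_mul_assoc)
      then show "((mat 1 + t *\<^sub>R (matrix_inv C ** Rt ** C)) ** matrix_inv C) *v w = (matrix_inv C ** (mat 1 + t *\<^sub>R Rt)) *v w"
        by (simp flip: matrix_vector_mul_assoc scaleR_matrix_vector_assoc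
            add: matrix_vector_mult_add_rdistrib matrix_vector_right_distrib matrix_vector_mult_scaleR)
    qed
    finally show ?thesis by (simp add: NN_def matrix_mul_assoc)
  qed
  have near: "\<exists>\<tau> W. 0 < \<tau> & open W & z0 \<in> W & (\<forall>t z. t \<in> S & \<bar>t - t0\<bar> < \<tau> & z \<in> X & z \<in> W --> z \<in> U & (T ^^ n) z \<in> U \<and>
      norm (cc t z n - cc t0 z0 n) < e)"
    if "z0 \<in> X" "z0 \<in> U" "(T ^^ n) z0 \<in> U" "t0 \<in> S" "0 < e" for z0 n t0 e
    unfolding cc_def by (rule cm_near[OF QS(1) cS U(1,1) that])
  have cci: "invertible (cc t z n)" if "t \<in> S" "z \<in> X" "z \<in> U" "(T ^^ n) z \<in> U" for t z n
    unfolding cc_def by (rule invertible_conj[OF C cm_invertible[OF QS(1)[OF that(1)] U(1,1) that(2-4)]])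
  have cccont: "continuous_on S' (\<lambda>t. cc t z n)" if "z \<in> X" "z \<in> U" "(T ^^ n) z \<in> U" "S' \<subseteq> S" for z n S'
  proof -
    have 1: "continuous_on S' (\<lambda>t. (t, z))" by (intro continuous_intros)
    have "continuous_on S' (\<lambda>t. cm E T (Q (fst (t, z))) \<psi> \<psi> (snd (t, z)) n)"
      by (rule continuous_on_compose2[OF cm_continuous[OF QS(1) cS U(1,1)] 1]) (use that in auto)
    then show ?thesis unfolding cc_def by (intro continuous_on_matrix_matrix continuous_on_const) simp
  qed
  obtain \<tau>1 W1 where W1: "0 < \<tau>1" "open W1" "p \<in> W1"
    and W1': "\<forall>t z. t \<in> S & \<bar>t - 0\<bar> < \<tau>1 & z \<in> X & z \<in> W1 --> z \<in> U & (T ^^ m) z \<in> U & norm (cc t z m - cc 0 p m) < \<delta>"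
    using near[OF pX U(2) pU S0 \<delta>(1)] by (elim exE conjE)
  have cc0p: "cc 0 p m = NN" using ccp[OF S0] by simp
  have hy: "\<exists>J. \<forall>k j. J <= j & j + J <= N k --> y k (\<beta> + int m * int j) \<in> W" if "open W" "p \<in> W" for W
  proof -
    from mp[OF spec[OF hW, of W] conjI[OF that]] obtain J where "(\<forall>j\<ge>J. x (- \<alpha> - int m * int j) \<in> W & x (\<beta> + int m * int j) \<in> W) \<and>
       (\<forall>k j. J <= j & j + J <= N k --> y k (\<beta> + int m * int j) \<in> W)" by (rule exE)
    then show ?thesis by (intro exI[of _ J]) (rule conjunct2)
  qed
  obtain J2 where J2: "\<forall>k j. J2 <= j & j + J2 <= N k --> y k (\<beta> + int m * int j) \<in> W1" using hy[OF W1(2,3)] by (rule exE)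
  \<comment> \<open>Number of periods assigned to the excursion on either side; beyond them the
    returns are close to that of p both along \<open>x\<close> and, for small t, along the long
    orbits.\<close>
  define a where "a = max J J2"
  have aJ: "J <= a" "J2 <= a" by (simp_all add: a_def)
  define len where "len = nat (\<alpha> + \<beta>) + 2 * m * a"
  have len0: "0 < len" using al by (simp add: len_def)
  define zx where "zx = x (- \<alpha> - int m * int a)"
  define Qi where "Qi = cc 0 zx len"
  have Qi': "Qi = C ** cm E T A' \<psi> \<psi> (x (- \<alpha> - int m * int a)) (nat (\<alpha> + \<beta>) + 2 * m * a) ** matrix_inv C"
    by (simp add: Qi_def cc_def zx_def len_def Q(3))
  have Qc: "\<forall>I\<in>gaps rad. cone_pres Qi I" unfolding Qi' using exc aJ(1) by blast
  have xn: "z \<in> U" "(T ^^ m) z \<in> U" "norm (cc 0 z m - NN) < \<delta>"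
    if "J <= j" "z = x (\<beta> + int m * int j) \<or> z = x (- \<alpha> - int m * int j)" for z j
    using mp[OF spec[OF xnear, of z]] that unfolding cc_def Q(3) NN_def M_def by blast+
  have zxU: "zx \<in> U" "zx \<in> X" unfolding zx_def using xn(1)[OF aJ(1)] xX by auto
  have Tzx: "(T ^^ len) zx = x (\<beta> + int m * int a)"
    unfolding zx_def xT len_def using al by (simp add: algebra_simps)
  have TzxU: "(T ^^ len) zx \<in> U" unfolding Tzx using xn(1)[OF aJ(1)] by blast
  have Qiinv: "invertible Qi" unfolding Qi_def by (rule cci[OF S0 zxU(2,1) TzxU])
  have fin: "finite (gaps rad)" by simp
  obtain eF \<alpha>f \<beta>f where eF: "0 < eF"
    and gr: "\<forall>I\<in>gaps rad. 0 < \<alpha>f I & 0 < \<beta>f I & (\<forall>L. norm (L - Qi) < eF --> cone_pres L I & grow L I (\<alpha>f I) (\<beta>f I))"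
    using common_grow[OF fin Qc Qiinv] by (elim exE conjE)
  obtain \<tau>2 W2 where W2: "0 < \<tau>2" "open W2" "zx \<in> W2"
    and W2': "\<forall>t z. t \<in> S & \<bar>t - 0\<bar> < \<tau>2 & z \<in> X & z \<in> W2 --> z \<in> U & (T ^^ len) z \<in> U & norm (cc t z len - cc 0 zx len) < eF"
    using near[OF zxU(2,1) TzxU S0 eF] by (elim exE conjE)
  have "\<forall>\<^sub>F k in sequentially. y k (- \<alpha> - int m * int a) \<in> W2"
    using lim W2(2,3) unfolding zx_def by (metis topological_tendstoD)
  moreover have "\<forall>\<^sub>F k in sequentially. 2 * a + 1 <= N k" using N unfolding filterlim_at_top by blast
  ultimately have "\<forall>\<^sub>F k in sequentially. y k (- \<alpha> - int m * int a) \<in> W2 & 2 * a + 1 <= N k" by (rule eventually_conj)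
  then obtain k0 where k0: "\<forall>k\<ge>k0. y k (- \<alpha> - int m * int a) \<in> W2 & 2 * a + 1 <= N k" unfolding eventually_sequentially by (rule exE)
  define \<tau> where "\<tau> = min (\<epsilon> / 2) (min \<tau>1 \<tau>2 / 2)"
  have \<tau>: "0 < \<tau>" "\<tau> < \<tau>1" "\<tau> < \<tau>2" "\<tau> <= \<epsilon> / 2" using Q(1) W1(1) W2(1) by (auto simp: \<tau>_def)
  have tS: "t \<in> S & \<bar>t - 0\<bar> < \<tau>1 & \<bar>t - 0\<bar> < \<tau>2" if "0 <= t" "t <= \<tau>" for t
    using that \<tau> by (auto simp: S_def)
  have SS: "{0..\<tau>} \<subseteq> S" using \<tau>(4) by (auto simp: S_def)
  define z where "z k = y (k + k0) (- \<alpha> - int m * int a)" for k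
  \<comment> \<open>Of the N returns in a turn, a at either end are absorbed by the excursion
    block.\<close>
  define n where "n k = N (k + k0) - 2 * a" for k
  define X' where "X' k t i = cc t (y (k + k0) (\<beta> + int m * int (a + i))) m" for k t i
  define P where "P k t = cc t (z k) len" for k t
  have kk: "2 * a + 1 <= N (k + k0)" "z k \<in> W2" for k using k0[rule_format, of "k + k0"] by (simp_all add: z_def)
  have yW1: "y (k + k0) (\<beta> + int m * int (a + i)) \<in> W1" if "i < n k" for k i
  proof -
    have "J2 <= a + i & a + i + J2 <= N (k + k0)" using that aJ(2) by (simp add: n_def)
    then show ?thesis using J2 by blast
  qed
  have X'n: "y (k + k0) (\<beta> + int m * int (a + i)) \<in> U" "(T ^^ m) (y (k + k0) (\<beta> + int m * int (a + i))) \<in> U" "norm (X' k t i - NN) < \<delta>"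
    if "0 <= t" "t <= \<tau>" "i < n k" for k t i
    using W1'[rule_format, of t "y (k + k0) (\<beta> + int m * int (a + i))"] tS[OF that(1,2)] yW1[OF that(3)] yP(2) unfolding X'_def cc0p by blast+
  have Pn: "z k \<in> U" "(T ^^ len) (z k) \<in> U" "norm (P k t - Qi) < eF" if "0 <= t" "t <= \<tau>" for k t
    using W2'[rule_format, of t "z k"] tS[OF that] kk(2)[of k] yP(2) unfolding P_def Qi_def z_def by blast+
  have zX: "z k \<in> X" for k unfolding z_def by (rule yP(2))
  define K0 where "K0 = Kc rad (rad a0)"
  define J0 where "J0 = Jc rad (rad a0)"
  have KJ: "K0 \<in> gaps rad" "J0 \<in> gaps rad" "J0 \<subseteq> K0" "K0 - J0 = {a0, b0}"
    unfolding K0_def J0_def Kc_Jc(2) by (rule Kc_gap Jc_gap Kc_Jc(1) cls)+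
  have dm': "cone_pres L I & grow L I (ga rad I) (gb rad I)" if "norm (L - NN) < \<delta>" "I \<in> gaps rad" for L I
    using dm that unfolding NN_def by blast
  have gr': "0 < \<alpha>f I" "0 < \<beta>f I" if "I \<in> gaps rad" for I using gr that by blast+
  have gr'': "cone_pres L I & grow L I (\<alpha>f I) (\<beta>f I)" if "norm (L - Qi) < eF" "I \<in> gaps rad" for L I using gr that by blast
  have X'all: "invertible (X' k t i) & cone_pres (X' k t i) I & grow (X' k t i) I (ga rad I) (gb rad I)"
    if "0 <= t" "t <= \<tau>" "i < n k" "I \<in> gaps rad" for k t i I
    using cci[OF conjunct1[OF tS[OF that(1,2)]] yP(2) X'n(1,2)[OF that(1-3)]] dm'[OF X'n(3)[OF that(1-3)] that(4)] unfolding X'_def by blast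
  have Pall: "invertible (P k t) & cone_pres (P k t) I & grow (P k t) I (\<alpha>f I) (\<beta>f I)"
    if "0 <= t" "t <= \<tau>" "I \<in> gaps rad" for k t I
    using cci[OF conjunct1[OF tS[OF that(1,2)]] zX Pn(1,2)[OF that(1,2)]] gr''[OF Pn(3)[OF that(1,2)] that(3)] unfolding P_def by blast
  have nlim: "filterlim n at_top sequentially"
    unfolding filterlim_at_top
  proof
    fix c
    have "\<forall>\<^sub>F k in sequentially. c + 2 * a <= N k" using N unfolding filterlim_at_top by blast
    then obtain k1 where "\<forall>k\<ge>k1. c + 2 * a <= N k" unfolding eventually_sequentially by (rule exE)
    then have "c + 2 * a <= N (k + k0)" if "k1 <= k" for k using that by simp
    then have "c <= n k" if "k1 <= k" for k using that unfolding n_def by (metis add_implies_diff diff_add_inverse2 diff_le_mono)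
    then show "\<forall>\<^sub>F k in sequentially. c <= n k" unfolding eventually_sequentially by blast
  qed
  interpret c: cyc J0 K0 a0 b0 "ga rad J0" "gb rad J0" "ga rad K0" "gb rad K0" "\<alpha>f J0" "\<beta>f J0" "\<alpha>f K0" "\<beta>f K0" X' P n \<tau>
  proof
    show "J0 \<subseteq> K0" "K0 - J0 = {a0, b0}" "a0 ~= b0" "0 < \<tau>" by (rule KJ(3) KJ(4) ab0 \<tau>(1))+
    show "0 < gb rad J0" "gb rad J0 < ga rad J0" "0 < gb rad K0" "gb rad K0 < ga rad K0" using gab KJ by auto
    show "0 < \<alpha>f J0" "0 < \<beta>f J0" "0 < \<alpha>f K0" "0 < \<beta>f K0" using gr' KJ by auto
    show "filterlim n at_top sequentially" by (rule nlim)
    show "continuous_on {0..\<tau>} (\<lambda>t. X' k t i)" if "i < n k" for k i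
      unfolding X'_def using X'n(1,2)[of 0 i k] \<tau>(1) that by (intro cccont yP(2) SS) auto
    show "continuous_on {0..\<tau>} (P k)" for k
      unfolding P_def[abs_def] using Pn(1,2)[of 0 k] \<tau>(1) by (intro cccont zX SS) auto
    show "invertible (X' k t i) & cone_pres (X' k t i) J0 & grow (X' k t i) J0 (ga rad J0) (gb rad J0) \<and>
      cone_pres (X' k t i) K0 & grow (X' k t i) K0 (ga rad K0) (gb rad K0)" if "0 <= t" "t <= \<tau>" "i < n k" for k t i
      using X'all[OF that KJ(1)] X'all[OF that KJ(2)] by blast
    show "invertible (P k t) & cone_pres (P k t) J0 & grow (P k t) J0 (\<alpha>f J0) (\<beta>f J0) \<and>
      cone_pres (P k t) K0 & grow (P k t) K0 (\<alpha>f K0) (\<beta>f K0)" if "0 <= t" "t <= \<tau>" for k t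
      using Pall[OF that KJ(1)] Pall[OF that KJ(2)] by blast
  qed
  have lims: "c.lim2 f (cc 0 w nn)"
    if w: "w \<in> X" "w \<in> U" "(T ^^ nn) w \<in> U" and wk: "\<And>k. wk k \<in> X" "wk \<longlonglongrightarrow> w"
      and f: "\<forall>\<^sub>F k in sequentially. \<forall>t. f k t = cc t (wk k) nn" for f w nn wk
    unfolding c.lim2_def
  proof (intro allI impI)
    fix e :: real assume e: "0 < e"
    obtain \<sigma> W where W: "0 < \<sigma>" "open W" "w \<in> W"
      and W': "\<forall>t z. t \<in> S & \<bar>t - 0\<bar> < \<sigma> & z \<in> X & z \<in> W --> z \<in> U & (T ^^ nn) z \<in> U & norm (cc t z nn - cc 0 w nn) < e"
      using near[OF w S0 e] by (elim exE conjE)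
    have "\<forall>\<^sub>F k in sequentially. wk k \<in> W" using wk(2) W(2,3) by (rule topological_tendstoD)
    then have "\<forall>\<^sub>F k in sequentially. wk k \<in> W & (\<forall>t. f k t = cc t (wk k) nn)" using f by (rule eventually_conj)
    then obtain k1 where k1: "\<forall>k\<ge>k1. wk k \<in> W & (\<forall>t. f k t = cc t (wk k) nn)" unfolding eventually_sequentially by (rule exE)
    have "norm (f k t - cc 0 w nn) < e" if "k1 <= k" "0 <= t" "t <= min \<tau> (\<sigma> / 2)" for k t
    proof -
      have t: "t \<in> S" "\<bar>t - 0\<bar> < \<sigma>" using tS[of t] that W(1) by auto
      have "wk k \<in> W" "f k t = cc t (wk k) nn" using k1 that(1) by blast+
      then show ?thesis using W' t wk(1)[of k] by simp
    qed
    then show "\<exists>k0 \<sigma>. 0 < \<sigma> & (\<forall>k t. k0 <= k & 0 <= t & t <= \<sigma> --> norm (f k t - cc 0 w nn) < e)"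
      using \<tau>(1) W(1) by (intro exI[of _ k1] exI[of _ "min \<tau> (\<sigma> / 2)"]) simp
  qed
  have yl: "(\<lambda>k. y (k + k0) i) \<longlonglongrightarrow> x i" for i by (rule LIMSEQ_ignore_initial_segment) (rule spec[OF lim])
  define Lp where "Lp j = cc 0 (x (\<beta> + int m * int (a + j))) m" for j
  define Lm where "Lm j = cc 0 (x (- \<alpha> - int m * int (Suc (a + j)))) m" for j
  have xp: "x (\<beta> + int m * int (a + j)) \<in> U" "(T ^^ m) (x (\<beta> + int m * int (a + j))) \<in> U" "norm (Lp j - NN) < \<delta>" for j
    using xn[of "a + j" "x (\<beta> + int m * int (a + j))"] aJ(1) unfolding Lp_def by auto
  have xm: "x (- \<alpha> - int m * int (Suc (a + j))) \<in> U" "(T ^^ m) (x (- \<alpha> - int m * int (Suc (a + j)))) \<in> U" "norm (Lm j - NN) < \<delta>" for j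
    using xn[of "Suc (a + j)" "x (- \<alpha> - int m * int (Suc (a + j)))"] aJ(1) unfolding Lm_def by auto
  have zl: "z \<longlonglongrightarrow> zx" unfolding z_def[abs_def] zx_def by (rule yl)
  have limP: "c.lim2 P Qi" unfolding Qi_def
    by (rule lims[OF zxU(2,1) TzxU, of z]) (use zX zl in \<open>auto simp: P_def\<close>)
  have limp: "c.lim2 (\<lambda>k t. X' k t j) (Lp j)" for j unfolding Lp_def
    by (rule lims[OF xX xp(1,2), of "\<lambda>k. y (k + k0) (\<beta> + int m * int (a + j))"]) (use yP yl in \<open>auto simp: X'_def\<close>)
  have per: "y k (i - (\<alpha> + \<beta> + int m * int (N k))) = y k i" for k i
    using y[rule_format, of k "i - (\<alpha> + \<beta> + int m * int (N k))"] by simp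
  have limm: "c.lim2 (\<lambda>k t. X' k t (n k - 1 - j)) (Lm j)" for j unfolding Lm_def
  proof (rule lims[OF xX xm(1,2), of "\<lambda>k. y (k + k0) (- \<alpha> - int m * int (Suc (a + j)))"])
    show "\<forall>\<^sub>F k in sequentially. \<forall>t. X' k t (n k - 1 - j) = cc t (y (k + k0) (- \<alpha> - int m * int (Suc (a + j)))) m"
    proof (rule eventually_mono)
      show "\<forall>\<^sub>F k in sequentially. Suc j <= n k" using nlim unfolding filterlim_at_top by blast
      fix k assume j: "Suc j <= n k"
      \<comment> \<open>Counted from the end of the stay near p, return number j becomes, one full
        turn earlier, the return starting at - \<alpha> - m (a + j + 1), just before the
        excursion.\<close>
      have "int (a + (n k - 1 - j)) = int (N (k + k0)) - int (Suc (a + j))" using j kk(1)[of k] by (simp add: n_def)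
      then have "\<beta> + int m * int (a + (n k - 1 - j)) = \<beta> + int m * int (N (k + k0)) - int m * int (Suc (a + j))"
        by (simp only: right_diff_distrib)
      then have e: "\<beta> + int m * int (a + (n k - 1 - j)) - (\<alpha> + \<beta> + int m * int (N (k + k0))) = - \<alpha> - int m * int (Suc (a + j))" by linarith
      have "y (k + k0) (\<beta> + int m * int (a + (n k - 1 - j))) = y (k + k0) (- \<alpha> - int m * int (Suc (a + j)))"
        using per[of "k + k0" "\<beta> + int m * int (a + (n k - 1 - j))"] unfolding e by (rule sym)
      then show "\<forall>t. X' k t (n k - 1 - j) = cc t (y (k + k0) (- \<alpha> - int m * int (Suc (a + j)))) m" unfolding X'_def by simp
    qed
  qed (rule yP(2), rule yl)
  have Lpd: "invertible (Lp j)" "cone_pres (Lp j) J0" "grow (Lp j) J0 (ga rad J0) (gb rad J0)" for j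
    using dm'[OF xp(3) KJ(2)] cci[OF S0 xX xp(1,2)] unfolding Lp_def by blast+
  have Lmd: "invertible (Lm j)" "cone_pres (Lm j) K0" "grow (Lm j) K0 (ga rad K0) (gb rad K0)" for j
    using dm'[OF xm(3) KJ(1)] cci[OF S0 xX xm(1,2)] unfolding Lm_def by blast+
  have Qd: "cone_pres Qi J0" "cone_pres Qi K0" using Qc KJ by blast+
  obtain c0 k1 \<sigma> where c0: "c0 ~= 0" and \<sigma>: "0 < \<sigma>" "\<sigma> <= \<tau>"
    and c1: "\<forall>k t. k1 <= k & 0 <= t & t <= \<sigma> & c.good k --> cmod (c.\<zeta> (P k t *v c.u k t) - c0) < cmod c0"
    using c.hom_limit[OF Lpd Lmd Qiinv Qd limp limm limP] by (elim exE conjE)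
  have \<sigma>S: "\<sigma> \<in> S" using \<sigma> SS by auto
  have N0: "c.\<zeta> (NN *v v) = l0 * c.\<zeta> v" for v using rot unfolding c.\<zeta>_def NN_def by blast
  have N1: "c.\<zeta> ((NN ** (mat 1 + \<sigma> *\<^sub>R Rt)) *v v) = l0 * (1 + \<i> * complex_of_real \<sigma>) * c.\<zeta> v" for v
  proof -
    have "(mat 1 + \<sigma> *\<^sub>R Rt) *v v = v + \<sigma> *\<^sub>R (Rt *v v)"
      by (simp add: matrix_vector_mult_add_rdistrib scaleR_matrix_vector_assoc)
    then have "c.\<zeta> ((mat 1 + \<sigma> *\<^sub>R Rt) *v v) = (1 + \<i> * complex_of_real \<sigma>) * c.\<zeta> v"
      using rotm[OF ab0, of v] unfolding c.\<zeta>_def Rt_def by (simp add: complex_eq_iff algebra_simps)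
    then show ?thesis using N0[of "(mat 1 + \<sigma> *\<^sub>R Rt) *v v"] by (simp flip: matrix_vector_mul_assoc add: mult.assoc)
  qed
  have "\<exists>kk0. \<forall>k\<ge>kk0. c.good k & (\<exists>t \<mu>. 0 <= t & t <= \<sigma> & c.Pi k t *v c.u k t = \<mu> *\<^sub>R c.u k t)"
  proof (rule c.winding[OF \<sigma> l0 N0 N1 _ _ _ c0])
    show "0 < Im (1 + \<i> * complex_of_real \<sigma>)" using \<sigma>(1) by simp
    show "norm (X' k t i - NN) < cmod l0 / 3" if "0 <= t" "t <= \<tau>" "i < n k" for k t i
      using X'n(3)[OF that] \<delta>(2) by linarith
    show "cmod (c.\<zeta> (P k t *v c.u k t) - c0) < cmod c0" if "k1 <= k" "0 <= t" "t <= \<sigma>" "c.good k" for k t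
      using c1 that by blast
    fix d :: real assume d: "0 < d"
    obtain ta Wa where Wa: "0 < ta" "open Wa" "p \<in> Wa"
      and Wa': "\<forall>t z. t \<in> S & \<bar>t - 0\<bar> < ta & z \<in> X & z \<in> Wa --> z \<in> U & (T ^^ m) z \<in> U & norm (cc t z m - cc 0 p m) < d"
      using near[OF pX U(2) pU S0 d] by (elim exE conjE)
    obtain tb Wb where Wb: "0 < tb" "open Wb" "p \<in> Wb"
      and Wb': "\<forall>t z. t \<in> S & \<bar>t - \<sigma>\<bar> < tb & z \<in> X & z \<in> Wb --> z \<in> U & (T ^^ m) z \<in> U & norm (cc t z m - cc \<sigma> p m) < d"
      using near[OF pX U(2) pU \<sigma>S d] by (elim exE conjE)
    obtain J3 where J3: "\<forall>k j. J3 <= j & j + J3 <= N k --> y k (\<beta> + int m * int j) \<in> Wa \<inter> Wb"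
      using hy[OF open_Int[OF Wa(2) Wb(2)] IntI[OF Wa(3) Wb(3)]] by (rule exE)
    have "norm (X' k 0 i - NN) < d & norm (X' k \<sigma> i - NN ** (mat 1 + \<sigma> *\<^sub>R Rt)) < d" if i: "J3 <= i" "i + J3 < n k" for k i
    proof -
      have "J3 <= a + i & a + i + J3 <= N (k + k0)" using i by (simp add: n_def)
      then have w: "y (k + k0) (\<beta> + int m * int (a + i)) \<in> Wa \<inter> Wb" using J3 by blast
      show ?thesis
        using Wa'[rule_format, of 0 "y (k + k0) (\<beta> + int m * int (a + i))"] Wb'[rule_format, of \<sigma> "y (k + k0) (\<beta> + int m * int (a + i))"]
          w yP(2) S0 \<sigma>S Wa(1) Wb(1) ccp[OF \<sigma>S] unfolding X'_def cc0p by simp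
    qed
    then show "\<exists>m k0. \<forall>k\<ge>k0. \<forall>i. m <= i & i + m < n k --> norm (X' k 0 i - NN) < d & norm (X' k \<sigma> i - NN ** (mat 1 + \<sigma> *\<^sub>R Rt)) < d"
      by (intro exI[of _ J3] exI[of _ 0]) blast
  qed
  then have ev1: "\<forall>\<^sub>F k in sequentially. c.good k & (\<exists>t \<mu>. 0 <= t & t <= \<sigma> & c.Pi k t *v c.u k t = \<mu> *\<^sub>R c.u k t)"
    unfolding eventually_sequentially .
  have "\<forall>\<^sub>F k in sequentially. \<forall>q\<in>gaps rad \<times> gaps rad. gb rad (fst q) < ga rad (snd q) --> gb rad (fst q) ^ n k * \<beta>f (fst q) < ga rad (snd q) ^ n k * \<alpha>f (snd q)"
  proof (intro eventually_ball_finite ballI)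
    fix q assume q: "q \<in> gaps rad \<times> gaps rad"
    show "\<forall>\<^sub>F k in sequentially. gb rad (fst q) < ga rad (snd q) --> gb rad (fst q) ^ n k * \<beta>f (fst q) < ga rad (snd q) ^ n k * \<alpha>f (snd q)"
    proof (cases "gb rad (fst q) < ga rad (snd q)")
      case True
      then show ?thesis
        using eventually_power_dominates[of "gb rad (fst q)" "ga rad (snd q)" "\<alpha>f (snd q)" n "\<beta>f (fst q)"] gab gr' q nlim by auto
    qed simp
  qed simp
  with ev1 have "\<forall>\<^sub>F k in sequentially. (c.good k & (\<exists>t \<mu>. 0 <= t & t <= \<sigma> & c.Pi k t *v c.u k t = \<mu> *\<^sub>R c.u k t)) \<and>
     (\<forall>q\<in>gaps rad \<times> gaps rad. gb rad (fst q) < ga rad (snd q) --> gb rad (fst q) ^ n k * \<beta>f (fst q) < ga rad (snd q) ^ n k * \<alpha>f (snd q))"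
    by (rule eventually_conj)
  then obtain k where "\<forall>k'\<ge>k. (c.good k' & (\<exists>t \<mu>. 0 <= t & t <= \<sigma> & c.Pi k' t *v c.u k' t = \<mu> *\<^sub>R c.u k' t)) \<and>
     (\<forall>q\<in>gaps rad \<times> gaps rad. gb rad (fst q) < ga rad (snd q) --> gb rad (fst q) ^ n k' * \<beta>f (fst q) < ga rad (snd q) ^ n k' * \<alpha>f (snd q))"
    unfolding eventually_sequentially by (rule exE)
  from mp[OF spec[OF this, of k] order_refl] obtain t \<mu> where gk: "c.good k" and t: "0 <= t" "t <= \<sigma>" and ev: "c.Pi k t *v c.u k t = \<mu> *\<^sub>R c.u k t"
    and sepq: "\<forall>q\<in>gaps rad \<times> gaps rad. gb rad (fst q) < ga rad (snd q) --> gb rad (fst q) ^ n k * \<beta>f (fst q) < ga rad (snd q) ^ n k * \<alpha>f (snd q)"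
    by (elim conjE exE)
  \<comment> \<open>Rates of a whole turn. The constants of the excursion enter once, so for large k
    the powers still separate the classes.\<close>
  define Af where "Af I = ga rad I ^ n k * \<alpha>f I" for I
  define Bf where "Bf I = gb rad I ^ n k * \<beta>f I" for I
  have sep: "Bf I < Af I'" if "I \<in> gaps rad" "I' \<in> gaps rad" "gb rad I < ga rad I'" for I I'
    using sepq[rule_format, of "(I, I')"] that unfolding Af_def Bf_def by simp
  have t': "0 <= t" "t <= \<tau>" using t \<sigma> by auto
  define PP where "PP = c.Pi k t"
  have PPe: "PP = qp (X' k t) (n k) ** P k t" by (simp add: PP_def c.Pi_def)
  have PPi: "invertible PP" unfolding PP_def using c.Pi[OF t'] by blast
  have domPP: "\<forall>I\<in>gaps rad. dom Af Bf PP I"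
  proof
    fix I assume I: "I \<in> gaps rad"
    have 1: "cone_pres (qp (X' k t) (n k) ** P k t) I & grow (qp (X' k t) (n k) ** P k t) I (ga rad I ^ n k * \<alpha>f I) (gb rad I ^ n k * \<beta>f I)"
      by (rule qp_dom) (use X'all[OF t' _ I] Pall[OF t' I] gab I in \<open>auto intro: less_imp_le less_trans\<close>)
    have 2: "Bf I < Af I" using gab I by (intro sep) auto
    have 3: "0 < Bf I" using gab gr'[OF I] I by (simp add: Bf_def)
    show "dom Af Bf PP I" unfolding dom_def PPe using 1 2 3 unfolding Af_def Bf_def by blast
  qed
  have sepPP: "\<forall>s\<in>range rad. \<forall>s'\<in>range rad. s < s' --> Bf (Jc rad s) < Af (Kc rad s')"
    by (intro ballI impI sep Jc_gap Kc_gap gap_sep[OF rad0[rule_format]])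
  define l where "l = len + m * n k"
  have il: "int l = \<alpha> + \<beta> + int m * int (N (k + k0))"
  proof -
    have "N (k + k0) = 2 * a + n k" using kk(1)[of k] by (simp add: n_def)
    then show ?thesis using al by (simp add: l_def len_def algebra_simps)
  qed
  have Tlen: "(T ^^ len) (z k) = y (k + k0) (\<beta> + int m * int a)"
    unfolding z_def yT len_def using al by (simp add: algebra_simps)
  have Tl: "(T ^^ l) (z k) = z k"
    unfolding z_def yT il using y[rule_format, of "k + k0"] by blast
  have qpU: "y (k + k0) (\<beta> + int m * int a + int m * int j) \<in> U" if "j <= n k" for j
  proof (cases "j < n k")
    case True
    then show ?thesis using X'n(1)[OF t', of j k] by (simp add: algebra_simps)
  next
    case False
    then have "\<beta> + int m * int a + int m * int j = - \<alpha> - int m * int a + int l"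
      using that kk(1)[of k] unfolding il by (simp add: n_def algebra_simps)
    then show ?thesis using y[rule_format, of "k + k0" "- \<alpha> - int m * int a"] Pn(1)[OF t', of k] unfolding il z_def by metis
  qed
  have PPcm: "PP = cc t (z k) l"
  proof -
    have tq: "Q t \<in> LC" using QS(1) tS[OF t'] by blast
    have Tn: "(T ^^ (m * n k)) ((T ^^ len) (z k)) \<in> U"
      unfolding Tlen yT using qpU[of "n k"] by simp
    have 1: "cm E T (Q t) \<psi> \<psi> (z k) l = cm E T (Q t) \<psi> \<psi> (y (k + k0) (\<beta> + int m * int a)) (m * n k) ** cm E T (Q t) \<psi> \<psi> (z k) len"
      using cm_add[OF tq U(1,1,1) zX Pn(1)[OF t'] Pn(2)[OF t'] Tn] unfolding l_def Tlen by simp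
    have 2: "C ** cm E T (Q t) \<psi> \<psi> (y (k + k0) (\<beta> + int m * int a)) (m * n k) ** matrix_inv C = qp (X' k t) (n k)"
    proof -
      have "C ** cm E T (Q t) \<psi> \<psi> (y (k + k0) (\<beta> + int m * int a)) (m * n k) ** matrix_inv C
        = qp (\<lambda>j. C ** cm E T (Q t) \<psi> \<psi> (y (k + k0) (\<beta> + int m * int a + int m * int j)) m ** matrix_inv C) (n k)"
        by (rule orbit_qp[OF tq U(1) yo C]) (rule qpU)
      also have "\<dots> = qp (X' k t) (n k)" unfolding X'_def[abs_def] cc_def by (simp add: algebra_simps)
      finally show ?thesis .
    qed
    show ?thesis unfolding PPe P_def cc_def 1 2[symmetric] conj_mult[OF C] ..
  qed
  have zP: "z k \<in> Per" unfolding z_def by (rule yP(1))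
  \<comment> \<open>The period of the long orbit is minimal because a shorter one would bring the
    orbit back to \<open>B\<close> in the middle of a turn.\<close>
  have hp: "has_period T (z k) l"
    unfolding has_period_def
  proof (intro conjI allI impI notI)
    show "0 < l" using len0 by (simp add: l_def)
    show "(T ^^ l) (z k) = z k" by (rule Tl)
    fix q assume q: "0 < q & q < l" and e: "(T ^^ q) (z k) = z k"
    define j where "j = nat (\<alpha> + int m * int a)"
    have j: "int j = \<alpha> + int m * int a" using al by (simp add: j_def)
    have zj: "(T ^^ j) (z k) = y (k + k0) 0" unfolding z_def yT j by simp
    have "(T ^^ q) ((T ^^ j) (z k)) = (T ^^ j) ((T ^^ q) (z k))" by (metis add.commute comp_apply funpow_add)
    then have "y (k + k0) (int q) = y (k + k0) 0" unfolding e zj yT by simp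
    moreover have "y (k + k0) (int q) \<notin> B" using yB q il by (metis of_nat_0_less_iff of_nat_less_iff)
    ultimately show False using yB by metis
  qed
  have zU: "z k \<in> U" by (rule Pn(1)[OF t'])
  have QtG: "Q t \<in> G" using QS(2) tS[OF t'] by blast
  have nmPP: "nmod PP = nmod (cm E T (Q t) \<psi> \<psi> (z k) l)" unfolding PPcm cc_def by (rule nmod_conj[OF C])
  \<comment> \<open>Maximality bounds the number of moduli on the long orbit from above and the
    persisting classes bound it from below. At this parameter the long orbit therefore attains the
    maximum itself, which makes its return matrix structured too.\<close>
  have le: "nmod PP <= card (range rad)"
    unfolding nmPP crad M_def by (rule max[OF QtG zP hp U(1) zU])
  have ge: "card (range rad) <= nmod PP" by (rule class_card[OF PPi domPP sepPP])
  have "structured (cm E T (Q t) \<psi> \<psi> (z k) l)"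
  proof (rule max_structured[OF G(1) QtG zX hp U(1) zU])
    fix A'' assume "A'' \<in> G"
    then have "nmod (cm E T A'' \<psi> \<psi> (z k) l) <= nmod (cm E T A \<psi> \<psi> p m)" by (rule max[OF _ zP hp U(1) zU])
    then show "nmod (cm E T A'' \<psi> \<psi> (z k) l) <= nmod (cm E T (Q t) \<psi> \<psi> (z k) l)"
      using ge nmPP crad by (simp add: M_def)
  qed
  then have stPP: "structured PP" unfolding PPcm cc_def by (simp add: structured_conj[OF C])
  have uk: "c.u k t \<in> c.V k t" "c.u k t ~= 0" using c.u[OF t' gk] by blast+
  have eg: "eigp PP (complex_of_real \<mu>) (c.u k t) 0" using ev unfolding eigp_def PP_def by simp
  have \<mu>s: "complex_of_real \<mu> \<in> spec PP" unfolding spec_eigp using eg uk(2) by blast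
  have uV: "c.u k t \<in> Vsp PP (Bf J0) (Af K0)"
    using uk(1) unfolding c.V_def PP_def c.BJ_def c.AK_def Bf_def Af_def .
  have pos: "0 < Af K0" "0 < Bf J0" using gab gr'(1)[OF KJ(1)] gr'(2)[OF KJ(2)] KJ by (auto simp: Af_def Bf_def intro!: mult_pos_pos zero_less_power intro: less_trans)
  have V0: "0 \<in> Vsp PP (Bf J0) (Af K0)" by (rule subspace_0[OF subspace_Vsp]) (use pos in simp_all)
  have rg: "Af K0 <= cmod (complex_of_real \<mu>)" "cmod (complex_of_real \<mu>) <= Bf J0"
    using Vsp_eigp_range[OF PPi eg _ pos uV V0] uk(2) by blast+
  have rab: "rad a0 = rad b0" using cls by auto
  show False
    by (rule no_extra_real[OF PPi domPP sepPP stPP le ab0 rab \<mu>s]) (use rg in \<open>simp_all add: K0_def J0_def\<close>)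
qed

end

section \<open>The open dense set of cocycles\<close>

theorem theorem1:
  fixes \<Phi> :: "('m::{t2_space, second_countable_topology}, 'e::euclidean_space) chart set"
    and E :: "('m, 'v::topological_space, 'd::finite) vbundle"
    and X Y K :: "'m set"
    and T :: "'m \<Rightarrow> 'm"
    and n :: nat and a :: "nat \<Rightarrow> nat \<Rightarrow> nat"
    and D :: "(('m, 'e) chart \<times> ('m set \<times> ('v \<Rightarrow> real ^ 'd)) \<times> 'm set) set"
    and r :: nat
  assumes "smooth_atlas \<Phi>"
    and "open Y" and "smooth_vector_bundle \<Phi> Y E"
    and "compact X" and "infinite X" and "X \<subseteq> Y"
    and "T ` X \<subseteq> X" and "continuous_on X T"
    and "transition_matrix n a" and "transitive_on (sft n a) shift"
    and "is_factor_of X T (sft n a) shift"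
    and "compact K" and "X \<subseteq> interior K" and "K \<subseteq> Y" and "norm_cover \<Phi> E K D"
  shows "\<exists>\<O>. openin (LC_topology \<Phi> E X T D r) \<O> \<and>
    (LC_topology \<Phi> E X T D r) closure_of \<O> = linear_cocycles E X T \<and>
    (\<forall>A\<in>\<O>. simple_at_periodic_point E X T A)"
proof -
  obtain q where q: "continuous_on (sft n a) q" "q ` sft n a = X" "\<forall>z\<in>sft n a. q (shift z) = T (q z)"
    using assms(11) unfolding is_factor_of_def by blast
  interpret bundle_dyn \<Phi> E X Y K T D r
  proof
    show "X \<noteq> {}" using assms(5) by auto
    show "X \<subseteq> K" using assms(13) interior_subset by blast
  qed (use assms in auto)
  interpret s: sft_factor n a X T q
    by unfold_locales (use assms q in auto)
  \<comment> \<open>The set of all cocycles with the required property is itself open and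
    dense.\<close>
  define Sm where "Sm = {A \<in> LC. simple_at_periodic_point E X T A}"
  have top: "topspace (LC_topology \<Phi> E X T D r) = LC" by (rule topspace_LC_topology[OF assms(1,3,6)])
  have dense: "\<exists>A'\<in>G. A' \<in> Sm" if G: "openin (LC_topology \<Phi> E X T D r) G" and A: "A \<in> G" for G A
  proof (rule ccontr)
    assume neg: "\<not> ?thesis"
    have GL: "G \<subseteq> LC" using G unfolding openin_LC_topology by simp
    \<comment> \<open>All cocycles of \<open>G\<close>, all points of \<open>s.Per\<close> and all
      trivializations compete together, so that the resulting bound also covers perturbed cocycles
      on the long orbits.\<close>
    define val where "val k \<longleftrightarrow> (\<exists>A' y l U \<psi>. A' \<in> G \<and> y \<in> s.Per \<and> has_period T y l \<and> (U, \<psi>) \<in> trivs E \<and> y \<in> U \<and>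
      nmod (cm E T A' \<psi> \<psi> y l) = k)" for k
    obtain p0 m0 where p0: "p0 \<in> s.Per" "has_period T p0 m0" using s.Per_nonempty s.has_period_exists by blast
    have "p0 \<in> Y" using p0(1) s.Per_X XY by blast
    then obtain U0 \<psi>0 where "(U0, \<psi>0) \<in> trivs E" "p0 \<in> U0" using triv_at by blast
    then have "val (nmod (cm E T A \<psi>0 \<psi>0 p0 m0))" unfolding val_def using A p0 by blast
    moreover have "\<forall>k. val k \<longrightarrow> k \<le> CARD('d)" unfolding val_def using nmod_le by blast
    ultimately have "\<exists>k. val k \<and> (\<forall>k'. val k' \<longrightarrow> k' \<le> k)" by (metis Nat.ex_has_greatest_nat)
    then obtain k where k: "val k" "\<forall>k'. val k' \<longrightarrow> k' \<le> k" by (elim exE conjE)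
    from k(1)[unfolded val_def] obtain A1 p m U \<psi> where A1: "A1 \<in> G" and p: "p \<in> s.Per" "has_period T p m"
      and U: "(U, \<psi>) \<in> trivs E" "p \<in> U" and nm: "nmod (cm E T A1 \<psi> \<psi> p m) = k" by (elim exE conjE)
    have max: "nmod (cm E T A' \<psi>' \<psi>' y l) \<le> nmod (cm E T A1 \<psi> \<psi> p m)"
      if "A' \<in> G" "y \<in> s.Per" "has_period T y l" "(U', \<psi>') \<in> trivs E" "y \<in> U'" for A' y l U' \<psi>'
    proof -
      have "val (nmod (cm E T A' \<psi>' \<psi>' y l))" unfolding val_def using that by blast
      then show ?thesis using k(2) nm by simp
    qed
    have "nmod (cm E T A1 \<psi> \<psi> p m) \<noteq> CARD('d)"
    proof
      assume "nmod (cm E T A1 \<psi> \<psi> p m) = CARD('d)"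
      then have "distinct_moduli (eigenvalues (triv_matrix E \<psi> p (A1 ^^ m)))"
        unfolding distinct_moduli_iff by (simp add: triv_matrix_def cm_def)
      then have "simple_at_periodic_point E X T A1"
        unfolding simple_at_periodic_point_def simple_spectrum_at_def using p U s.Per_X by blast
      then show False using neg A1 GL unfolding Sm_def by blast
    qed
    then have lt: "nmod (cm E T A1 \<psi> \<psi> p m) < CARD('d)" using nmod_le[of "cm E T A1 \<psi> \<psi> p m"] by simp
    have m: "0 < m" "(T ^^ m) p = p" using p(2) by (auto simp: has_period_def)
    from s.homoclinic_isolated[OF p(1) m] obtain x \<alpha> \<beta> N y B where
      x: "\<forall>i. x i \<in> X \<and> T (x i) = x (i + 1)" and al: "0 < \<alpha>" "0 < \<beta>" and N: "filterlim N at_top sequentially"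
      and y: "\<forall>k i. y k i \<in> s.Per \<and> T (y k i) = y k (i + 1) \<and> y k (i + (\<alpha> + \<beta> + int m * int (N k))) = y k i"
      and lim: "\<forall>i. (\<lambda>k. y k i) \<longlonglongrightarrow> x i"
      and hW: "\<forall>W. open W \<and> p \<in> W \<longrightarrow> (\<exists>J. (\<forall>j\<ge>J. x (- \<alpha> - int m * int j) \<in> W \<and> x (\<beta> + int m * int j) \<in> W) \<and>
         (\<forall>k j. J \<le> j \<and> j + J \<le> N k \<longrightarrow> y k (\<beta> + int m * int j) \<in> W))"
      and B: "open B" "x 0 \<in> B" "\<forall>j. (T ^^ j) p \<notin> B" "\<forall>i. i \<noteq> 0 \<longrightarrow> x i \<notin> B"
      and yB: "\<forall>k. y k 0 \<in> B \<and> (\<forall>i. 0 < i \<and> i < \<alpha> + \<beta> + int m * int (N k) \<longrightarrow> y k i \<notin> B)"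
      by (elim exE conjE)
    show False
      by (rule no_submaximal_return[OF G A1 s.Per_X p U max lt x al N y lim hW B yB])
  qed
  have "(LC_topology \<Phi> E X T D r) closure_of Sm = LC"
  proof
    show "(LC_topology \<Phi> E X T D r) closure_of Sm \<subseteq> LC" using closure_of_subset_topspace top by metis
    show "LC \<subseteq> (LC_topology \<Phi> E X T D r) closure_of Sm"
      using dense unfolding closure_of_def top by blast
  qed
  moreover have "openin (LC_topology \<Phi> E X T D r) Sm" unfolding Sm_def by (rule simple_open)
  ultimately show ?thesis unfolding Sm_def by blast
qed

end
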